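(* Let $n$ be a positive integer, $w=\mathrm{polylog}(n)$, and let $S$ be a set of $n$ points in $[2^{w}]^2$. For any choice of a constant $0<\alpha<1$, one can construct in $\tilde{O}(n^2)$ time with high probability a data structure using $\tilde{O}(n^{2-\alpha/4})$ words of space which answers the following queries in $\tilde{O}(n^{\alpha})$ time: given a two-dimensional box $B$, return the Theil-Sen estimator of the points in $S\cap B$.
   Context: $[M]$ denotes $\{0,1,\dots,M-1\}$. The notation $\tilde{O}(\cdot)$ omits factors polylogarithmic in $n$. A "box" is an axis-aligned rectangle. The Theil-Sen estimator of a finite point set $P\subset\mathbb{R}^2$ is the median of the slopes of all lines through two points of $P$. Space is measured in machine words (word RAM model). *)

theory Defs
  imports "HOL-Probability.Probability" "HOL-Library.Landau_Symbols"
begin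

section \<open>Asymptotics\<close>

definition polylog :: "(nat \<Rightarrow> nat) \<Rightarrow> bool" where
  "polylog f \<longleftrightarrow> (\<exists>k::nat. (\<lambda>n. real (f n)) \<in> O(\<lambda>n. ln (real n) ^ k))"

definition soft_O :: "(nat \<Rightarrow> real) \<Rightarrow> (nat \<Rightarrow> real) set" where
  "soft_O g = (\<Union>k::nat. O(\<lambda>n. g n * ln (real n) ^ k))"


section \<open>The Theil-Sen estimator\<close>

text \<open>
  Every unordered pair of points contributes one slope, so equal slopes are counted with
  multiplicity. A vertical line has no slope; \<^term>\<open>fst p < fst q\<close> leaves such pairs out and
  picks one orientation of each remaining pair.
\<close>

definition slopes :: "(nat \<times> nat) set \<Rightarrow> real multiset" where
  "slopes P = image_mset
     (\<lambda>(p, q). (real (snd q) - real (snd p)) / (real (fst q) - real (fst p)))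
     (mset_set {(p, q). p \<in> P \<and> q \<in> P \<and> fst p < fst q})"

text \<open>For an even number of values the median is the mean of the two middle ones.\<close>

definition median :: "real multiset \<Rightarrow> real" where
  "median M = (let xs = sorted_list_of_multiset M; m = length xs in
     if odd m then xs ! (m div 2) else (xs ! (m div 2 - 1) + xs ! (m div 2)) / 2)"

text \<open>\<^term>\<open>None\<close> if no two points span a non-vertical line.\<close>

definition theil_sen :: "(nat \<times> nat) set \<Rightarrow> real option" where
  "theil_sen P = (if slopes P = {#} then None else Some (median (slopes P)))"

definition grid :: "nat \<Rightarrow> (nat \<times> nat) set" where
  "grid w = {..<2 ^ w} \<times> {..<2 ^ w}"


section \<open>The randomised word RAM\<close>

text \<open>
  Registers and memory cells hold words of \<open>b\<close> bits, represented by the natural numbers below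
  \<open>2 ^ b\<close>. Memory is reachable only through addresses stored in registers, hence has \<open>2 ^ b\<close>
  cells. A program is a finite list of instructions and so uses a constant number of registers.
  Each instruction costs one time unit.
\<close>

datatype binop = ADD | SUB | MUL | DIV | MOD | AND | OR | XOR | SHL | SHR | LESS | EQUAL

datatype instr =
    LoadConst nat nat       (* r := k *)
  | Oper binop nat nat nat  (* r := s op t *)
  | Load nat nat            (* r := mem[s] *)
  | Store nat nat           (* mem[r] := s *)
  | Random nat              (* r := uniformly random word *)
  | JumpZero nat nat        (* if r = 0 goto l *)

type_synonym program = "instr list"

record config =
  pc :: nat
  regs :: "nat \<Rightarrow> nat"
  mem :: "nat \<Rightarrow> nat"

fun eval_binop :: "nat \<Rightarrow> binop \<Rightarrow> nat \<Rightarrow> nat \<Rightarrow> nat" where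
  "eval_binop b ADD x y = (x + y) mod 2 ^ b"
| "eval_binop b SUB x y = nat ((int x - int y) mod 2 ^ b)"
| "eval_binop b MUL x y = (x * y) mod 2 ^ b"
| "eval_binop b DIV x y = x div y"
| "eval_binop b MOD x y = x mod y"
| "eval_binop b AND x y = Bit_Operations.and x y"
| "eval_binop b OR x y = Bit_Operations.or x y"
| "eval_binop b XOR x y = Bit_Operations.xor x y"
| "eval_binop b SHL x y = (x * 2 ^ y) mod 2 ^ b"
| "eval_binop b SHR x y = x div 2 ^ y"
| "eval_binop b LESS x y = (if x < y then 1 else 0)"
| "eval_binop b EQUAL x y = (if x = y then 1 else 0)"

definition set_reg :: "nat \<Rightarrow> nat \<Rightarrow> config \<Rightarrow> config" where
  "set_reg r v c = c\<lparr>pc := Suc (pc c), regs := (regs c)(r := v)\<rparr>"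

fun exec_instr :: "nat \<Rightarrow> instr \<Rightarrow> config \<Rightarrow> config pmf" where
  "exec_instr b (LoadConst r k) c = return_pmf (set_reg r (k mod 2 ^ b) c)"
| "exec_instr b (Oper f r s t) c = return_pmf (set_reg r (eval_binop b f (regs c s) (regs c t)) c)"
| "exec_instr b (Load r s) c = return_pmf (set_reg r (mem c (regs c s)) c)"
| "exec_instr b (Store r s) c =
     return_pmf (c\<lparr>pc := Suc (pc c), mem := (mem c)(regs c r := regs c s)\<rparr>)"
| "exec_instr b (Random r) c = map_pmf (\<lambda>v. set_reg r v c) (pmf_of_set {..<2 ^ b})"
| "exec_instr b (JumpZero r l) c =
     return_pmf (c\<lparr>pc := (if regs c r = 0 then l else Suc (pc c))\<rparr>)"

definition halted :: "program \<Rightarrow> config \<Rightarrow> bool" where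
  "halted P c \<longleftrightarrow> length P \<le> pc c"

definition step :: "nat \<Rightarrow> program \<Rightarrow> config \<Rightarrow> config pmf" where
  "step b P c = (if halted P c then return_pmf c else exec_instr b (P ! pc c) c)"

text \<open>
  The distribution of the configuration after \<open>t\<close> time units. Halted configurations do not
  change any more, so the program stops within time \<open>t\<close> iff it is halted after \<open>t\<close> units.
\<close>

primrec run :: "nat \<Rightarrow> program \<Rightarrow> nat \<Rightarrow> config \<Rightarrow> config pmf" where
  "run b P 0 c = return_pmf c"
| "run b P (Suc t) c = bind_pmf (step b P c) (run b P t)"

definition zero_padded :: "nat list \<Rightarrow> nat \<Rightarrow> nat" where
  "zero_padded xs i = (if i < length xs then xs ! i else 0)"

definition init_config :: "nat list \<Rightarrow> nat list \<Rightarrow> config" where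
  "init_config rs ms = \<lparr>pc = 0, regs = zero_padded rs, mem = zero_padded ms\<rparr>"


section \<open>Data structures for Theil-Sen queries\<close>

text \<open>
  The points are stored in memory in the order given by \<open>ps\<close>. The parameters are passed in
  registers; \<open>q\<close> is the trade-off parameter, namely \<open>n powr \<alpha>\<close> rounded down. It is part of the
  input because a finite program cannot compute it for an arbitrary real \<open>\<alpha>\<close>.
\<close>

definition construction_input :: "nat \<Rightarrow> nat \<Rightarrow> nat \<Rightarrow> (nat \<times> nat) list \<Rightarrow> config" where
  "construction_input n w q ps = init_config [n, w, q] (concat (map (\<lambda>(x, y). [x, y]) ps))"

text \<open>On termination, register 0 holds the size of the data structure, stored from cell 0 on.\<close>

definition constructed :: "config \<Rightarrow> nat list" where
  "constructed c = map (mem c) [0..<regs c 0]"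

text \<open>
  Answers are fractions: sign in register 0, numerator in register 1 and denominator in
  register 2 (not necessarily in lowest terms). Denominator 0 says that there is no estimator.
\<close>

definition query_answer :: "config \<Rightarrow> real option" where
  "query_answer c = (if regs c 2 = 0 then None else
     Some ((if regs c 0 = 0 then 1 else - 1) * real (regs c 1) / real (regs c 2)))"

text \<open>
  The query program starts with nothing but the data structure \<open>D\<close> in memory and the box
  \<open>{x1..x2} \<times> {y1..y2}\<close> in registers. Its answer has to be correct for every box and whatever
  random words it draws.
\<close>

definition answers_theil_sen_queries ::
  "nat \<Rightarrow> nat \<Rightarrow> program \<Rightarrow> nat \<Rightarrow> (nat \<times> nat) set \<Rightarrow> nat list \<Rightarrow> bool" where
  "answers_theil_sen_queries b w Q t S D \<longleftrightarrow>
     (\<forall>x1 < 2 ^ w. \<forall>x2 < 2 ^ w. \<forall>y1 < 2 ^ w. \<forall>y2 < 2 ^ w.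
        \<forall>c \<in> set_pmf (run b Q t (init_config [x1, x2, y1, y2] D)).
          halted Q c \<and> query_answer c = theil_sen (S \<inter> {x1..x2} \<times> {y1..y2}))"

end

theory Submission
  imports Defs "HOL-Real_Asymp.Real_Asymp" "HOL-Computational_Algebra.Primes" "HOL-Number_Theory.Cong"
begin

text \<open>
  Every ordered pair of points is combined with every choice of a dyadic interval around each of
  its four coordinates. The resulting \<open>N\<close> elements, polylogarithmically more than \<open>n\<^sup>2\<close>, receive
  a key made of the four intervals and an integer code that preserves the order of slopes. A box
  is a disjoint union of few products of dyadic intervals, so the number of slopes in it below a
  bound is a sum of polylogarithmically many differences of ranks in the sorted list \<open>A\<close> of keys;
  the median then follows by bisection.

  Storing \<open>A\<close> would take too much space. Only every \<open>t\<close>-th key is kept, where \<open>t\<close> is about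
  \<open>n\<close> to the power \<open>\<alpha>/4\<close>. The function \<open>g\<close> that maps an element to its block of \<open>A\<close> is then
  computable, and listing a block means inverting \<open>g\<close>. This is done by rainbow tables (Hellman's
  time-space tradeoff): a table iterates \<open>B \<mapsto> g (h B)\<close> for \<open>t\<close> steps with a fresh pairwise
  independent hash function \<open>h\<close> in each step, from \<open>M / (2 t)\<close> of the \<open>M = N / t\<close> blocks, and stores
  only the end points. An element is recovered from a table if a chain hits it and merges with no
  other chain, which has probability at least \<open>1 / (8 t)\<close> by inclusion-exclusion; hence
  \<open>O (t log n)\<close> tables recover all elements with high probability. They take \<open>N / t\<close> words up to
  logarithmic factors. Looking into all tables at all positions costs \<open>t\<^sup>3\<close>, and a rank needs up to
  \<open>t\<close> steps to a successor within a block, which adds up to \<open>t\<^sup>4\<close>.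

  The machine programs are obtained from a small structured language with a verified compiler.
  Costs are bounded through the nesting of loops: the degree of a program in \<open>n\<close> is the maximal
  sum of the degrees of the bounds of nested loops.
\<close>

section \<open>A structured language compiled to the word RAM\<close>

text \<open>\<open>gg\<close> leads from elements to blocks, so it can be iterated only through a
  hash function from blocks back to elements; its randomness makes the bounds independent of the
  input. With one hash function per table, chains that ever meet would run on together. With a
  separate one for each step they merge only when they meet at the same step, with probability at
  most \<open>1 / M\<close> per step and pair of chains. Seeds of different steps are independent,
  so within a step pairwise independence is enough. With \<open>M / (2 t)\<close> chains of length
  \<open>t\<close>, a given chain merges with at most 1/2 other chain in expectation.

  Candidates are never verified: each is an element, so its key occurs in \<open>A\<close> and
  cannot undercut the successor that is sought. Tables that fail cause omissions only. Queries are
  deterministic, and coverage of all elements makes all of them correct at once.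

  Loops run for a number of rounds held in a parameter register, never until a condition holds.
  Running times thus depend on neither points, box nor seeds, which makes a syntactic cost bound
  possible.\<close>

datatype expr = EConst nat | EVar nat | EOp "binop option" expr expr | ERead expr | EIf expr expr expr
  | EFold nat expr expr

datatype com = CWrite expr expr | CSeq com com | CFor nat com

text \<open>Loop bounds may only come from registers 4 to \<open>G - 1\<close>. Registers 0 to 3
  receive the query box and registers from \<open>G\<close> on are work space, so running times
  become functions of the parameters alone.\<close>

definition limit :: "nat \<Rightarrow> (nat \<Rightarrow> nat) \<Rightarrow> nat \<Rightarrow> nat" where
  "limit G \<rho> p = (if 4 \<le> p \<and> p < G then \<rho> p else 0)"

text \<open>Without an operator, a binary expression is a \<open>let\<close>.\<close>

definition opval :: "nat \<Rightarrow> binop option \<Rightarrow> nat \<Rightarrow> nat \<Rightarrow> nat" where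
  "opval b f x y = (case f of None \<Rightarrow> y | Some g \<Rightarrow> eval_binop b g x y)"

primrec iterate :: "nat \<Rightarrow> (nat \<Rightarrow> 'a \<Rightarrow> 'a) \<Rightarrow> 'a \<Rightarrow> 'a" where
  "iterate 0 f a = a"
| "iterate (Suc k) f a = f k (iterate k f a)"

text \<open>Variables are de Bruijn levels, and the depth \<open>d\<close> is also the stack pointer
  of the compiled code. The right operand of \<open>EOp\<close> can refer to the left one as
  variable \<open>d\<close>; a \<open>let\<close> is therefore an operation that forgets its first
  value. \<open>EFold\<close> binds the accumulator at \<open>d\<close> and the counter at
  \<open>Suc d\<close>.\<close>

primrec eval :: "nat \<Rightarrow> nat \<Rightarrow> (nat \<Rightarrow> nat) \<Rightarrow> expr \<Rightarrow> nat \<Rightarrow> (nat \<Rightarrow> nat) \<Rightarrow> nat" where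
  "eval b G m (EConst k) d \<rho> = k mod 2 ^ b"
| "eval b G m (EVar i) d \<rho> = (if i < d then \<rho> i else 0)"
| "eval b G m (EOp f x y) d \<rho> = opval b f (eval b G m x d \<rho>)
     (eval b G m y (Suc d) (\<rho>(d := eval b G m x d \<rho>)))"
| "eval b G m (ERead x) d \<rho> = m (eval b G m x d \<rho>)"
| "eval b G m (EIf c x y) d \<rho> =
     (if eval b G m c d \<rho> \<noteq> 0 then eval b G m x d \<rho> else eval b G m y d \<rho>)"
| "eval b G m (EFold p x y) d \<rho> = iterate (limit G \<rho> p)
     (\<lambda>j a. eval b G m y (Suc (Suc d)) (\<rho>(d := a, Suc d := j))) (eval b G m x d \<rho>)"

primrec sem :: "nat \<Rightarrow> nat \<Rightarrow> com \<Rightarrow> nat \<Rightarrow> (nat \<Rightarrow> nat) \<Rightarrow> (nat \<Rightarrow> nat) \<Rightarrow> (nat \<Rightarrow> nat)" where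
  "sem b G (CWrite x y) d \<rho> m = m(eval b G m x d \<rho> :=
     eval b G m y (Suc d) (\<rho>(d := eval b G m x d \<rho>)))"
| "sem b G (CSeq c1 c2) d \<rho> m = sem b G c2 d \<rho> (sem b G c1 d \<rho> m)"
| "sem b G (CFor p c) d \<rho> m =
     iterate (limit G \<rho> p) (\<lambda>j m. sem b G c (Suc d) (\<rho>(d := j)) m) m"

primrec esize :: "expr \<Rightarrow> nat" where
  "esize (EConst k) = 1"
| "esize (EVar i) = 1"
| "esize (EOp f x y) = esize x + esize y + 1"
| "esize (ERead x) = esize x + 1"
| "esize (EIf c x y) = esize c + esize x + esize y + 3"
| "esize (EFold p x y) = esize x + esize y + 8"

primrec csize :: "com \<Rightarrow> nat" where
  "csize (CWrite x y) = esize x + esize y + 1"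
| "csize (CSeq c1 c2) = csize c1 + csize c2"
| "csize (CFor p c) = csize c + 7"

text \<open>An illegal bound compiles to a test that always fails, in agreement with a
  \<open>limit\<close> of 0.\<close>

definition test_instr :: "nat \<Rightarrow> nat \<Rightarrow> nat \<Rightarrow> nat \<Rightarrow> instr" where
  "test_instr G r s p = (if 4 \<le> p \<and> p < G then Oper LESS r s p else LoadConst r 0)"

text \<open>
  At depth \<open>d\<close> the registers below \<open>d\<close> hold the environment and are preserved; the value
  is left in register \<open>d\<close>. As jump targets are absolute, \<open>off\<close> is the position of the code.
\<close>

primrec ecode :: "nat \<Rightarrow> expr \<Rightarrow> nat \<Rightarrow> nat \<Rightarrow> instr list" where
  "ecode G (EConst k) d off = [LoadConst d k]"
| "ecode G (EVar i) d off = [if i < d then Oper OR d i i else LoadConst d 0]"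
| "ecode G (EOp f x y) d off =
     ecode G x d off @ ecode G y (Suc d) (off + esize x) @
     [case f of None \<Rightarrow> Oper OR d (Suc d) (Suc d) | Some g \<Rightarrow> Oper g d d (Suc d)]"
| "ecode G (ERead x) d off = ecode G x d off @ [Load d d]"
| "ecode G (EIf c x y) d off = ecode G c d off
     @ [JumpZero d (off + esize c + esize x + 3)]
     @ ecode G x d (off + esize c + 1)
     @ [LoadConst (Suc d) 0, JumpZero (Suc d) (off + esize c + esize x + esize y + 3)]
     @ ecode G y d (off + esize c + esize x + 3)"
| "ecode G (EFold p x y) d off = ecode G x d off
     @ [LoadConst (Suc d) 0, test_instr G (Suc (Suc d)) (Suc d) p,
        JumpZero (Suc (Suc d)) (off + esize x + esize y + 8)]
     @ ecode G y (Suc (Suc d)) (off + esize x + 3)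
     @ [Oper OR d (Suc (Suc d)) (Suc (Suc d)), LoadConst (Suc (Suc d)) 1,
        Oper ADD (Suc d) (Suc d) (Suc (Suc d)), LoadConst (Suc (Suc d)) 0,
        JumpZero (Suc (Suc d)) (off + esize x + 1)]"

primrec ccode :: "nat \<Rightarrow> com \<Rightarrow> nat \<Rightarrow> nat \<Rightarrow> instr list" where
  "ccode G (CWrite x y) d off =
     ecode G x d off @ ecode G y (Suc d) (off + esize x) @ [Store d (Suc d)]"
| "ccode G (CSeq c1 c2) d off = ccode G c1 d off @ ccode G c2 d (off + csize c1)"
| "ccode G (CFor p c) d off =
     [LoadConst d 0, test_instr G (Suc d) d p, JumpZero (Suc d) (off + csize c + 7)]
     @ ccode G c (Suc d) (off + 3)
     @ [LoadConst (Suc d) 1, Oper ADD d d (Suc d), LoadConst (Suc d) 0,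
        JumpZero (Suc d) (off + 1)]"

text \<open>Both branches of a conditional are charged, so the cost mentions neither the memory nor
  any computed value. The constants count the jump and counter instructions of
  \<open>ecode\<close>.\<close>

primrec ecost :: "nat \<Rightarrow> (nat \<Rightarrow> nat) \<Rightarrow> expr \<Rightarrow> nat" where
  "ecost G \<rho> (EConst k) = 1"
| "ecost G \<rho> (EVar i) = 1"
| "ecost G \<rho> (EOp f x y) = ecost G \<rho> x + ecost G \<rho> y + 1"
| "ecost G \<rho> (ERead x) = ecost G \<rho> x + 1"
| "ecost G \<rho> (EIf c x y) = ecost G \<rho> c + ecost G \<rho> x + ecost G \<rho> y + 3"
| "ecost G \<rho> (EFold p x y) = ecost G \<rho> x + limit G \<rho> p * (ecost G \<rho> y + 7) + 3"

primrec ccost :: "nat \<Rightarrow> (nat \<Rightarrow> nat) \<Rightarrow> com \<Rightarrow> nat" where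
  "ccost G \<rho> (CWrite x y) = ecost G \<rho> x + ecost G \<rho> y + 1"
| "ccost G \<rho> (CSeq c1 c2) = ccost G \<rho> c1 + ccost G \<rho> c2"
| "ccost G \<rho> (CFor p c) = limit G \<rho> p * (ccost G \<rho> c + 6) + 3"

section \<open>Sizes of code, and costs as functions of the loop bounds\<close>

lemma length_ecode [simp]: "length (ecode G e d off) = esize e"
  by (induction e arbitrary: d off) auto

lemma length_ccode [simp]: "length (ccode G c d off) = csize c"
  by (induction c arbitrary: d off) simp_all

lemma limit_cong: "(\<And>p. 4 \<le> p \<Longrightarrow> p < G \<Longrightarrow> \<rho> p = \<rho>' p) \<Longrightarrow> limit G \<rho> = limit G \<rho>'"
  by (auto simp: limit_def fun_eq_iff)

lemma ecost_cong: "limit G \<rho> = limit G \<rho>' \<Longrightarrow> ecost G \<rho> e = ecost G \<rho>' e"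
  by (induction e) auto

lemma ccost_cong: "limit G \<rho> = limit G \<rho>' \<Longrightarrow> ccost G \<rho> c = ccost G \<rho>' c"
  by (induction c) (simp_all add: ecost_cong[of G \<rho> \<rho>'])

lemma limit_upd: "G \<le> i \<Longrightarrow> limit G (\<rho>(i := v)) = limit G \<rho>"
  by (auto simp: limit_def fun_eq_iff)

lemma ecost_upd: "G \<le> i \<Longrightarrow> ecost G (\<rho>(i := v)) e = ecost G \<rho> e"
  by (intro ecost_cong limit_upd)

lemma ccost_upd: "G \<le> i \<Longrightarrow> ccost G (\<rho>(i := v)) c = ccost G \<rho> c"
  by (intro ccost_cong limit_upd)

subsection \<open>Correctness of the compiler\<close>

primrec code_at :: "program \<Rightarrow> nat \<Rightarrow> instr list \<Rightarrow> bool" where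
  "code_at P off [] = True"
| "code_at P off (x # xs) = (off < length P \<and> P ! off = x \<and> code_at P (Suc off) xs)"

lemma code_at_append:
  "code_at P off (xs @ ys) \<longleftrightarrow> code_at P off xs \<and> code_at P (off + length xs) ys"
  by (induction xs arbitrary: off) auto

lemma code_at_self: "code_at (A @ xs @ B) (length A) xs"
proof (induction xs arbitrary: A)
  case (Cons x xs)
  then show ?case using Cons[of "A @ [x]"] by (simp add: nth_append)
qed simp

text \<open>Describes deterministic stretches of a run only. The number of steps is an upper bound,
  as \<open>ecost\<close> charges for both branches of a conditional.\<close>

definition reach :: "nat \<Rightarrow> program \<Rightarrow> nat \<Rightarrow> nat \<Rightarrow> (nat \<Rightarrow> nat) \<Rightarrow> (nat \<Rightarrow> nat) \<Rightarrow>
    nat \<Rightarrow> (nat \<Rightarrow> nat) \<Rightarrow> (nat \<Rightarrow> nat) \<Rightarrow> bool" where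
  "reach b P U p r m p' r' m' \<longleftrightarrow> (\<exists>T\<le>U. run b P T \<lparr>pc = p, regs = r, mem = m\<rparr> =
     return_pmf \<lparr>pc = p', regs = r', mem = m'\<rparr>)"

lemma run_add: "run b P (s + t) c = bind_pmf (run b P s c) (run b P t)"
  by (induction s arbitrary: c) (auto simp: bind_return_pmf bind_assoc_pmf intro!: bind_pmf_cong)

lemma reach_refl: "reach b P U p r m p r m"
  unfolding reach_def by (intro exI[of _ 0]) auto

lemma reach_trans:
  assumes "reach b P U p r m p1 r1 m1" "reach b P V p1 r1 m1 p2 r2 m2" "U + V \<le> W"
  shows "reach b P W p r m p2 r2 m2"
proof -
  obtain T where T: "T \<le> U" "run b P T \<lparr>pc = p, regs = r, mem = m\<rparr> =
     return_pmf \<lparr>pc = p1, regs = r1, mem = m1\<rparr>" using assms(1) by (auto simp: reach_def)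
  obtain T' where T': "T' \<le> V" "run b P T' \<lparr>pc = p1, regs = r1, mem = m1\<rparr> =
     return_pmf \<lparr>pc = p2, regs = r2, mem = m2\<rparr>" using assms(2) by (auto simp: reach_def)
  show ?thesis unfolding reach_def
    using T T' assms(3) by (intro exI[of _ "T + T'"]) (auto simp: run_add bind_return_pmf)
qed

lemma reach_step:
  assumes "p < length P"
    "exec_instr b (P ! p) \<lparr>pc = p, regs = r, mem = m\<rparr> = return_pmf \<lparr>pc = p1, regs = r1, mem = m1\<rparr>"
    "reach b P U p1 r1 m1 p2 r2 m2" "Suc U \<le> W"
  shows "reach b P W p r m p2 r2 m2"
proof (rule reach_trans[OF _ assms(3)])
  show "reach b P 1 p r m p1 r1 m1" unfolding reach_def using assms(1,2)
    by (intro exI[of _ 1]) (auto simp: step_def halted_def bind_return_pmf bind_return_pmf')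
qed (use assms(4) in auto)

lemma reach_step1:
  assumes "p < length P"
    "exec_instr b (P ! p) \<lparr>pc = p, regs = r, mem = m\<rparr> = return_pmf \<lparr>pc = p1, regs = r1, mem = m1\<rparr>"
    "1 \<le> W"
  shows "reach b P W p r m p1 r1 m1"
  by (rule reach_step[OF assms(1,2) reach_refl[where U = 0]]) (use assms(3) in auto)

lemma bitop_less:
  assumes "(x::nat) < 2 ^ b" "y < 2 ^ b"
  shows "Bit_Operations.or x y < 2 ^ b" "Bit_Operations.and x y < 2 ^ b" "Bit_Operations.xor x y < 2 ^ b"
proof -
  have "take_bit b (Bit_Operations.or x y) = Bit_Operations.or x y"
    "take_bit b (Bit_Operations.and x y) = Bit_Operations.and x y"
    "take_bit b (Bit_Operations.xor x y) = Bit_Operations.xor x y"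
    using assms by (simp_all add: take_bit_or take_bit_and take_bit_xor take_bit_nat_eq_self)
  then show "Bit_Operations.or x y < 2 ^ b" "Bit_Operations.and x y < 2 ^ b" "Bit_Operations.xor x y < 2 ^ b"
    by (metis take_bit_nat_less_exp)+
qed

lemma eval_binop_less:
  assumes "x < 2 ^ b" "y < 2 ^ b" "1 \<le> b"
  shows "eval_binop b f x y < 2 ^ b"
proof -
  have b1: "(1::nat) < 2 ^ b" using assms one_less_power[of "2::nat" b] by simp
  have sub: "nat ((int x - int y) mod 2 ^ b) < 2 ^ b" by (simp add: nat_less_iff)
  have dv: "x div y < 2 ^ b" by (rule le_less_trans[OF div_le_dividend assms(1)])
  have md: "x mod y < 2 ^ b" by (rule le_less_trans[OF mod_less_eq_dividend assms(1)])
  have sr: "x div 2 ^ y < 2 ^ b" by (rule le_less_trans[OF div_le_dividend assms(1)])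
  show ?thesis
    using b1 sub dv md sr bitop_less[OF assms(1,2)] by (cases f) simp_all
qed

text \<open>Needed to keep the increment of a loop counter from wrapping around: the counter is
  below a register value, and registers of the environment hold words.\<close>

lemma eval_less:
  assumes "\<And>a. m a < 2 ^ b" "\<And>i. i < d \<Longrightarrow> \<rho> i < 2 ^ b" "1 \<le> b" "G \<le> d"
  shows "eval b G m e d \<rho> < 2 ^ b"
  using assms(2,4)
proof (induction e arbitrary: d \<rho>)
  case (EOp f x y)
  have x: "eval b G m x d \<rho> < 2 ^ b" using EOp by auto
  have y: "eval b G m y (Suc d) (\<rho>(d := eval b G m x d \<rho>)) < 2 ^ b"
    by (rule EOp.IH(2)) (use EOp.prems x in \<open>auto simp: less_Suc_eq\<close>)
  show ?case using y eval_binop_less[OF x y assms(3)] by (cases f) (simp_all add: opval_def)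
next
  case (EFold p x y)
  have lim: "limit G \<rho> p < 2 ^ b" using EFold.prems assms by (auto simp: limit_def)
  have "iterate k (\<lambda>j a. eval b G m y (Suc (Suc d)) (\<rho>(d := a, Suc d := j))) (eval b G m x d \<rho>) < 2 ^ b"
    if "k \<le> limit G \<rho> p" for k
    using that
  proof (induction k)
    case 0
    then show ?case using EFold.IH(1) EFold.prems by simp
  next
    case (Suc k)
    have a: "iterate k (\<lambda>j a. eval b G m y (Suc (Suc d)) (\<rho>(d := a, Suc d := j)))
      (eval b G m x d \<rho>) < 2 ^ b" using Suc by (simp del: fun_upd_apply)
    show ?case unfolding iterate.simps
      by (intro EFold.IH(2)) (use a Suc.prems lim EFold.prems in \<open>auto simp: less_Suc_eq\<close>)
  qed
  then show ?case by simp
qed (use assms in auto)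

lemma exec_test_instr:
  "exec_instr b (test_instr G r s p) \<lparr>pc = q, regs = R, mem = m\<rparr> =
     return_pmf \<lparr>pc = Suc q, regs = R(r := (if R s < limit G R p then 1 else 0)), mem = m\<rparr>"
  by (simp add: test_instr_def set_reg_def limit_def)

text \<open>Registers beyond \<open>d\<close> are scratch, so nothing is promised about them; this
  is what allows the code of subexpressions to be placed one after another at increasing
  depth.\<close>

lemma ecode_correct:
  assumes "code_at P off (ecode G e d off)" "\<And>i. i < d \<Longrightarrow> r i = \<rho> i" "\<And>i. i < d \<Longrightarrow> \<rho> i < 2 ^ b"
    "\<And>a. m a < 2 ^ b" "1 \<le> b" "G \<le> d"
  shows "\<exists>r'. reach b P (ecost G \<rho> e) off r m (off + esize e) r' m \<and>
    (\<forall>i<d. r' i = \<rho> i) \<and> r' d = eval b G m e d \<rho>"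
  using assms(1-3,6)
proof (induction e arbitrary: d off r \<rho>)
  case (EConst k)
  show ?case
    by (rule exI[of _ "r(d := k mod 2 ^ b)"], intro conjI, rule reach_step1)
      (use EConst in \<open>auto simp: set_reg_def\<close>)
next
  case (EVar i)
  show ?case
    by (rule exI[of _ "r(d := (if i < d then \<rho> i else 0))"], intro conjI, rule reach_step1)
      (use EVar in \<open>auto simp: set_reg_def\<close>)
next
  case (EOp f x y)
  note c = EOp.prems(1)[simplified code_at_append ecode.simps length_ecode, simplified]
  obtain r1 where r1: "reach b P (ecost G \<rho> x) off r m (off + esize x) r1 m"
    "\<forall>i<d. r1 i = \<rho> i" "r1 d = eval b G m x d \<rho>"
    using EOp.IH(1)[of off d r \<rho>] c EOp.prems by auto
  let ?\<rho> = "\<rho>(d := eval b G m x d \<rho>)"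
  have ag: "i < Suc d \<Longrightarrow> r1 i = ?\<rho> i" for i using r1 by (auto simp: less_Suc_eq)
  have bd: "i < Suc d \<Longrightarrow> ?\<rho> i < 2 ^ b" for i
    using EOp.prems(3,4) eval_less[of m b d \<rho> G x] assms(4,5) by (auto simp: less_Suc_eq)
  have cost: "ecost G ?\<rho> y = ecost G \<rho> y" using EOp.prems(4) by (simp add: ecost_upd)
  obtain r2 where r2: "reach b P (ecost G \<rho> y) (off + esize x) r1 m (off + esize x + esize y) r2 m"
    "\<forall>i<Suc d. r2 i = ?\<rho> i" "r2 (Suc d) = eval b G m y (Suc d) ?\<rho>"
    using EOp.IH(2)[of "off + esize x" "Suc d" r1 ?\<rho>, OF _ ag bd] c EOp.prems(4) cost
    by (auto simp del: fun_upd_apply)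
  show ?case
    by (rule exI[of _ "r2(d := opval b f (r2 d) (r2 (Suc d)))"], intro conjI,
        rule reach_trans[OF r1(1) reach_trans[OF r2(1) reach_step1 order_refl]])
      (use c r2 in \<open>auto simp: set_reg_def add.assoc opval_def split: option.splits\<close>)
next
  case (ERead x)
  note c = ERead.prems(1)[simplified code_at_append ecode.simps length_ecode, simplified]
  obtain r1 where r1: "reach b P (ecost G \<rho> x) off r m (off + esize x) r1 m"
    "\<forall>i<d. r1 i = \<rho> i" "r1 d = eval b G m x d \<rho>"
    using ERead.IH(1)[of off d r \<rho>] c ERead.prems by auto
  show ?case
    by (rule exI[of _ "r1(d := m (r1 d))"], intro conjI, rule reach_trans[OF r1(1) reach_step1])
      (use c r1 in \<open>auto simp: set_reg_def add.assoc\<close>)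
next
  case (EIf e x y)
  note c = EIf.prems(1)[simplified code_at_append ecode.simps length_ecode, simplified]
  obtain r1 where r1: "reach b P (ecost G \<rho> e) off r m (off + esize e) r1 m"
    "\<forall>i<d. r1 i = \<rho> i" "r1 d = eval b G m e d \<rho>"
    using EIf.IH(1)[of off d r \<rho>] c EIf.prems by auto
  show ?case
  proof (cases "eval b G m e d \<rho> = 0")
    case True
    have s: "reach b P 1 (off + esize e) r1 m (off + esize e + esize x + 3) r1 m"
      by (rule reach_step1) (use c r1 True in auto)
    obtain r2 where r2: "reach b P (ecost G \<rho> y) (off + esize e + esize x + 3) r1 m
        (off + esize e + esize x + 3 + esize y) r2 m"
      "\<forall>i<d. r2 i = \<rho> i" "r2 d = eval b G m y d \<rho>"
      using EIf.IH(3)[of "off + esize e + esize x + 3" d r1 \<rho>] c EIf.prems r1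
      by (auto simp: algebra_simps numeral_3_eq_3)
    have "reach b P (ecost G \<rho> (EIf e x y)) off r m (off + esize (EIf e x y)) r2 m"
      using reach_trans[OF r1(1) reach_trans[OF s r2(1) order_refl], of "ecost G \<rho> (EIf e x y)"]
      by (simp add: algebra_simps)
    then show ?thesis using True r2 by (intro exI[of _ r2]) auto
  next
    case False
    have s: "reach b P 1 (off + esize e) r1 m (off + esize e + 1) r1 m"
      by (rule reach_step1) (use c r1 False in auto)
    obtain r2 where r2: "reach b P (ecost G \<rho> x) (off + esize e + 1) r1 m
        (off + esize e + 1 + esize x) r2 m"
      "\<forall>i<d. r2 i = \<rho> i" "r2 d = eval b G m x d \<rho>"
      using EIf.IH(2)[of "off + esize e + 1" d r1 \<rho>] c EIf.prems r1 by auto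
    \<comment> \<open>An unconditional jump is a conditional one on a register that has just been
      set to 0.\<close>
    have s2: "reach b P 2 (off + esize e + 1 + esize x) r2 m
        (off + esize e + esize x + esize y + 3) (r2(Suc d := 0)) m"
      by (rule reach_step[OF _ _ reach_step1[of _ _ _ _ _ _ _ _ 1]])
        (use c in \<open>auto simp: set_reg_def\<close>)
    have "reach b P (ecost G \<rho> (EIf e x y)) off r m (off + esize (EIf e x y)) (r2(Suc d := 0)) m"
      using reach_trans[OF r1(1) reach_trans[OF s reach_trans[OF r2(1) s2 order_refl] order_refl],
          of "ecost G \<rho> (EIf e x y)"]
      by (simp add: algebra_simps)
    moreover have "\<forall>i<d. (r2(Suc d := 0)) i = \<rho> i" "(r2(Suc d := 0)) d = eval b G m (EIf e x y) d \<rho>"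
      using False r2 by auto
    ultimately show ?thesis by blast
  qed
next
  case (EFold p x y)
  note c = EFold.prems(1)[simplified code_at_append ecode.simps length_ecode, simplified]
  obtain r1 where r1: "reach b P (ecost G \<rho> x) off r m (off + esize x) r1 m"
    "\<forall>i<d. r1 i = \<rho> i" "r1 d = eval b G m x d \<rho>"
    using EFold.IH(1)[of off d r \<rho>] c EFold.prems by auto
  define L where "L = off + esize x + 1"
  define f where "f = (\<lambda>j a. eval b G m y (Suc (Suc d)) (\<rho>(d := a, Suc d := j)))"
  define it where "it = (\<lambda>k. iterate k f (eval b G m x d \<rho>))"
  have lim: "limit G \<rho> p < 2 ^ b" using EFold.prems assms(5) by (auto simp: limit_def)
  have limr: "limit G r' p = limit G \<rho> p" if "\<forall>i<d. r' i = \<rho> i" for r'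
    using that EFold.prems by (auto simp: limit_def)
  define r0 where "r0 = r1(Suc d := 0)"
  have s1: "reach b P 1 (off + esize x) r1 m L r0 m"
    by (rule reach_step1) (use c in \<open>auto simp: set_reg_def L_def r0_def\<close>)
  \<comment> \<open>Invariant at the loop head \<open>L\<close>: accumulator in register
    \<open>d\<close>, counter in \<open>Suc d\<close>. A round costs the body, two instructions for
    the test and five for the update and the jump back.\<close>
  have loop: "it k < 2 ^ b \<and> (\<exists>r'. reach b P (k * (ecost G \<rho> y + 7)) L r0 m L r' m \<and>
      (\<forall>i<d. r' i = \<rho> i) \<and> r' d = it k \<and> r' (Suc d) = k)" if "k \<le> limit G \<rho> p" for k
    using that
  proof (induction k)
    case 0
    have "it 0 < 2 ^ b"
      using eval_less[of m b d \<rho> G x] EFold.prems assms by (simp add: it_def)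
    moreover have "\<forall>i<d. r0 i = \<rho> i" "r0 d = it 0" "r0 (Suc d) = 0"
      using r1 by (auto simp: it_def r0_def)
    ultimately show ?case using reach_refl by (metis mult_0)
  next
    case (Suc k)
    then obtain r' where r': "reach b P (k * (ecost G \<rho> y + 7)) L r0 m L r' m"
      "\<forall>i<d. r' i = \<rho> i" "r' d = it k" "r' (Suc d) = k" and itk: "it k < 2 ^ b" by auto
    let ?r2 = "r'(Suc (Suc d) := 1)"
    have t: "reach b P 2 L r' m (L + 2) ?r2 m"
      by (rule reach_step[OF _ _ reach_step1[of _ _ _ _ _ _ _ _ 1]])
        (use c r' Suc.prems limr[of r'] in \<open>auto simp: exec_test_instr L_def\<close>)
    let ?\<rho> = "\<rho>(d := it k, Suc d := k)"
    have cost: "ecost G ?\<rho> y = ecost G \<rho> y" using EFold.prems(4) by (simp add: ecost_upd)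
    have bd: "i < Suc (Suc d) \<Longrightarrow> ?\<rho> i < 2 ^ b" for i
      using EFold.prems(3) itk Suc.prems lim by (auto simp: less_Suc_eq)
    have "\<forall>i<Suc (Suc d). ?r2 i = ?\<rho> i" using r' by (simp add: All_less_Suc)
    then have ag: "i < Suc (Suc d) \<Longrightarrow> ?r2 i = ?\<rho> i" for i by blast
    have cL: "code_at P (L + 2) (ecode G y (Suc (Suc d)) (L + 2))"
      using c by (simp add: L_def numeral_3_eq_3)
    have itS': "it (Suc k) = eval b G m y (Suc (Suc d)) ?\<rho>" by (simp add: it_def f_def)
    obtain r3 where r3: "reach b P (ecost G \<rho> y) (L + 2) ?r2 m (L + 2 + esize y) r3 m"
      "\<forall>i<Suc (Suc d). r3 i = ?\<rho> i" "r3 (Suc (Suc d)) = it (Suc k)"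
      using EFold.IH(2)[of "L + 2" "Suc (Suc d)" ?r2 ?\<rho>, OF cL ag bd
          le_SucI[OF le_SucI[OF EFold.prems(4)]], unfolded cost, folded itS']
      by blast
    let ?r4 = "r3(d := it (Suc k), Suc d := Suc k, Suc (Suc d) := 0)"
    have big: "(1::nat) < 2 ^ b" using assms(5) one_less_power[of "2::nat" b] by simp
    have u: "reach b P 5 (L + 2 + esize y) r3 m L ?r4 m"
      unfolding reach_def
      using c r3(2,3) Suc.prems lim big assms(5)
      by (intro exI[of _ 5])
        (simp add: eval_nat_numeral step_def halted_def set_reg_def bind_return_pmf L_def fun_eq_iff)
    have "it (Suc k) < 2 ^ b"
      using eval_less[of m b "Suc (Suc d)" ?\<rho> G y] bd assms EFold.prems(4)
      by (simp add: it_def f_def)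
    moreover have "reach b P (Suc k * (ecost G \<rho> y + 7)) L r0 m L ?r4 m"
      by (rule reach_trans[OF r'(1) reach_trans[OF t reach_trans[OF r3(1) u order_refl] order_refl]])
        auto
    moreover have "\<forall>i<d. ?r4 i = \<rho> i" "?r4 d = it (Suc k)" "?r4 (Suc d) = Suc k"
      using r3 by auto
    ultimately show ?case by blast
  qed
  obtain r2 where r2: "reach b P (limit G \<rho> p * (ecost G \<rho> y + 7)) L r0 m L r2 m"
    "\<forall>i<d. r2 i = \<rho> i" "r2 d = it (limit G \<rho> p)" "r2 (Suc d) = limit G \<rho> p"
    using loop[of "limit G \<rho> p"] by auto
  have s3: "reach b P 2 L r2 m (off + esize x + esize y + 8) (r2(Suc (Suc d) := 0)) m"
    by (rule reach_step[OF _ _ reach_step1[of _ _ _ _ _ _ _ _ 1]])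
      (use c r2 limr[of r2] in \<open>auto simp: exec_test_instr L_def\<close>)
  have "reach b P (ecost G \<rho> (EFold p x y)) off r m (off + esize (EFold p x y)) (r2(Suc (Suc d) := 0)) m"
    using reach_trans[OF r1(1) reach_trans[OF s1 reach_trans[OF r2(1) s3 order_refl] order_refl]]
    by (auto simp: algebra_simps)
  moreover have "\<forall>i<d. (r2(Suc (Suc d) := 0)) i = \<rho> i"
    "(r2(Suc (Suc d) := 0)) d = eval b G m (EFold p x y) d \<rho>"
    using r2 by (auto simp: it_def f_def)
  ultimately show ?case by blast
qed

text \<open>Commands change the memory, so the induction also has to carry that all cells remain
  words; the next command relies on it.\<close>

lemma ccode_correct:
  assumes "code_at P off (ccode G c d off)" "\<And>i. i < d \<Longrightarrow> r i = \<rho> i" "\<And>i. i < d \<Longrightarrow> \<rho> i < 2 ^ b"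
    "\<And>a. m a < 2 ^ b" "1 \<le> b" "G \<le> d"
  shows "(\<exists>r'. reach b P (ccost G \<rho> c) off r m (off + csize c) r' (sem b G c d \<rho> m) \<and>
    (\<forall>i<d. r' i = \<rho> i)) \<and> (\<forall>a. sem b G c d \<rho> m a < 2 ^ b)"
  using assms(1-4,6)
proof (induction c arbitrary: d off r \<rho> m)
  case (CWrite x y)
  note c = CWrite.prems(1)[simplified code_at_append ccode.simps length_ecode, simplified]
  obtain r1 where r1: "reach b P (ecost G \<rho> x) off r m (off + esize x) r1 m"
    "\<forall>i<d. r1 i = \<rho> i" "r1 d = eval b G m x d \<rho>"
    using ecode_correct[of P off G x d r \<rho> b m] c CWrite.prems assms(5) by auto
  let ?\<rho> = "\<rho>(d := eval b G m x d \<rho>)"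
  have ag: "i < Suc d \<Longrightarrow> r1 i = ?\<rho> i" for i using r1 by (auto simp: less_Suc_eq)
  have bd: "i < Suc d \<Longrightarrow> ?\<rho> i < 2 ^ b" for i
    using CWrite.prems eval_less[of m b d \<rho> G x] assms(5) by (auto simp: less_Suc_eq)
  have cost: "ecost G ?\<rho> y = ecost G \<rho> y" using CWrite.prems by (simp add: ecost_upd)
  obtain r2 where r2: "reach b P (ecost G \<rho> y) (off + esize x) r1 m (off + esize x + esize y) r2 m"
    "\<forall>i<Suc d. r2 i = ?\<rho> i" "r2 (Suc d) = eval b G m y (Suc d) ?\<rho>"
    using ecode_correct[of P "off + esize x" G y "Suc d" r1 ?\<rho> b m, OF _ ag bd]
      c CWrite.prems cost assms(5)
    by (auto simp del: fun_upd_apply)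
  have fin: "reach b P (ccost G \<rho> (CWrite x y)) off r m (off + csize (CWrite x y)) r2
      (sem b G (CWrite x y) d \<rho> m)"
    by (rule reach_trans[OF r1(1) reach_trans[OF r2(1) reach_step1 order_refl]])
      (use c r2 in auto)
  have "eval b G m y (Suc d) ?\<rho> < 2 ^ b"
    by (rule eval_less) (use CWrite.prems bd assms(5) in \<open>auto simp del: fun_upd_apply\<close>)
  then have "\<forall>a. sem b G (CWrite x y) d \<rho> m a < 2 ^ b" using CWrite.prems by auto
  moreover have "\<forall>i<d. r2 i = \<rho> i" using r2 by auto
  ultimately show ?case using fin by blast
next
  case (CSeq c1 c2)
  note c = CSeq.prems(1)[simplified code_at_append ccode.simps length_ccode, simplified]
  obtain r1 where r1: "reach b P (ccost G \<rho> c1) off r m (off + csize c1) r1 (sem b G c1 d \<rho> m)"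
    "\<forall>i<d. r1 i = \<rho> i" "\<forall>a. sem b G c1 d \<rho> m a < 2 ^ b"
    using CSeq.IH(1)[of off d r \<rho> m] c CSeq.prems by auto
  obtain r2 where r2: "reach b P (ccost G \<rho> c2) (off + csize c1) r1 (sem b G c1 d \<rho> m)
      (off + csize c1 + csize c2) r2 (sem b G c2 d \<rho> (sem b G c1 d \<rho> m))"
    "\<forall>i<d. r2 i = \<rho> i" "\<forall>a. sem b G c2 d \<rho> (sem b G c1 d \<rho> m) a < 2 ^ b"
    using CSeq.IH(2)[of "off + csize c1" d r1 \<rho> "sem b G c1 d \<rho> m"] c CSeq.prems r1 by auto
  show ?case using reach_trans[OF r1(1) r2(1) order_refl] r2 by (auto simp: add.assoc)
next
  case (CFor p c0)
  note c = CFor.prems(1)[simplified code_at_append ccode.simps length_ccode, simplified]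
  define L where "L = off + 1"
  define it where "it = (\<lambda>k. iterate k (\<lambda>j m. sem b G c0 (Suc d) (\<rho>(d := j)) m) m)"
  have lim: "limit G \<rho> p < 2 ^ b" using CFor.prems assms(5) by (auto simp: limit_def)
  have limr: "limit G r' p = limit G \<rho> p" if "\<forall>i<d. r' i = \<rho> i" for r'
    using that CFor.prems by (auto simp: limit_def)
  define r0 where "r0 = r(d := 0)"
  have s1: "reach b P 1 off r m L r0 m"
    by (rule reach_step1) (use c in \<open>auto simp: set_reg_def L_def r0_def\<close>)
  have loop: "(\<forall>a. it k a < 2 ^ b) \<and> (\<exists>r'. reach b P (k * (ccost G \<rho> c0 + 6)) L r0 m L r' (it k) \<and>
      (\<forall>i<d. r' i = \<rho> i) \<and> r' d = k)" if "k \<le> limit G \<rho> p" for k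
    using that
  proof (induction k)
    case 0
    have "\<forall>a. it 0 a < 2 ^ b" "it 0 = m" using CFor.prems by (simp_all add: it_def)
    moreover have "\<forall>i<d. r0 i = \<rho> i" "r0 d = 0" using CFor.prems by (auto simp: r0_def)
    ultimately show ?case using reach_refl by (metis mult_0)
  next
    case (Suc k)
    then obtain r' where r': "reach b P (k * (ccost G \<rho> c0 + 6)) L r0 m L r' (it k)"
      "\<forall>i<d. r' i = \<rho> i" "r' d = k" and itk: "\<forall>a. it k a < 2 ^ b" by auto
    let ?r2 = "r'(Suc d := 1)"
    have t: "reach b P 2 L r' (it k) (L + 2) ?r2 (it k)"
      by (rule reach_step[OF _ _ reach_step1[of _ _ _ _ _ _ _ _ 1]])
        (use c r' Suc.prems limr[of r'] in \<open>auto simp: exec_test_instr L_def\<close>)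
    let ?\<rho> = "\<rho>(d := k)"
    have cost: "ccost G ?\<rho> c0 = ccost G \<rho> c0" using CFor.prems by (simp add: ccost_upd)
    have bd: "i < Suc d \<Longrightarrow> ?\<rho> i < 2 ^ b" for i
      using CFor.prems Suc.prems lim by (auto simp: less_Suc_eq)
    have "\<forall>i<Suc d. ?r2 i = ?\<rho> i" using r' by (simp add: All_less_Suc)
    then have ag: "i < Suc d \<Longrightarrow> ?r2 i = ?\<rho> i" for i by blast
    have cL: "code_at P (L + 2) (ccode G c0 (Suc d) (L + 2))"
      using c by (simp add: L_def numeral_3_eq_3)
    have itS': "it (Suc k) = sem b G c0 (Suc d) ?\<rho> (it k)" by (simp add: it_def)
    obtain r3 where r3: "reach b P (ccost G \<rho> c0) (L + 2) ?r2 (it k) (L + 2 + csize c0) r3 (it (Suc k))"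
      "\<forall>i<Suc d. r3 i = ?\<rho> i" and itS: "\<forall>a. it (Suc k) a < 2 ^ b"
      using CFor.IH[of "L + 2" "Suc d" ?r2 ?\<rho> "it k", OF cL ag bd itk[rule_format]
          le_SucI[OF CFor.prems(5)], unfolded cost, folded itS']
      by blast
    let ?r4 = "r3(d := Suc k, Suc d := 0)"
    have big: "(1::nat) < 2 ^ b" using assms(5) one_less_power[of "2::nat" b] by simp
    have u: "reach b P 4 (L + 2 + csize c0) r3 (it (Suc k)) L ?r4 (it (Suc k))"
      unfolding reach_def
      using c r3(2) Suc.prems lim big assms(5)
      by (intro exI[of _ 4])
        (simp add: eval_nat_numeral step_def halted_def set_reg_def bind_return_pmf L_def fun_eq_iff)
    have "reach b P (Suc k * (ccost G \<rho> c0 + 6)) L r0 m L ?r4 (it (Suc k))"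
      by (rule reach_trans[OF r'(1) reach_trans[OF t reach_trans[OF r3(1) u order_refl] order_refl]])
        auto
    moreover have "\<forall>i<d. ?r4 i = \<rho> i" "?r4 d = Suc k" using r3 by auto
    ultimately show ?case using itS by blast
  qed
  obtain r2 where r2: "reach b P (limit G \<rho> p * (ccost G \<rho> c0 + 6)) L r0 m L r2 (it (limit G \<rho> p))"
    "\<forall>i<d. r2 i = \<rho> i" "r2 d = limit G \<rho> p" and itl: "\<forall>a. it (limit G \<rho> p) a < 2 ^ b"
    using loop[of "limit G \<rho> p"] by auto
  have s3: "reach b P 2 L r2 (it (limit G \<rho> p)) (off + csize c0 + 7) (r2(Suc d := 0)) (it (limit G \<rho> p))"
    by (rule reach_step[OF _ _ reach_step1[of _ _ _ _ _ _ _ _ 1]])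
      (use c r2 limr[of r2] in \<open>auto simp: exec_test_instr L_def\<close>)
  have "reach b P (ccost G \<rho> (CFor p c0)) off r m (off + csize (CFor p c0)) (r2(Suc d := 0))
      (it (limit G \<rho> p))"
    using reach_trans[OF s1 reach_trans[OF r2(1) s3 order_refl], of "ccost G \<rho> (CFor p c0)"]
    by (simp add: add.assoc)
  moreover have "\<forall>i<d. (r2(Suc d := 0)) i = \<rho> i" using r2 by auto
  moreover have "sem b G (CFor p c0) d \<rho> m = it (limit G \<rho> p)" by (simp add: it_def)
  ultimately show ?case using itl by metis
qed

subsection \<open>Whole programs\<close>

text \<open>While register \<open>d\<close> is being computed, only the registers below it can serve
  as loop bounds, hence \<open>min d G\<close>. In this way the parameters computed early bound the
  loops that compute the later ones.\<close>

primrec lets_code :: "nat \<Rightarrow> expr list \<Rightarrow> nat \<Rightarrow> nat \<Rightarrow> instr list" where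
  "lets_code G [] d off = []"
| "lets_code G (e # es) d off = ecode (min d G) e d off @ lets_code G es (Suc d) (off + esize e)"

primrec lets_env :: "nat \<Rightarrow> nat \<Rightarrow> (nat \<Rightarrow> nat) \<Rightarrow> expr list \<Rightarrow> nat \<Rightarrow> (nat \<Rightarrow> nat) \<Rightarrow> (nat \<Rightarrow> nat)" where
  "lets_env b G m [] d \<rho> = \<rho>"
| "lets_env b G m (e # es) d \<rho> = lets_env b G m es (Suc d) (\<rho>(d := eval b (min d G) m e d \<rho>))"

primrec lets_cost :: "nat \<Rightarrow> nat \<Rightarrow> (nat \<Rightarrow> nat) \<Rightarrow> expr list \<Rightarrow> nat \<Rightarrow> (nat \<Rightarrow> nat) \<Rightarrow> nat" where
  "lets_cost b G m [] d \<rho> = 0"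
| "lets_cost b G m (e # es) d \<rho> =
     ecost (min d G) \<rho> e + lets_cost b G m es (Suc d) (\<rho>(d := eval b (min d G) m e d \<rho>))"

lemma length_lets_code: "length (lets_code G es d off) = sum_list (map esize es)"
  by (induction es arbitrary: d off) auto

lemma lets_env_below: "i < d \<Longrightarrow> lets_env b G m es d \<rho> i = \<rho> i"
  by (induction es arbitrary: d \<rho>) auto

lemma lets_correct:
  assumes "code_at P off (lets_code G es d off)" "\<And>i. i < d \<Longrightarrow> r i = \<rho> i"
    "\<And>i. i < d \<Longrightarrow> \<rho> i < 2 ^ b" "\<And>a. m a < 2 ^ b" "1 \<le> b"
  shows "(\<exists>r'. reach b P (lets_cost b G m es d \<rho>) off r m (off + sum_list (map esize es)) r' m \<and>
    (\<forall>i<d + length es. r' i = lets_env b G m es d \<rho> i)) \<and>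
    (\<forall>i<d + length es. lets_env b G m es d \<rho> i < 2 ^ b)"
  using assms(1-3)
proof (induction es arbitrary: off d r \<rho>)
  case Nil
  then show ?case using reach_refl by (simp, blast)
next
  case (Cons e es)
  note c = Cons.prems(1)[simplified code_at_append lets_code.simps length_ecode, simplified]
  let ?G = "min d G"
  obtain r1 where r1: "reach b P (ecost ?G \<rho> e) off r m (off + esize e) r1 m"
    "\<forall>i<d. r1 i = \<rho> i" "r1 d = eval b ?G m e d \<rho>"
    using ecode_correct[of P off ?G e d r \<rho> b m] c Cons.prems assms(4,5) by auto
  let ?\<rho> = "\<rho>(d := eval b ?G m e d \<rho>)"
  have ag: "i < Suc d \<Longrightarrow> r1 i = ?\<rho> i" for i using r1 by (auto simp: less_Suc_eq)
  have bd: "i < Suc d \<Longrightarrow> ?\<rho> i < 2 ^ b" for i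
    using Cons.prems eval_less[of m b d \<rho> ?G e] assms(4,5) by (auto simp: less_Suc_eq)
  from Cons.IH[of "off + esize e" "Suc d" r1 ?\<rho>, OF _ ag bd] c
  obtain r2 where r2: "reach b P (lets_cost b G m es (Suc d) ?\<rho>) (off + esize e) r1 m
      (off + esize e + sum_list (map esize es)) r2 m"
    "\<forall>i<Suc d + length es. r2 i = lets_env b G m es (Suc d) ?\<rho> i"
    "\<forall>i<Suc d + length es. lets_env b G m es (Suc d) ?\<rho> i < 2 ^ b"
    by (auto simp del: fun_upd_apply)
  show ?case using reach_trans[OF r1(1) r2(1) order_refl] r2(2,3) by (auto simp: add.assoc)
qed

definition moves_code :: "(nat \<times> nat) list \<Rightarrow> instr list" where
  "moves_code mv = map (\<lambda>(x, y). Oper OR x y y) mv"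

primrec moves_regs :: "(nat \<times> nat) list \<Rightarrow> (nat \<Rightarrow> nat) \<Rightarrow> nat \<Rightarrow> nat" where
  "moves_regs [] r = r"
| "moves_regs (xy # mv) r = moves_regs mv (r(fst xy := r (snd xy)))"

lemma moves_correct:
  assumes "code_at P off (moves_code mv)"
  shows "reach b P (length mv) off r m (off + length mv) (moves_regs mv r) m"
  using assms
proof (induction mv arbitrary: off r)
  case Nil
  then show ?case using reach_refl by simp
next
  case (Cons xy mv)
  obtain x y where xy: "xy = (x, y)" by fastforce
  have "reach b P (length mv) (Suc off) (r(x := r y)) m (Suc off + length mv)
      (moves_regs mv (r(x := r y))) m"
    using Cons.IH[of "Suc off" "r(x := r y)"] Cons.prems
    by (simp add: moves_code_def del: fun_upd_apply)
  note s = reach_step[OF _ _ this]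
  show ?case
    using s[of off r m "length (xy # mv)"] Cons.prems xy
    by (simp add: moves_code_def set_reg_def del: fun_upd_apply)
qed

lemma run_halted: "halted P c \<Longrightarrow> run b P t c = return_pmf c"
  by (induction t) (auto simp: step_def bind_return_pmf)

text \<open>A halted configuration is a fixed point, so an upper bound on the number of steps
  becomes an exact statement about every later time.\<close>

lemma reach_run:
  assumes "reach b P U p r m p' r' m'" "length P \<le> p'" "U \<le> T"
  shows "run b P T \<lparr>pc = p, regs = r, mem = m\<rparr> = return_pmf \<lparr>pc = p', regs = r', mem = m'\<rparr>"
proof -
  obtain t where t: "t \<le> U" "run b P t \<lparr>pc = p, regs = r, mem = m\<rparr> =
      return_pmf \<lparr>pc = p', regs = r', mem = m'\<rparr>"
    using assms(1) by (auto simp: reach_def)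
  have "run b P (t + (T - t)) \<lparr>pc = p, regs = r, mem = m\<rparr> =
      return_pmf \<lparr>pc = p', regs = r', mem = m'\<rparr>"
    unfolding run_add t(2) using assms(2) by (simp add: bind_return_pmf run_halted halted_def)
  then show ?thesis using t(1) assms(3) by simp
qed

definition query_program :: "nat \<Rightarrow> expr list \<Rightarrow> (nat \<times> nat) list \<Rightarrow> program" where
  "query_program G es mv = lets_code G es 4 0 @ moves_code mv"

text \<open>All sources of the final moves lie above all targets, so the moves cannot disturb each
  other.\<close>

lemma query_program_correct:
  assumes "\<And>i. \<rho> i < 2 ^ b" "\<And>a. m a < 2 ^ b" "1 \<le> b"
    "\<And>x y. (x, y) \<in> set mv \<Longrightarrow> x < 4 \<and> 4 \<le> y \<and> y < 4 + length es" "distinct (map fst mv)"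
    "lets_cost b G m es 4 \<rho> + length mv \<le> T"
  shows "\<exists>c. run b (query_program G es mv) T \<lparr>pc = 0, regs = \<rho>, mem = m\<rparr> = return_pmf c \<and>
    halted (query_program G es mv) c \<and> (\<forall>(x, y) \<in> set mv. regs c x = lets_env b G m es 4 \<rho> y)"
proof -
  let ?P = "query_program G es mv"
  let ?n = "sum_list (map esize es)"
  have c: "code_at ?P 0 (lets_code G es 4 0)" "code_at ?P ?n (moves_code mv)"
    using code_at_self[of "[]" "lets_code G es 4 0" "moves_code mv"]
      code_at_self[of "lets_code G es 4 0" "moves_code mv" "[]"]
    by (simp_all add: query_program_def length_lets_code)
  obtain r where r: "reach b ?P (lets_cost b G m es 4 \<rho>) 0 \<rho> m (0 + ?n) r m"
    "\<forall>i<4 + length es. r i = lets_env b G m es 4 \<rho> i"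
    using lets_correct[of ?P 0 G es 4 \<rho> \<rho> b m] c assms by auto
  have *: "(\<forall>(x, y) \<in> set mv. moves_regs mv r x = r y) \<and>
      (\<forall>i. i \<notin> fst ` set mv \<longrightarrow> moves_regs mv r i = r i)"
    if "\<And>x y. (x, y) \<in> set mv \<Longrightarrow> x < 4 \<and> 4 \<le> y" "distinct (map fst mv)" for mv r
    using that
  proof (induction mv arbitrary: r)
    case (Cons xy mv)
    have "y \<noteq> fst xy" if "(x, y) \<in> set mv" for x y
      using Cons.prems(1)[of x y] Cons.prems(1)[of "fst xy" "snd xy"] that by auto
    then show ?case using Cons.IH[of "r(fst xy := r (snd xy))"] Cons.prems
      by (fastforce simp: image_iff)
  qed simp
  have len: "length ?P = ?n + length mv"
    by (simp add: query_program_def length_lets_code moves_code_def)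
  have "run b ?P T \<lparr>pc = 0, regs = \<rho>, mem = m\<rparr> =
      return_pmf \<lparr>pc = ?n + length mv, regs = moves_regs mv r, mem = m\<rparr>"
    by (rule reach_run[OF reach_trans[OF r(1)[simplified] moves_correct[OF c(2)] order_refl]])
      (use len assms(6) in auto)
  moreover have "\<forall>(x, y) \<in> set mv. moves_regs mv r x = lets_env b G m es 4 \<rho> y"
    using *[of mv r] assms(4,5) r(2) by fastforce
  ultimately show ?thesis using len by (auto simp: halted_def)
qed

subsection \<open>Random words\<close>

definition store_list :: "nat \<Rightarrow> nat list \<Rightarrow> (nat \<Rightarrow> nat) \<Rightarrow> (nat \<Rightarrow> nat)" where
  "store_list a xs m = (\<lambda>i. if a \<le> i \<and> i < a + length xs then xs ! (i - a) else m i)"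

lemma store_list_Cons: "store_list a (x # xs) m = store_list (Suc a) xs (m(a := x))"
  by (auto simp: store_list_def fun_eq_iff nth_Cons')

lemma store_list_Nil [simp]: "store_list a [] m = m"
  by (auto simp: store_list_def)

text \<open>Register \<open>d\<close> counts the words drawn, register \<open>s\<close> holds the
  first address and register \<open>c\<close> the number of words.\<close>

definition random_code :: "nat \<Rightarrow> nat \<Rightarrow> nat \<Rightarrow> nat \<Rightarrow> instr list" where
  "random_code d s c off = [LoadConst d 0, Oper LESS (Suc d) d c, JumpZero (Suc d) (off + 10),
     Random (Suc d), Oper ADD (Suc (Suc d)) s d, Store (Suc (Suc d)) (Suc d),
     LoadConst (Suc d) 1, Oper ADD d d (Suc d), LoadConst (Suc d) 0, JumpZero (Suc d) (off + 1)]"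

abbreviation random_word :: "nat \<Rightarrow> nat pmf" where
  "random_word b \<equiv> pmf_of_set {..<2 ^ b}"

text \<open>The outcome is the image under some \<open>g\<close> of the uniform distribution on
  lists of words. All later probabilities can therefore be taken over the list of seeds, the rest of
  the execution being determined by it.\<close>

lemma random_loop:
  assumes c: "code_at P off (random_code d s c off)" and b: "1 \<le> b" and sc: "s < d" "c < d"
    and "\<rho> s + \<rho> c \<le> 2 ^ b" "\<rho> c < 2 ^ b"
    and "\<And>i. i < d \<Longrightarrow> r i = \<rho> i" "r d + k = \<rho> c"
  shows "\<exists>g. run b P (9 * k + 2) \<lparr>pc = off + 1, regs = r, mem = m\<rparr> =
      map_pmf g (replicate_pmf k (random_word b)) \<and>
    (\<forall>xs. length xs = k \<longrightarrow> pc (g xs) = off + 10 \<and> mem (g xs) = store_list (\<rho> s + r d) xs m \<and>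
      (\<forall>i<d. regs (g xs) i = \<rho> i))"
  using assms(7,8)
proof (induction k arbitrary: r m)
  case 0
  have "run b P 2 \<lparr>pc = off + 1, regs = r, mem = m\<rparr> =
      return_pmf \<lparr>pc = off + 10, regs = r(Suc d := 0), mem = m\<rparr>"
    using c 0 sc
    by (simp add: random_code_def eval_nat_numeral step_def halted_def set_reg_def bind_return_pmf)
  then show ?case using 0 sc
    by (intro exI[of _ "\<lambda>_. \<lparr>pc = off + 10, regs = r(Suc d := 0), mem = m\<rparr>"])
      (simp add: map_pmf_def bind_return_pmf numeral_2_eq_2 del: run.simps)
next
  case (Suc k)
  define r' where "r' = r(Suc (Suc d) := \<rho> s + r d, d := Suc (r d), Suc d := 0)"
  have big: "(1::nat) < 2 ^ b" using b one_less_power[of "2::nat" b] by simp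
  have lt: "\<rho> s + r d < 2 ^ b" "Suc (r d) < 2 ^ b" "r d < \<rho> c"
    using assms(5,6) Suc.prems by auto
  \<comment> \<open>One round: test, conditional exit, draw, address, store, and four instructions
    to increment the counter and jump back.\<close>
  have step9: "run b P 9 \<lparr>pc = off + 1, regs = r, mem = m\<rparr> =
      map_pmf (\<lambda>v. \<lparr>pc = off + 1, regs = r', mem = m(\<rho> s + r d := v)\<rparr>) (random_word b)"
    using c Suc.prems(1) sc lt big b
    by (simp add: random_code_def eval_nat_numeral step_def halted_def set_reg_def bind_return_pmf
        map_pmf_def bind_assoc_pmf r'_def)
  have r': "\<And>i. i < d \<Longrightarrow> r' i = \<rho> i" "r' d + k = \<rho> c" "r' d = Suc (r d)"
    using Suc.prems sc by (auto simp: r'_def)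
  have "\<forall>v. \<exists>g. run b P (9 * k + 2) \<lparr>pc = off + 1, regs = r', mem = m(\<rho> s + r d := v)\<rparr> =
      map_pmf g (replicate_pmf k (random_word b)) \<and>
    (\<forall>xs. length xs = k \<longrightarrow> pc (g xs) = off + 10 \<and>
      mem (g xs) = store_list (\<rho> s + r' d) xs (m(\<rho> s + r d := v)) \<and>
      (\<forall>i<d. regs (g xs) i = \<rho> i))"
    using Suc.IH[OF r'(1,2)] by blast
  then obtain g where g: "\<And>v. run b P (9 * k + 2) \<lparr>pc = off + 1, regs = r', mem = m(\<rho> s + r d := v)\<rparr> =
      map_pmf (g v) (replicate_pmf k (random_word b))"
    "\<And>v xs. length xs = k \<Longrightarrow> pc (g v xs) = off + 10 \<and>
      mem (g v xs) = store_list (\<rho> s + r' d) xs (m(\<rho> s + r d := v)) \<and>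
      (\<forall>i<d. regs (g v xs) i = \<rho> i)"
    by metis
  have "run b P (9 + (9 * k + 2)) \<lparr>pc = off + 1, regs = r, mem = m\<rparr> =
      map_pmf (\<lambda>xs. g (hd xs) (tl xs)) (replicate_pmf (Suc k) (random_word b))"
    unfolding run_add[of _ _ 9] step9 map_pmf_def bind_assoc_pmf bind_return_pmf g
    by (simp add: map_pmf_def bind_assoc_pmf bind_return_pmf)
  moreover have "9 + (9 * k + 2) = 9 * Suc k + 2" by simp
  moreover have "pc (g (hd xs) (tl xs)) = off + 10 \<and>
      mem (g (hd xs) (tl xs)) = store_list (\<rho> s + r d) xs m \<and>
      (\<forall>i<d. regs (g (hd xs) (tl xs)) i = \<rho> i)" if "length xs = Suc k" for xs
    using that g(2)[of "tl xs" "hd xs"] r'(3) by (cases xs) (auto simp: store_list_Cons)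
  ultimately show ?case by (intro exI[of _ "\<lambda>xs. g (hd xs) (tl xs)"]) auto
qed

text \<open>One random phase between two deterministic ones is enough: the leaders are computed
  without seeds, the chains are a function of them.\<close>

definition construct_program ::
  "nat \<Rightarrow> expr list \<Rightarrow> com \<Rightarrow> nat \<Rightarrow> nat \<Rightarrow> com \<Rightarrow> nat \<Rightarrow> program" where
  "construct_program G es c0 s c c1 z =
     (let d = 3 + length es; o0 = sum_list (map esize es); o1 = o0 + csize c0;
          o2 = o1 + 10 in
      lets_code G es 3 0 @ ccode G c0 d o0 @ random_code d s c o1 @ ccode G c1 d o2 @
      [Oper OR 0 z z])"

lemma construct_program_correct:
  fixes \<rho> :: "nat \<Rightarrow> nat"
  assumes "\<And>i. \<rho> i < 2 ^ b" "\<And>a. m a < 2 ^ b" "1 \<le> b" "G \<le> 3 + length es"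
    "s < 3 + length es" "c < 3 + length es" "z < 3 + length es"
  defines "\<rho>' \<equiv> lets_env b G m es 3 \<rho>"
  assumes "\<rho>' s + \<rho>' c \<le> 2 ^ b"
    "lets_cost b G m es 3 \<rho> + ccost G \<rho>' c0 + 9 * \<rho>' c + ccost G \<rho>' c1 + 4 \<le> T"
  shows "\<exists>g. run b (construct_program G es c0 s c c1 z) T \<lparr>pc = 0, regs = \<rho>, mem = m\<rparr> =
      map_pmf g (replicate_pmf (\<rho>' c) (random_word b)) \<and>
    (\<forall>xs. length xs = \<rho>' c \<and> (\<forall>x\<in>set xs. x < 2 ^ b) \<longrightarrow>
       halted (construct_program G es c0 s c c1 z) (g xs) \<and> regs (g xs) 0 = \<rho>' z \<and>
       mem (g xs) = sem b G c1 (3 + length es) \<rho>'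
         (store_list (\<rho>' s) xs (sem b G c0 (3 + length es) \<rho>' m)) \<and> (\<forall>a. mem (g xs) a < 2 ^ b))"
proof -
  define d where "d = 3 + length es"
  define o0 where "o0 = sum_list (map esize es)"
  define o1 where "o1 = o0 + csize c0"
  define o2 where "o2 = o1 + 10"
  define P where "P = construct_program G es c0 s c c1 z"
  have Peq: "P = lets_code G es 3 0 @ ccode G c0 d o0 @ random_code d s c o1 @ ccode G c1 d o2 @
      [Oper OR 0 z z]"
    by (simp add: P_def construct_program_def Let_def d_def o0_def o1_def o2_def)
  have "code_at P 0 P" using code_at_self[of "[]" P "[]"] by simp
  from this[unfolded Peq code_at_append, folded Peq]
  have code: "code_at P 0 (lets_code G es 3 0)" "code_at P o0 (ccode G c0 d o0)"
    "code_at P o1 (random_code d s c o1)" "code_at P o2 (ccode G c1 d o2)"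
    "code_at P (o2 + csize c1) [Oper OR 0 z z]"
    by (simp_all add: length_lets_code o0_def o1_def o2_def random_code_def eval_nat_numeral)
  have lenP: "length P = o2 + csize c1 + 1"
    by (simp add: Peq length_lets_code o0_def o1_def o2_def random_code_def)
  obtain r0 where r0: "reach b P (lets_cost b G m es 3 \<rho>) 0 \<rho> m o0 r0 m"
    "\<forall>i<d. r0 i = \<rho>' i" and \<rho>'b: "\<forall>i<d. \<rho>' i < 2 ^ b"
    using lets_correct[of P 0 G es 3 \<rho> \<rho> b m] code(1) assms(1-3)
    by (auto simp: \<rho>'_def o0_def d_def)
  define m0 where "m0 = sem b G c0 d \<rho>' m"
  have Gd: "G \<le> d" using assms(4) by (simp add: d_def)
  obtain r1 where r1: "reach b P (ccost G \<rho>' c0) o0 r0 m o1 r1 m0" "\<forall>i<d. r1 i = \<rho>' i"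
    and m0b: "\<forall>a. m0 a < 2 ^ b"
    using ccode_correct[of P o0 G c0 d r0 \<rho>' b m] code(2) r0 \<rho>'b assms(2,3) Gd
    by (auto simp: m0_def o1_def)
  obtain t0 where t0: "t0 \<le> lets_cost b G m es 3 \<rho> + ccost G \<rho>' c0"
    "run b P t0 \<lparr>pc = 0, regs = \<rho>, mem = m\<rparr> = return_pmf \<lparr>pc = o1, regs = r1, mem = m0\<rparr>"
    using reach_trans[OF r0(1) r1(1) order_refl] by (auto simp: reach_def)
  have one: "run b P 1 \<lparr>pc = o1, regs = r1, mem = m0\<rparr> =
      return_pmf \<lparr>pc = o1 + 1, regs = r1(d := 0), mem = m0\<rparr>"
    using code(3) by (simp add: random_code_def step_def halted_def set_reg_def bind_return_pmf)
  have sc: "s < d" "c < d" using assms(5,6) by (auto simp: d_def)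
  obtain g where g: "run b P (9 * \<rho>' c + 2) \<lparr>pc = o1 + 1, regs = r1(d := 0), mem = m0\<rparr> =
      map_pmf g (replicate_pmf (\<rho>' c) (random_word b))"
    "\<And>xs. length xs = \<rho>' c \<Longrightarrow> pc (g xs) = o2 \<and> mem (g xs) = store_list (\<rho>' s) xs m0 \<and>
      (\<forall>i<d. regs (g xs) i = \<rho>' i)"
    using random_loop[OF code(3) assms(3) sc, of \<rho>' "r1(d := 0)" "\<rho>' c" m0] r1(2) \<rho>'b sc assms(9)
    by (auto simp: o2_def)
  define t1 where "t1 = T - (t0 + (1 + (9 * \<rho>' c + 2)))"
  have T: "T = t0 + (1 + ((9 * \<rho>' c + 2) + t1))" "ccost G \<rho>' c1 + 1 \<le> t1"
    using t0(1) assms(10) by (auto simp: t1_def)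
  have fin: "\<exists>c'. run b P t1 (g xs) = return_pmf c' \<and> halted P c' \<and> regs c' 0 = \<rho>' z \<and>
      mem c' = sem b G c1 d \<rho>' (store_list (\<rho>' s) xs m0) \<and> (\<forall>a. mem c' a < 2 ^ b)"
    if xs: "length xs = \<rho>' c" "\<forall>x\<in>set xs. x < 2 ^ b" for xs
  proof -
    let ?m = "store_list (\<rho>' s) xs m0"
    have cfg: "g xs = \<lparr>pc = o2, regs = regs (g xs), mem = ?m\<rparr>"
      using g(2)[OF xs(1)] by simp
    have mb: "?m a < 2 ^ b" for a using xs m0b by (auto simp: store_list_def)
    obtain r2 where r2: "reach b P (ccost G \<rho>' c1) o2 (regs (g xs)) ?m (o2 + csize c1) r2
        (sem b G c1 d \<rho>' ?m)" "\<forall>i<d. r2 i = \<rho>' i" "\<forall>a. sem b G c1 d \<rho>' ?m a < 2 ^ b"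
      using ccode_correct[of P o2 G c1 d "regs (g xs)" \<rho>' b ?m] code(4) g(2)[OF xs(1)] \<rho>'b
        assms(3) Gd mb by auto
    have s: "reach b P 1 (o2 + csize c1) r2 (sem b G c1 d \<rho>' ?m) (length P) (r2(0 := r2 z))
        (sem b G c1 d \<rho>' ?m)"
      by (rule reach_step1) (use code(5) lenP in \<open>auto simp: set_reg_def\<close>)
    have "run b P t1 (g xs) =
        return_pmf \<lparr>pc = length P, regs = r2(0 := r2 z), mem = sem b G c1 d \<rho>' ?m\<rparr>"
      by (subst cfg, rule reach_run[OF reach_trans[OF r2(1) s order_refl]]) (use T in auto)
    then show ?thesis using r2 assms(7) by (auto simp: halted_def d_def)
  qed
  then obtain h where h: "\<And>xs. length xs = \<rho>' c \<Longrightarrow> \<forall>x\<in>set xs. x < 2 ^ b \<Longrightarrow>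
      run b P t1 (g xs) = return_pmf (h xs) \<and> halted P (h xs) \<and> regs (h xs) 0 = \<rho>' z \<and>
      mem (h xs) = sem b G c1 d \<rho>' (store_list (\<rho>' s) xs m0) \<and> (\<forall>a. mem (h xs) a < 2 ^ b)"
    by metis
  have "run b P T \<lparr>pc = 0, regs = \<rho>, mem = m\<rparr> =
      bind_pmf (replicate_pmf (\<rho>' c) (random_word b)) (\<lambda>xs. run b P t1 (g xs))"
    unfolding T(1) run_add[of _ _ t0] run_add[of _ _ 1] run_add[of _ _ _ t1] t0(2) bind_return_pmf one g(1)
    by (simp add: map_pmf_def bind_assoc_pmf bind_return_pmf)
  also have "\<dots> = bind_pmf (replicate_pmf (\<rho>' c) (random_word b)) (\<lambda>xs. return_pmf (h xs))"
  proof (rule bind_pmf_cong[OF refl])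
    \<comment> \<open>Only lists of words of the right length lie in the support, and for these the
      last phase is deterministic.\<close>
    fix xs assume "xs \<in> set_pmf (replicate_pmf (\<rho>' c) (random_word b))"
    then have "length xs = \<rho>' c" "\<forall>x\<in>set xs. x < 2 ^ b"
      by (auto simp: set_replicate_pmf set_pmf_of_set lessThan_empty_iff in_lists_conv_set)
    then show "run b P t1 (g xs) = return_pmf (h xs)" using h by blast
  qed
  finally show ?thesis using h unfolding m0_def d_def P_def map_pmf_def by blast
qed

subsection \<open>Growth of running times\<close>

definition soft_pow :: "real \<Rightarrow> (nat \<Rightarrow> real) set" where
  "soft_pow D = soft_O (\<lambda>n. real n powr D)"

lemma soft_powI: "(\<lambda>n. f n) \<in> O(\<lambda>n. real n powr D * ln (real n) ^ k) \<Longrightarrow> f \<in> soft_pow D"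
  by (auto simp: soft_pow_def soft_O_def)

section \<open>Closure properties of growth classes up to polylogarithmic factors\<close>

lemma eventually_ln_ge_1: "eventually (\<lambda>n. 1 \<le> ln (real n)) sequentially"
  by real_asymp

lemma soft_pow_mono:
  assumes "f \<in> soft_pow D" "D \<le> E"
  shows "f \<in> soft_pow E"
proof -
  obtain k where k: "f \<in> O(\<lambda>n. real n powr D * ln (real n) ^ k)"
    using assms(1) by (auto simp: soft_pow_def soft_O_def)
  have "(\<lambda>n. real n powr D * ln (real n) ^ k) \<in> O(\<lambda>n. real n powr E * ln (real n) ^ k)"
    by (intro landau_o.big.mult landau_o.big_refl landau_o.big_mono
        eventually_mono[OF eventually_ge_at_top[of 1]]) (use assms(2) in \<open>auto intro: powr_mono\<close>)
  then show ?thesis using k landau_o.big_trans soft_powI by blast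
qed

lemma soft_pow_raise:
  assumes "f \<in> O(\<lambda>n. real n powr D * ln (real n) ^ k)" "k \<le> l"
  shows "f \<in> O(\<lambda>n. real n powr D * ln (real n) ^ l)"
proof -
  have "(\<lambda>n. real n powr D * ln (real n) ^ k) \<in> O(\<lambda>n. real n powr D * ln (real n) ^ l)"
    by (intro landau_o.big.mult landau_o.big_refl landau_o.big_mono
        eventually_mono[OF eventually_ln_ge_1]) (use assms(2) in \<open>auto intro: power_increasing\<close>)
  then show ?thesis using assms(1) landau_o.big_trans by blast
qed

lemma soft_pow_add:
  assumes "f \<in> soft_pow D" "g \<in> soft_pow D"
  shows "(\<lambda>n. f n + g n) \<in> soft_pow D"
proof -
  obtain k l where "f \<in> O(\<lambda>n. real n powr D * ln (real n) ^ k)"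
    "g \<in> O(\<lambda>n. real n powr D * ln (real n) ^ l)"
    using assms by (auto simp: soft_pow_def soft_O_def)
  then have "f \<in> O(\<lambda>n. real n powr D * ln (real n) ^ max k l)"
    "g \<in> O(\<lambda>n. real n powr D * ln (real n) ^ max k l)"
    by (auto intro: soft_pow_raise)
  then show ?thesis by (intro soft_powI sum_in_bigo)
qed

lemma soft_pow_mult:
  assumes "f \<in> soft_pow D" "g \<in> soft_pow E"
  shows "(\<lambda>n. f n * g n) \<in> soft_pow (D + E)"
proof -
  obtain k l where "f \<in> O(\<lambda>n. real n powr D * ln (real n) ^ k)"
    "g \<in> O(\<lambda>n. real n powr E * ln (real n) ^ l)"
    using assms by (auto simp: soft_pow_def soft_O_def)
  then have "(\<lambda>n. f n * g n) \<in> O(\<lambda>n. (real n powr D * ln (real n) ^ k) * (real n powr E * ln (real n) ^ l))"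
    by (rule landau_o.big.mult)
  then show ?thesis
    by (intro soft_powI[of _ _ "k + l"]) (simp add: powr_add power_add algebra_simps)
qed

lemma soft_powE:
  assumes "f \<in> soft_pow D"
  obtains k where "f \<in> O(\<lambda>n. real n powr D * ln (real n) ^ k)"
  using assms unfolding soft_pow_def soft_O_def by auto

lemma soft_pow_const:
  assumes "0 \<le> D" shows "(\<lambda>n. c) \<in> soft_pow D"
proof -
  have "(\<lambda>n::nat. c) \<in> O(\<lambda>n. real n powr 0 * ln (real n) ^ 0)"
  proof (rule bigoI)
    show "\<forall>\<^sub>F n in sequentially. norm c \<le> \<bar>c\<bar> * norm (real n powr 0 * ln (real n) ^ 0)"
      using eventually_ge_at_top[of 1] by eventually_elim simp
  qed
  from soft_pow_mono[OF soft_powI[OF this] assms] show ?thesis .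
qed

lemma soft_pow_le:
  assumes "g \<in> soft_pow D" "\<And>n. 1 \<le> n \<Longrightarrow> \<bar>f n\<bar> \<le> C * \<bar>g n\<bar>"
  shows "f \<in> soft_pow D"
proof -
  obtain k where k: "g \<in> O(\<lambda>n. real n powr D * ln (real n) ^ k)" by (rule soft_powE[OF assms(1)])
  have "f \<in> O(g)"
  proof (rule bigoI)
    show "\<forall>\<^sub>F n in sequentially. norm (f n) \<le> C * norm (g n)"
      using eventually_ge_at_top[of 1] by eventually_elim (simp add: assms(2))
  qed
  from soft_powI[OF landau_o.big_trans[OF this k]] show ?thesis .
qed

lemma soft_pow_powr: "(\<lambda>n. real n powr D) \<in> soft_pow D"
  by (intro soft_powI[of _ _ 0]) simp

lemma soft_pow_power: "f \<in> soft_pow 0 \<Longrightarrow> (\<lambda>n. f n ^ k) \<in> soft_pow 0"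
proof (induction k)
  case (Suc k)
  then show ?case using soft_pow_mult[of f 0 "\<lambda>n. f n ^ k" 0] by simp
qed (simp add: soft_pow_const)

section \<open>Degrees: exponents of \<open>n\<close> in running times\<close>

primrec edeg :: "(nat \<Rightarrow> real) \<Rightarrow> expr \<Rightarrow> real" where
  "edeg g (EConst k) = 0"
| "edeg g (EVar i) = 0"
| "edeg g (EOp f x y) = max (edeg g x) (edeg g y)"
| "edeg g (ERead x) = edeg g x"
| "edeg g (EIf c x y) = max (edeg g c) (max (edeg g x) (edeg g y))"
| "edeg g (EFold p x y) = max (edeg g x) (g p + edeg g y)"

primrec cdeg :: "(nat \<Rightarrow> real) \<Rightarrow> com \<Rightarrow> real" where
  "cdeg g (CWrite x y) = max (edeg g x) (edeg g y)"
| "cdeg g (CSeq c1 c2) = max (cdeg g c1) (cdeg g c2)"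
| "cdeg g (CFor p c) = max 0 (g p + cdeg g c)"

lemma edeg_nonneg: "(\<And>p. 0 \<le> g p) \<Longrightarrow> 0 \<le> edeg g e"
  by (induction e) (auto simp: le_max_iff_disj)

lemma cdeg_nonneg: "(\<And>p. 0 \<le> g p) \<Longrightarrow> 0 \<le> cdeg g e"
  by (induction e) (auto simp: le_max_iff_disj edeg_nonneg)

lemma limit_soft_pow:
  assumes "\<And>p. 4 \<le> p \<Longrightarrow> p < G \<Longrightarrow> (\<lambda>n. real (P n p)) \<in> soft_pow (g p)" "\<And>p. 0 \<le> g p"
  shows "(\<lambda>n. real (limit G (P n) p)) \<in> soft_pow (g p)"
proof (cases "4 \<le> p \<and> p < G")
  case True
  then show ?thesis using assms(1) by (simp add: limit_def)
next
  case False
  then have "limit G (P n) p = 0" for n unfolding limit_def by (rule if_not_P)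
  then show ?thesis using soft_pow_const[OF assms(2), where c = 0] by simp
qed

text \<open>The program is fixed while its parameter registers vary with \<open>n\<close>. The cost
  is thus built from finitely many sums and products of the bounds, which never leave the growth
  classes; nested loops add their degrees.\<close>

lemma ecost_soft_pow:
  assumes "\<And>p. 4 \<le> p \<Longrightarrow> p < G \<Longrightarrow> (\<lambda>n. real (P n p)) \<in> soft_pow (g p)" "\<And>p. 0 \<le> g p"
  shows "(\<lambda>n. real (ecost G (P n) e)) \<in> soft_pow (edeg g e)"
proof (induction e)
  case (EFold p x y)
  let ?D = "edeg g (EFold p x y)"
  note nn = edeg_nonneg[OF assms(2)]
  have "(\<lambda>n. real (limit G (P n) p) * (real (ecost G (P n) y) + 7)) \<in> soft_pow (g p + edeg g y)"
    by (intro soft_pow_mult limit_soft_pow assms soft_pow_add EFold.IH soft_pow_const nn)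
  from soft_pow_mono[where E = ?D, OF this] soft_pow_mono[where E = ?D, OF EFold.IH(1)]
  have "(\<lambda>n. real (ecost G (P n) x) + real (limit G (P n) p) * (real (ecost G (P n) y) + 7) + 3)
      \<in> soft_pow ?D"
    by (intro soft_pow_add soft_pow_const nn) simp_all
  then show ?case by (simp add: add_ac)
next
  case (EOp f x y)
  let ?D = "edeg g (EOp f x y)"
  from soft_pow_mono[where E = ?D, OF EOp.IH(1)] soft_pow_mono[where E = ?D, OF EOp.IH(2)]
  have "(\<lambda>n. real (ecost G (P n) x) + real (ecost G (P n) y) + 1) \<in> soft_pow ?D"
    by (intro soft_pow_add soft_pow_const edeg_nonneg[OF assms(2)]) simp_all
  then show ?case by (simp add: add_ac)
next
  case (ERead x)
  then have "(\<lambda>n. real (ecost G (P n) x) + 1) \<in> soft_pow (edeg g x)"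
    by (intro soft_pow_add soft_pow_const edeg_nonneg[OF assms(2)])
  then show ?case by (simp add: add_ac)
next
  case (EIf e x y)
  let ?D = "edeg g (EIf e x y)"
  from soft_pow_mono[where E = ?D, OF EIf.IH(1)] soft_pow_mono[where E = ?D, OF EIf.IH(2)]
    soft_pow_mono[where E = ?D, OF EIf.IH(3)]
  have "(\<lambda>n. real (ecost G (P n) e) + real (ecost G (P n) x) + real (ecost G (P n) y) + 3) \<in> soft_pow ?D"
    by (intro soft_pow_add soft_pow_const edeg_nonneg[OF assms(2)]) simp_all
  then show ?case by (simp add: add_ac)
qed (simp_all add: soft_pow_const)

lemma ccost_soft_pow:
  assumes "\<And>p. 4 \<le> p \<Longrightarrow> p < G \<Longrightarrow> (\<lambda>n. real (P n p)) \<in> soft_pow (g p)" "\<And>p. 0 \<le> g p"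
  shows "(\<lambda>n. real (ccost G (P n) c)) \<in> soft_pow (cdeg g c)"
proof (induction c)
  case (CFor p c)
  let ?D = "cdeg g (CFor p c)"
  have "(\<lambda>n. real (limit G (P n) p) * (real (ccost G (P n) c) + 6)) \<in> soft_pow (g p + cdeg g c)"
    by (intro soft_pow_mult limit_soft_pow assms soft_pow_add CFor.IH soft_pow_const cdeg_nonneg)
  from soft_pow_mono[where E = ?D, OF this]
  have "(\<lambda>n. real (limit G (P n) p) * (real (ccost G (P n) c) + 6) + 3) \<in> soft_pow ?D"
    by (intro soft_pow_add soft_pow_const) simp_all
  then show ?case by (simp add: add_ac)
next
  case (CWrite x y)
  let ?D = "cdeg g (CWrite x y)"
  from soft_pow_mono[where E = ?D, OF ecost_soft_pow[OF assms, where e = x]]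
    soft_pow_mono[where E = ?D, OF ecost_soft_pow[OF assms, where e = y]]
  have "(\<lambda>n. real (ecost G (P n) x) + real (ecost G (P n) y) + 1) \<in> soft_pow ?D"
    by (intro soft_pow_add soft_pow_const cdeg_nonneg[OF assms(2)]) simp_all
  then show ?case by (simp add: add_ac)
next
  case (CSeq x y)
  let ?D = "cdeg g (CSeq x y)"
  from soft_pow_mono[where E = ?D, OF CSeq.IH(1)] soft_pow_mono[where E = ?D, OF CSeq.IH(2)]
  have "(\<lambda>n. real (ccost G (P n) x) + real (ccost G (P n) y)) \<in> soft_pow ?D"
    by (intro soft_pow_add) simp_all
  then show ?case by (simp add: add_ac)
qed

section \<open>Expressions and commands in higher-order abstract syntax\<close>

text \<open>An expression is a function of the depth at which it is placed. A binder hands out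
  \<open>var d\<close> for its own depth, so levels never have to be shifted.\<close>

type_synonym hexpr = "nat \<Rightarrow> expr"
type_synonym hcom = "nat \<Rightarrow> com"

definition cst :: "nat \<Rightarrow> hexpr" where "cst k = (\<lambda>d. EConst k)"
definition var :: "nat \<Rightarrow> hexpr" where "var i = (\<lambda>d. EVar i)"
definition opr :: "binop \<Rightarrow> hexpr \<Rightarrow> hexpr \<Rightarrow> hexpr" where "opr f a b = (\<lambda>d. EOp (Some f) (a d) (b (Suc d)))"
definition rd :: "hexpr \<Rightarrow> hexpr" where "rd a = (\<lambda>d. ERead (a d))"
definition ite :: "hexpr \<Rightarrow> hexpr \<Rightarrow> hexpr \<Rightarrow> hexpr" where "ite a x y = (\<lambda>d. EIf (a d) (x d) (y d))"
definition hlet :: "hexpr \<Rightarrow> (hexpr \<Rightarrow> hexpr) \<Rightarrow> hexpr" where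
  "hlet a f = (\<lambda>d. EOp None (a d) (f (var d) (Suc d)))"
definition hfold :: "nat \<Rightarrow> hexpr \<Rightarrow> (hexpr \<Rightarrow> hexpr \<Rightarrow> hexpr) \<Rightarrow> hexpr" where
  "hfold p i f = (\<lambda>d. EFold p (i d) (f (var d) (var (Suc d)) (Suc (Suc d))))"

definition cwr :: "hexpr \<Rightarrow> hexpr \<Rightarrow> hcom" where "cwr a v = (\<lambda>d. CWrite (a d) (v (Suc d)))"
definition csq :: "hcom \<Rightarrow> hcom \<Rightarrow> hcom" (infixr ";;;" 40) where "csq x y = (\<lambda>d. CSeq (x d) (y d))"
definition cfor :: "nat \<Rightarrow> (hexpr \<Rightarrow> hcom) \<Rightarrow> hcom" where
  "cfor p f = (\<lambda>d. CFor p (f (var d) (Suc d)))"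
abbreviation hadd (infixl "\<oplus>" 65) where "a \<oplus> b \<equiv> opr ADD a b"
abbreviation hsub (infixl "\<ominus>" 65) where "a \<ominus> b \<equiv> opr SUB a b"
abbreviation hmul (infixl "\<otimes>" 70) where "a \<otimes> b \<equiv> opr MUL a b"
abbreviation hdiv (infixl "\<oslash>" 70) where "a \<oslash> b \<equiv> opr DIV a b"
abbreviation hmod (infixl "\<odot>" 70) where "a \<odot> b \<equiv> opr MOD a b"
abbreviation hshl (infixl "\<lless>" 75) where "a \<lless> b \<equiv> opr SHL a b"
abbreviation hshr (infixl "\<ggreater>" 75) where "a \<ggreater> b \<equiv> opr SHR a b"
abbreviation hless (infix "\<prec>" 50) where "a \<prec> b \<equiv> opr LESS a b"

section \<open>Contexts, and judgements about values and commands\<close>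

record ctx =
  bits :: nat
  lregs :: nat
  cmem :: "nat \<Rightarrow> nat"
  depth :: nat
  env :: "nat \<Rightarrow> nat"

abbreviation evl :: "ctx \<Rightarrow> hexpr \<Rightarrow> nat" where
  "evl c a \<equiv> eval (bits c) (lregs c) (cmem c) (a (depth c)) (depth c) (env c)"
abbreviation exc :: "ctx \<Rightarrow> hcom \<Rightarrow> nat \<Rightarrow> nat" where
  "exc c a \<equiv> sem (bits c) (lregs c) (a (depth c)) (depth c) (env c) (cmem c)"

text \<open>Evaluating an expression only pushes variables, hence memory and loop registers stay
  fixed.\<close>

definition ext :: "ctx \<Rightarrow> ctx \<Rightarrow> bool" (infix "\<sqsubseteq>" 50) where
  "c \<sqsubseteq> c' \<longleftrightarrow> bits c' = bits c \<and> lregs c' = lregs c \<and> cmem c' = cmem c \<and> depth c \<le> depth c' \<and>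
     (\<forall>i<depth c. env c' i = env c i)"

text \<open>
  A Kripke-style judgement: the expression has value \<open>v\<close> in every context that extends \<open>c\<close>
  by further bound variables.
\<close>

definition val :: "ctx \<Rightarrow> hexpr \<Rightarrow> nat \<Rightarrow> bool" where
  "val c a v \<longleftrightarrow> (\<forall>c'. c \<sqsubseteq> c' \<longrightarrow>
     evl c' a = v)"

text \<open>\<open>lregs c \<le> depth c\<close> prevents binders from overwriting a loop
  bound.\<close>

definition lreg :: "ctx \<Rightarrow> nat \<Rightarrow> nat \<Rightarrow> bool" where
  "lreg c p k \<longleftrightarrow> 4 \<le> p \<and> p < lregs c \<and> lregs c \<le> depth c \<and> env c p = k"

definition hoare :: "ctx \<Rightarrow> hcom \<Rightarrow> ((nat \<Rightarrow> nat) \<Rightarrow> bool) \<Rightarrow> bool" where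
  "hoare c a Q \<longleftrightarrow> (\<forall>c'. c \<sqsubseteq> c' \<longrightarrow>
     Q (exc c' a))"

lemma ext_refl [simp]: "c \<sqsubseteq> c" by (auto simp: ext_def)

lemma ext_trans: "c \<sqsubseteq> c' \<Longrightarrow> c' \<sqsubseteq> c'' \<Longrightarrow> c \<sqsubseteq> c''"
  unfolding ext_def by (metis order_less_le_trans order_trans)

lemma ext_cmem: "c \<sqsubseteq> c' \<Longrightarrow> cmem c' = cmem c" by (auto simp: ext_def)
lemma ext_bits: "c \<sqsubseteq> c' \<Longrightarrow> bits c' = bits c" by (auto simp: ext_def)

lemma ext_push: "c \<sqsubseteq> c\<lparr>depth := Suc (depth c), env := (env c)(depth c := v)\<rparr>"
  by (auto simp: ext_def)

lemma ext_push2: "c \<sqsubseteq> c\<lparr>depth := Suc (Suc (depth c)), env := (env c)(depth c := v, Suc (depth c) := u)\<rparr>"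
  by (auto simp: ext_def)

lemma ext_mem_upd: "c \<sqsubseteq> c' \<Longrightarrow> c\<lparr>cmem := m\<rparr> \<sqsubseteq> c'\<lparr>cmem := m\<rparr>"
  by (auto simp: ext_def)

lemma val_mono: "val c a v \<Longrightarrow> c \<sqsubseteq> c' \<Longrightarrow> val c' a v"
  unfolding val_def using ext_trans by blast

lemma lreg_mono: "lreg c p k \<Longrightarrow> c \<sqsubseteq> c' \<Longrightarrow> lreg c' p k"
  by (auto simp: lreg_def ext_def)

lemma val_eval: "val c a v \<Longrightarrow> evl c a = v"
  unfolding val_def by simp

lemma val_var: "i < depth c \<Longrightarrow> val c (var i) (env c i)"
  by (auto simp: val_def var_def ext_def)

lemma val_lreg: "lreg c p k \<Longrightarrow> val c (var p) k"
  using val_var[of p c] by (auto simp: lreg_def)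

lemma val_cst: "k < 2 ^ bits c \<Longrightarrow> val c (cst k) k"
  by (auto simp: val_def cst_def ext_def)

lemma val_op:
  assumes "val c a v" "val c x u"
  shows "val c (opr f a x) (eval_binop (bits c) f v u)"
  unfolding val_def
proof (intro allI impI)
  fix c' assume e: "c \<sqsubseteq> c'"
  have a: "evl c' a = v"
    using assms(1) e by (auto simp: val_def)
  let ?c = "c'\<lparr>depth := Suc (depth c'), env := (env c')(depth c' := v)\<rparr>"
  have "c \<sqsubseteq> ?c" using ext_trans[OF e ext_push] .
  then have "evl ?c x = u"
    using assms(2) unfolding val_def by blast
  then show "evl c' (opr f a x) =
      eval_binop (bits c) f v u"
    using a ext_bits[OF e] by (simp add: opr_def opval_def)
qed

lemma val_add: "val c a v \<Longrightarrow> val c x u \<Longrightarrow> v + u < 2 ^ bits c \<Longrightarrow> val c (a \<oplus> x) (v + u)"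
  using val_op[of c a v x u ADD] by simp

lemma val_sub:
  assumes "val c a v" "val c x u" "u \<le> v" "v < 2 ^ bits c"
  shows "val c (a \<ominus> x) (v - u)"
proof -
  have "(int v - int u) mod 2 ^ bits c = int ((v - u) mod 2 ^ bits c)"
    using assms(3) by (simp add: of_nat_diff zmod_int)
  moreover have "v - u < 2 ^ bits c" using assms(4) by (rule less_imp_diff_less)
  ultimately have "nat ((int v - int u) mod 2 ^ bits c) = v - u" by simp
  then show ?thesis using val_op[OF assms(1,2), of SUB] by simp
qed

lemma val_mul: "val c a v \<Longrightarrow> val c x u \<Longrightarrow> v * u < 2 ^ bits c \<Longrightarrow> val c (a \<otimes> x) (v * u)"
  using val_op[of c a v x u MUL] by simp
lemma val_div: "val c a v \<Longrightarrow> val c x u \<Longrightarrow> val c (a \<oslash> x) (v div u)"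
  using val_op[of c a v x u DIV] by simp
lemma val_mod: "val c a v \<Longrightarrow> val c x u \<Longrightarrow> val c (a \<odot> x) (v mod u)"
  using val_op[of c a v x u MOD] by simp
lemma val_shl: "val c a v \<Longrightarrow> val c x u \<Longrightarrow> v * 2 ^ u < 2 ^ bits c \<Longrightarrow> val c (a \<lless> x) (v * 2 ^ u)"
  using val_op[of c a v x u SHL] by simp
lemma val_shr: "val c a v \<Longrightarrow> val c x u \<Longrightarrow> val c (a \<ggreater> x) (v div 2 ^ u)"
  using val_op[of c a v x u SHR] by simp
lemma val_less: "val c a v \<Longrightarrow> val c x u \<Longrightarrow> val c (a \<prec> x) (if v < u then 1 else 0)"
  using val_op[of c a v x u LESS] by simp

lemma val_rd: "val c a v \<Longrightarrow> cmem c v = u \<Longrightarrow> val c (rd a) u"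
  by (auto simp: val_def rd_def ext_cmem)

lemma val_ite:
  "val c a v \<Longrightarrow> (v \<noteq> 0 \<Longrightarrow> val c x u) \<Longrightarrow> (v = 0 \<Longrightarrow> val c y u) \<Longrightarrow> val c (ite a x y) u"
  by (auto simp: val_def ite_def)

lemma val_ite_less:
  "val c a v \<Longrightarrow> val c b u \<Longrightarrow> (v < u \<Longrightarrow> val c x r) \<Longrightarrow> (\<not> v < u \<Longrightarrow> val c y s) \<Longrightarrow>
   val c (ite (a \<prec> b) x y) (if v < u then r else s)"
  by (rule val_ite[OF val_less]) (auto split: if_splits)

text \<open>The body is checked for an arbitrary expression of value \<open>v\<close> instead of the
  variable actually bound, so that proofs about programs never mention registers of bound
  variables.\<close>

lemma val_let:
  assumes "val c a v" "\<And>c' x. c \<sqsubseteq> c' \<Longrightarrow> val c' x v \<Longrightarrow> val c' (f x) u"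
  shows "val c (hlet a f) u"
  unfolding val_def
proof (intro allI impI)
  fix c' assume e: "c \<sqsubseteq> c'"
  have a: "evl c' a = v"
    using assms(1) e by (auto simp: val_def)
  let ?c = "c'\<lparr>depth := Suc (depth c'), env := (env c')(depth c' := v)\<rparr>"
  have ce: "c \<sqsubseteq> ?c" using ext_trans[OF e ext_push] .
  have "val ?c (var (depth c')) v" using val_var[of "depth c'" ?c] by simp
  from val_eval[OF assms(2)[OF ce this]]
  show "evl c' (hlet a f) = u"
    using a by (simp add: hlet_def opval_def)
qed

text \<open>The invariant \<open>I\<close> serves to bound the accumulator: overflow has to be
  excluded anew in each round.\<close>

lemma val_fold:
  assumes "lreg c p k" "val c i v0" "I 0 v0"
    "\<And>c' x y j a. c \<sqsubseteq> c' \<Longrightarrow> j < k \<Longrightarrow> I j a \<Longrightarrow> val c' x a \<Longrightarrow> val c' y j \<Longrightarrow>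
       val c' (f x y) (F j a) \<and> I (Suc j) (F j a)"
  shows "val c (hfold p i f) (iterate k F v0)"
  unfolding val_def
proof (intro allI impI)
  fix c' assume e: "c \<sqsubseteq> c'"
  have a: "evl c' i = v0"
    using assms(2) e by (auto simp: val_def)
  have "lreg c' p k" using lreg_mono[OF assms(1) e] .
  then have lim: "limit (lregs c') (env c') p = k" by (auto simp: lreg_def limit_def)
  have "iterate l (\<lambda>j a. eval (bits c') (lregs c') (cmem c')
        (f (var (depth c')) (var (Suc (depth c'))) (Suc (Suc (depth c'))))
        (Suc (Suc (depth c'))) ((env c')(depth c' := a, Suc (depth c') := j))) v0 = iterate l F v0 \<and>
      I l (iterate l F v0)" if "l \<le> k" for l
    using that
  proof (induction l)
    case 0
    then show ?case using assms(3) by simp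
  next
    case (Suc l)
    let ?a = "iterate l F v0"
    let ?c = "c'\<lparr>depth := Suc (Suc (depth c')), env := (env c')(depth c' := ?a, Suc (depth c') := l)\<rparr>"
    have ce: "c \<sqsubseteq> ?c" using ext_trans[OF e ext_push2] .
    have "val ?c (var (depth c')) ?a" "val ?c (var (Suc (depth c'))) l"
      using val_var[of "depth c'" ?c] val_var[of "Suc (depth c')" ?c] by simp_all
    with assms(4)[OF ce _ _ this] Suc
    have "val ?c (f (var (depth c')) (var (Suc (depth c')))) (F l ?a)" "I (Suc l) (F l ?a)"
      by auto
    from val_eval[OF this(1)] this(2) Suc show ?case by (simp del: fun_upd_apply)
  qed
  then show "evl c' (hfold p i f) =
      iterate k F v0"
    using a lim by (simp add: hfold_def)
qed

lemma hoare_wr: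
  assumes "val c a x" "val c v y" "Q ((cmem c)(x := y))"
  shows "hoare c (cwr a v) Q"
  unfolding hoare_def
proof (intro allI impI)
  fix c' assume e: "c \<sqsubseteq> c'"
  have a: "evl c' a = x"
    using assms(1) e by (auto simp: val_def)
  let ?c = "c'\<lparr>depth := Suc (depth c'), env := (env c')(depth c' := x)\<rparr>"
  have ce: "c \<sqsubseteq> ?c" using ext_trans[OF e ext_push] .
  from val_eval[OF val_mono[OF assms(2) ce]]
  show "Q (exc c' (cwr a v))"
    using a assms(3) ext_cmem[OF e] by (simp add: cwr_def)
qed

lemma hoare_sq:
  assumes "hoare c x R" "\<And>m. R m \<Longrightarrow> hoare (c\<lparr>cmem := m\<rparr>) y Q"
  shows "hoare c (x ;;; y) Q"
  unfolding hoare_def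
proof (intro allI impI)
  fix c' assume e: "c \<sqsubseteq> c'"
  define m where "m = exc c' x"
  have "R m" using assms(1) e by (auto simp: hoare_def m_def)
  from assms(2)[OF this] ext_mem_upd[OF e, of m]
  show "Q (exc c' ((x ;;; y)))"
    unfolding hoare_def csq_def by (auto simp: m_def)
qed

lemma hoare_conseq: "hoare c a Q \<Longrightarrow> (\<And>m. Q m \<Longrightarrow> R m) \<Longrightarrow> hoare c a R"
  by (auto simp: hoare_def)

subsection \<open>Degrees of expressions and commands\<close>

definition deg_le :: "(nat \<Rightarrow> real) \<Rightarrow> hexpr \<Rightarrow> real \<Rightarrow> bool" where
  "deg_le g a D \<longleftrightarrow> (\<forall>d. edeg g (a d) \<le> D)"

definition cdeg_le :: "(nat \<Rightarrow> real) \<Rightarrow> hcom \<Rightarrow> real \<Rightarrow> bool" where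
  "cdeg_le g a D \<longleftrightarrow> (\<forall>d. cdeg g (a d) \<le> D)"

text \<open>Binders only ever supply variables, so a body needs its degree on variables only. A fold
  leaves the degree \<open>D - g p\<close> to its body because the cost of the body is multiplied by
  the bound.\<close>

lemma deg_le_intros:
  "0 \<le> D \<Longrightarrow> deg_le g (cst k) D"
  "0 \<le> D \<Longrightarrow> deg_le g (var i) D"
  "deg_le g a D \<Longrightarrow> deg_le g x D \<Longrightarrow> deg_le g (opr f a x) D"
  "deg_le g a D \<Longrightarrow> deg_le g (rd a) D"
  "deg_le g e D \<Longrightarrow> deg_le g a D \<Longrightarrow> deg_le g x D \<Longrightarrow> deg_le g (ite e a x) D"
  "deg_le g a D \<Longrightarrow> (\<And>i. deg_le g (h (var i)) D) \<Longrightarrow> deg_le g (hlet a h) D"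
  "deg_le g a D \<Longrightarrow> (\<And>i j. deg_le g (h2 (var i) (var j)) (D - g p)) \<Longrightarrow> deg_le g (hfold p a h2) D"
  by (auto simp: deg_le_def cst_def var_def opr_def rd_def ite_def hlet_def hfold_def algebra_simps)

lemma cdeg_le_intros:
  "deg_le g a D \<Longrightarrow> deg_le g x D \<Longrightarrow> cdeg_le g (cwr a x) D"
  "cdeg_le g c D \<Longrightarrow> cdeg_le g c' D \<Longrightarrow> cdeg_le g (c ;;; c') D"
  "0 \<le> D \<Longrightarrow> (\<And>i. cdeg_le g (h (var i)) (D - g p)) \<Longrightarrow> cdeg_le g (cfor p h) D"
  by (auto simp: deg_le_def cdeg_le_def cwr_def csq_def cfor_def algebra_simps)

section \<open>Rainbow tables\<close>

subsection \<open>Averages over uniformly random lists\<close>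

text \<open>The expectation over independent uniform entries, unfolded one entry at a time; this is
  the recursion by which chains consume their seeds.\<close>

primrec avg :: "'a set \<Rightarrow> nat \<Rightarrow> ('a list \<Rightarrow> real) \<Rightarrow> real" where
  "avg A 0 \<phi> = \<phi> []"
| "avg A (Suc L) \<phi> = (\<Sum>\<omega>\<in>A. avg A L (\<lambda>r. \<phi> (\<omega> # r))) / real (card A)"

lemma avg_mono:
  assumes "\<And>xs. length xs = L \<Longrightarrow> set xs \<subseteq> A \<Longrightarrow> \<phi> xs \<le> \<psi> xs"
  shows "avg A L \<phi> \<le> avg A L \<psi>"
  using assms
proof (induction L arbitrary: \<phi> \<psi>)
  case (Suc L)
  have "avg A L (\<lambda>r. \<phi> (\<omega> # r)) \<le> avg A L (\<lambda>r. \<psi> (\<omega> # r))" if "\<omega> \<in> A" for \<omega>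
    by (intro Suc.IH Suc.prems) (use that in auto)
  then show ?case by (auto intro!: divide_right_mono sum_mono)
qed simp

lemma avg_cong:
  assumes "\<And>xs. length xs = L \<Longrightarrow> set xs \<subseteq> A \<Longrightarrow> \<phi> xs = \<psi> xs"
  shows "avg A L \<phi> = avg A L \<psi>"
  by (intro antisym avg_mono) (simp_all add: assms)

lemma avg_add: "avg A L (\<lambda>x. \<phi> x + \<psi> x) = avg A L \<phi> + avg A L \<psi>"
  by (induction L arbitrary: \<phi> \<psi>) (simp_all add: sum.distrib add_divide_distrib)

lemma avg_cmult: "avg A L (\<lambda>x. k * \<phi> x) = k * avg A L \<phi>"
  by (induction L arbitrary: \<phi>) (simp_all add: sum_distrib_left)

lemma avg_const: "finite A \<Longrightarrow> A \<noteq> {} \<Longrightarrow> avg A L (\<lambda>x. k) = k"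
  by (induction L) (auto simp: card_eq_0_iff)

lemma avg_diff: "avg A L (\<lambda>x. \<phi> x - \<psi> x) = avg A L \<phi> - avg A L \<psi>"
  using avg_add[of A L \<phi> "\<lambda>x. (-1) * \<psi> x"] avg_cmult[of A L "-1" \<psi>] by simp

lemma avg_half: "avg A L (\<lambda>x. \<phi> x / 2) = avg A L \<phi> / 2"
  using avg_cmult[of A L "1/2" \<phi>] by simp

lemma avg_sum: "finite A \<Longrightarrow> A \<noteq> {} \<Longrightarrow> avg A L (\<lambda>x. \<Sum>i\<in>I. \<phi> i x) = (\<Sum>i\<in>I. avg A L (\<phi> i))"
  by (induction I rule: infinite_finite_induct) (simp_all add: avg_const avg_add)

lemma avg_append: "avg A (L1 + L2) \<phi> = avg A L1 (\<lambda>xs. avg A L2 (\<lambda>ys. \<phi> (xs @ ys)))"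
  by (induction L1 arbitrary: \<phi>) simp_all

text \<open>Bridge from the distribution produced by the machine to elementary averages.\<close>

lemma prob_replicate_pmf:
  assumes "finite A" "A \<noteq> {}"
  shows "measure_pmf.prob (replicate_pmf L (pmf_of_set A)) X = avg A L (\<lambda>xs. of_bool (xs \<in> X))"
proof (induction L arbitrary: X)
  case 0
  show ?case by (simp add: indicator_def of_bool_def)
next
  case (Suc L)
  let ?p = "pmf_of_set A" and ?q = "replicate_pmf L (pmf_of_set A)"
  have eq: "replicate_pmf (Suc L) ?p = bind_pmf ?p (\<lambda>x. map_pmf (Cons x) ?q)"
    by (simp add: map_pmf_def)
  have fin: "finite (set_pmf ?q)"
    using assms by (simp add: set_replicate_pmf lists_eq_set finite_lists_length_eq)
  have "measure_pmf.expectation (bind_pmf ?p (\<lambda>x. map_pmf (Cons x) ?q)) (indicator X :: _ \<Rightarrow> real) =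
      (\<Sum>x\<in>A. pmf ?p x *\<^sub>R measure_pmf.expectation (map_pmf (Cons x) ?q) (indicator X))"
    by (rule pmf_expectation_bind) (use assms fin in auto)
  then have "measure_pmf.prob (replicate_pmf (Suc L) ?p) X =
      (\<Sum>x\<in>A. pmf ?p x * measure_pmf.prob (map_pmf (Cons x) ?q) X)"
    unfolding eq by simp
  also have "\<dots> = (\<Sum>x\<in>A. measure_pmf.prob ?q (Cons x -` X)) / card A"
    using assms by (simp add: sum_divide_distrib)
  finally show ?case by (simp add: Suc.IH)
qed

text \<open>Ordered pairs count twice, hence the half. If \<open>Suc k\<close> of the events hold,
  the left side is \<open>(k + 1) - (k + 1) * k / 2\<close>, which is at most 1 because
  \<open>k * (k - 1)\<close> is never negative.\<close>

lemma bonferroni_pair: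
  fixes u :: "'i \<Rightarrow> bool"
  assumes "finite I"
  shows "(\<Sum>a\<in>I. of_bool (u a)) - (\<Sum>a\<in>I. \<Sum>c\<in>I - {a}. of_bool (u a \<and> u c)) / 2
    \<le> (of_bool (\<exists>a\<in>I. u a) :: real)"
proof -
  define Y where "Y = {a \<in> I. u a}"
  have fY: "finite Y" using assms by (simp add: Y_def)
  have cnt: "(\<Sum>c\<in>J. of_bool (Q c)) = real (card {c \<in> J. Q c})" if "finite J" for J :: "'i set" and Q
    using that by (induction J rule: finite_induct) (auto simp: conj_disj_distribR Collect_disj_eq Collect_conv_if)
  have 1: "(\<Sum>a\<in>I. of_bool (u a)) = real (card Y)"
    unfolding Y_def by (rule cnt[OF assms])
  have "(\<Sum>c\<in>I - {a}. of_bool (u a \<and> u c)) = of_bool (u a) * real (card Y - 1)" if "a \<in> I" for a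
  proof (cases "u a")
    case True
    have "{c \<in> I - {a}. u a \<and> u c} = Y - {a}" using True by (auto simp: Y_def)
    then have "(\<Sum>c\<in>I - {a}. of_bool (u a \<and> u c)) = real (card (Y - {a}))"
      using cnt[of "I - {a}" "\<lambda>c. u a \<and> u c"] assms by simp
    then show ?thesis using True that fY by (simp add: Y_def)
  qed simp
  then have "(\<Sum>a\<in>I. \<Sum>c\<in>I - {a}. of_bool (u a \<and> u c)) = (\<Sum>a\<in>I. of_bool (u a)) * real (card Y - 1)"
    unfolding sum_distrib_right by (rule sum.cong[OF refl])
  then have 2: "(\<Sum>a\<in>I. \<Sum>c\<in>I - {a}. of_bool (u a \<and> u c)) = real (card Y) * real (card Y - 1)"
    unfolding 1 .
  show ?thesis
  proof (cases "Y = {}")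
    case True
    then show ?thesis using 1 2 by (auto simp: Y_def)
  next
    case False
    then have ex: "\<exists>a\<in>I. u a" by (auto simp: Y_def)
    obtain k where k: "card Y = Suc k" using False fY by (metis card_0_eq not0_implies_Suc)
    have "real (k + 1) - (real (k + 1) * real k) / 2 \<le> 1"
    proof -
      have "0 \<le> real k * (real k - 1)" by (cases k) auto
      then show ?thesis by (simp add: field_simps)
    qed
    then show ?thesis unfolding 1 2 using ex k by simp
  qed
qed

subsection \<open>Chains\<close>

text \<open>\<open>Om\<close> contains the seeds of one hash function from blocks to elements.
  Single values are exactly uniform; for pairs only an upper bound is recorded, since joint events
  are only ever bounded from above.\<close>

locale rainbow =
  fixes Om :: "'w set" and H :: "'w \<Rightarrow> nat \<Rightarrow> nat" and g :: "nat \<Rightarrow> nat" and N M t :: nat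
  assumes fin: "finite Om" and ne: "Om \<noteq> {}"
    and M: "1 \<le> M" and t: "1 \<le> t" and N: "N = M * t"
    and g_less: "x < N \<Longrightarrow> g x < M"
    and g_card: "B < M \<Longrightarrow> card {x. x < N \<and> g x = B} \<le> t"
    and H_less: "\<omega> \<in> Om \<Longrightarrow> B < M \<Longrightarrow> H \<omega> B < N"
    and single: "B < M \<Longrightarrow> x < N \<Longrightarrow> real (card {\<omega> \<in> Om. H \<omega> B = x}) = real (card Om) / real N"
    and pair: "B < M \<Longrightarrow> B' < M \<Longrightarrow> B \<noteq> B' \<Longrightarrow> x < N \<Longrightarrow> y < N \<Longrightarrow>
      real (card {\<omega> \<in> Om. H \<omega> B = x \<and> H \<omega> B' = y}) \<le> real (card Om) / real N ^ 2"
begin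

primrec walk :: "'w list \<Rightarrow> nat \<Rightarrow> nat" where
  "walk [] B = B"
| "walk (\<omega> # r) B = walk r (g (H \<omega> B))"

primrec hit :: "nat \<Rightarrow> 'w list \<Rightarrow> nat \<Rightarrow> nat \<Rightarrow> bool" where
  "hit j [] B x = False"
| "hit j (\<omega> # r) B x = (case j of 0 \<Rightarrow> H \<omega> B = x | Suc i \<Rightarrow> hit i r (g (H \<omega> B)) x)"

text \<open>Uniqueness of the end point makes the table invertible: from the block of
  \<open>x\<close> the walk can be completed to the end point, and this determines the start
  \<open>s\<close>.\<close>

definition covered :: "nat \<Rightarrow> 'w list \<Rightarrow> nat \<Rightarrow> bool" where
  "covered m \<omega>s x \<longleftrightarrow> (\<exists>s<m. \<exists>j<length \<omega>s. hit j \<omega>s s x \<and> (\<forall>s'<m. s' \<noteq> s \<longrightarrow> walk \<omega>s s \<noteq> walk \<omega>s s'))"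

section \<open>Counting seeds of a single hash function\<close>

lemma c0: "real (card Om) > 0" using fin ne by (simp add: card_gt_0_iff)
lemma N0: "real N > 0" using M t N by simp
lemma M0: "real M > 0" using M by simp
lemma tN: "real t / real N ^ 2 = 1 / (real M * real N)"
  using N M t by (simp add: power2_eq_square field_simps)

lemma sum_of_bool: "(\<Sum>\<omega>\<in>Om. of_bool (Q \<omega>)) = real (card {\<omega> \<in> Om. Q \<omega>})"
  using fin by (simp add: of_bool_def sum.If_cases Int_def)

lemma card_cover:
  assumes "finite Y" "\<And>\<omega>. \<omega> \<in> Om \<Longrightarrow> Q \<omega> \<Longrightarrow> \<exists>y\<in>Y. R y \<omega>" "\<And>y. y \<in> Y \<Longrightarrow> real (card {\<omega> \<in> Om. R y \<omega>}) \<le> K"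
  shows "real (card {\<omega> \<in> Om. Q \<omega>}) \<le> real (card Y) * K"
proof -
  have "card {\<omega> \<in> Om. Q \<omega>} \<le> card (\<Union>y\<in>Y. {\<omega> \<in> Om. R y \<omega>})"
    by (intro card_mono) (use fin assms in auto)
  also have "\<dots> \<le> (\<Sum>y\<in>Y. card {\<omega> \<in> Om. R y \<omega>})" by (rule card_UN_le[OF assms(1)])
  finally have "real (card {\<omega> \<in> Om. Q \<omega>}) \<le> (\<Sum>y\<in>Y. real (card {\<omega> \<in> Om. R y \<omega>}))"
    unfolding of_nat_sum[symmetric] by (rule of_nat_mono)
  also have "\<dots> \<le> (\<Sum>y\<in>Y. K)" by (intro sum_mono assms(3))
  finally show ?thesis by simp
qed

text \<open>Pairwise independence summed over the at most \<open>t\<close> elements of the block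
  \<open>C\<close>; here \<open>t / N^2\<close> equals \<open>1 / (M * N)\<close>.\<close>

lemma card_pair_bucket:
  assumes "B < M" "B' < M" "B \<noteq> B'" "x < N" "C < M"
  shows "real (card {\<omega> \<in> Om. H \<omega> B = x \<and> g (H \<omega> B') = C}) \<le> real (card Om) / (real M * real N)"
proof -
  let ?Y = "{y. y < N \<and> g y = C}"
  have "real (card {\<omega> \<in> Om. H \<omega> B = x \<and> g (H \<omega> B') = C}) \<le> real (card ?Y) * (real (card Om) / real N ^ 2)"
    by (rule card_cover[where R = "\<lambda>y \<omega>. H \<omega> B = x \<and> H \<omega> B' = y"]) (use assms pair H_less in auto)
  also have "\<dots> \<le> real t * (real (card Om) / real N ^ 2)"
    using g_card[OF assms(5)] by (intro mult_right_mono) simp_all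
  also have "\<dots> = real (card Om) * (real t / real N ^ 2)" by simp
  also have "\<dots> = real (card Om) / (real M * real N)" unfolding tN by simp
  finally show ?thesis .
qed

text \<open>Sums \<open>card_pair_bucket\<close> over the \<open>N\<close> possible values of
  \<open>H \<omega> B\<close>.\<close>

lemma card_collision:
  assumes "B < M" "B' < M" "B \<noteq> B'"
  shows "real (card {\<omega> \<in> Om. g (H \<omega> B) = g (H \<omega> B')}) \<le> real (card Om) / real M"
proof -
  have "real (card {\<omega> \<in> Om. g (H \<omega> B) = g (H \<omega> B')}) \<le> real (card {..<N}) * (real (card Om) / (real M * real N))"
    by (rule card_cover[where R = "\<lambda>x \<omega>. H \<omega> B = x \<and> g (H \<omega> B') = g x"])
      (use assms H_less g_less card_pair_bucket in auto)
  then show ?thesis using N0 by simp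
qed

text \<open>Conditions on the first seed: \<open>f\<close> bounds the conditional averages.\<close>

lemma avg_Suc_le:
  assumes "\<And>\<omega>. \<omega> \<in> Om \<Longrightarrow> avg Om L (\<lambda>r. \<phi> (\<omega> # r)) \<le> f \<omega>" "(\<Sum>\<omega>\<in>Om. f \<omega>) \<le> real (card Om) * K"
  shows "avg Om (Suc L) \<phi> \<le> K"
proof -
  have "(\<Sum>\<omega>\<in>Om. avg Om L (\<lambda>r. \<phi> (\<omega> # r))) \<le> real (card Om) * K"
    by (rule order_trans[OF sum_mono assms(2)]) (rule assms(1))
  then show ?thesis using c0 by (simp add: field_simps)
qed

lemma avg_bool_le_1: "avg Om L (\<lambda>r. of_bool (Q r)) \<le> 1"
  using avg_mono[of L Om "\<lambda>r. of_bool (Q r)" "\<lambda>_. 1"] avg_const[OF fin ne] by simp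

text \<open>As long as the chains are in different blocks, the fresh hash function of the next step
  sends them to a common block with probability at most \<open>1 / M\<close>. This is summed over
  \<open>L\<close> steps.\<close>

lemma avg_merge:
  assumes "B < M" "B' < M" "B \<noteq> B'"
  shows "avg Om L (\<lambda>r. of_bool (walk r B = walk r B')) \<le> real L / real M"
  using assms
proof (induction L arbitrary: B B')
  case (Suc L)
  show ?case
  proof (rule avg_Suc_le[where f = "\<lambda>\<omega>. of_bool (g (H \<omega> B) = g (H \<omega> B')) + real L / real M"])
    fix \<omega> assume \<omega>: "\<omega> \<in> Om"
    show "avg Om L (\<lambda>r. of_bool (walk (\<omega> # r) B = walk (\<omega> # r) B')) \<le>
        of_bool (g (H \<omega> B) = g (H \<omega> B')) + real L / real M"
    proof (cases "g (H \<omega> B) = g (H \<omega> B')")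
      case True
      then show ?thesis by (simp add: avg_const[OF fin ne])
    next
      case False
      then show ?thesis using Suc.IH[of "g (H \<omega> B)" "g (H \<omega> B')"] Suc.prems \<omega> H_less g_less by simp
    qed
  next
    show "(\<Sum>\<omega>\<in>Om. of_bool (g (H \<omega> B) = g (H \<omega> B')) + real L / real M) \<le>
        real (card Om) * (real (Suc L) / real M)"
      using card_collision[OF Suc.prems] unfolding sum.distrib sum_of_bool
      by (simp add: field_simps add_divide_distrib)
  qed
qed simp

text \<open>The block reached before step \<open>j\<close> does not depend on the seed of step
  \<open>j\<close>, and a single hash value is uniform.\<close>

lemma avg_hit:
  assumes "B < M" "x < N" "j < L"
  shows "avg Om L (\<lambda>r. of_bool (hit j r B x)) = 1 / real N"
  using assms
proof (induction L arbitrary: B j)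
  case (Suc L)
  show ?case
  proof (cases j)
    case 0
    have "(\<Sum>\<omega>\<in>Om. avg Om L (\<lambda>r. of_bool (H \<omega> B = x))) = real (card {\<omega> \<in> Om. H \<omega> B = x})"
      by (simp add: avg_const[OF fin ne] sum_of_bool)
    then show ?thesis using 0 single[OF Suc.prems(1,2)] c0 by simp
  next
    case (Suc i)
    have "(\<Sum>\<omega>\<in>Om. avg Om L (\<lambda>r. of_bool (hit i r (g (H \<omega> B)) x))) = (\<Sum>\<omega>\<in>Om. 1 / real N)"
      by (intro sum.cong refl Suc.IH) (use Suc.prems Suc H_less g_less in auto)
    then show ?thesis using Suc c0 by simp
  qed
qed simp

text \<open>At the step of the hit, the second chain either enters the block of \<open>x\<close> at
  once, which is bounded by pairwise independence, or merges in a later step. A collision before the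
  hit has to be followed by a plain hit. Every step contributes \<open>1 / (M * N)\<close>.\<close>

lemma avg_hit_merge:
  assumes "B < M" "B' < M" "B \<noteq> B'" "x < N" "j < L"
  shows "avg Om L (\<lambda>r. of_bool (hit j r B x \<and> walk r B = walk r B')) \<le> real L / (real M * real N)"
  using assms
proof (induction L arbitrary: B B' j)
  case (Suc L)
  show ?case
  proof (cases j)
    case 0
    show ?thesis
    proof (rule avg_Suc_le[where f = "\<lambda>\<omega>. of_bool (H \<omega> B = x \<and> g (H \<omega> B') = g x) +
          of_bool (H \<omega> B = x) * (real L / real M)"])
      fix \<omega> assume \<omega>: "\<omega> \<in> Om"
      show "avg Om L (\<lambda>r. of_bool (hit j (\<omega> # r) B x \<and> walk (\<omega> # r) B = walk (\<omega> # r) B')) \<le>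
        of_bool (H \<omega> B = x \<and> g (H \<omega> B') = g x) + of_bool (H \<omega> B = x) * (real L / real M)"
      proof (cases "H \<omega> B = x")
        case True
        then show ?thesis
          using avg_merge[of "g x" "g (H \<omega> B')" L] 0 \<omega> H_less g_less Suc.prems
          by (cases "g (H \<omega> B') = g x") (auto simp: avg_const[OF fin ne])
      next
        case False
        then show ?thesis using 0 avg_const[OF fin ne, of L 0] by simp
      qed
    next
      have "(\<Sum>\<omega>\<in>Om. of_bool (H \<omega> B = x) * (real L / real M)) = real (card Om) / real N * (real L / real M)"
        by (simp only: sum_distrib_right[symmetric] sum_of_bool single[OF Suc.prems(1,4)])
      then show "(\<Sum>\<omega>\<in>Om. of_bool (H \<omega> B = x \<and> g (H \<omega> B') = g x) + of_bool (H \<omega> B = x) * (real L / real M)) \<le>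
        real (card Om) * (real (Suc L) / (real M * real N))"
        using card_pair_bucket[OF Suc.prems(1-4) g_less[OF Suc.prems(4)]] unfolding sum.distrib sum_of_bool
        by (simp add: field_simps add_divide_distrib)
    qed
  next
    case (Suc i)
    show ?thesis
    proof (rule avg_Suc_le[where f = "\<lambda>\<omega>. of_bool (g (H \<omega> B) = g (H \<omega> B')) * (1 / real N) +
          real L / (real M * real N)"])
      fix \<omega> assume \<omega>: "\<omega> \<in> Om"
      show "avg Om L (\<lambda>r. of_bool (hit j (\<omega> # r) B x \<and> walk (\<omega> # r) B = walk (\<omega> # r) B')) \<le>
        of_bool (g (H \<omega> B) = g (H \<omega> B')) * (1 / real N) + real L / (real M * real N)"
      proof (cases "g (H \<omega> B) = g (H \<omega> B')")
        case True
        then show ?thesis using avg_hit[of "g (H \<omega> B)" x i L] Suc Suc.prems \<omega> H_less g_less by simp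
      next
        case False
        then show ?thesis using Suc.IH[of "g (H \<omega> B)" "g (H \<omega> B')" i] Suc Suc.prems \<omega> H_less g_less
          by simp
      qed
    next
      show "(\<Sum>\<omega>\<in>Om. of_bool (g (H \<omega> B) = g (H \<omega> B')) * (1 / real N) + real L / (real M * real N)) \<le>
        real (card Om) * (real (Suc L) / (real M * real N))"
        using mult_right_mono[OF card_collision[OF Suc.prems(1-3)], of "1 / real N"]
        unfolding sum.distrib sum_distrib_right[symmetric] sum_of_bool
        by (simp add: field_simps add_divide_distrib)
    qed
  qed
qed simp

text \<open>The last condition excludes that both hits are one event, namely at equal positions of
  equal or merged chains. Hits at the same position then come from different blocks and are
  controlled by pairwise independence; hits at different positions are controlled by two independent
  seeds.\<close>

lemma avg_hit_hit:
  assumes "B < M" "B' < M" "x < N" "j < L" "j' < L"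
  shows "avg Om L (\<lambda>r. of_bool (hit j r B x \<and> hit j' r B' x \<and> (j \<noteq> j' \<or> walk r B \<noteq> walk r B')))
    \<le> 1 / real N ^ 2"
  using assms
proof (induction L arbitrary: B B' j j')
  case (Suc L)
  have zero: "avg Om L (\<lambda>r. 0) = 0" using avg_const[OF fin ne] .
  have one: "avg Om (Suc L) \<phi> \<le> 1 / real N ^ 2"
    if "B < M" "\<And>\<omega>. \<omega> \<in> Om \<Longrightarrow> avg Om L (\<lambda>r. \<phi> (\<omega> # r)) \<le> of_bool (H \<omega> B = x) * (1 / real N)" for \<phi> B
    by (rule avg_Suc_le[OF that(2)], assumption)
      (unfold sum_distrib_right[symmetric] sum_of_bool, use single[OF that(1) Suc.prems(3)] in \<open>simp add: power2_eq_square\<close>)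
  consider "j = 0" "j' = 0" | i where "j = 0" "j' = Suc i" | i where "j = Suc i" "j' = 0"
    | i i' where "j = Suc i" "j' = Suc i'" by (cases j; cases j') auto
  then show ?case
  proof cases
    \<comment> \<open>For \<open>B = B'\<close> the walks coincide, so the event is empty; this is
      why \<open>f\<close> can include \<open>B \<noteq> B'\<close>.\<close>
    case 1
    show ?thesis
    proof (rule avg_Suc_le[where f = "\<lambda>\<omega>. of_bool (H \<omega> B = x \<and> H \<omega> B' = x \<and> B \<noteq> B')"])
      fix \<omega> assume \<omega>: "\<omega> \<in> Om"
      show "avg Om L (\<lambda>r. of_bool (hit j (\<omega> # r) B x \<and> hit j' (\<omega> # r) B' x \<and>
          (j \<noteq> j' \<or> walk (\<omega> # r) B \<noteq> walk (\<omega> # r) B'))) \<le> of_bool (H \<omega> B = x \<and> H \<omega> B' = x \<and> B \<noteq> B')"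
        using 1 zero avg_bool_le_1[of L "\<lambda>r. walk r (g (H \<omega> B)) \<noteq> walk r (g (H \<omega> B'))"]
        by (cases "H \<omega> B = x \<and> H \<omega> B' = x \<and> B \<noteq> B'") (auto simp: zero)
    next
      show "(\<Sum>\<omega>\<in>Om. of_bool (H \<omega> B = x \<and> H \<omega> B' = x \<and> B \<noteq> B')) \<le> real (card Om) * (1 / real N ^ 2)"
        using pair[of B B' x x] Suc.prems unfolding sum_of_bool by (cases "B = B'") auto
    qed
  next
    case 2
    show ?thesis
    proof (rule one[OF Suc.prems(1)], goal_cases)
      case (1 \<omega>)
      then show ?case using 2 zero avg_hit[of "g (H \<omega> B')" x i L] Suc.prems H_less g_less
        by (cases "H \<omega> B = x") auto
    qed
  next
    case 3
    show ?thesis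
    proof (rule one[OF Suc.prems(2)], goal_cases)
      case (1 \<omega>)
      then show ?case using 3 zero avg_hit[of "g (H \<omega> B)" x i L] Suc.prems H_less g_less
        by (cases "H \<omega> B' = x") auto
    qed
  next
    case 4
    show ?thesis
    proof (rule avg_Suc_le[where f = "\<lambda>\<omega>. 1 / real N ^ 2"])
      fix \<omega> assume \<omega>: "\<omega> \<in> Om"
      show "avg Om L (\<lambda>r. of_bool (hit j (\<omega> # r) B x \<and> hit j' (\<omega> # r) B' x \<and>
          (j \<noteq> j' \<or> walk (\<omega> # r) B \<noteq> walk (\<omega> # r) B'))) \<le> 1 / real N ^ 2"
        using 4 Suc.IH[of "g (H \<omega> B)" "g (H \<omega> B')" i i'] Suc.prems \<omega> H_less g_less by simp
    qed simp
  qed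
qed simp

text \<open>Bonferroni over the \<open>m * L\<close> events that the chain from \<open>s\<close>
  hits \<open>x\<close> in step \<open>j\<close> and shares its end point with no other chain. Each
  has probability at least \<open>1 / N - m * L / (M * N)\<close>, and any two of them occur
  together with probability at most \<open>1 / N^2\<close>.\<close>

lemma avg_covered:
  assumes "x < N" "m \<le> M"
  shows "real (m * L) / real N * (1 - real (m * L) / real M) - (real (m * L) / real N) ^ 2 / 2
    \<le> avg Om L (\<lambda>r. of_bool (covered m r x))"
proof -
  define I where "I = {..<m} \<times> {..<L}"
  define iso where "iso = (\<lambda>r s. \<forall>s'<m. s' \<noteq> s \<longrightarrow> walk r s \<noteq> walk r s')"
  define u where "u = (\<lambda>r (s, j). hit j r s x \<and> iso r s)"
  have fI: "finite I" by (simp add: I_def)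
  have cI: "real (card I) = real (m * L)" by (simp add: I_def)
  have cov: "covered m r x \<longleftrightarrow> (\<exists>a\<in>I. u r a)" if "length r = L" for r
    using that by (auto simp: covered_def u_def I_def iso_def)
  have lower: "1 / real N - real m * (real L / (real M * real N)) \<le> avg Om L (\<lambda>r. of_bool (u r a))"
    if a: "a \<in> I" for a
  proof -
    obtain s j where sj: "a = (s, j)" "s < m" "j < L" using a by (auto simp: I_def)
    \<comment> \<open>A hit fails to be isolated only through some other start \<open>s'\<close>, so
      a union bound over these starts is subtracted.\<close>
    have "of_bool (hit j r s x) - (\<Sum>s'\<in>{..<m} - {s}. of_bool (hit j r s x \<and> walk r s = walk r s'))
        \<le> (of_bool (u r a) :: real)" for r
    proof (cases "u r a \<or> \<not> hit j r s x")
      case True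
      then show ?thesis by (auto simp: sj u_def intro: sum_nonneg)
    next
      case False
      then obtain s' where s': "s' < m" "s' \<noteq> s" "walk r s = walk r s'"
        by (auto simp: u_def sj iso_def)
      have "(1::real) \<le> (\<Sum>s'\<in>{..<m} - {s}. of_bool (hit j r s x \<and> walk r s = walk r s'))"
        using s' False member_le_sum[of s' "{..<m} - {s}" "\<lambda>s'. of_bool (hit j r s x \<and> walk r s = walk r s') :: real"]
        by auto
      then show ?thesis using False by simp
    qed
    then have "avg Om L (\<lambda>r. of_bool (hit j r s x) -
        (\<Sum>s'\<in>{..<m} - {s}. of_bool (hit j r s x \<and> walk r s = walk r s'))) \<le> avg Om L (\<lambda>r. of_bool (u r a))"
      by (intro avg_mono) auto
    also have "avg Om L (\<lambda>r. of_bool (hit j r s x) -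
        (\<Sum>s'\<in>{..<m} - {s}. of_bool (hit j r s x \<and> walk r s = walk r s'))) =
        1 / real N - (\<Sum>s'\<in>{..<m} - {s}. avg Om L (\<lambda>r. of_bool (hit j r s x \<and> walk r s = walk r s')))"
      unfolding avg_diff avg_sum[OF fin ne] using avg_hit[of s x j L] sj assms by simp
    finally have 1: "1 / real N - (\<Sum>s'\<in>{..<m} - {s}. avg Om L (\<lambda>r. of_bool (hit j r s x \<and> walk r s = walk r s')))
        \<le> avg Om L (\<lambda>r. of_bool (u r a))" .
    have "(\<Sum>s'\<in>{..<m} - {s}. avg Om L (\<lambda>r. of_bool (hit j r s x \<and> walk r s = walk r s'))) \<le>
        (\<Sum>s'\<in>{..<m} - {s}. real L / (real M * real N))"
      by (intro sum_mono avg_hit_merge) (use sj assms in auto)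
    also have "\<dots> \<le> real m * (real L / (real M * real N))"
      using sj by (simp add: mult_right_mono divide_right_mono)
    finally show ?thesis using 1 by linarith
  qed
  have upper: "avg Om L (\<lambda>r. of_bool (u r a \<and> u r c)) \<le> 1 / real N ^ 2" if ac: "a \<in> I" "c \<in> I - {a}" for a c
  proof -
    obtain s j where sj: "a = (s, j)" "s < m" "j < L" using ac by (auto simp: I_def)
    obtain s' j' where sj': "c = (s', j')" "s' < m" "j' < L" using ac by (auto simp: I_def)
    \<comment> \<open>Two distinct isolated hits at the same position have different starts and
      hence different end points, so the condition of \<open>avg_hit_hit\<close> is met.\<close>
    have "avg Om L (\<lambda>r. of_bool (u r a \<and> u r c)) \<le>
        avg Om L (\<lambda>r. of_bool (hit j r s x \<and> hit j' r s' x \<and> (j \<noteq> j' \<or> walk r s \<noteq> walk r s')))"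
      by (intro avg_mono) (use ac sj sj' in \<open>auto simp: u_def iso_def\<close>)
    also have "\<dots> \<le> 1 / real N ^ 2" using avg_hit_hit[of s s' x j L j'] sj sj' assms by simp
    finally show ?thesis .
  qed
  have "(\<Sum>a\<in>I. \<Sum>c\<in>I - {a}. avg Om L (\<lambda>r. of_bool (u r a \<and> u r c))) \<le> (\<Sum>a\<in>I. \<Sum>c\<in>I - {a}. 1 / real N ^ 2)"
    by (intro sum_mono upper)
  also have "\<dots> \<le> (\<Sum>a\<in>I. real (card I) * (1 / real N ^ 2))"
    by (intro sum_mono) (use fI in \<open>auto intro!: divide_right_mono simp: card_Diff_subset\<close>)
  also have "\<dots> = (real (m * L) / real N) ^ 2" using cI by (simp add: power2_eq_square)
  finally have p: "(\<Sum>a\<in>I. \<Sum>c\<in>I - {a}. avg Om L (\<lambda>r. of_bool (u r a \<and> u r c))) \<le> (real (m * L) / real N) ^ 2" .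
  have "real (m * L) / real N * (1 - real (m * L) / real M) =
      (\<Sum>a\<in>I. 1 / real N - real m * (real L / (real M * real N)))"
    using cI M0 N0 by (simp add: field_simps)
  also have "\<dots> \<le> (\<Sum>a\<in>I. avg Om L (\<lambda>r. of_bool (u r a)))" by (intro sum_mono lower)
  finally have "real (m * L) / real N * (1 - real (m * L) / real M) - (real (m * L) / real N) ^ 2 / 2 \<le>
      (\<Sum>a\<in>I. avg Om L (\<lambda>r. of_bool (u r a))) - (\<Sum>a\<in>I. \<Sum>c\<in>I - {a}. avg Om L (\<lambda>r. of_bool (u r a \<and> u r c))) / 2"
    using p by linarith
  also have "\<dots> = avg Om L (\<lambda>r. (\<Sum>a\<in>I. of_bool (u r a)) - (\<Sum>a\<in>I. \<Sum>c\<in>I - {a}. of_bool (u r a \<and> u r c)) / 2)"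
    unfolding avg_diff avg_sum[OF fin ne] avg_half by (simp only: avg_sum[OF fin ne])
  also have "\<dots> \<le> avg Om L (\<lambda>r. of_bool (covered m r x))"
  proof (rule avg_mono)
    fix r :: "'w list" assume "length r = L"
    show "(\<Sum>a\<in>I. of_bool (u r a)) - (\<Sum>a\<in>I. \<Sum>c\<in>I - {a}. of_bool (u r a \<and> u r c)) / 2 \<le>
        (of_bool (covered m r x) :: real)"
      using bonferroni_pair[OF fI, of "u r"] cov[OF \<open>length r = L\<close>] by simp
  qed
  finally show ?thesis .
qed

text \<open>\<open>m * t\<close> is half of \<open>M\<close>, so \<open>m * t / N\<close> is
  \<open>1 / (2 * t)\<close> and the bound becomes \<open>1 / (4 * t) - 1 / (8 * t^2)\<close>, which
  is at least \<open>1 / (8 * t)\<close> because \<open>t\<close> is at least 1.\<close>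

lemma avg_covered':
  assumes "x < N" "2 * m * t = M"
  shows "1 / (8 * real t) \<le> avg Om t (\<lambda>r. of_bool (covered m r x))"
proof -
  have "m \<le> M" using assms(2) t by auto
  have m0: "0 < m" using assms(2) M by (cases m) auto
  have t0: "0 < t" using t by simp
  have M: "real M = 2 * real (m * t)" unfolding assms(2)[symmetric] by simp
  have "real (m * t) / real N = 1 / (2 * real t)" unfolding N using M m0 t0 by (simp add: field_simps)
  moreover have "real (m * t) / real M = 1 / 2" unfolding M using m0 t0 by simp
  ultimately have "1 / (2 * real t) * (1 / 2) - (1 / (2 * real t)) ^ 2 / 2 \<le> avg Om t (\<lambda>r. of_bool (covered m r x))"
    using avg_covered[OF assms(1) \<open>m \<le> M\<close>, of t] by (simp only:) simp
  moreover have "1 / (8 * real t) \<le> 1 / (2 * real t) * (1 / 2) - (1 / (2 * real t)) ^ 2 / 2"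
    using t by (simp add: field_simps power2_eq_square)
  ultimately show ?thesis by linarith
qed

definition block :: "nat \<Rightarrow> 'w list \<Rightarrow> 'w list" where
  "block i r = take t (drop (i * t) r)"

text \<open>Different tables use disjoint stretches of the seeds, so their failures are independent
  and the averages multiply.\<close>

lemma avg_all_uncovered:
  assumes "x < N" "2 * m * t = M"
  shows "avg Om (T * t) (\<lambda>r. of_bool (\<forall>i<T. \<not> covered m (block i r) x)) \<le> (1 - 1 / (8 * real t)) ^ T"
proof (induction T)
  case (Suc T)
  let ?q = "1 - 1 / (8 * real t)"
  have q: "0 \<le> ?q" using t by (simp add: field_simps)
  have "avg Om (Suc T * t) (\<lambda>r. of_bool (\<forall>i<Suc T. \<not> covered m (block i r) x)) =
      avg Om t (\<lambda>xs. avg Om (T * t) (\<lambda>ys. of_bool (\<forall>i<Suc T. \<not> covered m (block i (xs @ ys)) x)))"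
    by (simp add: avg_append)
  also have "\<dots> = avg Om t (\<lambda>xs. avg Om (T * t) (\<lambda>ys. of_bool (\<forall>i<T. \<not> covered m (block i ys) x)) *
      of_bool (\<not> covered m xs x))"
  proof (rule avg_cong)
    fix xs :: "'w list" assume l: "length xs = t"
    have "(\<forall>i<Suc T. \<not> covered m (block i (xs @ ys)) x) \<longleftrightarrow>
        \<not> covered m xs x \<and> (\<forall>i<T. \<not> covered m (block i ys) x)" for ys
      using l by (auto simp: block_def All_less_Suc2)
    then have "avg Om (T * t) (\<lambda>ys. of_bool (\<forall>i<Suc T. \<not> covered m (block i (xs @ ys)) x)) =
        avg Om (T * t) (\<lambda>ys. of_bool (\<not> covered m xs x) * of_bool (\<forall>i<T. \<not> covered m (block i ys) x))"
      by (simp only: of_bool_conj)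
    then show "avg Om (T * t) (\<lambda>ys. of_bool (\<forall>i<Suc T. \<not> covered m (block i (xs @ ys)) x)) =
        avg Om (T * t) (\<lambda>ys. of_bool (\<forall>i<T. \<not> covered m (block i ys) x)) * of_bool (\<not> covered m xs x)"
      by (simp only: avg_cmult mult.commute)
  qed
  also have "\<dots> = avg Om (T * t) (\<lambda>ys. of_bool (\<forall>i<T. \<not> covered m (block i ys) x)) *
      avg Om t (\<lambda>xs. of_bool (\<not> covered m xs x))"
    by (rule avg_cmult)
  also have "avg Om t (\<lambda>xs. of_bool (\<not> covered m xs x)) = 1 - avg Om t (\<lambda>xs. of_bool (covered m xs x))"
    using avg_diff[of Om t "\<lambda>_. 1" "\<lambda>xs. of_bool (covered m xs x)"] avg_const[OF fin ne, of t 1]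
    by (simp add: of_bool_not_iff)
  also have "avg Om (T * t) (\<lambda>ys. of_bool (\<forall>i<T. \<not> covered m (block i ys) x)) *
      (1 - avg Om t (\<lambda>xs. of_bool (covered m xs x))) \<le> ?q ^ T * ?q"
    by (intro mult_mono Suc.IH) (use avg_covered'[OF assms] avg_bool_le_1 q in auto)
  finally show ?case by (simp only: power_Suc2)
qed simp

text \<open>Union bound over all elements.\<close>

lemma avg_not_good:
  assumes "2 * m * t = M"
  shows "avg Om (T * t) (\<lambda>r. of_bool (\<not> (\<forall>x<N. \<exists>i<T. covered m (block i r) x))) \<le>
    real N * (1 - 1 / (8 * real t)) ^ T"
proof -
  have "of_bool (\<not> (\<forall>x<N. \<exists>i<T. covered m (block i r) x)) \<le>
      (\<Sum>x<N. of_bool (\<forall>i<T. \<not> covered m (block i r) x) :: real)" for r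
  proof (cases "\<forall>x<N. \<exists>i<T. covered m (block i r) x")
    case False
    then obtain x where x: "x < N" "\<forall>i<T. \<not> covered m (block i r) x" by auto
    then show ?thesis using member_le_sum[of x "{..<N}" "\<lambda>x. of_bool (\<forall>i<T. \<not> covered m (block i r) x) :: real"]
      by auto
  qed (auto intro: sum_nonneg)
  then have "avg Om (T * t) (\<lambda>r. of_bool (\<not> (\<forall>x<N. \<exists>i<T. covered m (block i r) x))) \<le>
      (\<Sum>x<N. avg Om (T * t) (\<lambda>r. of_bool (\<forall>i<T. \<not> covered m (block i r) x)))"
    unfolding avg_sum[OF fin ne, symmetric] by (intro avg_mono) auto
  also have "\<dots> \<le> (\<Sum>x<N. (1 - 1 / (8 * real t)) ^ T)"
    by (intro sum_mono avg_all_uncovered) (use assms in auto)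
  finally show ?thesis by simp
qed

end

subsection \<open>Multiply-shift hashing\<close>

text \<open>Dietzfelbinger's multiply-shift scheme: the top \<open>k\<close> of the low
  \<open>u\<close> bits of \<open>a * x + c\<close>, where \<open>a\<close> and \<open>c\<close> are
  the two lowest \<open>u\<close>-bit digits of the random word. It needs no prime modulus, only
  word operations.\<close>

definition mult_shift :: "nat \<Rightarrow> nat \<Rightarrow> nat \<Rightarrow> nat \<Rightarrow> nat" where
  "mult_shift u k \<omega> x = ((\<omega> mod 2 ^ u) * x + (\<omega> div 2 ^ u) mod 2 ^ u) mod 2 ^ u div 2 ^ (u - k)"

section \<open>Counting random words by their digits\<close>

lemma card_mod_div:
  fixes p r :: nat
  assumes "0 < p"
  shows "card {y. y < p * r \<and> Q (y mod p) (y div p)} = (\<Sum>a<p. card {c. c < r \<and> Q a c})"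
proof -
  let ?f = "\<lambda>(a, c). a + p * c"
  have "{y. y < p * r \<and> Q (y mod p) (y div p)} = ?f ` (SIGMA a:{..<p}. {c. c < r \<and> Q a c})"
  proof (intro set_eqI iffI)
    fix y assume "y \<in> {y. y < p * r \<and> Q (y mod p) (y div p)}"
    then have "y div p < r" "y mod p < p" "Q (y mod p) (y div p)" "y = ?f (y mod p, y div p)"
      using assms by (auto simp: less_mult_imp_div_less mult.commute)
    then show "y \<in> ?f ` (SIGMA a:{..<p}. {c. c < r \<and> Q a c})" by blast
  next
    fix y assume "y \<in> ?f ` (SIGMA a:{..<p}. {c. c < r \<and> Q a c})"
    then obtain a c where y: "y = a + p * c" "a < p" "c < r" "Q a c" by auto
    have "a + p * c < p * Suc c" using y by simp
    also have "\<dots> \<le> p * r" using y by (intro mult_le_mono) auto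
    finally show "y \<in> {y. y < p * r \<and> Q (y mod p) (y div p)}" using y by simp
  qed
  moreover have "inj_on ?f (SIGMA a:{..<p}. {c. c < r \<and> Q a c})"
  proof (rule inj_onI, clarsimp)
    fix a c a' c' assume h: "a < p" "a' < p" "a + p * c = a' + p * c'"
    have "(a + p * c) mod p = a" "(a' + p * c') mod p = a'" using h(1,2) by simp_all
    then have "a = a'" unfolding h(3) by simp
    then show "a = a' \<and> c = c'" using h assms by simp
  qed
  ultimately show ?thesis by (simp add: card_image card_SigmaI)
qed

text \<open>Bits of the word above the lowest \<open>2 * u\<close> contribute a constant factor, and
  the remaining ones split into two independent digits.\<close>

lemma card_mult_shift:
  assumes "2 * u \<le> b"
  shows "card {\<omega> \<in> {..<2 ^ b}. Q (\<omega> mod 2 ^ u) (\<omega> div 2 ^ u mod 2 ^ u)} =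
    2 ^ (b - 2 * u) * (\<Sum>a<2 ^ u. card {c. c < 2 ^ u \<and> Q a (c::nat)})"
proof -
  let ?R = "\<lambda>y::nat. Q (y mod 2 ^ u) (y div 2 ^ u)"
  have p: "(2::nat) ^ u * 2 ^ u = 2 ^ (2 * u)" by (simp add: power_add[symmetric] mult_2)
  have "Q (\<omega> mod 2 ^ u) (\<omega> div 2 ^ u mod 2 ^ u) = ?R (\<omega> mod 2 ^ (2 * u))" for \<omega>
  proof -
    have "\<omega> mod 2 ^ (2 * u) mod 2 ^ u = \<omega> mod 2 ^ u"
      by (rule mod_mod_cancel) (simp add: le_imp_power_dvd)
    moreover have "\<omega> mod 2 ^ (2 * u) div 2 ^ u = \<omega> div 2 ^ u mod 2 ^ u"
      unfolding p[symmetric] mod_mult2_eq by simp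
    ultimately show ?thesis by simp
  qed
  then have "{\<omega> \<in> {..<2 ^ b}. Q (\<omega> mod 2 ^ u) (\<omega> div 2 ^ u mod 2 ^ u)} =
      {\<omega>. \<omega> < 2 ^ (2 * u) * 2 ^ (b - 2 * u) \<and> ?R (\<omega> mod 2 ^ (2 * u))}"
    using assms by (auto simp: power_add[symmetric])
  then have "card {\<omega> \<in> {..<2 ^ b}. Q (\<omega> mod 2 ^ u) (\<omega> div 2 ^ u mod 2 ^ u)} =
      (\<Sum>y<(2::nat) ^ (2 * u). card {c::nat. c < 2 ^ (b - 2 * u) \<and> ?R y})"
    using card_mod_div[of "2 ^ (2 * u)" "2 ^ (b - 2 * u)" "\<lambda>y c. ?R y"] by simp
  also have "\<dots> = (\<Sum>y<(2::nat) ^ (2 * u). 2 ^ (b - 2 * u) * (if ?R y then 1 else 0))"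
    by (intro sum.cong) auto
  also have "\<dots> = 2 ^ (b - 2 * u) * card {y. y < 2 ^ u * 2 ^ u \<and> ?R y}"
    unfolding sum_distrib_left[symmetric] p by (simp add: sum.If_cases Int_def)
  also have "card {y. y < 2 ^ u * 2 ^ u \<and> ?R y} = (\<Sum>a<2 ^ u. card {c. c < 2 ^ u \<and> Q a (c::nat)})"
    by (rule card_mod_div) simp
  finally show ?thesis .
qed

lemma div_eq_set:
  assumes "0 < (p::nat)"
  shows "{z. z div p = y} = {y * p..<y * p + p}"
proof (intro equalityI subsetI)
  fix z assume "z \<in> {z. z div p = y}"
  then have "z div p = y" by simp
  then show "z \<in> {y * p..<y * p + p}"
    using div_times_less_eq_dividend[of z p] dividend_less_div_times[OF assms, of z] by simp
next
  fix z assume "z \<in> {y * p..<y * p + p}"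
  then show "z \<in> {z. z div p = y}" by (auto intro!: div_nat_eqI simp: mult.commute)
qed

text \<open>Translation permutes the residues modulo \<open>2 ^ u\<close>; this is why the summand
  \<open>c\<close> alone makes a single hash value uniform.\<close>

lemma card_shifted_block:
  fixes s :: nat
  assumes "k \<le> u"
  shows "card {c. c < 2 ^ u \<and> Q ((s + c) mod 2 ^ u)} = card {z. z < 2 ^ u \<and> Q (z::nat)}"
proof (rule bij_betw_same_card[of "\<lambda>c. (s + c) mod 2 ^ u"])
  have inj: "inj_on (\<lambda>c. (s + c) mod 2 ^ u) {..<2 ^ u}"
  proof (rule inj_onI)
    fix c c' :: nat assume h: "c \<in> {..<2 ^ u}" "c' \<in> {..<2 ^ u}" "(s + c) mod 2 ^ u = (s + c') mod 2 ^ u"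
    then have "[s + c = s + c'] (mod 2 ^ u)" by (simp add: cong_def)
    then have "[c = c'] (mod 2 ^ u)" by (simp add: cong_add_lcancel_nat)
    then show "c = c'" using h by (simp add: cong_def)
  qed
  then have "(\<lambda>c. (s + c) mod 2 ^ u) ` {..<2 ^ u} = {..<2 ^ u}"
    by (intro endo_inj_surj) auto
  then show "bij_betw (\<lambda>c. (s + c) mod 2 ^ u) {c. c < 2 ^ u \<and> Q ((s + c) mod 2 ^ u)} {z. z < 2 ^ u \<and> Q z}"
    unfolding bij_betw_def using inj by (auto intro: inj_on_subset)
qed

lemma card_block:
  assumes "k \<le> u" "x < 2 ^ k"
  shows "card {z. z < 2 ^ u \<and> z div 2 ^ (u - k) = (x::nat)} = 2 ^ (u - k)"
proof -
  have "(x + 1) * 2 ^ (u - k) \<le> 2 ^ k * 2 ^ (u - k)" using assms by (intro mult_le_mono1) auto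
  then have "x * 2 ^ (u - k) + 2 ^ (u - k) \<le> 2 ^ u" using assms by (simp add: power_add[symmetric])
  then have "{z. z < 2 ^ u \<and> z div 2 ^ (u - k) = x} = {z. z div 2 ^ (u - k) = x}"
    by (auto simp: div_eq_set[of "2 ^ (u - k)" x, simplified set_eq_iff, simplified])
  then show ?thesis using div_eq_set[of "2 ^ (u - k)" x] by simp
qed

lemma card_mult_shift_single:
  assumes "2 * u \<le> b" "k \<le> u" "x < 2 ^ k"
  shows "card {\<omega> \<in> {..<2 ^ b}. mult_shift u k \<omega> B = x} * 2 ^ k = 2 ^ b"
proof -
  have "card {\<omega> \<in> {..<2 ^ b}. mult_shift u k \<omega> B = x} =
      2 ^ (b - 2 * u) * (\<Sum>a<2 ^ u. card {c. c < 2 ^ u \<and> (a * B + c) mod 2 ^ u div 2 ^ (u - k) = x})"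
    unfolding mult_shift_def by (rule card_mult_shift[OF assms(1)])
  also have "\<dots> = 2 ^ (b - 2 * u) * (\<Sum>a<(2::nat) ^ u. 2 ^ (u - k))"
    using card_shifted_block[OF assms(2), where Q = "\<lambda>z. z div 2 ^ (u - k) = x"] card_block[OF assms(2,3)]
    by simp
  finally show ?thesis using assms by (simp add: power_add[symmetric])
qed

text \<open>Write \<open>D = 2 ^ s * q\<close> with \<open>q\<close> odd and \<open>s < k\<close>.
  Modulo \<open>2 ^ u\<close> the progression has period \<open>2 ^ (u - s)\<close>, and within a
  period it visits distinct members of one residue class modulo \<open>2 ^ s\<close>. Since
  \<open>2 * k \<le> u\<close> gives \<open>s \<le> u - k\<close>, an aligned interval of length
  \<open>2 ^ (u - k)\<close> contains \<open>2 ^ (u - k - s)\<close> members of the class, and there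
  are \<open>2 ^ s\<close> periods.\<close>

lemma card_progression:
  fixes z D :: nat
  assumes "2 * k \<le> u" "\<not> 2 ^ k dvd D"
  shows "card {a. a < 2 ^ u \<and> (z + a * D) mod 2 ^ u div 2 ^ (u - k) = y} \<le> 2 ^ (u - k)"
proof -
  have D0: "D \<noteq> 0" using assms(2) by (intro notI) simp
  define s where "s = multiplicity 2 D"
  have "s < k"
  proof (rule ccontr)
    assume "\<not> s < k"
    then have "(2::nat) ^ k dvd 2 ^ s" by (simp add: le_imp_power_dvd)
    also have "2 ^ s dvd D" unfolding s_def by (rule multiplicity_dvd)
    finally show False using assms(2) by simp
  qed
  obtain q where q: "D = 2 ^ s * q" "odd q"
    using multiplicity_decompose'[of D 2] D0 unfolding s_def by auto
  define f where "f = (\<lambda>a. (z + a * D) mod 2 ^ u)"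
  have su: "s \<le> u" "s \<le> u - k" "s + (u - (k + s)) = u - k" using \<open>s < k\<close> assms(1) by auto
  have per: "f (a mod 2 ^ (u - s)) = f a" for a
  proof -
    have pu: "(2::nat) ^ s * 2 ^ (u - s) = 2 ^ u" using su by (simp add: power_add[symmetric])
    have "a mod 2 ^ (u - s) * D = q * (2 ^ s * (a mod 2 ^ (u - s)))" by (simp add: q)
    also have "2 ^ s * (a mod 2 ^ (u - s)) = (2 ^ s * a) mod 2 ^ u"
      unfolding pu[symmetric] by (rule mult_mod_right)
    finally have "f (a mod 2 ^ (u - s)) = (z + q * ((2 ^ s * a) mod 2 ^ u)) mod 2 ^ u"
      by (simp only: f_def)
    also have "\<dots> = (z + q * (2 ^ s * a)) mod 2 ^ u"
      by (subst (1 2) mod_add_right_eq[symmetric]) (simp only: mod_mult_right_eq)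
    also have "q * (2 ^ s * a) = a * D" by (simp add: q)
    finally show ?thesis by (simp only: f_def)
  qed
  have fs: "f a mod 2 ^ s = z mod 2 ^ s" for a
  proof -
    have "f a mod 2 ^ s = (z + a * D) mod 2 ^ s" unfolding f_def
      using su by (intro mod_mod_cancel) (simp add: le_imp_power_dvd)
    also have "a * D = 2 ^ s * (a * q)" by (simp add: q)
    finally show ?thesis by simp
  qed
  have inj: "inj_on f {..<2 ^ (u - s)}"
  proof (rule inj_onI)
    fix a a' assume h: "a \<in> {..<2 ^ (u - s)}" "a' \<in> {..<2 ^ (u - s)}" "f a = f a'"
    then have "[z + a * D = z + a' * D] (mod 2 ^ u)" by (simp add: f_def cong_def)
    then have "[a * D = a' * D] (mod 2 ^ u)" by (simp add: cong_add_lcancel_nat)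
    moreover have "2 ^ u = (2::nat) ^ s * 2 ^ (u - s)" "a * D = 2 ^ s * (a * q)" "a' * D = 2 ^ s * (a' * q)"
      using su by (simp_all add: q power_add[symmetric])
    ultimately have "[a * q = a' * q] (mod 2 ^ (u - s))"
      by (simp add: cong_def)
    moreover have "coprime q (2 ^ (u - s))" using q by simp
    ultimately have "[a = a'] (mod 2 ^ (u - s))" by (simp add: cong_mult_rcancel_nat)
    then show "a = a'" using h by (simp add: cong_def)
  qed
  let ?S = "{a. a < 2 ^ (u - s) \<and> f a div 2 ^ (u - k) = y}"
  have "card ?S \<le> card {j. j div 2 ^ (u - k - s) = y}"
  proof (rule card_inj_on_le[of "\<lambda>a. f a div 2 ^ s"])
    show "inj_on (\<lambda>a. f a div 2 ^ s) ?S"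
    proof (rule inj_onI)
      fix a a' assume h: "a \<in> ?S" "a' \<in> ?S" "f a div 2 ^ s = f a' div 2 ^ s"
      then have "f a = f a'" using fs[of a] fs[of a'] by (metis div_mult_mod_eq)
      then show "a = a'" using inj h by (auto dest: inj_onD)
    qed
    show "(\<lambda>a. f a div 2 ^ s) ` ?S \<subseteq> {j. j div 2 ^ (u - k - s) = y}"
      using su by (auto simp: div_mult2_eq[symmetric] power_add[symmetric])
  qed (simp add: div_eq_set)
  then have S: "card ?S \<le> 2 ^ (u - k - s)" by (simp add: div_eq_set)
  have "{a. a < 2 ^ u \<and> f a div 2 ^ (u - k) = y} =
      {a. a < 2 ^ (u - s) * 2 ^ s \<and> f (a mod 2 ^ (u - s)) div 2 ^ (u - k) = y}"
    using su per by (simp add: power_add[symmetric])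
  then have "card {a. a < 2 ^ u \<and> f a div 2 ^ (u - k) = y} =
      (\<Sum>a<2 ^ (u - s). card {c. c < (2::nat) ^ s \<and> f a div 2 ^ (u - k) = y})"
    using card_mod_div[of "2 ^ (u - s)" "2 ^ s" "\<lambda>a c. f a div 2 ^ (u - k) = y"] by simp
  also have "\<dots> = (\<Sum>a<2 ^ (u - s). (2::nat) ^ s * (if f a div 2 ^ (u - k) = y then 1 else 0))"
    by (intro sum.cong) auto
  also have "\<dots> = 2 ^ s * card ?S"
    unfolding sum_distrib_left[symmetric] by (simp add: sum.If_cases Int_def)
  also have "\<dots> \<le> 2 ^ s * 2 ^ (u - k - s)" using S by simp
  finally show ?thesis using su by (simp add: f_def power_add[symmetric])
qed

text \<open>For fixed \<open>a\<close>, substituting \<open>z\<close> for \<open>a * B + c\<close>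
  leaves the first hash value depending on \<open>z\<close> only and makes the second one that of
  \<open>z + a * D\<close>. After exchanging the sums, the multipliers \<open>a\<close> are counted
  for each \<open>z\<close> that gives \<open>x\<close>, which is a count along a
  progression.\<close>

lemma card_mult_shift_pair:
  assumes "2 * u \<le> b" "2 * k \<le> u" "B < 2 ^ k" "B' < 2 ^ k" "B \<noteq> B'" "x < 2 ^ k"
  shows "card {\<omega> \<in> {..<2 ^ b}. mult_shift u k \<omega> B = x \<and> mult_shift u k \<omega> B' = y} * (2 ^ k) ^ 2 \<le> 2 ^ b"
proof -
  have ku: "k \<le> u" using assms(2) by simp
  then have Bu: "B < 2 ^ u" using order_less_le_trans[OF assms(3) power_increasing[OF ku]] by simp
  \<comment> \<open>The difference of the arguments modulo \<open>2 ^ u\<close>, kept natural by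
    adding \<open>2 ^ u\<close>. It is not divisible by \<open>2 ^ k\<close> because
    \<open>B\<close> and \<open>B'\<close> are distinct and below \<open>2 ^ k\<close>.\<close>
  define D where "D = B' + 2 ^ u - B"
  have BD: "B + D = B' + 2 ^ u" using Bu by (simp add: D_def)
  have D: "\<not> 2 ^ k dvd D"
  proof
    assume "2 ^ k dvd D"
    then obtain x where x: "D = 2 ^ k * x" by (rule dvdE)
    have u: "(2::nat) ^ u = 2 ^ k * 2 ^ (u - k)" using ku by (simp add: power_add[symmetric])
    have "(B + 2 ^ k * x) mod 2 ^ k = (B' + 2 ^ k * 2 ^ (u - k)) mod 2 ^ k"
      using BD unfolding x u by simp
    then have "B mod 2 ^ k = B' mod 2 ^ k" by simp
    then show False using assms by simp
  qed
  have key: "(a * B' + c) mod 2 ^ u = ((a * B + c) mod 2 ^ u + a * D) mod 2 ^ u" for a c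
  proof -
    have "a * B + c + a * D = a * (B + D) + c" by (simp add: add_mult_distrib2)
    also have "\<dots> = a * (B' + 2 ^ u) + c" unfolding BD ..
    finally have "a * B + c + a * D = a * (B' + 2 ^ u) + c" .
    then have "((a * B + c) mod 2 ^ u + a * D) mod 2 ^ u = (a * (B' + 2 ^ u) + c) mod 2 ^ u"
      by (simp only: mod_add_left_eq)
    also have "a * (B' + 2 ^ u) + c = a * B' + c + a * 2 ^ u" by (simp add: add_mult_distrib2)
    finally show ?thesis by simp
  qed
  let ?P = "\<lambda>a z. z div 2 ^ (u - k) = x \<and> (z + a * D) mod 2 ^ u div 2 ^ (u - k) = y"
  have eq: "card {\<omega> \<in> {..<2 ^ b}. mult_shift u k \<omega> B = x \<and> mult_shift u k \<omega> B' = y} =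
      2 ^ (b - 2 * u) * (\<Sum>a<2 ^ u. card {c. c < 2 ^ u \<and> ((a * B + c) mod 2 ^ u div 2 ^ (u - k) = x \<and>
        (a * B' + c) mod 2 ^ u div 2 ^ (u - k) = y)})"
    unfolding mult_shift_def by (rule card_mult_shift[OF assms(1)])
  have "(\<Sum>a<2 ^ u. card {c. c < 2 ^ u \<and> ((a * B + c) mod 2 ^ u div 2 ^ (u - k) = x \<and>
        (a * B' + c) mod 2 ^ u div 2 ^ (u - k) = y)}) = (\<Sum>a<2 ^ u. card {z. z < 2 ^ u \<and> ?P a z})"
    unfolding key by (intro sum.cong refl card_shifted_block[OF ku])
  also have "\<dots> = (\<Sum>a<2 ^ u. \<Sum>z<2 ^ u. of_bool (?P a z))"
    by (intro sum.cong) (simp_all add: of_bool_def sum.If_cases Int_def)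
  also have "\<dots> = (\<Sum>z<2 ^ u. \<Sum>a<2 ^ u. of_bool (?P a z))" by (rule sum.swap)
  also have "\<dots> \<le> (\<Sum>z<2 ^ u. of_bool (z div 2 ^ (u - k) = x) * 2 ^ (u - k))"
  proof (rule sum_mono)
    fix z
    have "(\<Sum>a<2 ^ u. of_bool (?P a z)) = (of_bool (z div 2 ^ (u - k) = x) :: nat) *
        card {a. a < 2 ^ u \<and> (z + a * D) mod 2 ^ u div 2 ^ (u - k) = y}"
      by (cases "z div 2 ^ (u - k) = x") (simp_all add: of_bool_def sum.If_cases Int_def)
    also have "\<dots> \<le> of_bool (z div 2 ^ (u - k) = x) * 2 ^ (u - k)"
      by (intro mult_le_mono2 card_progression[OF assms(2) D])
    finally show "(\<Sum>a<2 ^ u. of_bool (?P a z)) \<le> (of_bool (z div 2 ^ (u - k) = x) :: nat) * 2 ^ (u - k)" .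
  qed
  also have "\<dots> = 2 ^ (u - k) * 2 ^ (u - k)"
    unfolding sum_distrib_right[symmetric] using card_block[OF ku assms(6)]
    by (simp add: of_bool_def sum.If_cases Int_def)
  finally have "card {\<omega> \<in> {..<2 ^ b}. mult_shift u k \<omega> B = x \<and> mult_shift u k \<omega> B' = y} \<le>
      2 ^ (b - 2 * u) * (2 ^ (u - k) * 2 ^ (u - k))" unfolding eq by (rule mult_le_mono2)
  then have "card {\<omega> \<in> {..<2 ^ b}. mult_shift u k \<omega> B = x \<and> mult_shift u k \<omega> B' = y} * (2 ^ k) ^ 2 \<le>
      2 ^ (b - 2 * u) * (2 ^ (u - k) * 2 ^ (u - k)) * (2 ^ k) ^ 2" by (rule mult_le_mono1)
  also have "\<dots> = 2 ^ (b - 2 * u) * (2 ^ (u - k) * 2 ^ k) ^ 2" by (simp add: power2_eq_square)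
  also have "(2::nat) ^ (u - k) * 2 ^ k = 2 ^ u" using ku by (simp add: power_add[symmetric])
  also have "((2::nat) ^ u) ^ 2 = 2 ^ (2 * u)" by (simp add: power2_eq_square power_add[symmetric] mult_2)
  also have "(2::nat) ^ (b - 2 * u) * 2 ^ (2 * u) = 2 ^ b" using assms(1) by (simp add: power_add[symmetric])
  finally show ?thesis .
qed

lemma mult_shift_less: "k \<le> u \<Longrightarrow> mult_shift u k \<omega> x < 2 ^ k"
proof -
  assume "k \<le> u"
  then have "(2::nat) ^ u = 2 ^ (u - k) * 2 ^ k" by (simp add: power_add[symmetric])
  then have "((\<omega> mod 2 ^ u) * x + (\<omega> div 2 ^ u) mod 2 ^ u) mod 2 ^ u < 2 ^ k * 2 ^ (u - k)"
    by (simp add: mult.commute)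
  then show ?thesis unfolding mult_shift_def by (rule less_mult_imp_div_less)
qed

text \<open>The scheme outputs \<open>k\<close> bits, so the number of elements has to be a power of
  two here; this is the reason for padding the elements to \<open>NN\<close>.\<close>

lemma rainbow_mult_shift:
  assumes "2 * u \<le> b" "2 * k \<le> u" "2 ^ k = M * t"
    and "\<And>x. x < 2 ^ k \<Longrightarrow> g x < M" "\<And>B. B < M \<Longrightarrow> card {x. x < 2 ^ k \<and> g x = B} \<le> t"
  shows "rainbow {..<2 ^ b} (mult_shift u k) g (2 ^ k) M t"
proof
  have "M * t \<noteq> 0" unfolding assms(3)[symmetric] by simp
  then have "M \<noteq> 0" "t \<noteq> 0" by auto
  then show "1 \<le> M" "1 \<le> t" by auto
  then have Mk: "M \<le> 2 ^ k" using assms(3) by simp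
  show "{..<2 ^ b} \<noteq> ({}::nat set)" by (simp add: lessThan_empty_iff)
  show "mult_shift u k \<omega> B < 2 ^ k" for \<omega> B using assms(2) by (intro mult_shift_less) simp
  show "real (card {\<omega> \<in> {..<2 ^ b}. mult_shift u k \<omega> B = x}) = real (card {..<2 ^ b :: nat}) / real (2 ^ k)"
    if "x < 2 ^ k" for B x
  proof -
    have ku: "k \<le> u" using assms(2) by simp
    have "real (card {\<omega> \<in> {..<2 ^ b}. mult_shift u k \<omega> B = x} * 2 ^ k) = real (2 ^ b)"
      by (simp only: card_mult_shift_single[OF assms(1) ku that])
    then show ?thesis by (simp add: field_simps)
  qed
  show "real (card {\<omega> \<in> {..<2 ^ b}. mult_shift u k \<omega> B = x \<and> mult_shift u k \<omega> B' = y})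
      \<le> real (card {..<2 ^ b :: nat}) / real (2 ^ k) ^ 2"
    if "B < M" "B' < M" "B \<noteq> B'" "x < 2 ^ k" for B B' x y
  proof -
    have "B < 2 ^ k" "B' < 2 ^ k" using that Mk by auto
    from card_mult_shift_pair[OF assms(1,2) this that(3,4), of y]
    have "real (card {\<omega> \<in> {..<2 ^ b}. mult_shift u k \<omega> B = x \<and> mult_shift u k \<omega> B' = y} * (2 ^ k) ^ 2) \<le> real (2 ^ b)"
      by (rule of_nat_mono)
    then show ?thesis by (simp add: field_simps)
  qed
qed (use assms in auto)

section \<open>Searching, dyadic intervals and medians\<close>

text \<open>Sets the bits of the answer greedily from the top. Only positive positions are tested,
  so 0 is the default if none satisfies \<open>Q\<close>.\<close>

definition descend :: "nat \<Rightarrow> (nat \<Rightarrow> bool) \<Rightarrow> nat" where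
  "descend nb Q = iterate nb (\<lambda>j p. if Q (p + 2 ^ (nb - 1 - j)) then p + 2 ^ (nb - 1 - j) else p) 0"

lemma descend_step_bound:
  assumes "j \<le> nb"
  shows "iterate j (\<lambda>j p. if Q (p + 2 ^ (nb - 1 - j)) then p + 2 ^ (nb - 1 - j) else p) 0 + 2 ^ (nb - j)
    \<le> (2::nat) ^ nb"
  using assms
proof (induction j)
  case (Suc j)
  have "nb - j = Suc (nb - Suc j)" using Suc.prems by simp
  then have "(2::nat) ^ (nb - j) = 2 ^ (nb - Suc j) + 2 ^ (nb - Suc j)" by simp
  then show ?case using Suc by auto
qed simp

lemma descend_correct:
  assumes mono: "\<And>p p'. p' \<le> p \<Longrightarrow> 0 < p' \<Longrightarrow> Q p \<Longrightarrow> Q p'"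
  shows "descend nb Q < 2 ^ nb" "descend nb Q = 0 \<or> Q (descend nb Q)"
    "\<And>p. descend nb Q < p \<Longrightarrow> p < 2 ^ nb \<Longrightarrow> \<not> Q p"
proof -
  define it where "it = (\<lambda>j. iterate j (\<lambda>j p. if Q (p + 2 ^ (nb - 1 - j)) then p + 2 ^ (nb - 1 - j) else p) 0)"
  have it0: "it 0 = 0" by (simp add: it_def)
  have itS: "it (Suc j) = (if Q (it j + 2 ^ (nb - Suc j)) then it j + 2 ^ (nb - Suc j) else it j)" for j
    by (simp add: it_def)
  have inv: "(it j = 0 \<or> Q (it j)) \<and> (\<forall>p. it j + 2 ^ (nb - j) \<le> p \<and> p < 2 ^ nb \<longrightarrow> \<not> Q p)"
    if "j \<le> nb" for j
    using that
  proof (induction j)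
    case 0
    then show ?case by (auto simp: it0)
  next
    case (Suc j)
    define s where "s = (2::nat) ^ (nb - Suc j)"
    define P where "P = it j"
    have "nb - j = Suc (nb - Suc j)" using Suc.prems by simp
    then have e: "(2::nat) ^ (nb - j) = s + s" by (simp add: s_def)
    have IH: "P = 0 \<or> Q P" "\<And>p. P + (s + s) \<le> p \<Longrightarrow> p < 2 ^ nb \<Longrightarrow> \<not> Q p"
      using Suc unfolding e P_def by auto
    show ?case
    proof (cases "Q (P + s)")
      case True
      then have "it (Suc j) = P + s" by (simp add: itS P_def s_def)
      then show ?thesis unfolding s_def[symmetric] using True IH(2) by (auto simp: add.assoc)
    next
      case False
      then have eq: "it (Suc j) = P" by (simp add: itS P_def s_def)
      have s0: "0 < P + s" by (simp add: s_def)
      have "\<not> Q p" if "P + s \<le> p" for p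
        using mono[OF that s0] False by blast
      then show ?thesis unfolding s_def[symmetric] eq using IH(1) by blast
    qed
  qed
  have d: "descend nb Q = it nb" by (simp add: it_def descend_def)
  show "descend nb Q < 2 ^ nb" using descend_step_bound[of nb nb Q] by (simp add: descend_def)
  show "descend nb Q = 0 \<or> Q (descend nb Q)" using inv[of nb] by (simp add: d)
  show "\<not> Q p" if "descend nb Q < p" "p < 2 ^ nb" for p
    using inv[of nb] that by (simp add: d)
qed

lemma descend_eqI:
  assumes mono: "\<And>p p'. p' \<le> p \<Longrightarrow> 0 < p' \<Longrightarrow> Q p \<Longrightarrow> Q p'"
    and "d < 2 ^ nb" "d = 0 \<or> Q d" "\<not> Q (Suc d)"
  shows "descend nb Q = d"
proof (rule antisym)
  show "descend nb Q \<le> d"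
  proof (rule ccontr)
    assume "\<not> descend nb Q \<le> d"
    then have "Suc d \<le> descend nb Q" "descend nb Q \<noteq> 0" by auto
    then have "Q (Suc d)" using descend_correct(2)[where Q = Q and nb = nb, OF mono] mono[of "Suc d" "descend nb Q"] by auto
    then show False using assms(4) by simp
  qed
  show "d \<le> descend nb Q"
  proof (rule ccontr)
    assume "\<not> d \<le> descend nb Q"
    then show False using descend_correct(3)[where Q = Q and nb = nb and p = d, OF mono] assms(2,3) by auto
  qed
qed

text \<open>This is how logarithms are obtained without loops of variable length: \<open>nb\<close>
  rounds suffice for any bit length below \<open>nb\<close>.\<close>

lemma iterate_count_up:
  assumes "\<not> P L"
  shows "iterate nb (\<lambda>j l. if P l then Suc l else l) 0 = min nb (LEAST l. \<not> P l)"
proof -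
  define K where "K = (LEAST l. \<not> P l)"
  have K: "\<not> P K" unfolding K_def by (rule LeastI[of "\<lambda>l. \<not> P l", OF assms])
  have lt: "P l" if "l < K" for l using that not_less_Least[of l "\<lambda>l. \<not> P l"] unfolding K_def by blast
  have "iterate nb (\<lambda>j l. if P l then Suc l else l) 0 = min nb K"
  proof (induction nb)
    case (Suc nb)
    show ?case
    proof (cases "nb < K")
      case True
      then show ?thesis using Suc lt[OF True] by simp
    next
      case False
      then have "min nb K = K" "min (Suc nb) K = K" by simp_all
      then show ?thesis using Suc K by simp
    qed
  qed simp
  then show ?thesis by (simp only: K_def)
qed

lemma sum_lessThan_add: "(\<Sum>z<(c + a::nat). F z) = (\<Sum>z<c. F z) + (\<Sum>x<a. F (c + x) :: 'b::comm_monoid_add)"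
  by (induction a) (simp_all add: add.assoc)

text \<open>Lets a single loop over a product stand for nested sums.\<close>

lemma sum_mod_div:
  fixes f :: "nat \<Rightarrow> nat \<Rightarrow> 'b::comm_monoid_add"
  assumes "0 < a"
  shows "(\<Sum>z<a * b. f (z mod a) (z div a)) = (\<Sum>x<a. \<Sum>y<b. f x y)"
proof (induction b)
  case (Suc b)
  have "(\<Sum>z<a * Suc b. f (z mod a) (z div a)) = (\<Sum>z<a * b + a. f (z mod a) (z div a))"
    by (simp only: mult_Suc_right add.commute)
  also have "\<dots> = (\<Sum>x<a. \<Sum>y<b. f x y) + (\<Sum>x<a. f ((a * b + x) mod a) ((a * b + x) div a))"
    unfolding sum_lessThan_add Suc.IH ..
  also have "(\<Sum>x<a. f ((a * b + x) mod a) ((a * b + x) div a)) = (\<Sum>x<a. f x b)"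
    by (intro sum.cong) (use assms in auto)
  finally show ?case by (simp add: sum.distrib)
qed simp

subsection \<open>Dyadic pieces of an interval\<close>

text \<open>
  The interval \<open>{lo..hi}\<close> is a disjoint union of dyadic intervals, at most one at either end on
  every level; \<open>piece\<close> is 1 plus the number of that interval, or 0 if there is none.
\<close>

definition piece :: "nat \<Rightarrow> nat \<Rightarrow> nat \<Rightarrow> nat \<Rightarrow> nat" where
  "piece lo hi i s = (let l = (lo + 2 ^ i - 1) div 2 ^ i; r = (hi + 1) div 2 ^ i in
     if l < r then (if s \<noteq> 0 then (if odd r then r else 0) else (if odd l then l + 1 else 0)) else 0)"

text \<open>The nonempty interval from \<open>l\<close> to \<open>r - 1\<close> gives up
  \<open>l\<close> if \<open>l\<close> is odd and \<open>r - 1\<close> if \<open>r\<close> is odd;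
  what remains is a union of sibling pairs and can be halved.\<close>

lemma dyadic_step:
  fixes l r x :: nat
  shows "(of_bool (l \<le> x \<and> x < r) :: nat) = of_bool (l < r \<and> odd l \<and> x = l) +
    of_bool (l < r \<and> odd r \<and> x + 1 = r) + of_bool ((l + 1) div 2 \<le> x div 2 \<and> x div 2 < r div 2)"
proof -
  obtain a where "l = 2 * a \<or> l = 2 * a + 1" by (metis oddE evenE)
  moreover obtain c where "r = 2 * c \<or> r = 2 * c + 1" by (metis oddE evenE)
  moreover obtain y where "x = 2 * y \<or> x = 2 * y + 1" by (metis oddE evenE)
  ultimately show ?thesis by (elim disjE) (simp_all add: of_bool_def, (linarith | arith)+)
qed

lemma sum_piece:
  assumes "hi < 2 ^ w"
  shows "(\<Sum>i<Suc w. \<Sum>s<2. of_bool (piece lo hi i s = x div 2 ^ i + 1)) = (of_bool (lo \<le> x \<and> x \<le> hi) :: nat)"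
proof -
  \<comment> \<open>\<open>L\<close> is the ceiling of \<open>lo / 2 ^ i\<close> and
    \<open>R\<close> the floor of \<open>(hi + 1) / 2 ^ i\<close>; between them lies the part not
    yet covered by pieces of lower levels.\<close>
  define L where "L = (\<lambda>i. (lo + 2 ^ i - 1) div (2::nat) ^ i)"
  define R where "R = (\<lambda>i. (hi + 1) div (2::nat) ^ i)"
  have L: "L (Suc i) = (L i + 1) div 2" for i
  proof -
    have "1 \<le> (2::nat) ^ i" by simp
    then have "lo + 2 ^ Suc i - 1 = (lo + 2 ^ i - 1) + 2 ^ i" by simp
    then have "L (Suc i) = ((lo + 2 ^ i - 1) + 2 ^ i) div (2 ^ i * 2)" by (simp add: L_def mult.commute)
    also have "\<dots> = ((lo + 2 ^ i - 1) + 2 ^ i) div 2 ^ i div 2" by (rule div_mult2_eq)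
    finally show ?thesis by (simp add: L_def)
  qed
  have R: "R (Suc i) = R i div 2" for i
    by (simp add: R_def mult.commute[of 2] div_mult2_eq)
  have X: "x div 2 ^ Suc i = x div 2 ^ i div 2" for i
    by (simp add: mult.commute[of 2] div_mult2_eq)
  have p: "(\<Sum>s<2. of_bool (piece lo hi i s = x div 2 ^ i + 1)) =
      (of_bool (L i < R i \<and> odd (L i) \<and> x div 2 ^ i = L i) +
      of_bool (L i < R i \<and> odd (R i) \<and> x div 2 ^ i + 1 = R i) :: nat)" for i
    by (auto simp: numeral_2_eq_2 piece_def Let_def L_def R_def)
  have "(of_bool (L 0 \<le> x \<and> x < R 0) :: nat) =
      (\<Sum>i<j. \<Sum>s<2. of_bool (piece lo hi i s = x div 2 ^ i + 1)) +
      of_bool (L j \<le> x div 2 ^ j \<and> x div 2 ^ j < R j)" for j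
  proof (induction j)
    case (Suc j)
    then show ?case
      using dyadic_step[of "L j" "x div 2 ^ j" "R j"] unfolding sum.lessThan_Suc p L R X by linarith
  qed simp
  from this[of "Suc w"] have "(of_bool (L 0 \<le> x \<and> x < R 0) :: nat) =
      (\<Sum>i<Suc w. \<Sum>s<2. of_bool (piece lo hi i s = x div 2 ^ i + 1)) +
      of_bool (L (Suc w) \<le> x div 2 ^ Suc w \<and> x div 2 ^ Suc w < R (Suc w))" .
  \<comment> \<open>\<open>hi + 1\<close> is at most \<open>2 ^ w\<close>, so nothing remains after
    level \<open>w\<close>.\<close>
  moreover have "R (Suc w) = 0" using assms by (simp add: R_def)
  ultimately show ?thesis by (simp add: L_def R_def less_Suc_eq_le)
qed

subsection \<open>Slope codes\<close>

text \<open>Numerator of the slope increased by \<open>2 ^ W\<close>. The shift makes all slopes of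
  points in the grid positive.\<close>

definition slope_num :: "nat \<Rightarrow> nat \<Rightarrow> nat \<Rightarrow> nat \<Rightarrow> nat \<Rightarrow> nat" where
  "slope_num W x y x' y' = y' + (x' - x) * 2 ^ W - y"

text \<open>The shifted slope in fixed point with \<open>2 * W\<close> binary digits after the
  point, rounded down.\<close>

definition slope_code :: "nat \<Rightarrow> nat \<Rightarrow> nat \<Rightarrow> nat \<Rightarrow> nat \<Rightarrow> nat" where
  "slope_code W x y x' y' = slope_num W x y x' y' * 2 ^ (2 * W) div (x' - x)"

lemma slope_num_real:
  assumes "y < 2 ^ W" "x < x'"
  shows "(real y' - real y) / (real x' - real x) = real (slope_num W x y x' y') / real (x' - x) - 2 ^ W"
proof -
  have "2 ^ W \<le> (x' - x) * 2 ^ W" using assms by simp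
  then have "y \<le> y' + (x' - x) * 2 ^ W" using assms by linarith
  then have "real (slope_num W x y x' y') = real y' + real (x' - x) * 2 ^ W - real y"
    by (simp add: slope_num_def of_nat_diff)
  moreover have "real (x' - x) = real x' - real x" "real x' - real x > 0" using assms by auto
  ultimately show ?thesis by (simp add: field_simps)
qed

text \<open>Different fractions with denominators \<open>d\<close> and \<open>d'\<close> are at
  least \<open>1 / (d * d')\<close> apart. Scaling by \<open>s\<close> makes the distance at least
  1, which survives rounding down.\<close>

lemma div_less_of_fraction_less:
  fixes a d a' d' s :: nat
  assumes "a * d' < a' * d" "0 < d" "0 < d'" "d * d' \<le> s"
  shows "a * s div d < a' * s div d'"
proof -
  define c where "c = a * s div d"
  have "c * d \<le> a * s" by (simp add: c_def)
  have "(c + 1) * d' * d = c * d * d' + d * d'" by (simp add: algebra_simps)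
  also have "\<dots> \<le> a * s * d' + s"
    using mult_le_mono1[OF \<open>c * d \<le> a * s\<close>, of d'] assms(4) by linarith
  also have "\<dots> = (a * d' + 1) * s" by (simp add: algebra_simps)
  also have "\<dots> \<le> (a' * d) * s" using assms(1) by (intro mult_le_mono1) simp
  finally have "(c + 1) * d' * d \<le> a' * s * d" by (simp add: algebra_simps)
  then have "(c + 1) * d' \<le> a' * s" using assms(2) by simp
  then have "c + 1 \<le> a' * s div d'" using assms(3) by (simp add: less_eq_div_iff_mult_less_eq)
  then show ?thesis by (simp add: c_def)
qed

lemma slope_code_mono:
  assumes "y < 2 ^ W" "x1 < x2" "y' < 2 ^ W" "x1' < x2'" "x2 < 2 ^ W" "x2' < 2 ^ W"
    "(real y2 - real y) / (real x2 - real x1) < (real y2' - real y') / (real x2' - real x1')"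
  shows "slope_code W x1 y x2 y2 < slope_code W x1' y' x2' y2'"
proof -
  let ?a = "slope_num W x1 y x2 y2" and ?a' = "slope_num W x1' y' x2' y2'"
  have "real ?a / real (x2 - x1) < real ?a' / real (x2' - x1')"
    using assms(7) unfolding slope_num_real[OF assms(1,2)] slope_num_real[OF assms(3,4)] by simp
  then have "real ?a * real (x2' - x1') < real ?a' * real (x2 - x1)"
    using assms(2,4) by (simp add: field_simps)
  then have "?a * (x2' - x1') < ?a' * (x2 - x1)"
    unfolding of_nat_mult[symmetric] of_nat_less_iff .
  moreover have "(x2 - x1) * (x2' - x1') \<le> 2 ^ W * 2 ^ W"
    using assms by (intro mult_le_mono) auto
  then have "(x2 - x1) * (x2' - x1') \<le> 2 ^ (2 * W)" by (simp add: mult_2 power_add)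
  ultimately show ?thesis unfolding slope_code_def
    using assms(2,4) by (intro div_less_of_fraction_less) auto
qed

lemma slope_code_bound:
  assumes "y' < 2 ^ w" "x < x'" "x' < 2 ^ w"
  shows "slope_code (Suc w) x y x' y' < 2 ^ (4 * Suc w)"
    and "slope_num (Suc w) x y x' y' \<le> 2 ^ (2 * Suc w)"
proof -
  let ?W = "Suc w"
  have d: "1 \<le> x' - x" "x' - x < 2 ^ w" using assms by auto
  have "slope_num ?W x y x' y' \<le> y' + (x' - x) * 2 ^ ?W" by (simp add: slope_num_def)
  also have "\<dots> \<le> (x' - x) * 2 ^ w + (x' - x) * 2 ^ ?W"
  proof -
    have "1 * 2 ^ w \<le> (x' - x) * 2 ^ w" using d(1) by (rule mult_le_mono1)
    then have "y' \<le> (x' - x) * 2 ^ w" using assms(1) by linarith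
    then show ?thesis by (rule add_le_mono1)
  qed
  finally have a: "slope_num ?W x y x' y' \<le> (x' - x) * (2 ^ w + 2 ^ ?W)" by (simp add: add_mult_distrib2)
  then have "slope_num ?W x y x' y' * 2 ^ (2 * ?W) \<le> (x' - x) * ((2 ^ w + 2 ^ ?W) * 2 ^ (2 * ?W))"
    by (simp only: mult.assoc[symmetric] mult_le_mono1)
  then have "slope_code ?W x y x' y' \<le> (x' - x) * ((2 ^ w + 2 ^ ?W) * 2 ^ (2 * ?W)) div (x' - x)"
    unfolding slope_code_def by (rule div_le_mono)
  also have "\<dots> = (2 ^ w + 2 ^ ?W) * 2 ^ (2 * ?W)" using d(1) by simp
  also have "\<dots> < 2 ^ (2 * ?W) * 2 ^ (2 * ?W)"
  proof (rule mult_less_mono1)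
    have "(2::nat) ^ w + 2 ^ ?W < 4 * 2 ^ w" by simp
    also have "\<dots> \<le> 4 * (2 ^ w * 2 ^ w)" by simp
    also have "\<dots> = 2 ^ (2 * ?W)" by (simp add: mult_2 power_add)
    finally show "(2::nat) ^ w + 2 ^ ?W < 2 ^ (2 * ?W)" .
  qed simp
  also have "\<dots> = 2 ^ (2 * ?W + 2 * ?W)" by (rule power_add[symmetric])
  also have "2 * ?W + 2 * ?W = 4 * ?W" by simp
  finally show "slope_code ?W x y x' y' < 2 ^ (4 * ?W)" .
  have "(x' - x) * (2 ^ w + 2 ^ ?W) \<le> 2 ^ w * (2 ^ w + 2 ^ ?W)" using d by (intro mult_le_mono1) simp
  also have "\<dots> \<le> 2 ^ (2 * ?W)" by (simp add: mult_2 power_add add_mult_distrib2)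
  finally show "slope_num ?W x y x' y' \<le> 2 ^ (2 * ?W)" using a by (rule order_trans[rotated])
qed

subsection \<open>Selecting from a multiset\<close>

lemma length_filter_slopes:
  assumes "finite I"
  shows "length (filter P (sorted_list_of_multiset (image_mset f (mset_set I)))) = card {i \<in> I. P (f i)}"
proof -
  have "length (filter P (sorted_list_of_multiset (image_mset f (mset_set I)))) =
      size (filter_mset P (image_mset f (mset_set I)))"
    by (metis mset_filter mset_sorted_list_of_multiset size_mset)
  also have "\<dots> = size (filter_mset (\<lambda>i. P (f i)) (mset_set I))"
    by (simp add: filter_mset_image_mset)
  also have "\<dots> = card {i \<in> I. P (f i)}" using assms by (simp add: filter_mset_mset_set)
  finally show ?thesis .
qed

lemma nth_sorted_by_counts:
  fixes xs :: "'a::linorder list"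
  assumes "sorted xs" "r < length xs" "length (filter (\<lambda>x. x < v) xs) \<le> r"
    "r < length (filter (\<lambda>x. x \<le> v) xs)"
  shows "xs ! r = v"
proof (rule antisym)
  show "xs ! r \<le> v"
  proof (rule ccontr)
    assume "\<not> xs ! r \<le> v"
    then have "{i. i < length xs \<and> xs ! i \<le> v} \<subseteq> {..<r}"
      using assms(1) by (auto simp: not_le) (meson leI order.strict_trans1 order.trans sorted_nth_mono not_le)
    then have "card {i. i < length xs \<and> xs ! i \<le> v} \<le> r"
      using card_mono[of "{..<r}"] by fastforce
    then show False using assms(4) by (simp add: length_filter_conv_card)
  qed
  show "v \<le> xs ! r"
  proof (rule ccontr)
    assume "\<not> v \<le> xs ! r"
    then have "{..r} \<subseteq> {i. i < length xs \<and> xs ! i < v}"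
      using assms(1,2) by (auto simp: not_le) (meson le_less_trans sorted_nth_mono)
    then have "card {..r} \<le> card {i. i < length xs \<and> xs ! i < v}"
      by (intro card_mono) auto
    then show False using assms(3) by (simp add: length_filter_conv_card)
  qed
qed

text \<open>Selection only sees the codes \<open>g\<close>. As \<open>f i < f j\<close> forces
  \<open>g i < g j\<close>, the codes below \<open>g e\<close> include those of all smaller slopes,
  and the codes up to \<open>g e\<close> belong to slopes up to \<open>f e\<close> only.\<close>

lemma nth_slope_by_counts:
  fixes f :: "'i \<Rightarrow> real" and g :: "'i \<Rightarrow> nat"
  assumes "finite I" "\<And>i j. i \<in> I \<Longrightarrow> j \<in> I \<Longrightarrow> f i < f j \<Longrightarrow> g i < g j"
    and "e \<in> I" "card {i \<in> I. g i < g e} \<le> r" "r < card {i \<in> I. g i < g e + 1}"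
  shows "sorted_list_of_multiset (image_mset f (mset_set I)) ! r = f e"
proof (rule nth_sorted_by_counts)
  let ?xs = "sorted_list_of_multiset (image_mset f (mset_set I))"
  have 1: "{i \<in> I. f i < f e} \<subseteq> {i \<in> I. g i < g e}" using assms(2,3) by auto
  have 2: "{i \<in> I. g i < g e + 1} \<subseteq> {i \<in> I. f i \<le> f e}"
  proof
    fix i assume i: "i \<in> {i \<in> I. g i < g e + 1}"
    show "i \<in> {i \<in> I. f i \<le> f e}"
    proof (rule ccontr)
      assume "i \<notin> {i \<in> I. f i \<le> f e}"
      then have "g e < g i" using assms(2)[of e i] assms(3) i by auto
      then show False using i by simp
    qed
  qed
  show "length (filter (\<lambda>x. x < f e) ?xs) \<le> r"
    unfolding length_filter_slopes[OF assms(1)] using card_mono[OF _ 1] assms(1,4) by simp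
  show "r < length (filter (\<lambda>x. x \<le> f e) ?xs)"
    unfolding length_filter_slopes[OF assms(1)] using card_mono[OF _ 2] assms(1,5) by simp
  then show "r < length ?xs" by (rule less_le_trans) (rule length_filter_le)
  show "sorted ?xs" by (rule sorted_sorted_list_of_multiset)
qed

text \<open>For odd \<open>m\<close> both indices coincide, so a single formula serves both
  parities.\<close>

lemma median_eq:
  assumes "size M = m" "0 < m"
  shows "median M = (sorted_list_of_multiset M ! ((m - 1) div 2) + sorted_list_of_multiset M ! (m div 2)) / 2"
proof -
  have len: "length (sorted_list_of_multiset M) = m"
    using assms(1) by (metis mset_sorted_list_of_multiset size_mset)
  show ?thesis
  proof (cases "odd m")
    case True
    then have "(m - 1) div 2 = m div 2" by presburger
    then show ?thesis using True by (simp add: median_def Let_def len)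
  next
    case False
    then have "(m - 1) div 2 = m div 2 - 1" using assms(2) by presburger
    then show ?thesis using False by (simp add: median_def Let_def len)
  qed
qed

section \<open>The data structure\<close>

subsection \<open>Parameters\<close>

text \<open>\<open>n \<le> 2 ^ (2 * w)\<close> holds for distinct points of the grid and lets all
  sizes polynomial in \<open>n\<close> fit into \<open>O(w)\<close> bits. The bound on
  \<open>K\<close> provides words of at least \<open>C + 100 * WW\<close> bits.\<close>

locale params =
  fixes K C n w q :: nat
  assumes n1: "1 \<le> n" and nw: "n \<le> 2 ^ (2 * w)" and q1: "1 \<le> q" and qn: "q \<le> n"
    and C1: "1 \<le> C" and K: "100 + C \<le> K"
begin

text \<open>\<open>WW\<close> is the number of dyadic levels and \<open>lt4\<close> the logarithm of
  \<open>tt\<close>, the largest power of two whose fourth power is at most \<open>q\<close>. The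
  \<open>NW\<close> elements are padded to the power of two \<open>NN\<close>. There are
  \<open>MM\<close> blocks, \<open>TT\<close> tables with \<open>mm\<close> chains each,
  \<open>RR\<close> seeds, and \<open>LV\<close> choices of four levels and four ends of intervals.
  The structure consists of header and points, leaders from \<open>LB\<close>, seeds from
  \<open>SB\<close> and sorted chain words from \<open>CB\<close> up to \<open>EN\<close>. Hashing
  is done modulo \<open>2 ^ uu\<close>; \<open>18 * WW\<close> leaves room for twice the
  \<open>8 * WW\<close> bits of an element.\<close>

definition "WW = Suc w"
definition "bb = K * WW"
definition "lt4 = (LEAST l. \<not> 2 ^ (4 * Suc l) \<le> q)"
definition "tt = (2::nat) ^ lt4"
definition "NW = n * n * WW ^ 4"
definition "kk = Suc (LEAST l. \<not> 2 ^ Suc l < NW)"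
definition "NN = (2::nat) ^ kk"
definition "MM = (2::nat) ^ (kk - lt4)"
definition "mm = (2::nat) ^ (kk - 2 * lt4 - 1)"
definition "TT = C * tt * kk"
definition "RR = TT * tt"
definition "LV = 16 * WW ^ 4"
definition "LB = 3 + 2 * n"
definition "SB = LB + MM + 1"
definition "CB = SB + RR"
definition "TM = TT * mm"
definition "EN = CB + TM"
definition "uu = 18 * WW"

section \<open>Sizes of the parameters and the word length\<close>

lemma tt4_pow: "tt ^ 4 = 2 ^ (4 * lt4)"
  by (simp only: tt_def power_mult[symmetric] mult.commute)

lemma tt4: "tt ^ 4 \<le> q" "q < 16 * tt ^ 4"
proof -
  have "q < 2 ^ q" by (rule less_exp)
  also have "(2::nat) ^ q \<le> 2 ^ (4 * Suc q)" by (rule power_increasing) auto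
  finally have ex: "\<not> 2 ^ (4 * Suc q) \<le> q" by simp
  have "\<not> 2 ^ (4 * Suc lt4) \<le> q"
    unfolding lt4_def by (rule LeastI[of "\<lambda>l. \<not> 2 ^ (4 * Suc l) \<le> q", OF ex])
  moreover have "(2::nat) ^ (4 * Suc lt4) = 16 * tt ^ 4"
    unfolding tt4_pow by (simp add: power_add)
  ultimately show "q < 16 * tt ^ 4" by simp
  show "tt ^ 4 \<le> q"
  proof (cases lt4)
    case 0
    then show ?thesis using q1 by (simp add: tt_def)
  next
    case (Suc l)
    have "l < (LEAST l. \<not> 2 ^ (4 * Suc l) \<le> q)" using Suc by (simp add: lt4_def)
    from not_less_Least[OF this] have "2 ^ (4 * Suc l) \<le> q" by simp
    moreover have "(2::nat) ^ (4 * Suc l) = tt ^ 4"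
      unfolding tt_def Suc by (simp only: power_mult[symmetric] mult.commute)
    ultimately show ?thesis by simp
  qed
qed

lemma lt4_le: "4 * lt4 \<le> 2 * w"
proof -
  have "(2::nat) ^ (4 * lt4) \<le> 2 ^ (2 * w)"
    using tt4(1) qn nw unfolding tt4_pow by linarith
  then show ?thesis by (rule power_le_imp_le_exp[rotated]) simp
qed

lemma WW_pow: "WW \<le> 2 ^ w" "1 \<le> WW" unfolding WW_def by (simp_all add: Suc_leI)

lemma NW_le: "NW \<le> 2 ^ (8 * w)"
proof -
  have "n * n * WW ^ 4 \<le> 2 ^ (2 * w) * 2 ^ (2 * w) * (2 ^ w) ^ 4"
    by (intro mult_le_mono power_mono nw WW_pow) simp
  also have "((2::nat) ^ w) ^ 4 = 2 ^ (w * 4)" by (rule power_mult[symmetric])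
  also have "(2::nat) ^ (2 * w) * 2 ^ (2 * w) * 2 ^ (w * 4) = 2 ^ (8 * w)" by (simp add: power_add[symmetric])
  finally show ?thesis unfolding NW_def .
qed

lemma n_le_NW: "n \<le> NW"
proof -
  have "n * 1 * 1 \<le> n * n * WW ^ 4" using n1 WW_pow by (intro mult_le_mono) simp_all
  then show ?thesis by (simp add: NW_def)
qed

lemma NW1: "1 \<le> NW" using n1 WW_pow by (simp add: NW_def)

lemma kk_le: "kk \<le> 8 * WW"
proof -
  have "NW \<le> 2 ^ Suc (8 * w)" using NW_le by simp
  then have "(LEAST l. \<not> 2 ^ Suc l < NW) \<le> 8 * w"
    by (intro Least_le) simp
  then show ?thesis by (simp add: kk_def WW_def)
qed

lemma NN_bounds: "NW \<le> NN" "NN \<le> 2 * NW"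
proof -
  have ex: "\<not> 2 ^ Suc (8 * w) < NW" using NW_le by simp
  have "\<not> 2 ^ Suc (LEAST l. \<not> 2 ^ Suc l < NW) < NW"
    by (rule LeastI[of "\<lambda>l. \<not> 2 ^ Suc l < NW", OF ex])
  then show "NW \<le> NN" by (simp add: NN_def kk_def)
  show "NN \<le> 2 * NW"
  proof (cases "LEAST l. \<not> 2 ^ Suc l < NW")
    case 0
    then show ?thesis using NW1 by (simp add: NN_def kk_def)
  next
    case (Suc l)
    then have "l < (LEAST l. \<not> 2 ^ Suc l < NW)" by simp
    from not_less_Least[OF this] have "2 ^ Suc l < NW" by simp
    moreover have "kk = Suc (Suc l)" by (simp only: kk_def Suc)
    ultimately show ?thesis by (simp add: NN_def)
  qed
qed

text \<open>Ensures that the subtractions in the exponent of \<open>mm\<close> are exact: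
  \<open>tt ^ 4 \<le> n \<le> NN\<close> gives \<open>4 * lt4 \<le> kk\<close>, and for
  \<open>tt = 1\<close> the successor in the definition of \<open>kk\<close> suffices.\<close>

lemma lt4_kk: "2 * lt4 + 1 \<le> kk"
proof (cases "lt4 = 0")
  case True
  then show ?thesis by (simp add: kk_def)
next
  case False
  have "(2::nat) ^ (4 * lt4) = tt ^ 4" by (simp only: tt_def power_mult[symmetric] mult.commute)
  also have "\<dots> \<le> n" using tt4(1) qn by simp
  also have "n \<le> NW" by (rule n_le_NW)
  also have "\<dots> \<le> 2 ^ kk" using NN_bounds(1) by (simp add: NN_def)
  finally have "4 * lt4 \<le> kk" by simp
  then show ?thesis using False by simp
qed

lemma NN_MM: "NN = MM * tt"
  using lt4_kk by (simp add: NN_def MM_def tt_def power_add[symmetric])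

lemma MM_mm: "2 * mm * tt = MM"
proof -
  have "MM = 2 ^ (Suc (kk - 2 * lt4 - 1) + lt4)" unfolding MM_def using lt4_kk by (intro arg_cong[of _ _ "power 2"]) simp
  then show ?thesis by (simp add: mm_def tt_def power_add)
qed

lemma pos: "0 < tt" "0 < NN" "0 < MM" "0 < mm" "0 < kk" "0 < TT" "0 < RR" "0 < TM" "0 < WW"
  using C1 by (simp_all add: tt_def NN_def MM_def mm_def kk_def TT_def RR_def TM_def WW_def)

lemma NN_le: "NN \<le> 2 ^ (8 * WW)" unfolding NN_def using kk_le by (intro power_increasing) auto
lemma tt_le: "tt \<le> 2 ^ WW" unfolding tt_def using lt4_le by (intro power_increasing) (auto simp: WW_def)
lemma MM_le_NN: "MM \<le> NN" unfolding MM_def NN_def by (intro power_increasing) auto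
lemma mm_le_NN: "mm \<le> NN" unfolding mm_def NN_def by (intro power_increasing) auto
lemma mm_le_MM: "mm \<le> MM"
proof -
  have "mm * 1 \<le> mm * (2 * tt)" using pos by (intro mult_le_mono2) simp
  then show ?thesis unfolding MM_mm[symmetric] by (simp add: ac_simps)
qed
lemma n_le: "n \<le> 2 ^ (2 * WW)"
  using nw power_increasing[of "2 * w" "2 * WW" "2::nat"] by (simp add: WW_def)

lemma eight_WW: "8 * WW \<le> 2 ^ (4 * WW)"
proof -
  have "(8::nat) * WW \<le> 2 ^ 3 * 2 ^ w" using WW_pow by simp
  also have "\<dots> = 2 ^ (3 + w)" by (simp only: power_add)
  also have "\<dots> \<le> 2 ^ (4 * WW)" by (rule power_increasing) (auto simp: WW_def)
  finally show ?thesis .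
qed

lemma TT_le: "TT \<le> 2 ^ (C + 5 * WW)"
proof -
  have "C \<le> 2 ^ C" by (rule less_imp_le[OF less_exp])
  then have "TT \<le> 2 ^ C * 2 ^ WW * 2 ^ (4 * WW)"
    unfolding TT_def using tt_le kk_le eight_WW by (intro mult_le_mono) auto
  also have "\<dots> = 2 ^ (C + 5 * WW)" by (simp add: power_add[symmetric])
  finally show ?thesis .
qed

lemma RR_le: "RR \<le> 2 ^ (C + 6 * WW)"
proof -
  have "RR \<le> 2 ^ (C + 5 * WW) * 2 ^ WW" unfolding RR_def by (intro mult_le_mono TT_le tt_le)
  also have "\<dots> = 2 ^ (C + 6 * WW)" by (simp add: power_add[symmetric])
  finally show ?thesis .
qed

lemma TM_le: "TM \<le> 2 ^ (C + 13 * WW)"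
proof -
  have "TM \<le> 2 ^ (C + 5 * WW) * 2 ^ (8 * WW)"
    unfolding TM_def using TT_le mm_le_NN NN_le by (intro mult_le_mono) auto
  also have "\<dots> = 2 ^ (C + 13 * WW)" by (simp add: power_add[symmetric])
  finally show ?thesis .
qed

lemma pow_le: "i \<le> j \<Longrightarrow> (2::nat) ^ i \<le> 2 ^ j" by (rule power_increasing) auto

text \<open>The slack accounts for the work space of the construction and for small offsets, so that
  one inequality serves every address.\<close>

lemma EN_le: "EN + NN + TM + NN + 20 \<le> 2 ^ (C + 20 * WW)"
proof -
  let ?X = "(2::nat) ^ (C + 13 * WW)"
  have "(2::nat) ^ 13 \<le> ?X" using pos by (intro pow_le) (simp add: WW_def)
  moreover have "n \<le> ?X" by (rule order_trans[OF n_le pow_le]) simp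
  moreover have "NN \<le> ?X" by (rule order_trans[OF NN_le pow_le]) simp
  moreover have "RR \<le> ?X" by (rule order_trans[OF RR_le pow_le]) simp
  ultimately have "EN + NN + TM + NN + 20 \<le> 10 * ?X"
    using MM_le_NN TM_le by (simp add: EN_def CB_def SB_def LB_def)
  also have "10 * ?X \<le> 2 ^ (7 * WW) * ?X"
  proof (rule mult_le_mono1)
    have "(10::nat) \<le> 2 ^ 7" by simp
    also have "\<dots> \<le> 2 ^ (7 * WW)" using pos by (intro pow_le) (simp add: WW_def)
    finally show "(10::nat) \<le> 2 ^ (7 * WW)" .
  qed
  also have "\<dots> = 2 ^ (C + 20 * WW)" by (simp add: power_add[symmetric])
  finally show ?thesis .
qed

lemma bb_ge: "C + 100 * WW \<le> bb"
proof -
  have "C \<le> C * WW" using pos by simp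
  moreover have "(100 + C) * WW \<le> K * WW" using K by (rule mult_le_mono1)
  ultimately show ?thesis unfolding bb_def add_mult_distrib by linarith
qed

lemma fits_less:
  assumes "(x::nat) < 2 ^ j" "j \<le> C + 100 * WW" shows "x < 2 ^ bb"
proof -
  have "(2::nat) ^ j \<le> 2 ^ bb" using assms(2) bb_ge by (intro pow_le) linarith
  then show ?thesis using assms(1) by linarith
qed

lemma fits_le:
  assumes "(x::nat) \<le> 2 ^ j" "j < C + 100 * WW" shows "x < 2 ^ bb"
proof -
  have "(2::nat) ^ j < 2 ^ bb" using assms(2) bb_ge by (intro power_strict_increasing) linarith+
  then show ?thesis using assms(1) by linarith
qed

lemma addr_less: "x \<le> EN + NN + TM + NN + 20 \<Longrightarrow> x < 2 ^ bb"
  using EN_le fits_le[of x "C + 20 * WW"] pos by simp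

lemma WW4: "WW ^ 4 \<le> 2 ^ (4 * WW)"
proof -
  have "WW ^ 4 \<le> (2 ^ WW) ^ 4" by (intro power_mono less_imp_le[OF less_exp]) simp
  then show ?thesis by (simp add: power_mult[symmetric] mult.commute)
qed

end

subsection \<open>Keys of pairs of points\<close>

locale inst = params +
  fixes px py :: "nat \<Rightarrow> nat" and rs :: "nat list"
  assumes px: "i < n \<Longrightarrow> px i < 2 ^ w" and py: "i < n \<Longrightarrow> py i < 2 ^ w"
begin

lemma px_less: "i < n \<Longrightarrow> px i < 2 ^ WW" "i < n \<Longrightarrow> py i < 2 ^ WW"
  using px[of i] py[of i] pow_le[of w WW] by (simp_all add: WW_def)

definition "lv1 l = l mod WW"
definition "lv2 l = l div WW mod WW"
definition "lv3 l = l div WW div WW mod WW"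
definition "lv4 l = l div WW div WW div WW mod WW"

definition horner :: "nat \<Rightarrow> nat \<Rightarrow> nat \<Rightarrow> nat \<Rightarrow> nat \<Rightarrow> nat" where
  "horner l v1 v2 v3 v4 = (((l * 2 ^ WW + v1) * 2 ^ WW + v2) * 2 ^ WW + v3) * 2 ^ WW + v4"

text \<open>The low \<open>4 * WW\<close> bits are left free for a slope code.\<close>

definition base :: "nat \<Rightarrow> nat \<Rightarrow> nat \<Rightarrow> nat \<Rightarrow> nat \<Rightarrow> nat" where
  "base l v1 v2 v3 v4 = horner l v1 v2 v3 v4 * 2 ^ (4 * WW)"

definition code :: "nat \<Rightarrow> nat \<Rightarrow> nat" where
  "code i j = slope_code WW (px i) (py i) (px j) (py j)"

text \<open>
  The number \<open>e\<close> stands for a pair of points with a dyadic interval around each of their four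
  coordinates (given by the levels encoded in \<open>l\<close>). Keys order these first by intervals and
  then by slope; numbers that do not encode a pair come last.
\<close>

definition hi :: "nat \<Rightarrow> nat" where
  "hi e = (let i = e mod n; j = e div n mod n; l = e div n div n in
     if e < NW \<and> px i < px j
     then base l (px i div 2 ^ lv1 l) (py i div 2 ^ lv2 l) (px j div 2 ^ lv3 l) (py j div 2 ^ lv4 l) + code i j
     else 2 ^ (12 * WW))"

text \<open>Appending \<open>e\<close> makes keys distinct and allows the element to be read off a
  key that was found by searching.\<close>

definition key :: "nat \<Rightarrow> nat" where
  "key e = hi e * 2 ^ (8 * WW) + e"

lemma code_less: "i < n \<Longrightarrow> j < n \<Longrightarrow> px i < px j \<Longrightarrow> code i j < 2 ^ (4 * WW)"
  unfolding code_def WW_def by (intro slope_code_bound px py)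

lemma digit_step: "v < u \<Longrightarrow> v' < u \<Longrightarrow> (a * u + v = a' * u + v') \<longleftrightarrow> a = a' \<and> v = (v'::nat)"
proof
  assume v: "v < u" "v' < u" and e: "a * u + v = a' * u + v'"
  have "(a * u + v) div u = a" "(a' * u + v') div u = a'" using v by simp_all
  then have "a = a'" unfolding e by simp
  then show "a = a' \<and> v = v'" using e by simp
qed simp

lemma horner_eq:
  assumes "v1 < 2 ^ WW" "v2 < 2 ^ WW" "v3 < 2 ^ WW" "v4 < 2 ^ WW"
    "v1' < 2 ^ WW" "v2' < 2 ^ WW" "v3' < 2 ^ WW" "v4' < 2 ^ WW"
  shows "horner l v1 v2 v3 v4 = horner l' v1' v2' v3' v4' \<longleftrightarrow>
    l = l' \<and> v1 = v1' \<and> v2 = v2' \<and> v3 = v3' \<and> v4 = v4'"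
  unfolding horner_def digit_step[OF assms(4,8)] digit_step[OF assms(3,7)] digit_step[OF assms(2,6)]
    digit_step[OF assms(1,5)] by blast

lemma horner_less:
  assumes "v1 < 2 ^ WW" "v2 < 2 ^ WW" "v3 < 2 ^ WW" "v4 < 2 ^ WW" "l < WW ^ 4"
  shows "horner l v1 v2 v3 v4 < 2 ^ (8 * WW)"
proof -
  have step: "a * 2 ^ WW + v < A * 2 ^ WW" if "a < A" "v < 2 ^ WW" for a A v :: nat
  proof -
    have "a * 2 ^ WW + v < Suc a * 2 ^ WW" using that by simp
    also have "\<dots> \<le> A * 2 ^ WW" using that by (intro mult_le_mono1) simp
    finally show ?thesis .
  qed
  have "l < 2 ^ (4 * WW)" using assms(5) WW4 by simp
  then have "horner l v1 v2 v3 v4 < 2 ^ (4 * WW) * 2 ^ WW * 2 ^ WW * 2 ^ WW * 2 ^ WW"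
    unfolding horner_def by (intro step assms(1-4))
  also have "\<dots> = 2 ^ (8 * WW)" by (simp add: power_add[symmetric])
  finally show ?thesis .
qed

lemma base_less:
  assumes "v1 < 2 ^ WW" "v2 < 2 ^ WW" "v3 < 2 ^ WW" "v4 < 2 ^ WW" "l < WW ^ 4"
  shows "base l v1 v2 v3 v4 + 2 ^ (4 * WW) \<le> 2 ^ (12 * WW)"
proof -
  have "(horner l v1 v2 v3 v4 + 1) * 2 ^ (4 * WW) \<le> 2 ^ (8 * WW) * 2 ^ (4 * WW)"
    using horner_less[OF assms] by (intro mult_le_mono1) simp
  also have "\<dots> = 2 ^ (12 * WW)" by (simp add: power_add[symmetric])
  finally show ?thesis by (simp add: base_def)
qed

lemma div_pow_less:
  assumes "x < 2 ^ w" shows "x div 2 ^ i < (2::nat) ^ WW"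
proof -
  have "(2::nat) ^ w \<le> 2 ^ WW" by (rule pow_le) (simp add: WW_def)
  then have "x < 2 ^ WW" using assms by linarith
  then show ?thesis by (rule le_less_trans[OF div_le_dividend])
qed

lemma level_less: "e < NW \<Longrightarrow> e div n div n < WW ^ 4"
proof -
  assume "e < NW"
  moreover have "NW = WW ^ 4 * n * n" by (simp add: NW_def)
  ultimately have "e < WW ^ 4 * n * n" by simp
  from less_mult_imp_div_less[OF less_mult_imp_div_less[OF this]] show ?thesis .
qed

lemma hi_le: "hi e \<le> 2 ^ (12 * WW)"
proof -
  let ?i = "e mod n" and ?j = "e div n mod n" and ?l = "e div n div n"
  have ij: "?i < n" "?j < n" using n1 by simp_all
  show ?thesis
  proof (cases "e < NW \<and> px ?i < px ?j")
    case True
    then have "hi e = base ?l (px ?i div 2 ^ lv1 ?l) (py ?i div 2 ^ lv2 ?l) (px ?j div 2 ^ lv3 ?l)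
        (py ?j div 2 ^ lv4 ?l) + code ?i ?j" by (simp add: hi_def Let_def)
    moreover have "code ?i ?j < 2 ^ (4 * WW)" using True ij by (intro code_less) auto
    moreover note base_less[OF div_pow_less[OF px[OF ij(1)], of "lv1 ?l"]
        div_pow_less[OF py[OF ij(1)], of "lv2 ?l"] div_pow_less[OF px[OF ij(2)], of "lv3 ?l"]
        div_pow_less[OF py[OF ij(2)], of "lv4 ?l"] level_less[OF conjunct1[OF True]]]
    ultimately show ?thesis by linarith
  next
    case False
    then have "hi e = 2 ^ (12 * WW)" unfolding hi_def Let_def by (rule if_not_P)
    then show ?thesis by simp
  qed
qed

text \<open>Division by \<open>2 ^ (4 * WW)\<close> recovers the digits and leaves the slope code as
  remainder, while numbers that encode no pair sit at \<open>2 ^ (12 * WW)\<close>, beyond all these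
  ranges. A count of slopes thereby becomes a difference of two ranks.\<close>

lemma hi_in_base:
  assumes v: "v1 < 2 ^ WW" "v2 < 2 ^ WW" "v3 < 2 ^ WW" "v4 < 2 ^ WW" and l: "l < WW ^ 4"
    and \<sigma>: "\<sigma> \<le> 2 ^ (4 * WW)"
  shows "base l v1 v2 v3 v4 \<le> hi e \<and> hi e < base l v1 v2 v3 v4 + \<sigma> \<longleftrightarrow>
    (let i = e mod n; j = e div n mod n in e < NW \<and> e div n div n = l \<and> px i < px j \<and> code i j < \<sigma> \<and>
      px i div 2 ^ lv1 l = v1 \<and> py i div 2 ^ lv2 l = v2 \<and> px j div 2 ^ lv3 l = v3 \<and> py j div 2 ^ lv4 l = v4)"
proof -
  let ?i = "e mod n" and ?j = "e div n mod n" and ?l = "e div n div n"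
  have ij: "?i < n" "?j < n" using n1 by simp_all
  show ?thesis
  proof (cases "e < NW \<and> px ?i < px ?j")
    case True
    let ?h = "horner ?l (px ?i div 2 ^ lv1 ?l) (py ?i div 2 ^ lv2 ?l) (px ?j div 2 ^ lv3 ?l) (py ?j div 2 ^ lv4 ?l)"
    have hi: "hi e = ?h * 2 ^ (4 * WW) + code ?i ?j" using True by (simp add: hi_def Let_def base_def)
    have c: "code ?i ?j < 2 ^ (4 * WW)" using True ij by (intro code_less) auto
    have dv: "hi e div 2 ^ (4 * WW) = ?h" "hi e mod 2 ^ (4 * WW) = code ?i ?j"
      using c by (simp_all add: hi)
    have "base l v1 v2 v3 v4 \<le> hi e \<and> hi e < base l v1 v2 v3 v4 + \<sigma> \<longleftrightarrow>
        hi e div 2 ^ (4 * WW) = horner l v1 v2 v3 v4 \<and> hi e mod 2 ^ (4 * WW) < \<sigma>" (is "?L \<longleftrightarrow> ?R")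
    proof
      assume L: ?L
      have d: "hi e div 2 ^ (4 * WW) = horner l v1 v2 v3 v4"
        by (rule div_nat_eqI) (use L \<sigma> in \<open>auto simp: base_def mult.commute\<close>)
      then show ?R using L div_mult_mod_eq[of "hi e" "2 ^ (4 * WW)"] by (simp add: base_def)
    next
      assume ?R
      then show ?L using div_mult_mod_eq[of "hi e" "2 ^ (4 * WW)"] by (simp add: base_def)
    qed
    also have "\<dots> \<longleftrightarrow> ?h = horner l v1 v2 v3 v4 \<and> code ?i ?j < \<sigma>" unfolding dv ..
    also have "?h = horner l v1 v2 v3 v4 \<longleftrightarrow> ?l = l \<and> px ?i div 2 ^ lv1 ?l = v1 \<and>
        py ?i div 2 ^ lv2 ?l = v2 \<and> px ?j div 2 ^ lv3 ?l = v3 \<and> py ?j div 2 ^ lv4 ?l = v4"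
      by (rule horner_eq) (intro div_pow_less px py ij v)+
    finally show ?thesis using True by (auto simp: Let_def)
  next
    case False
    then have "hi e = 2 ^ (12 * WW)" unfolding hi_def Let_def by (rule if_not_P)
    then have "\<not> hi e < base l v1 v2 v3 v4 + \<sigma>" using base_less[OF v l] \<sigma> by linarith
    then show ?thesis using False by (auto simp: Let_def)
  qed
qed

lemma key_mod: "e < NN \<Longrightarrow> key e mod 2 ^ (8 * WW) = e"
  using NN_le by (simp add: key_def)

text \<open>The appended element is below \<open>2 ^ (8 * WW)\<close> and cannot carry into the
  upper part.\<close>

lemma key_less_iff: "e < NN \<Longrightarrow> key e < Z * 2 ^ (8 * WW) \<longleftrightarrow> hi e < Z"
proof -
  assume "e < NN"
  then have e: "e < 2 ^ (8 * WW)" using NN_le by simp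
  show ?thesis
  proof
    assume "hi e < Z"
    then have "(hi e + 1) * 2 ^ (8 * WW) \<le> Z * 2 ^ (8 * WW)" by (intro mult_le_mono1) simp
    then show "key e < Z * 2 ^ (8 * WW)" using e by (simp add: key_def)
  next
    assume "key e < Z * 2 ^ (8 * WW)"
    then have "hi e * 2 ^ (8 * WW) < Z * 2 ^ (8 * WW)" unfolding key_def by linarith
    then show "hi e < Z" by simp
  qed
qed

lemma key_bound: "e < NN \<Longrightarrow> key e < 2 ^ (21 * WW)"
proof -
  assume "e < NN"
  then have "key e < (2 ^ (12 * WW) + 1) * 2 ^ (8 * WW)"
    using hi_le[of e] by (subst key_less_iff) auto
  also have "\<dots> \<le> (2 ^ (12 * WW) * 2 ^ WW) * 2 ^ (8 * WW)"
  proof (rule mult_le_mono1)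
    have "(2::nat) ^ (12 * WW) + 1 \<le> 2 ^ (12 * WW) * 2" by simp
    also have "\<dots> \<le> 2 ^ (12 * WW) * 2 ^ WW" using pos by (intro mult_le_mono2) (simp add: WW_def)
    finally show "(2::nat) ^ (12 * WW) + 1 \<le> 2 ^ (12 * WW) * 2 ^ WW" .
  qed
  also have "\<dots> = 2 ^ (21 * WW)" by (simp add: power_add[symmetric])
  finally show ?thesis .
qed

subsection \<open>The sorted list of keys and its buckets\<close>

definition A :: "nat list" where "A = sort (map key [0..<NN])"

lemma key_inj: "inj_on key {..<NN}"
  by (rule inj_on_inverseI[of _ "\<lambda>x. x mod 2 ^ (8 * WW)"]) (simp add: key_mod)

lemma length_A [simp]: "length A = NN" by (simp add: A_def)
lemma set_A: "set A = key ` {..<NN}" by (auto simp: A_def)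
lemma sorted_A: "sorted A" by (simp add: A_def)

lemma distinct_A: "distinct A"
  using key_inj by (simp add: A_def distinct_map lessThan_atLeast0)

lemma A_mono: "i \<le> j \<Longrightarrow> j < NN \<Longrightarrow> A ! i \<le> A ! j"
  using sorted_nth_mono[OF sorted_A] by simp

lemma A_strict: "i < j \<Longrightarrow> j < NN \<Longrightarrow> A ! i < A ! j"
  using A_mono[of i j] distinct_A by (auto simp: order.order_iff_strict nth_eq_iff_index_eq)

lemma A_less_iff: "i < NN \<Longrightarrow> j < NN \<Longrightarrow> A ! i < A ! j \<longleftrightarrow> i < j"
  using A_strict[of i j] A_mono[of j i] by (cases "i < j") auto

lemma A_ex: "e < NN \<Longrightarrow> \<exists>i<NN. A ! i = key e"
  using set_A in_set_conv_nth[of "key e" A] by simp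

lemma A_nth: "i < NN \<Longrightarrow> \<exists>e<NN. A ! i = key e"
  using nth_mem[of i A] set_A by auto

text \<open>The smallest key of a block; \<open>2 ^ (21 * WW)\<close> is a sentinel above all keys
  that closes the last block.\<close>

definition leadr :: "nat \<Rightarrow> nat" where
  "leadr B = (if B < MM then A ! (B * tt) else 2 ^ (21 * WW))"

definition bucket :: "nat \<Rightarrow> nat" where
  "bucket \<kappa> = descend bb (\<lambda>p. p < MM \<and> leadr p \<le> \<kappa>)"

definition gg :: "nat \<Rightarrow> nat" where "gg e = bucket (key e)"

lemma mul_tt_less: "B < MM \<Longrightarrow> B * tt < NN"
  unfolding NN_MM using pos by simp

text \<open>Connects the search among the stored leaders with positions in the sorted list, which is
  not stored.\<close>

lemma bucket_nth:
  assumes "i < NN"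
  shows "bucket (A ! i) = i div tt"
  unfolding bucket_def
proof (rule descend_eqI)
  have d: "i div tt < MM" using assms unfolding NN_MM by (rule less_mult_imp_div_less)
  show "i div tt < 2 ^ bb"
    by (rule addr_less) (use d MM_le_NN in simp)
  have "i div tt * tt \<le> i" by simp
  then show "i div tt = 0 \<or> i div tt < MM \<and> leadr (i div tt) \<le> A ! i"
    using d assms by (simp add: leadr_def A_mono)
  show "\<not> (Suc (i div tt) < MM \<and> leadr (Suc (i div tt)) \<le> A ! i)"
  proof
    assume a: "Suc (i div tt) < MM \<and> leadr (Suc (i div tt)) \<le> A ! i"
    have "i < Suc (i div tt) * tt" using pos dividend_less_div_times[of tt i] by (simp add: add.commute)
    then have "A ! i < A ! (Suc (i div tt) * tt)" by (rule A_strict) (use a mul_tt_less in blast)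
    moreover have "leadr (Suc (i div tt)) = A ! (Suc (i div tt) * tt)" using a by (simp add: leadr_def)
    ultimately show False using a by linarith
  qed
  fix p p' assume "p' \<le> p" "p < MM \<and> leadr p \<le> A ! i"
  then have "p' < MM" "leadr p' \<le> leadr p"
    using mul_tt_less[of p] by (auto simp: leadr_def intro!: A_mono)
  then show "p' < MM \<and> leadr p' \<le> A ! i" using \<open>p < MM \<and> leadr p \<le> A ! i\<close> by auto
qed

lemma bucket_less: "bucket \<kappa> < MM"
proof -
  have "bucket \<kappa> = 0 \<or> bucket \<kappa> < MM \<and> leadr (bucket \<kappa>) \<le> \<kappa>"
    unfolding bucket_def
  proof (rule descend_correct(2))
    fix p p' assume "p' \<le> p" "p < MM \<and> leadr p \<le> \<kappa>"
    then have "p' < MM" "leadr p' \<le> leadr p"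
      using mul_tt_less[of p] by (auto simp: leadr_def intro!: A_mono)
    then show "p' < MM \<and> leadr p' \<le> \<kappa>" using \<open>p < MM \<and> leadr p \<le> \<kappa>\<close> by auto
  qed
  then show ?thesis using pos by auto
qed

lemma gg_less: "gg e < MM" by (simp add: gg_def bucket_less)

text \<open>The elements of a block are read off the \<open>tt\<close> keys at positions from
  \<open>B * tt\<close> on.\<close>

lemma gg_card: "card {x. x < 2 ^ kk \<and> gg x = B} \<le> tt"
proof -
  have "{x. x < 2 ^ kk \<and> gg x = B} \<subseteq> (\<lambda>i. A ! i mod 2 ^ (8 * WW)) ` {B * tt..<B * tt + tt}"
  proof
    fix x assume "x \<in> {x. x < 2 ^ kk \<and> gg x = B}"
    then have x: "x < NN" "gg x = B" by (simp_all add: NN_def)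
    obtain i where i: "i < NN" "A ! i = key x" using A_ex[OF x(1)] by auto
    have "i div tt = B" using x bucket_nth[OF i(1)] by (simp add: gg_def i(2))
    then have "i \<in> {B * tt..<B * tt + tt}" using div_eq_set[OF pos(1), of B] by blast
    moreover have "x = A ! i mod 2 ^ (8 * WW)" using i x by (simp add: key_mod)
    ultimately show "x \<in> (\<lambda>i. A ! i mod 2 ^ (8 * WW)) ` {B * tt..<B * tt + tt}" by blast
  qed
  then have "card {x. x < 2 ^ kk \<and> gg x = B} \<le> card ((\<lambda>i. A ! i mod 2 ^ (8 * WW)) ` {B * tt..<B * tt + tt})"
    by (rule card_mono[rotated]) simp
  also have "\<dots> \<le> tt" using card_image_le[of "{B * tt..<B * tt + tt}"] by simp
  finally show ?thesis .
qed

lemma rainbow: "rainbow {..<2 ^ bb} (mult_shift uu kk) gg NN MM tt"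
  unfolding NN_def
proof (rule rainbow_mult_shift)
  show "2 * uu \<le> bb" using bb_ge by (simp add: uu_def)
  show "2 * kk \<le> uu" using kk_le by (simp add: uu_def)
  show "2 ^ kk = MM * tt" using NN_MM by (simp add: NN_def)
qed (use gg_less gg_card in auto)

sublocale R: rainbow "{..<2 ^ bb}" "mult_shift uu kk" gg NN MM tt
  by (rule rainbow)

end

subsection \<open>Looking up a bucket\<close>

lemma iterate_min:
  fixes f :: "nat \<Rightarrow> nat"
  shows "iterate k (\<lambda>j acc. if P (f j) \<and> f j < acc then f j else acc) a = Min (insert a (f ` {j. j < k \<and> P (f j)}))"
proof (induction k)
  case (Suc k)
  define S where "S = insert a (f ` {j. j < k \<and> P (f j)})"
  have e: "insert a (f ` {j. j < Suc k \<and> P (f j)}) = (if P (f k) then insert (f k) S else S)"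
    by (auto simp: S_def less_Suc_eq)
  have "Min (insert (f k) S) = min (f k) (Min S)" by (rule Min_insert) (simp_all add: S_def)
  then show ?case unfolding e iterate.simps Suc[folded S_def] by (simp add: min_def)
qed simp

lemma iterate_min2:
  fixes f :: "nat \<Rightarrow> nat \<Rightarrow> nat"
  shows "iterate T (\<lambda>i acc. iterate t (\<lambda>j acc. if P (f i j) \<and> f i j < acc then f i j else acc) acc) a =
    Min (insert a (\<Union>i<T. f i ` {j. j < t \<and> P (f i j)}))"
  unfolding iterate_min
proof (induction T)
  case (Suc T)
  have m: "Min (insert (Min U) S) = Min (U \<union> S)" if "finite U" "U \<noteq> {}" "finite S" for U S :: "nat set"
    using that by (cases "S = {}") (simp_all add: Min_Un)
  show ?case unfolding iterate.simps Suc
    by (subst m) (simp_all add: lessThan_Suc Un_commute)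
qed simp

context inst
begin

definition hsh :: "nat \<Rightarrow> nat \<Rightarrow> nat \<Rightarrow> nat" where
  "hsh i j B = mult_shift uu kk (rs ! (i * tt + j)) B"

text \<open>Both ends of the walk are tested inside a loop of fixed length \<open>tt\<close>,
  because a loop bound has to be a parameter register.\<close>

definition seg :: "nat \<Rightarrow> nat \<Rightarrow> nat \<Rightarrow> nat \<Rightarrow> nat" where
  "seg i lo up B = iterate tt (\<lambda>u a. if u < lo then a else if u < up then gg (hsh i u a) else a) B"

abbreviation "wfrom i lo B \<equiv> seg i lo tt B"
abbreviation "wto i up B \<equiv> seg i 0 up B"

text \<open>\<open>y\<close> enumerates the starts of all tables. The word has the digits table, end
  point, start, so that a single sorted list serves all tables and the start is the last
  digit.\<close>

definition cword :: "nat \<Rightarrow> nat" where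
  "cword y = ((y div mm) * MM + wfrom (y div mm) 0 (y mod mm)) * mm + y mod mm"

definition chl :: "nat list" where "chl = sort (map cword [0..<TM])"

text \<open>\<open>mm - 1\<close> is the largest last digit, so the search stops at the last word
  not beyond table \<open>i\<close> and end point \<open>E\<close>. If exactly one start of table
  \<open>i\<close> ends in \<open>E\<close>, this is its word.\<close>

definition chain :: "nat \<Rightarrow> nat \<Rightarrow> nat" where
  "chain i E = (chl ! descend bb (\<lambda>p. p < TM \<and> chl ! p \<le> (i * MM + E) * mm + (mm - 1))) mod mm"

text \<open>Guesses that an element of block \<open>B\<close> was hit in step \<open>j\<close> of
  table \<open>i\<close>: the walk from \<open>B\<close> after that step gives the end point, the
  end point gives the start, and replaying the first \<open>j\<close> steps gives the element. A
  wrong guess yields some other element.\<close>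

definition cand :: "nat \<Rightarrow> nat \<Rightarrow> nat \<Rightarrow> nat" where
  "cand i j B = hsh i j (wto i j (chain i (wfrom i (Suc j) B)))"

definition good :: bool where
  "good \<longleftrightarrow> length rs = RR \<and> (\<forall>e<NN. \<exists>i<TT. R.covered mm (R.block i rs) e)"

text \<open>No candidate is checked for membership in \<open>B\<close>: a stray one still has a
  genuine key, and keys above \<open>cur\<close> cannot be smaller than the successor of
  \<open>cur\<close>. The next leader is the default at the end of a block.\<close>

definition succk :: "nat \<Rightarrow> nat \<Rightarrow> nat" where
  "succk B cur = iterate TT (\<lambda>i acc. iterate tt (\<lambda>j acc.
     if cur < key (cand i j B) \<and> key (cand i j B) < acc then key (cand i j B) else acc) acc) (leadr (Suc B))"

definition select :: "nat \<Rightarrow> nat" where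
  "select x = iterate tt (\<lambda>u acc. if u < x mod tt then succk (x div tt) acc else acc) (leadr (x div tt))"

text \<open>Positions are shifted by one, so that the default 0 of the search means that no key lies
  below \<open>\<kappa>\<close>.\<close>

definition rank :: "nat \<Rightarrow> nat" where
  "rank \<kappa> = descend bb (\<lambda>p. p \<le> NN \<and> select (p - 1) < \<kappa>)"

section \<open>Recovering elements from the tables\<close>

lemma hsh_less: "hsh i j B < NN"
  unfolding hsh_def NN_def by (rule mult_shift_less) (use kk_le in \<open>simp add: uu_def\<close>)

lemma cand_less: "cand i j B < NN" unfolding cand_def by (rule hsh_less)

lemma seg_less: "B < MM \<Longrightarrow> seg i lo up B < MM"
proof -
  assume B: "B < MM"
  have "iterate l (\<lambda>u a. if u < lo then a else if u < up then gg (hsh i u a) else a) B < MM" for l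
    by (induction l) (auto simp: B gg_less)
  then show ?thesis by (simp add: seg_def)
qed

lemma walk_append: "R.walk (xs @ ys) B = R.walk ys (R.walk xs B)"
  by (induction xs arbitrary: B) simp_all

lemma hit_iff: "R.hit j r s x \<longleftrightarrow> j < length r \<and> mult_shift uu kk (r ! j) (R.walk (take j r) s) = x"
proof (induction r arbitrary: j s)
  case (Cons \<omega> r)
  then show ?case by (cases j) simp_all
qed simp

lemma walk_hit:
  assumes "R.hit j r s x"
  shows "R.walk r s = R.walk (drop (Suc j) r) (gg x)"
proof -
  have j: "j < length r" "mult_shift uu kk (r ! j) (R.walk (take j r) s) = x"
    using assms by (simp_all add: hit_iff)
  have "R.walk r s = R.walk (take j r @ r ! j # drop (Suc j) r) s"
    using id_take_nth_drop[OF j(1)] by simp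
  then show ?thesis using j(2) by (simp add: walk_append)
qed

lemma block_props:
  assumes "length rs = RR" "i < TT"
  shows "length (R.block i rs) = tt" "j < tt \<Longrightarrow> R.block i rs ! j = rs ! (i * tt + j)"
proof -
  have "Suc i * tt \<le> TT * tt" using assms(2) by (intro mult_le_mono1) simp
  then have len: "i * tt + tt \<le> length rs" using assms(1) by (simp add: RR_def)
  then show "length (R.block i rs) = tt" by (simp add: R.block_def)
  show "j < tt \<Longrightarrow> R.block i rs ! j = rs ! (i * tt + j)" using len by (simp add: R.block_def)
qed

lemma seg_walk:
  assumes "length rs = RR" "i < TT" "up \<le> tt"
  shows "seg i lo up B = R.walk (drop lo (take up (R.block i rs))) B"
proof -
  let ?r = "R.block i rs"
  note bp = block_props[OF assms(1,2)]
  have "iterate l (\<lambda>u a. if u < lo then a else if u < up then gg (hsh i u a) else a) B =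
      R.walk (drop lo (take (min l up) ?r)) B" if "l \<le> tt" for l
    using that
  proof (induction l)
    case (Suc l)
    show ?case
    proof (cases "l < up")
      case True
      then have "take (min (Suc l) up) ?r = take (min l up) ?r @ [?r ! l]"
        using Suc.prems bp(1) by (simp add: take_Suc_conv_app_nth min_def)
      then show ?thesis using Suc True bp by (simp add: walk_append hsh_def)
    next
      case False
      then have "min (Suc l) up = min l up" by simp
      then show ?thesis using Suc False by simp
    qed
  qed simp
  from this[of tt] assms(3) show ?thesis by (simp add: seg_def min_def)
qed

lemma wfrom_walk: "length rs = RR \<Longrightarrow> i < TT \<Longrightarrow> wfrom i lo B = R.walk (drop lo (R.block i rs)) B"
  by (simp add: seg_walk block_props(1))

lemma length_chl [simp]: "length chl = TM" by (simp add: chl_def)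

text \<open>The word of \<open>s\<close> is not above the search bound, so the word found is
  squeezed between the two. They agree in table and end point, hence the word found has these as
  well, and only \<open>s\<close> has that end point.\<close>

lemma chain_unique:
  assumes i: "i < TT" and s: "s < mm"
    and u: "\<And>s'. s' < mm \<Longrightarrow> s' \<noteq> s \<Longrightarrow> wfrom i 0 s' \<noteq> wfrom i 0 s"
  shows "chain i (wfrom i 0 s) = s"
proof -
  let ?E = "wfrom i 0 s"
  define \<kappa> where "\<kappa> = (i * MM + ?E) * mm + (mm - 1)"
  define Q where "Q = (\<lambda>p. p < TM \<and> chl ! p \<le> \<kappa>)"
  have mono: "p' \<le> p \<Longrightarrow> 0 < p' \<Longrightarrow> Q p \<Longrightarrow> Q p'" for p p'
    unfolding Q_def using sorted_nth_mono[of chl p' p] by (auto simp: chl_def)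
  let ?p = "descend bb Q"
  have dc2: "?p = 0 \<or> Q ?p" by (rule descend_correct(2)) (use mono in blast)
  have dc3: "\<not> Q p" if "?p < p" "p < 2 ^ bb" for p
    by (rule descend_correct(3)[OF _ that]) (use mono in blast)
  define \<omega> where "\<omega> = (i * MM + ?E) * mm + s"
  have sM: "s < MM" using s mm_le_MM by simp
  have y: "i * mm + s < TM"
  proof -
    have "i * mm + s < Suc i * mm" using s by simp
    also have "\<dots> \<le> TT * mm" using i by (intro mult_le_mono1) simp
    finally show ?thesis by (simp add: TM_def)
  qed
  have "cword (i * mm + s) = \<omega>" using s by (simp add: cword_def \<omega>_def)
  then have "\<omega> \<in> set chl" using y by (auto simp: chl_def intro!: rev_image_eqI[of "i * mm + s"])
  then obtain x where x: "x < TM" "chl ! x = \<omega>" by (auto simp: in_set_conv_nth)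
  have "\<omega> \<le> \<kappa>" using s by (simp add: \<omega>_def \<kappa>_def)
  then have Qx: "Q x" using x by (simp add: Q_def)
  have xp: "x \<le> ?p"
  proof (rule ccontr)
    assume "\<not> x \<le> ?p"
    moreover have "x < 2 ^ bb" by (rule addr_less) (use x in simp)
    ultimately show False using dc3[of x] Qx by auto
  qed
  have Qp: "Q ?p" using dc2 Qx xp by auto
  have p: "?p < TM" "chl ! ?p \<le> \<kappa>" using Qp by (auto simp: Q_def)
  have ge: "\<omega> \<le> chl ! ?p" using sorted_nth_mono[of chl x ?p] xp p(1) x(2) by (simp add: chl_def)
  have "chl ! ?p \<in> set chl" using p by simp
  then obtain z where z: "z < TM" "chl ! ?p = cword z" by (auto simp: chl_def)
  have zi: "z div mm < TT" using z(1) unfolding TM_def by (rule less_mult_imp_div_less)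
  have zs: "z mod mm < mm" using pos by simp
  have zM: "z mod mm < MM" using zs mm_le_MM by simp
  let ?E' = "wfrom (z div mm) 0 (z mod mm)"
  have "cword z div mm = (z div mm) * MM + ?E'" using zs by (simp add: cword_def)
  moreover have dv: "(X * mm + r) div mm = X" if "r < mm" for X r using that by simp
  have "\<omega> div mm = i * MM + ?E" "\<kappa> div mm = i * MM + ?E"
    unfolding \<omega>_def \<kappa>_def by (rule dv, use s in simp)+
  moreover have "\<omega> div mm \<le> cword z div mm" "cword z div mm \<le> \<kappa> div mm"
    using ge p(2) z(2) by (simp_all add: div_le_mono)
  ultimately have "(z div mm) * MM + ?E' = i * MM + ?E" by linarith
  then have e: "z div mm = i" "?E' = ?E"
    using digit_step[OF seg_less[OF zM] seg_less[OF sM]] by blast+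
  have "z mod mm = s"
  proof (rule ccontr)
    assume "z mod mm \<noteq> s"
    then show False using u[OF zs] e by simp
  qed
  moreover have "cword z mod mm = z mod mm" by (simp add: cword_def)
  ultimately have "chl ! ?p mod mm = s" using z(2) by simp
  then show ?thesis by (simp add: chain_def Q_def \<kappa>_def)
qed

text \<open>Coverage provides a table, a start and a step. The walk from the block of
  \<open>e\<close> after that step leads to the end point of this start, which is unique, so the
  candidate replays the right chain up to \<open>e\<close>.\<close>

lemma good_cand:
  assumes good "e < NN"
  shows "\<exists>i<TT. \<exists>j<tt. cand i j (gg e) = e"
proof -
  have len: "length rs = RR" using assms(1) by (simp add: good_def)
  obtain i where i: "i < TT" "R.covered mm (R.block i rs) e" using assms by (auto simp: good_def)
  let ?r = "R.block i rs"
  note bp = block_props[OF len i(1)]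
  obtain s j where sj: "s < mm" "j < tt" "R.hit j ?r s e"
    "\<And>s'. s' < mm \<Longrightarrow> s' \<noteq> s \<Longrightarrow> R.walk ?r s \<noteq> R.walk ?r s'"
    using i(2) unfolding R.covered_def bp(1) by blast
  have w0: "wfrom i 0 s' = R.walk ?r s'" for s' using wfrom_walk[OF len i(1), of 0] by simp
  have "wfrom i (Suc j) (gg e) = wfrom i 0 s"
    unfolding w0 walk_hit[OF sj(3)] by (rule wfrom_walk[OF len i(1)])
  moreover have "chain i (wfrom i 0 s) = s"
    by (rule chain_unique[OF i(1) sj(1)]) (use sj(4) w0 in metis)
  ultimately have c: "cand i j (gg e) = hsh i j (wto i j s)" by (simp add: cand_def)
  have "wto i j s = R.walk (take j ?r) s" using seg_walk[OF len i(1)] sj(2) by simp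
  then have "hsh i j (wto i j s) = e"
    using sj(2,3) bp(2)[of j] by (simp add: hit_iff hsh_def)
  then show ?thesis using c i(1) sj(2) by auto
qed

text \<open>Candidates above the current key are never below the next one, so coverage is needed
  only to attain it: either the next key lies in the same block and its element is a candidate, or
  it is the next leader.\<close>

lemma succk_nth:
  assumes good "Suc x < NN"
  shows "succk (x div tt) (A ! x) = A ! Suc x"
proof -
  let ?B = "x div tt"
  let ?V = "insert (leadr (Suc ?B)) (\<Union>i<TT. (\<lambda>j. key (cand i j ?B)) ` {j. j < tt \<and> A ! x < key (cand i j ?B)})"
  have eq: "succk ?B (A ! x) = Min ?V" and fin: "finite ?V"
    unfolding succk_def by (rule iterate_min2) simp
  have lower: "A ! Suc x \<le> key e" if e: "e < NN" "A ! x < key e" for e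
  proof -
    obtain i where i: "i < NN" "A ! i = key e" using A_ex[OF e(1)] by auto
    have "x < i" using e(2) A_less_iff[of x i] i assms(2) by simp
    then show ?thesis using A_mono[of "Suc x" i] i by simp
  qed
  have xB: "Suc x \<le> Suc ?B * tt" using dividend_less_div_times[of tt x] pos by simp
  have lead: "A ! Suc x \<le> leadr (Suc ?B)"
  proof (cases "Suc ?B < MM")
    case True
    then show ?thesis using xB mul_tt_less[OF True] A_mono[of "Suc x" "Suc ?B * tt"] by (simp add: leadr_def)
  next
    case False
    obtain e where "e < NN" "A ! Suc x = key e" using A_nth[OF assms(2)] by auto
    then show ?thesis using key_bound[of e] False by (simp add: leadr_def)
  qed
  have ge: "A ! Suc x \<le> succk ?B (A ! x)"
    unfolding eq Min_ge_iff[OF fin insert_not_empty] using lead lower[OF cand_less] by auto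
  have le: "succk ?B (A ! x) \<le> A ! Suc x"
    unfolding eq
  proof (cases "Suc x div tt = ?B")
    case True
    obtain e where e: "e < NN" "A ! Suc x = key e" using A_nth[OF assms(2)] by auto
    have "gg e = ?B" using bucket_nth[OF assms(2)] True by (simp add: gg_def e(2))
    then obtain i j where ij: "i < TT" "j < tt" "cand i j ?B = e" using good_cand[OF assms(1) e(1)] by auto
    have "A ! x < key e" using A_strict[of x "Suc x"] assms(2) e by simp
    then have "key e \<in> ?V" using ij by auto
    then show "Min ?V \<le> A ! Suc x" unfolding e(2) by (rule Min_le[OF fin])
  next
    case False
    have "?B \<le> Suc x div tt" by (rule div_le_mono) simp
    then have "Suc ?B \<le> Suc x div tt" using False by linarith
    then have "Suc ?B * tt \<le> Suc x" by (metis div_times_less_eq_dividend mult_le_mono1 order_trans)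
    then have e: "Suc x = Suc ?B * tt" using xB by simp
    have "Suc ?B * tt < MM * tt" using assms(2) unfolding e NN_MM .
    then have "Suc ?B < MM" by (simp only: mult_less_cancel2)
    then have "leadr (Suc ?B) = A ! Suc x" by (simp add: leadr_def e)
    then show "Min ?V \<le> A ! Suc x" using Min_le[OF fin, of "leadr (Suc ?B)"] by simp
  qed
  show ?thesis using ge le by simp
qed

lemma select_nth:
  assumes good "x < NN"
  shows "select x = A ! x"
proof -
  let ?B = "x div tt"
  have Bt: "?B * tt + x mod tt = x" by simp
  have BM: "?B < MM" using assms(2) unfolding NN_MM by (rule less_mult_imp_div_less)
  have "iterate l (\<lambda>u acc. if u < x mod tt then succk ?B acc else acc) (leadr ?B) =
      A ! (?B * tt + min l (x mod tt))" for l
  proof (induction l)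
    case 0
    then show ?case using BM by (simp add: leadr_def)
  next
    case (Suc l)
    show ?case
    proof (cases "l < x mod tt")
      case True
      let ?y = "?B * tt + l"
      have "l < tt" using True pos by (meson less_trans mod_less_divisor)
      then have yB: "?y div tt = ?B" by simp
      have "Suc ?y < NN" using True Bt assms(2) by linarith
      from succk_nth[OF assms(1) this] show ?thesis using Suc True by (simp add: yB min_def)
    next
      case False
      then show ?thesis using Suc by (simp add: min_def)
    qed
  qed
  from this[of tt] show ?thesis
    using pos by (simp add: select_def min.absorb2 less_imp_le)
qed

text \<open>The positions of values below \<open>\<kappa>\<close> form an initial segment of a
  sorted list, and its length is the number of such elements because keys are distinct.\<close>

lemma A_less_iff_card:
  assumes "i < NN"
  shows "A ! i < \<kappa> \<longleftrightarrow> i < card {e. e < NN \<and> key e < \<kappa>}"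
proof -
  define d where "d = card {e. e < NN \<and> key e < \<kappa>}"
  have len: "length (filter (\<lambda>v. v < \<kappa>) A) = d"
  proof -
    have "length (filter (\<lambda>v. v < \<kappa>) A) = card (set (filter (\<lambda>v. v < \<kappa>) A))"
      by (rule distinct_card[symmetric]) (simp add: distinct_A)
    also have "set (filter (\<lambda>v. v < \<kappa>) A) = key ` {e. e < NN \<and> key e < \<kappa>}" using set_A by auto
    also have "card \<dots> = d" unfolding d_def by (rule card_image) (auto intro: inj_on_subset[OF key_inj])
    finally show ?thesis .
  qed
  have "d \<le> NN" using length_filter_le[of "\<lambda>v. v < \<kappa>" A] len by simp
  have idx: "{i. i < NN \<and> A ! i < \<kappa>} = {..<d}"
  proof -
    let ?S = "{i. i < NN \<and> A ! i < \<kappa>}"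
    have c: "card ?S = d" using len by (simp add: length_filter_conv_card)
    have down: "i \<in> ?S" if "j \<in> ?S" "i \<le> j" for i j
      using that A_mono[of i j] by auto
    have "?S \<subseteq> {..<d}"
    proof
      fix j assume j: "j \<in> ?S"
      then have "{..j} \<subseteq> ?S" using down by auto
      then have "card {..j} \<le> card ?S" by (intro card_mono) auto
      then show "j \<in> {..<d}" using c by simp
    qed
    then show ?thesis using c by (intro card_subset_eq) auto
  qed
  then show ?thesis using assms unfolding d_def by blast
qed

lemma card_keys_le: "card {e. e < NN \<and> key e < \<kappa>} \<le> NN"
proof -
  have "card {e. e < NN \<and> key e < \<kappa>} \<le> card {..<NN}" by (intro card_mono) auto
  then show ?thesis by simp
qed

lemma rank_eq:
  assumes good
  shows "rank \<kappa> = card {e. e < NN \<and> key e < \<kappa>}"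
proof -
  define d where "d = card {e. e < NN \<and> key e < \<kappa>}"
  have "d \<le> NN" unfolding d_def by (rule card_keys_le)
  have idx: "{i. i < NN \<and> A ! i < \<kappa>} = {..<d}"
    using A_less_iff_card \<open>d \<le> NN\<close> unfolding d_def by auto
  have "descend bb (\<lambda>p. p \<le> NN \<and> select (p - 1) < \<kappa>) = d"
  proof (rule descend_eqI)
    show "d < 2 ^ bb" by (rule addr_less) (use \<open>d \<le> NN\<close> in simp)
    show "d = 0 \<or> d \<le> NN \<and> select (d - 1) < \<kappa>"
    proof (cases "d = 0")
      case False
      then have "d - 1 \<in> {i. i < NN \<and> A ! i < \<kappa>}" unfolding idx by simp
      then show ?thesis using select_nth[OF assms, of "d - 1"] \<open>d \<le> NN\<close> by simp
    qed simp
    show "\<not> (Suc d \<le> NN \<and> select (Suc d - 1) < \<kappa>)"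
    proof
      assume a: "Suc d \<le> NN \<and> select (Suc d - 1) < \<kappa>"
      then have "d \<in> {i. i < NN \<and> A ! i < \<kappa>}" using select_nth[OF assms, of d] by simp
      then show False unfolding idx by simp
    qed
    fix p p' assume h: "p' \<le> p" "0 < p'" "p \<le> NN \<and> select (p - 1) < \<kappa>"
    then have "p' - 1 \<le> p - 1" "p - 1 < NN" "p' - 1 < NN" by linarith+
    then have "select (p' - 1) \<le> select (p - 1)"
      using select_nth[OF assms, of "p - 1"] select_nth[OF assms, of "p' - 1"] A_mono[of "p' - 1" "p - 1"] by simp
    then show "p' \<le> NN \<and> select (p' - 1) < \<kappa>" using h by simp
  qed
  then show ?thesis by (simp add: rank_def d_def)
qed

end

subsection \<open>Counting slopes in a box\<close>

lemma iterate_sum: "iterate k (\<lambda>z acc. acc + f z) 0 = (\<Sum>z<k. f z :: nat)"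
  by (induction k) auto

text \<open>A single loop runs over four end bits and four levels, all packed into \<open>z\<close>.
  Splitting off one digit after the other factorises the sum of products into one sum per
  coordinate.\<close>

lemma sum_digits:
  fixes F1 F2 F3 F4 :: "nat \<Rightarrow> nat \<Rightarrow> nat" and W :: nat
  assumes W: "0 < W"
  defines "G \<equiv> \<lambda>s1 s2 s3 s4 l. F1 (l mod W) s1 * (F2 (l div W mod W) s2 *
    (F3 (l div W div W mod W) s3 * F4 (l div W div W div W mod W) s4))"
  shows "(\<Sum>z<16 * W ^ 4. G (z mod 2) (z div 2 mod 2) (z div 2 div 2 mod 2) (z div 2 div 2 div 2 mod 2)
      (z div 2 div 2 div 2 div 2)) =
    (\<Sum>s<2. \<Sum>i<W. F1 i s) * ((\<Sum>s<2. \<Sum>i<W. F2 i s) * ((\<Sum>s<2. \<Sum>i<W. F3 i s) * (\<Sum>s<2. \<Sum>i<W. F4 i s)))"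
proof -
  have l: "(\<Sum>l<W * (W * (W * W)). G s1 s2 s3 s4 l) =
      (\<Sum>i<W. F1 i s1) * ((\<Sum>i<W. F2 i s2) * ((\<Sum>i<W. F3 i s3) * (\<Sum>i<W. F4 i s4)))" for s1 s2 s3 s4
  proof -
    have "(\<Sum>l<W * (W * (W * W)). G s1 s2 s3 s4 l) = (\<Sum>i1<W. \<Sum>l<W * (W * W). F1 i1 s1 * (F2 (l mod W) s2 *
        (F3 (l div W mod W) s3 * F4 (l div W div W mod W) s4)))"
      unfolding G_def using sum_mod_div[OF W, of "\<lambda>i1 l. F1 i1 s1 * (F2 (l mod W) s2 *
        (F3 (l div W mod W) s3 * F4 (l div W div W mod W) s4))" "W * (W * W)"] .
    also have "\<dots> = (\<Sum>i1<W. \<Sum>i2<W. \<Sum>l<W * W. F1 i1 s1 * (F2 i2 s2 *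
        (F3 (l mod W) s3 * F4 (l div W mod W) s4)))"
      by (rule sum.cong[OF refl sum_mod_div[OF W, of "\<lambda>i2 l. F1 i1 s1 * (F2 i2 s2 *
        (F3 (l mod W) s3 * F4 (l div W mod W) s4))" "W * W" for i1]])
    also have "\<dots> = (\<Sum>i1<W. \<Sum>i2<W. \<Sum>i3<W. \<Sum>l<W. F1 i1 s1 * (F2 i2 s2 * (F3 i3 s3 * F4 (l mod W) s4)))"
      by (rule sum.cong[OF refl sum.cong[OF refl sum_mod_div[OF W, of "\<lambda>i3 l. F1 i1 s1 * (F2 i2 s2 *
        (F3 i3 s3 * F4 (l mod W) s4))" W for i1 i2]]])
    also have "\<dots> = (\<Sum>i1<W. \<Sum>i2<W. \<Sum>i3<W. \<Sum>l<W. F1 i1 s1 * (F2 i2 s2 * (F3 i3 s3 * F4 l s4)))"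
      by (intro sum.cong refl) simp
    finally show ?thesis by (simp only: sum_distrib_left[symmetric] sum_distrib_right[symmetric])
  qed
  have W4: "16 * W ^ 4 = 2 * (2 * (2 * (2 * (W * (W * (W * W))))))"
    by (simp add: eval_nat_numeral)
  have two: "(0::nat) < 2" by simp
  let ?L = "W * (W * (W * W))"
  have "(\<Sum>z<16 * W ^ 4. G (z mod 2) (z div 2 mod 2) (z div 2 div 2 mod 2) (z div 2 div 2 div 2 mod 2)
      (z div 2 div 2 div 2 div 2)) =
    (\<Sum>s1<2. \<Sum>z<2 * (2 * (2 * ?L)). G s1 (z mod 2) (z div 2 mod 2) (z div 2 div 2 mod 2) (z div 2 div 2 div 2))"
    unfolding W4 by (rule sum_mod_div[OF two, of "\<lambda>s1 z. G s1 (z mod 2) (z div 2 mod 2) (z div 2 div 2 mod 2)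
      (z div 2 div 2 div 2)"])
  also have "\<dots> = (\<Sum>s1<2. \<Sum>s2<2. \<Sum>z<2 * (2 * ?L). G s1 s2 (z mod 2) (z div 2 mod 2) (z div 2 div 2))"
    by (intro sum.cong refl sum_mod_div[OF two, of "\<lambda>s2 z. G s1 s2 (z mod 2) (z div 2 mod 2) (z div 2 div 2)" for s1])
  also have "\<dots> = (\<Sum>s1<2. \<Sum>s2<2. \<Sum>s3<2. \<Sum>z<2 * ?L. G s1 s2 s3 (z mod 2) (z div 2))"
    by (intro sum.cong refl sum_mod_div[OF two, of "\<lambda>s3 z. G s1 s2 s3 (z mod 2) (z div 2)" for s1 s2])
  also have "\<dots> = (\<Sum>s1<2. \<Sum>s2<2. \<Sum>s3<2. \<Sum>s4<2. \<Sum>l<?L. G s1 s2 s3 s4 l)"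
    by (intro sum.cong refl sum_mod_div[OF two, of "\<lambda>s4 l. G s1 s2 s3 s4 l" for s1 s2 s3])
  finally show ?thesis unfolding l by (simp only: sum_distrib_left[symmetric] sum_distrib_right[symmetric])
qed

lemma piece_le: "piece lo hi i s \<le> hi + 1"
proof -
  define l r where "l = (lo + 2 ^ i - 1) div 2 ^ i" and "r = (hi + 1) div 2 ^ i"
  have "r \<le> hi + 1" unfolding r_def by (rule div_le_dividend)
  then show ?thesis unfolding piece_def Let_def l_def[symmetric] r_def[symmetric] by auto
qed

context inst
begin

definition pterm :: "nat \<Rightarrow> nat \<Rightarrow> nat \<Rightarrow> nat \<Rightarrow> nat \<Rightarrow> nat \<Rightarrow> nat" where
  "pterm x1 x2 y1 y2 \<sigma> z = (let z1 = z div 2; z2 = z1 div 2; z3 = z2 div 2; l = z3 div 2;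
     c1 = piece x1 x2 (lv1 l) (z mod 2); c2 = piece y1 y2 (lv2 l) (z1 mod 2);
     c3 = piece x1 x2 (lv3 l) (z2 mod 2); c4 = piece y1 y2 (lv4 l) (z3 mod 2) in
     if c1 \<noteq> 0 then if c2 \<noteq> 0 then if c3 \<noteq> 0 then if c4 \<noteq> 0 then
       rank ((base l (c1 - 1) (c2 - 1) (c3 - 1) (c4 - 1) + \<sigma>) * 2 ^ (8 * WW)) -
       rank (base l (c1 - 1) (c2 - 1) (c3 - 1) (c4 - 1) * 2 ^ (8 * WW)) else 0 else 0 else 0 else 0)"

definition cnt :: "nat \<Rightarrow> nat \<Rightarrow> nat \<Rightarrow> nat \<Rightarrow> nat \<Rightarrow> nat" where
  "cnt x1 x2 y1 y2 \<sigma> = iterate LV (\<lambda>z acc. acc + pterm x1 x2 y1 y2 \<sigma> z) 0"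

definition pairs :: "nat \<Rightarrow> nat \<Rightarrow> nat \<Rightarrow> nat \<Rightarrow> (nat \<times> nat) set" where
  "pairs x1 x2 y1 y2 = {(i, j). i < n \<and> j < n \<and> px i < px j \<and> (x1 \<le> px i \<and> px i \<le> x2) \<and>
     (y1 \<le> py i \<and> py i \<le> y2) \<and> (x1 \<le> px j \<and> px j \<le> x2) \<and> (y1 \<le> py j \<and> py j \<le> y2)}"

lemma finite_pairs: "finite (pairs x1 x2 y1 y2)"
  by (rule finite_subset[of _ "{..<n} \<times> {..<n}"]) (auto simp: pairs_def)

definition below :: "nat \<Rightarrow> (nat \<times> nat) set" where
  "below \<sigma> = {(i, j). i < n \<and> j < n \<and> px i < px j \<and> code i j < \<sigma>}"

lemma finite_below: "finite (below \<sigma>)"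
  by (rule finite_subset[of _ "{..<n} \<times> {..<n}"]) (auto simp: below_def)

lemma element_decode:
  assumes "i < n" "j < n"
  shows "(i + n * (j + n * l)) mod n = i" "(i + n * (j + n * l)) div n mod n = j"
    "(i + n * (j + n * l)) div n div n = l"
  using assms by simp_all

lemma element_less_NW:
  assumes "i < n" "j < n" "l < WW ^ 4"
  shows "i + n * (j + n * l) < NW"
proof -
  have "j + n * l < n * Suc l" using assms by simp
  also have "\<dots> \<le> n * WW ^ 4" using assms by (intro mult_le_mono2) simp
  finally have "Suc (j + n * l) \<le> n * WW ^ 4" by simp
  then have "n * Suc (j + n * l) \<le> n * (n * WW ^ 4)" by (rule mult_le_mono2)
  then show ?thesis using assms(1) by (simp add: NW_def)
qed

text \<open>For fixed levels \<open>l\<close> each pair of points is represented by the single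
  element \<open>i + n * (j + n * l)\<close>, so counting elements amounts to counting
  pairs.\<close>

lemma rank_diff:
  assumes good "v1 < 2 ^ WW" "v2 < 2 ^ WW" "v3 < 2 ^ WW" "v4 < 2 ^ WW" "l < WW ^ 4" "\<sigma> \<le> 2 ^ (4 * WW)"
  shows "rank ((base l v1 v2 v3 v4 + \<sigma>) * 2 ^ (8 * WW)) - rank (base l v1 v2 v3 v4 * 2 ^ (8 * WW)) =
    card {(i, j) \<in> below \<sigma>. px i div 2 ^ lv1 l = v1 \<and> py i div 2 ^ lv2 l = v2 \<and>
      px j div 2 ^ lv3 l = v3 \<and> py j div 2 ^ lv4 l = v4}"
proof -
  let ?Z = "base l v1 v2 v3 v4"
  let ?Y = "{(i, j) \<in> below \<sigma>. px i div 2 ^ lv1 l = v1 \<and> py i div 2 ^ lv2 l = v2 \<and>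
      px j div 2 ^ lv3 l = v3 \<and> py j div 2 ^ lv4 l = v4}"
  have r: "rank (Y * 2 ^ (8 * WW)) = card {e. e < NN \<and> hi e < Y}" for Y
    unfolding rank_eq[OF assms(1)] using key_less_iff by (intro arg_cong[of _ _ card]) auto
  have "rank ((?Z + \<sigma>) * 2 ^ (8 * WW)) - rank (?Z * 2 ^ (8 * WW)) =
      card ({e. e < NN \<and> hi e < ?Z + \<sigma>} - {e. e < NN \<and> hi e < ?Z})"
    unfolding r by (rule card_Diff_subset[symmetric]) auto
  also have "{e. e < NN \<and> hi e < ?Z + \<sigma>} - {e. e < NN \<and> hi e < ?Z} =
      {e. e < NN \<and> (?Z \<le> hi e \<and> hi e < ?Z + \<sigma>)}" by auto
  also have "\<dots> = (\<lambda>(i, j). i + n * (j + n * l)) ` ?Y"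
    unfolding hi_in_base[OF assms(2-7)] Let_def
  proof (intro set_eqI iffI, goal_cases)
    case (1 e)
    note e = 1
    have "(e mod n, e div n mod n) \<in> ?Y" using e n1 by (auto simp: below_def)
    moreover have "e = e mod n + n * (e div n mod n + n * l)"
    proof -
      have l: "l = e div n div n" using e by simp
      show ?thesis unfolding l by (simp only: mod_mult_div_eq)
    qed
    ultimately show ?case by force
  next
    case (2 e)
    then obtain i j where ij: "(i, j) \<in> ?Y" "e = i + n * (j + n * l)" by auto
    then have n: "i < n" "j < n" by (auto simp: below_def)
    have "e < NW" unfolding ij(2) by (rule element_less_NW[OF n assms(6)])
    then show ?case
      using ij(1) NN_bounds(1) unfolding ij(2) mem_Collect_eq element_decode[OF n]
      by (auto simp: below_def)
  qed
  also have "card \<dots> = card ?Y"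
  proof (rule card_image, rule inj_onI)
    fix a c assume h: "a \<in> ?Y" "c \<in> ?Y" "(case a of (i, j) \<Rightarrow> i + n * (j + n * l)) = (case c of (i, j) \<Rightarrow> i + n * (j + n * l))"
    obtain i j i' j' where ac: "a = (i, j)" "c = (i', j')" by (cases a; cases c)
    have n: "i < n" "j < n" "i' < n" "j' < n" using h ac by (auto simp: below_def)
    show "a = c" using h(3) element_decode[OF n(1,2), of l] element_decode[OF n(3,4), of l] unfolding ac by simp
  qed
  finally show ?thesis .
qed

lemma pterm_eq:
  assumes good "x2 < 2 ^ w" "y2 < 2 ^ w" "\<sigma> \<le> 2 ^ (4 * WW)" "z < LV"
  defines "l \<equiv> z div 2 div 2 div 2 div 2"
  shows "pterm x1 x2 y1 y2 \<sigma> z = (\<Sum>(i, j)\<in>below \<sigma>.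
    of_bool (piece x1 x2 (lv1 l) (z mod 2) = px i div 2 ^ lv1 l + 1) *
    (of_bool (piece y1 y2 (lv2 l) (z div 2 mod 2) = py i div 2 ^ lv2 l + 1) *
    (of_bool (piece x1 x2 (lv3 l) (z div 2 div 2 mod 2) = px j div 2 ^ lv3 l + 1) *
     of_bool (piece y1 y2 (lv4 l) (z div 2 div 2 div 2 mod 2) = py j div 2 ^ lv4 l + 1))))"
proof -
  define c1 where "c1 = piece x1 x2 (lv1 l) (z mod 2)"
  define c2 where "c2 = piece y1 y2 (lv2 l) (z div 2 mod 2)"
  define c3 where "c3 = piece x1 x2 (lv3 l) (z div 2 div 2 mod 2)"
  define c4 where "c4 = piece y1 y2 (lv4 l) (z div 2 div 2 div 2 mod 2)"
  have pw: "(2::nat) ^ w \<le> 2 ^ WW" by (rule pow_le) (simp add: WW_def)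
  have "c1 \<le> x2 + 1" "c2 \<le> y2 + 1" "c3 \<le> x2 + 1" "c4 \<le> y2 + 1"
    unfolding c1_def c2_def c3_def c4_def by (rule piece_le)+
  then have v: "c1 - 1 < 2 ^ WW" "c2 - 1 < 2 ^ WW" "c3 - 1 < 2 ^ WW" "c4 - 1 < 2 ^ WW"
    using assms(2,3) pw by linarith+
  have "z div 16 < WW ^ 4" using assms(5) by (simp add: LV_def less_mult_imp_div_less mult.commute)
  moreover have "l = z div 16" by (simp add: l_def div_mult2_eq[symmetric])
  ultimately have l: "l < WW ^ 4" by simp
  let ?X = "{(i, j) \<in> below \<sigma>. c1 = px i div 2 ^ lv1 l + 1 \<and> c2 = py i div 2 ^ lv2 l + 1 \<and>
        c3 = px j div 2 ^ lv3 l + 1 \<and> c4 = py j div 2 ^ lv4 l + 1}"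
  have rhs: "(\<Sum>(i, j)\<in>below \<sigma>. of_bool (c1 = px i div 2 ^ lv1 l + 1) * (of_bool (c2 = py i div 2 ^ lv2 l + 1) *
      (of_bool (c3 = px j div 2 ^ lv3 l + 1) * of_bool (c4 = py j div 2 ^ lv4 l + 1)))) =
      card ?X"
    unfolding of_bool_conj[symmetric] case_prod_unfold
    using finite_below[of \<sigma>] by (simp add: of_bool_def sum.If_cases Int_def)
  have p: "pterm x1 x2 y1 y2 \<sigma> z = (if c1 \<noteq> 0 then if c2 \<noteq> 0 then if c3 \<noteq> 0 then if c4 \<noteq> 0 then
       rank ((base l (c1 - 1) (c2 - 1) (c3 - 1) (c4 - 1) + \<sigma>) * 2 ^ (8 * WW)) -
       rank (base l (c1 - 1) (c2 - 1) (c3 - 1) (c4 - 1) * 2 ^ (8 * WW)) else 0 else 0 else 0 else 0)"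
    unfolding pterm_def Let_def c1_def c2_def c3_def c4_def l_def ..
  show ?thesis unfolding c1_def[symmetric] c2_def[symmetric] c3_def[symmetric] c4_def[symmetric] rhs
  proof (cases "c1 \<noteq> 0 \<and> c2 \<noteq> 0 \<and> c3 \<noteq> 0 \<and> c4 \<noteq> 0")
    case True
    then have "pterm x1 x2 y1 y2 \<sigma> z = card {(i, j) \<in> below \<sigma>. px i div 2 ^ lv1 l = c1 - 1 \<and>
        py i div 2 ^ lv2 l = c2 - 1 \<and> px j div 2 ^ lv3 l = c3 - 1 \<and> py j div 2 ^ lv4 l = c4 - 1}"
      unfolding p using rank_diff[OF assms(1) v l assms(4)] by simp
    also have "{(i, j) \<in> below \<sigma>. px i div 2 ^ lv1 l = c1 - 1 \<and>
        py i div 2 ^ lv2 l = c2 - 1 \<and> px j div 2 ^ lv3 l = c3 - 1 \<and> py j div 2 ^ lv4 l = c4 - 1} =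
      ?X"
      using True by auto
    finally show "pterm x1 x2 y1 y2 \<sigma> z = card {(i, j) \<in> below \<sigma>. c1 = px i div 2 ^ lv1 l + 1 \<and>
        c2 = py i div 2 ^ lv2 l + 1 \<and> c3 = px j div 2 ^ lv3 l + 1 \<and> c4 = py j div 2 ^ lv4 l + 1}" .
  next
    case False
    then have "?X = {}" by auto
    moreover have "pterm x1 x2 y1 y2 \<sigma> z = 0" unfolding p using False by auto
    ultimately show "pterm x1 x2 y1 y2 \<sigma> z = card {(i, j) \<in> below \<sigma>. c1 = px i div 2 ^ lv1 l + 1 \<and>
        c2 = py i div 2 ^ lv2 l + 1 \<and> c3 = px j div 2 ^ lv3 l + 1 \<and> c4 = py j div 2 ^ lv4 l + 1}" by (simp only: card.empty)
  qed
qed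

text \<open>After exchanging the sums, each coordinate of a pair contributes the number of pieces
  containing it, which by \<open>sum_piece\<close> is 1 inside the box and 0 outside.\<close>

lemma cnt_eq:
  assumes good "x2 < 2 ^ w" "y2 < 2 ^ w" "\<sigma> \<le> 2 ^ (4 * WW)"
  shows "cnt x1 x2 y1 y2 \<sigma> = card {ij \<in> pairs x1 x2 y1 y2. (case ij of (i, j) \<Rightarrow> code i j) < \<sigma>}"
proof -
  let ?P1 = "\<lambda>x i s. of_bool (piece x1 x2 i s = x div 2 ^ i + 1) :: nat"
  let ?P2 = "\<lambda>y i s. of_bool (piece y1 y2 i s = y div 2 ^ i + 1) :: nat"
  have s1: "(\<Sum>s<2. \<Sum>i<WW. ?P1 x i s) = of_bool (x1 \<le> x \<and> x \<le> x2)" for x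
    unfolding WW_def sum_piece[OF assms(2), symmetric] by (rule sum.swap)
  have s2: "(\<Sum>s<2. \<Sum>i<WW. ?P2 y i s) = of_bool (y1 \<le> y \<and> y \<le> y2)" for y
    unfolding WW_def sum_piece[OF assms(3), symmetric] by (rule sum.swap)
  have "cnt x1 x2 y1 y2 \<sigma> = (\<Sum>z<LV. pterm x1 x2 y1 y2 \<sigma> z)"
    by (simp add: cnt_def iterate_sum)
  also have "\<dots> = (\<Sum>z<LV. \<Sum>(i, j)\<in>below \<sigma>. let l = z div 2 div 2 div 2 div 2 in
      ?P1 (px i) (lv1 l) (z mod 2) * (?P2 (py i) (lv2 l) (z div 2 mod 2) *
      (?P1 (px j) (lv3 l) (z div 2 div 2 mod 2) * ?P2 (py j) (lv4 l) (z div 2 div 2 div 2 mod 2))))"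
    unfolding Let_def by (intro sum.cong refl pterm_eq assms) simp
  also have "\<dots> = (\<Sum>(i, j)\<in>below \<sigma>. \<Sum>z<LV. let l = z div 2 div 2 div 2 div 2 in
      ?P1 (px i) (lv1 l) (z mod 2) * (?P2 (py i) (lv2 l) (z div 2 mod 2) *
      (?P1 (px j) (lv3 l) (z div 2 div 2 mod 2) * ?P2 (py j) (lv4 l) (z div 2 div 2 div 2 mod 2))))"
    unfolding case_prod_unfold by (rule sum.swap)
  also have "\<dots> = (\<Sum>(i, j)\<in>below \<sigma>. of_bool (x1 \<le> px i \<and> px i \<le> x2) * (of_bool (y1 \<le> py i \<and> py i \<le> y2) *
      (of_bool (x1 \<le> px j \<and> px j \<le> x2) * of_bool (y1 \<le> py j \<and> py j \<le> y2))))"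
    unfolding LV_def lv1_def lv2_def lv3_def lv4_def Let_def
    by (simp only: sum_digits[OF pos(9), of "?P1 (px i)" "?P2 (py i)" "?P1 (px j)" "?P2 (py j)" for i j] s1 s2)
  also have "\<dots> = card {ij \<in> below \<sigma>. case ij of (i, j) \<Rightarrow> (x1 \<le> px i \<and> px i \<le> x2) \<and> (y1 \<le> py i \<and> py i \<le> y2) \<and>
      (x1 \<le> px j \<and> px j \<le> x2) \<and> (y1 \<le> py j \<and> py j \<le> y2)}"
    unfolding of_bool_conj[symmetric] case_prod_unfold
    using finite_below[of \<sigma>] by (simp add: of_bool_def sum.If_cases Int_def)
  also have "{ij \<in> below \<sigma>. case ij of (i, j) \<Rightarrow> (x1 \<le> px i \<and> px i \<le> x2) \<and> (y1 \<le> py i \<and> py i \<le> y2) \<and>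
      (x1 \<le> px j \<and> px j \<le> x2) \<and> (y1 \<le> py j \<and> py j \<le> y2)} =
      {ij \<in> pairs x1 x2 y1 y2. (case ij of (i, j) \<Rightarrow> code i j) < \<sigma>}"
    by (auto simp: below_def pairs_def)
  finally show ?thesis .
qed

subsection \<open>Answering a query\<close>

text \<open>All four levels are \<open>w\<close>, where one interval covers the whole range. This
  last group of keys therefore contains all pairs, sorted by slope.\<close>

definition ztop :: nat where "ztop = base (WW ^ 4 - 1) 0 0 0 0"

text \<open>Any pair with slope code \<open>\<sigma>\<close> serves, whether in the box or not,
  since only its slope is used.\<close>

definition find :: "nat \<Rightarrow> nat" where
  "find \<sigma> = select (rank ((ztop + \<sigma>) * 2 ^ (8 * WW))) mod 2 ^ (8 * WW)"

text \<open>The largest \<open>\<sigma>\<close> with at most \<open>r\<close> codes below it is the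
  code of the slope at position \<open>r\<close> of the sorted list.\<close>

definition sigma :: "nat \<Rightarrow> nat \<Rightarrow> nat \<Rightarrow> nat \<Rightarrow> nat \<Rightarrow> nat" where
  "sigma x1 x2 y1 y2 r = descend bb (\<lambda>\<sigma>. \<sigma> \<le> 2 ^ (4 * WW) \<and> cnt x1 x2 y1 y2 \<sigma> \<le> r)"

lemma pred_mult_decode:
  assumes "0 < W" "0 < X"
  shows "(W * X - 1) mod W = W - (1::nat)" "(W * X - 1) div W = X - (1::nat)"
proof -
  obtain W' X' where "W = Suc W'" "X = Suc X'" using assms by (metis gr0_implies_Suc)
  then have "W * X - 1 = W' + W * X'" "W' < W" "W - 1 = W'" "X - 1 = X'" by simp_all
  then show "(W * X - 1) mod W = W - 1" "(W * X - 1) div W = X - 1"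
    using div_mult_self2[of W W' X'] assms(1) by simp_all
qed

lemma top_levels:
  "lv1 (WW ^ 4 - 1) = w" "lv2 (WW ^ 4 - 1) = w" "lv3 (WW ^ 4 - 1) = w" "lv4 (WW ^ 4 - 1) = w"
proof -
  have e: "WW ^ 4 = WW * WW ^ 3" "WW ^ 3 = WW * WW ^ 2" "WW ^ 2 = WW * WW ^ 1" "WW ^ 1 = WW * 1"
    by (simp_all add: eval_nat_numeral)
  have p: "0 < WW ^ 3" "0 < WW ^ 2" "0 < WW ^ 1" using pos by simp_all
  note d = pred_mult_decode[OF pos(9) p(1), folded e(1)] pred_mult_decode[OF pos(9) p(2), folded e(2)]
    pred_mult_decode[OF pos(9) p(3), folded e(3)] pred_mult_decode[OF pos(9), of 1, folded e(4)]
  show "lv1 (WW ^ 4 - 1) = w" "lv2 (WW ^ 4 - 1) = w" "lv3 (WW ^ 4 - 1) = w" "lv4 (WW ^ 4 - 1) = w"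
    unfolding lv1_def lv2_def lv3_def lv4_def d by (simp_all add: WW_def)
qed

text \<open>The first key not below \<open>ztop + \<sigma>\<close> is at most the key of the given
  pair in the last group, so it belongs to this group and has code \<open>\<sigma>\<close>
  too.\<close>

lemma find_correct:
  assumes good "i < n" "j < n" "px i < px j" "code i j = \<sigma>"
  defines "e \<equiv> find \<sigma>"
  shows "px (e mod n) < px (e div n mod n)" "code (e mod n) (e div n mod n) = \<sigma>"
proof -
  let ?l = "WW ^ 4 - 1"
  have l: "?l < WW ^ 4" using pos by simp
  have z: "(0::nat) < 2 ^ WW" by simp
  have \<sigma>: "\<sigma> < 2 ^ (4 * WW)" using code_less[OF assms(2-4)] assms(5) by simp
  have zero: "x < 2 ^ w \<Longrightarrow> x div 2 ^ w = (0::nat)" for x by simp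
  define e0 where "e0 = i + n * (j + n * ?l)"
  have e0: "e0 < NW" "e0 < NN" using element_less_NW[OF assms(2,3) l] NN_bounds(1) by (simp_all add: e0_def)
  have dec: "e0 mod n = i" "e0 div n mod n = j" "e0 div n div n = ?l"
    unfolding e0_def by (rule element_decode[OF assms(2,3)])+
  have hi0: "hi e0 = ztop + \<sigma>"
    unfolding hi_def Let_def dec top_levels using e0 assms(4,5) px[OF assms(2)] py[OF assms(2)] px[OF assms(3)] py[OF assms(3)]
    by (simp add: ztop_def)
  define \<kappa> where "\<kappa> = (ztop + \<sigma>) * 2 ^ (8 * WW)"
  define d where "d = rank \<kappa>"
  have d: "d = card {e. e < NN \<and> key e < \<kappa>}" unfolding d_def by (rule rank_eq[OF assms(1)])
  have k0: "\<not> key e0 < \<kappa>" unfolding \<kappa>_def key_less_iff[OF e0(2)] hi0 by simp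
  obtain i0 where i0: "i0 < NN" "A ! i0 = key e0" using A_ex[OF e0(2)] by auto
  have di: "d \<le> i0" using k0 A_less_iff_card[OF i0(1), of \<kappa>] unfolding d i0(2) by simp
  then have dN: "d < NN" using i0 by simp
  obtain f where f: "f < NN" "A ! d = key f" using A_nth[OF dN] by auto
  have "find \<sigma> = f"
    unfolding find_def \<kappa>_def[symmetric] d_def[symmetric] select_nth[OF assms(1) dN] f(2) by (rule key_mod[OF f(1)])
  then have ef: "e = f" by (simp add: e_def)
  have "\<not> key f < \<kappa>" using A_less_iff_card[OF dN, of \<kappa>] unfolding d[symmetric] f(2) by simp
  then have ge: "ztop + \<sigma> \<le> hi f" unfolding \<kappa>_def key_less_iff[OF f(1)] by simp
  have "key f \<le> key e0" using A_mono[OF di i0(1)] unfolding f(2) i0(2) .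
  then have "key f < (ztop + \<sigma> + 1) * 2 ^ (8 * WW)"
    using key_less_iff[OF e0(2), of "ztop + \<sigma> + 1"] hi0 by simp
  then have le: "hi f < ztop + (\<sigma> + 1)" unfolding key_less_iff[OF f(1)] by simp
  have a: "base ?l 0 0 0 0 \<le> hi f \<and> hi f < base ?l 0 0 0 0 + (\<sigma> + 1)" using ge le by (simp add: ztop_def)
  have n: "\<not> (base ?l 0 0 0 0 \<le> hi f \<and> hi f < base ?l 0 0 0 0 + \<sigma>)" using ge by (simp add: ztop_def)
  have \<sigma>1: "\<sigma> + 1 \<le> 2 ^ (4 * WW)" "\<sigma> \<le> 2 ^ (4 * WW)" using \<sigma> by simp_all
  from a[unfolded hi_in_base[OF z z z z l \<sigma>1(1)] Let_def] n[unfolded hi_in_base[OF z z z z l \<sigma>1(2)] Let_def]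
  show "px (e mod n) < px (e div n mod n)" "code (e mod n) (e div n mod n) = \<sigma>"
    unfolding ef by auto
qed

definition slope :: "nat \<Rightarrow> nat \<Rightarrow> real" where
  "slope i j = (real (py j) - real (py i)) / (real (px j) - real (px i))"

lemma code_mono:
  assumes "i < n" "j < n" "px i < px j" "i' < n" "j' < n" "px i' < px j'" "slope i j < slope i' j'"
  shows "code i j < code i' j'"
proof -
  show ?thesis unfolding code_def
    by (rule slope_code_mono) (use assms px_less in \<open>auto simp: slope_def\<close>)
qed

text \<open>Raising \<open>\<sigma>\<close> by one makes the count exceed \<open>r\<close>, so some
  pair of the box has exactly this code.\<close>

lemma sigma_find:
  assumes g: good and x: "x2 < 2 ^ w" "y2 < 2 ^ w" and r: "r < card (pairs x1 x2 y1 y2)"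
  defines "e \<equiv> find (sigma x1 x2 y1 y2 r)"
  shows "px (e mod n) < px (e div n mod n)"
    "sorted_list_of_multiset (image_mset (\<lambda>(i, j). slope i j) (mset_set (pairs x1 x2 y1 y2))) ! r =
      slope (e mod n) (e div n mod n)"
proof -
  let ?I = "pairs x1 x2 y1 y2" and ?g = "\<lambda>ij. case ij of (i, j) \<Rightarrow> code i j"
  define Q where "Q = (\<lambda>\<sigma>. \<sigma> \<le> 2 ^ (4 * WW) \<and> cnt x1 x2 y1 y2 \<sigma> \<le> r)"
  define s where "s = sigma x1 x2 y1 y2 r"
  have sQ: "s = descend bb Q" by (simp add: s_def sigma_def Q_def)
  note c = cnt_eq[OF g x]
  have mono: "Q p'" if "p' \<le> p" "0 < p'" "Q p" for p p'
  proof -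
    have "card {ij \<in> ?I. ?g ij < p'} \<le> card {ij \<in> ?I. ?g ij < p}"
      by (intro card_mono) (use finite_pairs that in auto)
    then show ?thesis using that c[of p'] c[of p] by (simp add: Q_def)
  qed
  have s0: "s = 0 \<or> Q s" unfolding sQ by (rule descend_correct(2)) (use mono in blast)
  have Qs: "Q s"
  proof (cases "s = 0")
    case True
    then show ?thesis using c[of 0] by (simp add: Q_def)
  qed (use s0 in simp)
  have all: "{ij \<in> ?I. ?g ij < 2 ^ (4 * WW)} = ?I" using code_less by (auto simp: pairs_def)
  \<comment> \<open>At the top value all pairs would be counted; hence \<open>s + 1\<close> is still
    in the range of \<open>cnt_eq\<close>.\<close>
  have "s \<noteq> 2 ^ (4 * WW)"
  proof
    assume "s = 2 ^ (4 * WW)"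
    then show False using Qs c[of "2 ^ (4 * WW)"] all r by (simp add: Q_def)
  qed
  then have s1: "s + 1 \<le> 2 ^ (4 * WW)" "s \<le> 2 ^ (4 * WW)" using Qs by (auto simp: Q_def)
  have "\<not> Q (s + 1)"
  proof -
    have b: "s + 1 < 2 ^ bb" by (rule fits_le[OF s1(1)]) (use pos in simp)
    have l: "descend bb Q < s + 1" by (simp add: sQ)
    show ?thesis by (rule descend_correct(3)[where Q = Q and nb = bb, OF _ l b]) (use mono in blast)
  qed
  then have gt: "r < card {ij \<in> ?I. ?g ij < s + 1}" using s1 c[of "s + 1"] by (simp add: Q_def)
  have le: "card {ij \<in> ?I. ?g ij < s} \<le> r" using Qs s1 c[of s] by (simp add: Q_def)
  have "\<not> {ij \<in> ?I. ?g ij < s + 1} \<subseteq> {ij \<in> ?I. ?g ij < s}"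
  proof
    assume "{ij \<in> ?I. ?g ij < s + 1} \<subseteq> {ij \<in> ?I. ?g ij < s}"
    then have "card {ij \<in> ?I. ?g ij < s + 1} \<le> card {ij \<in> ?I. ?g ij < s}"
      by (intro card_mono) (use finite_pairs in auto)
    then show False using gt le by simp
  qed
  then obtain a where a': "a \<in> ?I" "?g a < s + 1" "\<not> ?g a < s" by blast
  then have a: "a \<in> ?I" "?g a = s" by linarith+
  obtain i j where ij: "a = (i, j)" by (cases a)
  have aI: "i < n" "j < n" "px i < px j" "code i j = s" using a by (auto simp: ij pairs_def)
  show "px (e mod n) < px (e div n mod n)" using find_correct(1)[OF g aI] by (simp add: e_def s_def)
  have fc: "px (e mod n) < px (e div n mod n)" "code (e mod n) (e div n mod n) = s"
    using find_correct[OF g aI] by (simp_all add: e_def s_def)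
  have en: "e mod n < n" "e div n mod n < n" using n1 by simp_all
  have "sorted_list_of_multiset (image_mset (\<lambda>(i, j). slope i j) (mset_set ?I)) ! r = (\<lambda>(i, j). slope i j) a"
  proof (rule nth_slope_by_counts[where g = ?g])
    fix p q assume "p \<in> ?I" "q \<in> ?I" "(case p of (i, j) \<Rightarrow> slope i j) < (case q of (i, j) \<Rightarrow> slope i j)"
    then show "?g p < ?g q" using code_mono by (auto simp: pairs_def)
  qed (use a le gt finite_pairs in auto)
  also have "\<dots> = slope i j" by (simp add: ij)
  also have "\<dots> = slope (e mod n) (e div n mod n)"
  \<comment> \<open>The pair found need not be the pair in the box, but equal codes rule out that
    either slope is smaller.\<close>
  proof (rule linorder_cases[of "slope i j" "slope (e mod n) (e div n mod n)"])
    assume "slope i j < slope (e mod n) (e div n mod n)"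
    from code_mono[OF aI(1-3) en fc(1) this] show ?thesis using aI(4) fc(2) by simp
  next
    assume "slope (e mod n) (e div n mod n) < slope i j"
    from code_mono[OF en fc(1) aI(1-3) this] show ?thesis using aI(4) fc(2) by simp
  qed
  finally show "sorted_list_of_multiset (image_mset (\<lambda>(i, j). slope i j) (mset_set ?I)) ! r =
      slope (e mod n) (e div n mod n)" .
qed

definition anum :: "nat \<Rightarrow> nat" where
  "anum e = slope_num WW (px (e mod n)) (py (e mod n)) (px (e div n mod n)) (py (e div n mod n))"

definition aden :: "nat \<Rightarrow> nat" where
  "aden e = px (e div n mod n) - px (e mod n)"

lemma slope_anum:
  assumes "px (e mod n) < px (e div n mod n)"
  shows "slope (e mod n) (e div n mod n) = real (anum e) / real (aden e) - 2 ^ WW"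
proof -
  have "py (e mod n) < 2 ^ WW" using n1 by (intro px_less) simp
  from slope_num_real[OF this assms] show ?thesis by (simp add: slope_def anum_def aden_def)
qed

text \<open>Each slope carries the shift \<open>2 ^ WW\<close>. Over the common denominator
  \<open>d\<close> the two shifts add up to \<open>d * 2 ^ Suc WW\<close>, and taking the mean
  doubles the denominator.\<close>

lemma median_query:
  assumes g: good and x: "x2 < 2 ^ w" "y2 < 2 ^ w" and ne: "pairs x1 x2 y1 y2 \<noteq> {}"
  defines "m \<equiv> card (pairs x1 x2 y1 y2)"
  defines "e1 \<equiv> find (sigma x1 x2 y1 y2 ((m - 1) div 2))" and "e2 \<equiv> find (sigma x1 x2 y1 y2 (m div 2))"
  defines "p \<equiv> anum e1 * aden e2 + anum e2 * aden e1" and "d \<equiv> aden e1 * aden e2"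
  shows "0 < aden e1" "0 < aden e2"
    "median (image_mset (\<lambda>(i, j). slope i j) (mset_set (pairs x1 x2 y1 y2))) =
      (real p - real (d * 2 ^ Suc WW)) / real (2 * d)"
proof -
  let ?M = "image_mset (\<lambda>(i, j). slope i j) (mset_set (pairs x1 x2 y1 y2))"
  have m: "size ?M = m" by (simp add: m_def)
  have m0: "0 < m" using ne finite_pairs by (simp add: m_def card_gt_0_iff)
  have r: "(m - 1) div 2 < card (pairs x1 x2 y1 y2)" "m div 2 < card (pairs x1 x2 y1 y2)"
    using m0 unfolding m_def by linarith+
  note s1 = sigma_find[OF g x r(1), folded e1_def] and s2 = sigma_find[OF g x r(2), folded e2_def]
  show d0: "0 < aden e1" "0 < aden e2" using s1(1) s2(1) by (simp_all add: aden_def)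
  have "median ?M = (slope (e1 mod n) (e1 div n mod n) + slope (e2 mod n) (e2 div n mod n)) / 2"
    using median_eq[OF m m0] s1(2) s2(2) by simp
  also have "\<dots> = (real p - real (d * 2 ^ Suc WW)) / real (2 * d)"
    unfolding slope_anum[OF s1(1)] slope_anum[OF s2(1)] p_def d_def
    using d0 by (simp add: field_simps)
  finally show "median ?M = (real p - real (d * 2 ^ Suc WW)) / real (2 * d)" .
qed

end

section \<open>The query program\<close>

subsection \<open>Programs\<close>

text \<open>
  Registers 0 to 3 hold the box and registers 4 to 31 the parameters listed in \<open>pv\<close> below.
\<close>

definition m_pow :: "hexpr \<Rightarrow> hexpr" where "m_pow a = cst 1 \<lless> a"

text \<open>Register 8 holds the word length, so every search takes \<open>bb\<close>
  rounds.\<close>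

definition m_desc :: "(hexpr \<Rightarrow> hexpr) \<Rightarrow> hexpr" where
  "m_desc P = hfold 8 (cst 0) (\<lambda>p j. hlet (p \<oplus> m_pow ((var 8 \<ominus> cst 1) \<ominus> j)) (\<lambda>s. ite (P s) s p))"

definition m_px :: "hexpr \<Rightarrow> hexpr" where "m_px i = rd (cst 3 \<oplus> (i \<oplus> i))"
definition m_py :: "hexpr \<Rightarrow> hexpr" where "m_py i = rd (cst 4 \<oplus> (i \<oplus> i))"

definition m_num :: "hexpr \<Rightarrow> hexpr \<Rightarrow> hexpr" where
  "m_num i j = (m_py j \<oplus> (m_px j \<ominus> m_px i) \<lless> var 7) \<ominus> m_py i"

definition m_code :: "hexpr \<Rightarrow> hexpr \<Rightarrow> hexpr" where
  "m_code i j = (m_num i j \<lless> var 30) \<oslash> (m_px j \<ominus> m_px i)"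

definition m_base :: "hexpr \<Rightarrow> hexpr \<Rightarrow> hexpr \<Rightarrow> hexpr \<Rightarrow> hexpr \<Rightarrow> hexpr" where
  "m_base l a1 a2 a3 a4 =
     ((((l \<lless> var 7 \<oplus> a1) \<lless> var 7 \<oplus> a2) \<lless> var 7 \<oplus> a3) \<lless> var 7 \<oplus> a4) \<lless> var 29"

definition m_hi :: "hexpr \<Rightarrow> hexpr \<Rightarrow> hexpr \<Rightarrow> hexpr" where
  "m_hi i j l = m_base l (m_px i \<ggreater> (l \<odot> var 7)) (m_py i \<ggreater> (l \<oslash> var 7 \<odot> var 7))
     (m_px j \<ggreater> (l \<oslash> var 7 \<oslash> var 7 \<odot> var 7)) (m_py j \<ggreater> (l \<oslash> var 7 \<oslash> var 7 \<oslash> var 7 \<odot> var 7)) \<oplus> m_code i j"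

definition m_key :: "hexpr \<Rightarrow> hexpr" where
  "m_key e = (ite (e \<prec> var 11) (ite (m_px (e \<odot> var 4) \<prec> m_px (e \<oslash> var 4 \<odot> var 4))
     (m_hi (e \<odot> var 4) (e \<oslash> var 4 \<odot> var 4) (e \<oslash> var 4 \<oslash> var 4)) (m_pow (var 31))) (m_pow (var 31))) \<lless> var 28 \<oplus> e"

definition m_bucket :: "hexpr \<Rightarrow> hexpr" where
  "m_bucket \<kappa> = m_desc (\<lambda>p. ite (p \<prec> var 14) (ite (\<kappa> \<prec> rd (var 19 \<oplus> p)) (cst 0) (cst 1)) (cst 0))"

definition m_gg :: "hexpr \<Rightarrow> hexpr" where "m_gg e = hlet (m_key e) m_bucket"

definition m_hash :: "hexpr \<Rightarrow> hexpr \<Rightarrow> hexpr \<Rightarrow> hexpr" where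
  "m_hash i j B = (((rd (var 20 \<oplus> (i \<otimes> var 10 \<oplus> j)) \<odot> m_pow (var 26)) \<otimes> B \<oplus>
     (rd (var 20 \<oplus> (i \<otimes> var 10 \<oplus> j)) \<ggreater> var 26) \<odot> m_pow (var 26)) \<odot> m_pow (var 26)) \<ggreater> var 27"

definition m_seg :: "hexpr \<Rightarrow> hexpr \<Rightarrow> hexpr \<Rightarrow> hexpr \<Rightarrow> hexpr" where
  "m_seg i lo up B = hfold 10 B (\<lambda>a u. ite (u \<prec> lo) a (ite (u \<prec> up) (hlet (m_hash i u a) m_gg) a))"

abbreviation "m_from i lo B \<equiv> m_seg i lo (var 10) B"
abbreviation "m_to i up B \<equiv> m_seg i (cst 0) up B"

definition m_chain :: "hexpr \<Rightarrow> hexpr \<Rightarrow> hexpr" where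
  "m_chain i E = hlet ((i \<otimes> var 14 \<oplus> E) \<otimes> var 15 \<oplus> (var 15 \<ominus> cst 1)) (\<lambda>\<kappa>.
     rd (var 21 \<oplus> m_desc (\<lambda>p. ite (p \<prec> var 23) (ite (\<kappa> \<prec> rd (var 21 \<oplus> p)) (cst 0) (cst 1)) (cst 0))) \<odot> var 15)"

definition m_cand :: "hexpr \<Rightarrow> hexpr \<Rightarrow> hexpr \<Rightarrow> hexpr" where
  "m_cand i j B = hlet (m_from i (j \<oplus> cst 1) B) (\<lambda>E. hlet (m_chain i E) (\<lambda>s. hlet (m_to i j s) (\<lambda>B'. m_hash i j B')))"

definition m_succ :: "hexpr \<Rightarrow> hexpr \<Rightarrow> hexpr" where
  "m_succ B cur = hfold 16 (rd (var 19 \<oplus> (B \<oplus> cst 1))) (\<lambda>acc i. hfold 10 acc (\<lambda>acc j.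
     hlet (m_cand i j B) (\<lambda>e. hlet (m_key e) (\<lambda>\<kappa>. ite (cur \<prec> \<kappa>) (ite (\<kappa> \<prec> acc) \<kappa> acc) acc))))"

definition m_select :: "hexpr \<Rightarrow> hexpr" where
  "m_select x = hfold 10 (rd (var 19 \<oplus> x \<oslash> var 10))
     (\<lambda>acc u. ite (u \<prec> x \<odot> var 10) (m_succ (x \<oslash> var 10) acc) acc)"

definition m_rank :: "hexpr \<Rightarrow> hexpr" where
  "m_rank \<kappa> = m_desc (\<lambda>p. ite (var 13 \<prec> p) (cst 0) (m_select (p \<ominus> cst 1) \<prec> \<kappa>))"

definition m_piece :: "hexpr \<Rightarrow> hexpr \<Rightarrow> hexpr \<Rightarrow> hexpr \<Rightarrow> hexpr" where
  "m_piece lo hi i s = ite (((lo \<oplus> m_pow i) \<ominus> cst 1) \<ggreater> i \<prec> (hi \<oplus> cst 1) \<ggreater> i)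
     (ite s (ite ((hi \<oplus> cst 1) \<ggreater> i \<odot> cst 2) ((hi \<oplus> cst 1) \<ggreater> i) (cst 0))
       (ite (((lo \<oplus> m_pow i) \<ominus> cst 1) \<ggreater> i \<odot> cst 2) (((lo \<oplus> m_pow i) \<ominus> cst 1) \<ggreater> i \<oplus> cst 1) (cst 0))) (cst 0)"

definition m_range :: "hexpr \<Rightarrow> hexpr \<Rightarrow> hexpr" where
  "m_range Z \<sigma> = hlet ((Z \<oplus> \<sigma>) \<lless> var 28) m_rank \<ominus> hlet (Z \<lless> var 28) m_rank"

definition m_pterm :: "hexpr \<Rightarrow> hexpr \<Rightarrow> hexpr" where
  "m_pterm \<sigma> z =
    (let z1 = z \<oslash> cst 2; z2 = z1 \<oslash> cst 2; z3 = z2 \<oslash> cst 2; l = z3 \<oslash> cst 2;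
         c1 = m_piece (var 0) (var 1) (l \<odot> var 7) (z \<odot> cst 2);
         c2 = m_piece (var 2) (var 3) (l \<oslash> var 7 \<odot> var 7) (z1 \<odot> cst 2);
         c3 = m_piece (var 0) (var 1) (l \<oslash> var 7 \<oslash> var 7 \<odot> var 7) (z2 \<odot> cst 2);
         c4 = m_piece (var 2) (var 3) (l \<oslash> var 7 \<oslash> var 7 \<oslash> var 7 \<odot> var 7) (z3 \<odot> cst 2) in
     ite c1 (ite c2 (ite c3 (ite c4
       (m_range (m_base l (c1 \<ominus> cst 1) (c2 \<ominus> cst 1) (c3 \<ominus> cst 1) (c4 \<ominus> cst 1)) \<sigma>)
       (cst 0)) (cst 0)) (cst 0)) (cst 0))"

definition m_cnt :: "hexpr \<Rightarrow> hexpr" where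
  "m_cnt \<sigma> = hfold 18 (cst 0) (\<lambda>acc z. acc \<oplus> m_pterm \<sigma> z)"

definition m_sigma :: "hexpr \<Rightarrow> hexpr" where
  "m_sigma r = m_desc (\<lambda>s. ite (m_pow (var 29) \<prec> s) (cst 0) (ite (r \<prec> m_cnt s) (cst 0) (cst 1)))"

definition m_top :: hexpr where
  "m_top = m_base (var 7 \<otimes> var 7 \<otimes> (var 7 \<otimes> var 7) \<ominus> cst 1) (cst 0) (cst 0) (cst 0) (cst 0)"

definition m_find :: "hexpr \<Rightarrow> hexpr" where
  "m_find \<sigma> = hlet (hlet ((m_top \<oplus> \<sigma>) \<lless> var 28) m_rank) m_select \<odot> m_pow (var 28)"

subsection \<open>Correctness\<close>

context params
begin

definition pv :: "nat list" where
  "pv = [n, w, q, WW, bb, lt4, tt, NW, kk, NN, MM, mm, TT, RR, LV, LB, SB, CB, EN, TM,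
     2 * n, EN + NN, uu, uu - kk, 8 * WW, 4 * WW, 2 * WW, 12 * WW]"

definition std :: "ctx \<Rightarrow> bool" where
  "std c \<longleftrightarrow> bits c = bb \<and> lregs c = 32 \<and> 32 \<le> depth c \<and> (\<forall>i<28. env c (4 + i) = pv ! i)"

lemma std_mono: "std c \<Longrightarrow> c \<sqsubseteq> c' \<Longrightarrow> std c'"
  by (auto simp: std_def ext_def)

lemma std_mem: "std c \<Longrightarrow> std (c\<lparr>cmem := m\<rparr>)" by (simp add: std_def)

lemma std_lregs:
  assumes "std c"
  shows "lreg c 4 n" "lreg c 5 w" "lreg c 6 q" "lreg c 7 WW" "lreg c 8 bb" "lreg c 9 lt4" "lreg c 10 tt"
    "lreg c 11 NW" "lreg c 12 kk" "lreg c 13 NN" "lreg c 14 MM" "lreg c 15 mm" "lreg c 16 TT" "lreg c 17 RR"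
    "lreg c 18 LV" "lreg c 19 LB" "lreg c 20 SB" "lreg c 21 CB" "lreg c 22 EN" "lreg c 23 TM"
    "lreg c 24 (2 * n)" "lreg c 25 (EN + NN)" "lreg c 26 uu" "lreg c 27 (uu - kk)" "lreg c 28 (8 * WW)"
    "lreg c 29 (4 * WW)" "lreg c 30 (2 * WW)" "lreg c 31 (12 * WW)"
  using assms by (simp_all add: std_def lreg_def pv_def All_less_Suc eval_nat_numeral)

lemmas std_vals = std_lregs[THEN val_lreg]

lemma std_bits: "std c \<Longrightarrow> bits c = bb" by (simp add: std_def)

lemma val_num: "std c \<Longrightarrow> k \<le> 20 \<Longrightarrow> val c (cst k) k"
  by (rule val_cst) (simp add: std_bits addr_less)

lemma val_pow:
  assumes "std c" "val c a i" "i < C + 100 * WW"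
  shows "val c (m_pow a) (2 ^ i)"
proof -
  have "(1::nat) * 2 ^ i < 2 ^ bits c" using fits_le[of "2 ^ i" i] assms std_bits by simp
  from val_shl[OF val_num[OF assms(1)] assms(2) this] show ?thesis by (simp add: m_pow_def)
qed

text \<open>The invariant says that the bits still to be decided are zero, so that adding the next
  power of two cannot overflow.\<close>

lemma val_desc:
  assumes "std c" "\<And>c' x s. c \<sqsubseteq> c' \<Longrightarrow> val c' x s \<Longrightarrow> 0 < s \<Longrightarrow> s < 2 ^ bb \<Longrightarrow> val c' (Q x) (of_bool (P s))"
  shows "val c (m_desc Q) (descend bb P)"
  unfolding m_desc_def descend_def
proof (rule val_fold[where I = "\<lambda>j a. a + 2 ^ (bb - j) \<le> 2 ^ bb"])
  fix c' x y j a
  assume e: "c \<sqsubseteq> c'" and j: "j < bb" and a: "a + 2 ^ (bb - j) \<le> 2 ^ bb" and x: "val c' x a" and y: "val c' y j"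
  let ?s = "a + 2 ^ (bb - 1 - j)"
  have s: "std c'" by (rule std_mono[OF assms(1) e])
  have "bb - j = Suc (bb - 1 - j)" using j by simp
  then have d: "(2::nat) ^ (bb - j) = 2 ^ (bb - 1 - j) + 2 ^ (bb - 1 - j)" by simp
  then have sb: "?s + 2 ^ (bb - 1 - j) \<le> 2 ^ bb" using a by simp
  have "0 < (2::nat) ^ (bb - 1 - j)" by simp
  then have sb1: "?s < 2 ^ bb" using sb by linarith
  have pw: "(2::nat) ^ (bb - 1 - j) < 2 ^ bb" using sb1 by linarith
  have bl: "bb < 2 ^ bb" "bb - 1 < 2 ^ bb" using less_exp[of bb] by linarith+
  have "val c' (m_pow ((var 8 \<ominus> cst 1) \<ominus> y)) (1 * 2 ^ (bb - 1 - j))"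
    unfolding m_pow_def
    by (intro val_shl val_num[OF s] val_sub std_vals[OF s] y) (use pw bl j std_bits[OF s] in auto)
  then have v: "val c' (x \<oplus> m_pow ((var 8 \<ominus> cst 1) \<ominus> y)) ?s"
    by (intro val_add x) (use sb1 std_bits[OF s] in auto)
  have "val c' (hlet (x \<oplus> m_pow ((var 8 \<ominus> cst 1) \<ominus> y)) (\<lambda>s. ite (Q s) s x)) (if P ?s then ?s else a)"
  proof (rule val_let[OF v])
    fix c2 z assume e2: "c' \<sqsubseteq> c2" and z: "val c2 z ?s"
    have q: "val c2 (Q z) (of_bool (P ?s))" by (rule assms(2)[OF ext_trans[OF e e2] z]) (use sb1 in auto)
    show "val c2 (ite (Q z) z x) (if P ?s then ?s else a)"
      by (rule val_ite[OF q]) (use z val_mono[OF x e2] in auto)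
  qed
  moreover have "(if P ?s then ?s else a) + 2 ^ (bb - Suc j) \<le> 2 ^ bb"
    using sb by auto
  ultimately show "val c' (hlet (x \<oplus> m_pow ((var 8 \<ominus> cst 1) \<ominus> y)) (\<lambda>s. ite (Q s) s x)) (if P ?s then ?s else a) \<and>
      (if P ?s then ?s else a) + 2 ^ (bb - Suc j) \<le> 2 ^ bb" by blast
qed (use std_lregs[OF assms(1)] val_num[OF assms(1)] in auto)

lemma val_of_bool_less: "val c a v \<Longrightarrow> val c x u \<Longrightarrow> val c (a \<prec> x) (of_bool (v < u))"
  using val_less[of c a v x u] by (simp add: of_bool_def)

lemma val_ite_nz:
  assumes "val c a v" "v \<noteq> 0 \<Longrightarrow> val c x u" "val c z s"
  shows "val c (ite a x z) (if v \<noteq> 0 then u else s)"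
  by (rule val_ite[OF assms(1)]) (use assms in simp_all)

text \<open>The index is tested first because the cell is known to hold \<open>F i\<close> only
  within the table.\<close>

lemma val_guard:
  assumes "std c" "val c p i" "val c b u" "val c \<kappa> v" "i < u \<Longrightarrow> val c r (F i)"
  shows "val c (ite (p \<prec> b) (ite (\<kappa> \<prec> r) (cst 0) (cst 1)) (cst 0)) (of_bool (i < u \<and> F i \<le> v))"
proof -
  note k = val_num[OF assms(1), of 0] val_num[OF assms(1), of 1]
  show ?thesis
  proof (rule val_ite[OF val_of_bool_less[OF assms(2,3)]])
    assume "of_bool (i < u) \<noteq> (0::nat)"
    then have i: "i < u" by simp
    show "val c (ite (\<kappa> \<prec> r) (cst 0) (cst 1)) (of_bool (i < u \<and> F i \<le> v))"
      by (rule val_ite[OF val_of_bool_less[OF assms(4) assms(5)[OF i]]]) (use k i in auto)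
  qed (use k in auto)
qed

end

section \<open>Values of keys, blocks, chains and candidates\<close>

context inst
begin

definition pts :: "ctx \<Rightarrow> bool" where
  "pts c \<longleftrightarrow> (\<forall>i<n. cmem c (3 + (i + i)) = px i \<and> cmem c (4 + (i + i)) = py i)"
definition leads :: "ctx \<Rightarrow> bool" where "leads c \<longleftrightarrow> (\<forall>B\<le>MM. cmem c (LB + B) = leadr B)"
definition seeds :: "ctx \<Rightarrow> bool" where "seeds c \<longleftrightarrow> (\<forall>j<RR. cmem c (SB + j) = rs ! j)"
definition chains :: "ctx \<Rightarrow> bool" where "chains c \<longleftrightarrow> (\<forall>j<TM. cmem c (CB + j) = chl ! j)"

lemma pts_mono: "pts c \<Longrightarrow> c \<sqsubseteq> c' \<Longrightarrow> pts c'" by (simp add: pts_def ext_cmem)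
lemma leads_mono: "leads c \<Longrightarrow> c \<sqsubseteq> c' \<Longrightarrow> leads c'" by (simp add: leads_def ext_cmem)
lemma seeds_mono: "seeds c \<Longrightarrow> c \<sqsubseteq> c' \<Longrightarrow> seeds c'" by (simp add: seeds_def ext_cmem)
lemma chains_mono: "chains c \<Longrightarrow> c \<sqsubseteq> c' \<Longrightarrow> chains c'" by (simp add: chains_def ext_cmem)

lemma val_px:
  assumes "std c" "pts c" "val c a i" "i < n"
  shows "val c (m_px a) (px i)" "val c (m_py a) (py i)"
proof -
  have b: "4 + (i + i) < 2 ^ bb"
    by (rule addr_less) (use assms(4) in \<open>simp add: EN_def CB_def SB_def LB_def\<close>)
  have "val c (cst 3 \<oplus> (a \<oplus> a)) (3 + (i + i))" "val c (cst 4 \<oplus> (a \<oplus> a)) (4 + (i + i))"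
    by (intro val_add val_num assms; use b std_bits[OF assms(1)] in simp)+
  then show "val c (m_px a) (px i)" "val c (m_py a) (py i)"
    unfolding m_px_def m_py_def using assms(2,4) by (auto intro!: val_rd simp: pts_def)
qed

lemma val_slope_num:
  assumes "std c" "pts c" "val c a i" "val c b j" "i < n" "j < n" "px i < px j"
  shows "val c (m_num a b) (slope_num WW (px i) (py i) (px j) (py j))"
    "slope_num WW (px i) (py i) (px j) (py j) \<le> 2 ^ (2 * WW)"
proof -
  note p = val_px[OF assms(1-3,5)] val_px[OF assms(1,2,4,6)]
  have "(2::nat) ^ WW * 2 ^ WW + 2 ^ WW \<le> 2 ^ (3 * WW)"
  proof -
    have "(2::nat) ^ WW * 1 \<le> 2 ^ WW * 2 ^ WW" by (intro mult_le_mono2) simp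
    then have "(2::nat) ^ WW * 2 ^ WW + 2 ^ WW \<le> 2 ^ WW * 2 ^ WW * 2" by simp
    also have "\<dots> \<le> 2 ^ WW * 2 ^ WW * 2 ^ WW" by (intro mult_le_mono2) (simp add: WW_def)
    also have "\<dots> = 2 ^ (3 * WW)" by (simp add: power_add[symmetric])
    finally show ?thesis .
  qed
  moreover have "(px j - px i) * 2 ^ WW \<le> 2 ^ WW * 2 ^ WW"
    using px_less(1)[OF assms(6)] by (intro mult_le_mono1) linarith
  moreover note px_less(2)[OF assms(6)]
  ultimately have le: "py j + (px j - px i) * 2 ^ WW \<le> 2 ^ (3 * WW)" by linarith
  have b: "py j + (px j - px i) * 2 ^ WW < 2 ^ bb" by (rule fits_le[OF le]) (use pos in simp)
  have "2 ^ WW \<le> (px j - px i) * 2 ^ WW" using assms(7) by simp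
  then have g: "py i \<le> py j + (px j - px i) * 2 ^ WW" using px_less(2)[OF assms(5)] by linarith
  show "val c (m_num a b) (slope_num WW (px i) (py i) (px j) (py j))"
    unfolding m_num_def slope_num_def
    by (intro val_sub val_add val_shl p std_vals assms(1))
      (use b g assms(7) std_bits[OF assms(1)] fits_less[OF px_less(1)[OF assms(6)]] in auto)
  show "slope_num WW (px i) (py i) (px j) (py j) \<le> 2 ^ (2 * WW)"
    unfolding WW_def by (rule slope_code_bound(2)) (use px py assms in auto)
qed

lemma val_code:
  assumes "std c" "pts c" "val c a i" "val c b j" "i < n" "j < n" "px i < px j"
  shows "val c (m_code a b) (code i j)"
proof -
  note p = val_px[OF assms(1-3,5)] val_px[OF assms(1,2,4,6)]
  note s = val_slope_num[OF assms]
  have "slope_num WW (px i) (py i) (px j) (py j) * 2 ^ (2 * WW) \<le> 2 ^ (2 * WW) * 2 ^ (2 * WW)"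
    using s(2) by (rule mult_le_mono1)
  also have "\<dots> = 2 ^ (4 * WW)" by (simp add: power_add[symmetric])
  finally have "slope_num WW (px i) (py i) (px j) (py j) * 2 ^ (2 * WW) < 2 ^ bb"
    by (rule fits_le) (use pos in simp)
  then show ?thesis unfolding m_code_def code_def slope_code_def
    by (intro val_div val_shl val_sub s p std_vals assms(1))
      (use assms(7) std_bits[OF assms(1)] fits_less[OF px_less(1)[OF assms(6)]] in auto)
qed

lemma val_base:
  assumes s: "std c" and a: "val c l i" "val c a1 v1" "val c a2 v2" "val c a3 v3" "val c a4 v4"
    and v: "v1 < 2 ^ WW" "v2 < 2 ^ WW" "v3 < 2 ^ WW" "v4 < 2 ^ WW" "i < WW ^ 4"
  shows "val c (m_base l a1 a2 a3 a4) (base i v1 v2 v3 v4)"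
proof -
  define h1 where "h1 = i * 2 ^ WW + v1"
  define h2 where "h2 = h1 * 2 ^ WW + v2"
  define h3 where "h3 = h2 * 2 ^ WW + v3"
  define h4 where "h4 = h3 * 2 ^ WW + v4"
  have m: "x \<le> x * 2 ^ WW" for x :: nat by simp
  have h4: "h4 < 2 ^ (8 * WW)" unfolding h4_def h3_def h2_def h1_def using horner_less[OF v] by (simp add: horner_def)
  have b4: "h4 < 2 ^ bb" by (rule fits_less[OF h4]) simp
  have b3: "h3 * 2 ^ WW < 2 ^ bb" "h3 < 2 ^ bb" using b4 m[of h3] unfolding h4_def by linarith+
  have b2: "h2 * 2 ^ WW < 2 ^ bb" "h2 < 2 ^ bb" using b3(2) m[of h2] unfolding h3_def by linarith+
  have b1: "h1 * 2 ^ WW < 2 ^ bb" "h1 < 2 ^ bb" using b2(2) m[of h1] unfolding h2_def by linarith+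
  have b0: "i * 2 ^ WW < 2 ^ bb" using b1(2) unfolding h1_def by linarith
  have b5: "h4 * 2 ^ (4 * WW) < 2 ^ bb"
  proof (rule fits_le[of _ "12 * WW"])
    have "h4 * 2 ^ (4 * WW) \<le> 2 ^ (8 * WW) * 2 ^ (4 * WW)" using h4 by (intro mult_le_mono1) simp
    then show "h4 * 2 ^ (4 * WW) \<le> 2 ^ (12 * WW)" by (simp add: power_add[symmetric])
  qed (use pos in simp)
  note W = std_vals(4)[OF s] and sb = std_bits[OF s]
  have x1: "val c (l \<lless> var 7 \<oplus> a1) h1"
    unfolding h1_def by (intro val_add val_shl a W) (use b0 b1 sb h1_def in auto)
  have x2: "val c ((l \<lless> var 7 \<oplus> a1) \<lless> var 7 \<oplus> a2) h2"
    unfolding h2_def by (intro val_add val_shl a W x1) (use b1 b2 sb h2_def in auto)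
  have x3: "val c (((l \<lless> var 7 \<oplus> a1) \<lless> var 7 \<oplus> a2) \<lless> var 7 \<oplus> a3) h3"
    unfolding h3_def by (intro val_add val_shl a W x2) (use b2 b3 sb h3_def in auto)
  have x4: "val c ((((l \<lless> var 7 \<oplus> a1) \<lless> var 7 \<oplus> a2) \<lless> var 7 \<oplus> a3) \<lless> var 7 \<oplus> a4) h4"
    unfolding h4_def by (intro val_add val_shl a W x3) (use b3 b4 sb h4_def in auto)
  have "val c (m_base l a1 a2 a3 a4) (h4 * 2 ^ (4 * WW))"
    unfolding m_base_def by (intro val_shl x4 std_vals s) (use b5 sb in auto)
  then show ?thesis by (simp add: base_def horner_def h4_def h3_def h2_def h1_def)
qed

lemma val_key:
  assumes s: "std c" and p: "pts c" and a: "val c a e" and e: "e < NN"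
  shows "val c (m_key a) (key e)"
proof -
  let ?i = "e mod n" and ?j = "e div n mod n" and ?l = "e div n div n"
  note sb = std_bits[OF s]
  have ij: "?i < n" "?j < n" using n1 by simp_all
  have i: "val c (a \<odot> var 4) ?i" and j: "val c (a \<oslash> var 4 \<odot> var 4) ?j" and l: "val c (a \<oslash> var 4 \<oslash> var 4) ?l"
    by (intro val_mod val_div a std_vals s)+
  note pi = val_px[OF s p i ij(1)] and pj = val_px[OF s p j ij(2)]
  have inf: "val c (m_pow (var 31)) (2 ^ (12 * WW))" by (rule val_pow[OF s std_vals(28)[OF s]]) (use pos in simp)
  let ?H = "ite (a \<prec> var 11) (ite (m_px (a \<odot> var 4) \<prec> m_px (a \<oslash> var 4 \<odot> var 4))
     (m_hi (a \<odot> var 4) (a \<oslash> var 4 \<odot> var 4) (a \<oslash> var 4 \<oslash> var 4)) (m_pow (var 31))) (m_pow (var 31))"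
  have hb: "hi e < 2 ^ bb" by (rule fits_le[OF hi_le]) (use pos in simp)
  have h: "hi e = (if e < NW then if px ?i < px ?j then base ?l (px ?i div 2 ^ lv1 ?l) (py ?i div 2 ^ lv2 ?l)
      (px ?j div 2 ^ lv3 ?l) (py ?j div 2 ^ lv4 ?l) + code ?i ?j else 2 ^ (12 * WW) else 2 ^ (12 * WW))"
    by (simp add: hi_def Let_def)
  have "val c ?H (hi e)"
    unfolding h m_hi_def lv1_def lv2_def lv3_def lv4_def
    by (intro val_ite_less[OF a std_vals(8)[OF s]] val_ite_less[OF pi(1) pj(1)] inf val_add val_base s l val_shr pi pj
        val_mod val_div std_vals(4)[OF s] val_code[OF s p i j ij] div_pow_less px py ij level_less;
      (assumption | use hb[unfolded h lv1_def lv2_def lv3_def lv4_def] sb in simp))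
  moreover have kb: "hi e * 2 ^ (8 * WW) + e < 2 ^ bb"
    using fits_less[OF key_bound[OF e]] by (simp add: key_def)
  ultimately show ?thesis
    unfolding m_key_def key_def by (intro val_add val_shl a std_vals s) (use sb in auto)
qed

lemma val_lead:
  assumes "std c" "leads c" "val c a B" "B \<le> MM"
  shows "val c (rd (var 19 \<oplus> a)) (leadr B)"
proof -
  have "LB + B < 2 ^ bb" by (rule addr_less) (use assms(4) in \<open>simp add: EN_def CB_def SB_def\<close>)
  then have "val c (var 19 \<oplus> a) (LB + B)" by (intro val_add std_vals assms) (simp add: std_bits[OF assms(1)])
  then show ?thesis by (rule val_rd) (use assms(2,4) in \<open>simp add: leads_def\<close>)
qed

lemma val_bucket:
  assumes s: "std c" and l: "leads c" and k: "val c a \<kappa>"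
  shows "val c (m_bucket a) (bucket \<kappa>)"
  unfolding m_bucket_def bucket_def
proof (rule val_desc[OF s])
  fix c' x p assume e: "c \<sqsubseteq> c'" and x: "val c' x p"
  note s' = std_mono[OF s e]
  show "val c' (ite (x \<prec> var 14) (ite (a \<prec> rd (var 19 \<oplus> x)) (cst 0) (cst 1)) (cst 0)) (of_bool (p < MM \<and> leadr p \<le> \<kappa>))"
    by (rule val_guard[OF s' x std_vals(11)[OF s'] val_mono[OF k e]], rule val_lead[OF s' leads_mono[OF l e] x]) simp
qed

lemma val_gg:
  assumes s: "std c" and pl: "pts c" "leads c" and e: "val c a e" "e < NN"
  shows "val c (m_gg a) (gg e)"
  unfolding m_gg_def gg_def
  by (rule val_let[OF val_key[OF s pl(1) e]]) (rule val_bucket[OF std_mono[OF s] leads_mono[OF pl(2)]])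

lemma hash_index: "i < TT \<Longrightarrow> j < tt \<Longrightarrow> i * tt + j < RR"
proof -
  assume "i < TT" "j < tt"
  then have "i * tt + j < Suc i * tt" by simp
  also have "\<dots> \<le> RR" unfolding RR_def using \<open>i < TT\<close> by (intro mult_le_mono1) simp
  finally show ?thesis .
qed

lemma val_hash:
  assumes s: "std c" and sd: "seeds c" and a: "val c a1 i" "val c a2 j" "val c a3 B"
    and ij: "i < TT" "j < tt" and B: "B < MM"
  shows "val c (m_hash a1 a2 a3) (hsh i j B)"
proof -
  note sb = std_bits[OF s]
  let ?\<omega> = "rs ! (i * tt + j)"
  have ix: "i * tt + j < RR" by (rule hash_index[OF ij])
  have ad: "SB + (i * tt + j) < 2 ^ bb" by (rule addr_less) (use ix in \<open>simp add: EN_def CB_def\<close>)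
  have b1: "i * tt + j < 2 ^ bb" "i * tt < 2 ^ bb" using ad by linarith+
  have "val c (var 20 \<oplus> (a1 \<otimes> var 10 \<oplus> a2)) (SB + (i * tt + j))"
    by (intro val_add val_mul a std_vals s) (use ad b1 sb in simp_all)
  then have w: "val c (rd (var 20 \<oplus> (a1 \<otimes> var 10 \<oplus> a2))) ?\<omega>"
    by (rule val_rd) (use sd ix in \<open>simp add: seeds_def\<close>)
  have p: "val c (m_pow (var 26)) (2 ^ uu)" by (rule val_pow[OF s std_vals(23)[OF s]]) (use pos in \<open>simp add: uu_def\<close>)
  \<comment> \<open>The product takes \<open>uu + 8 * WW\<close> bits, and the summand at most one
    more.\<close>
  have "B < 2 ^ (8 * WW)" using B MM_le_NN NN_le by linarith
  then have "(?\<omega> mod 2 ^ uu) * B \<le> 2 ^ uu * 2 ^ (8 * WW)" by (intro mult_le_mono) (simp_all add: less_imp_le)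
  also have "\<dots> = 2 ^ (26 * WW)" by (simp add: uu_def power_add[symmetric])
  finally have m: "(?\<omega> mod 2 ^ uu) * B \<le> 2 ^ (26 * WW)" .
  have "(?\<omega> div 2 ^ uu) mod 2 ^ uu < 2 ^ uu" by simp
  also have "(2::nat) ^ uu \<le> 2 ^ (26 * WW)" by (rule pow_le) (simp add: uu_def)
  finally have "(?\<omega> mod 2 ^ uu) * B + (?\<omega> div 2 ^ uu) mod 2 ^ uu \<le> 2 ^ (26 * WW) * 2" using m by simp
  also have "\<dots> = 2 ^ (26 * WW + 1)" by simp
  finally have b2: "(?\<omega> mod 2 ^ uu) * B + (?\<omega> div 2 ^ uu) mod 2 ^ uu < 2 ^ bb" by (rule fits_le) (use pos in simp)
  have b3: "(?\<omega> mod 2 ^ uu) * B < 2 ^ bb" using b2 by linarith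
  show ?thesis
    unfolding m_hash_def hsh_def mult_shift_def
    by (intro val_shr val_mod val_add val_mul w p a(3) std_vals s) (use b2 b3 sb in simp_all)
qed

lemma val_seg:
  assumes s: "std c" and m: "pts c" "leads c" "seeds c"
    and a: "val c a1 i" "val c a2 lo" "val c a3 up" "val c a4 B" and i: "i < TT" and B: "B < MM"
  shows "val c (m_seg a1 a2 a3 a4) (seg i lo up B)"
  unfolding m_seg_def seg_def
proof (rule val_fold[OF std_lregs(7)[OF s] a(4), where I = "\<lambda>_ v. v < MM"])
  fix c' x y u v assume e: "c \<sqsubseteq> c'" and u: "u < tt" and v: "v < MM" and xy: "val c' x v" "val c' y u"
  note s' = std_mono[OF s e] and sd = seeds_mono[OF m(3) e]
  have "val c' (hlet (m_hash a1 y x) m_gg) (gg (hsh i u v))"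
  proof (rule val_let[OF val_hash[OF s' sd val_mono[OF a(1) e] xy(2,1) i u v]])
    fix c2 z assume e2: "c' \<sqsubseteq> c2" and z: "val c2 z (hsh i u v)"
    note e3 = ext_trans[OF e e2]
    show "val c2 (m_gg z) (gg (hsh i u v))"
      by (rule val_gg[OF std_mono[OF s e3] pts_mono[OF m(1) e3] leads_mono[OF m(2) e3] z hsh_less])
  qed
  from val_ite_less[OF xy(2) val_mono[OF a(2) e] xy(1) val_ite_less[OF xy(2) val_mono[OF a(3) e] this xy(1)]]
  show "val c' (ite (y \<prec> a2) x (ite (y \<prec> a3) (hlet (m_hash a1 y x) m_gg) x))
      (if u < lo then v else if u < up then gg (hsh i u v) else v) \<and>
      (if u < lo then v else if u < up then gg (hsh i u v) else v) < MM" using v gg_less by simp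
qed (rule B)

lemma word_bound:
  assumes "i < TT" "E < MM" "s < mm"
  shows "(i * MM + E) * mm + s < 2 ^ bb"
proof -
  have "i * MM + E < Suc i * MM" using assms by simp
  also have "\<dots> \<le> TT * MM" using assms by (intro mult_le_mono1) simp
  finally have "(i * MM + E) * mm + s < Suc (i * MM + E) * mm" "Suc (i * MM + E) * mm \<le> TT * MM * mm"
    using assms(3) by (simp, intro mult_le_mono1) simp
  then have "(i * MM + E) * mm + s \<le> TT * MM * mm" by linarith
  also have "\<dots> \<le> 2 ^ (C + 5 * WW) * 2 ^ (8 * WW) * 2 ^ (8 * WW)"
    using TT_le MM_le_NN mm_le_NN NN_le by (intro mult_le_mono) auto
  also have "\<dots> = 2 ^ (C + 5 * WW + 8 * WW + 8 * WW)" by (simp only: power_add)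
  finally show ?thesis by (rule fits_le) (use pos in simp)
qed

lemma val_chain:
  assumes s: "std c" and m: "chains c" and a: "val c a1 i" "val c a2 E" and iE: "i < TT" "E < MM"
  shows "val c (m_chain a1 a2) (chain i E)"
  unfolding m_chain_def chain_def
proof (rule val_let)
  let ?\<kappa> = "(i * MM + E) * mm + (mm - 1)"
  let ?Q = "\<lambda>p. p < TM \<and> chl ! p \<le> ?\<kappa>"
  note sb = std_bits[OF s]
  have "mm - 1 < mm" using pos by simp
  from word_bound[OF iE this] have b: "?\<kappa> < 2 ^ bb" .
  have b1: "(i * MM + E) * mm < 2 ^ bb" using b by linarith
  have "i * MM + E \<le> (i * MM + E) * mm" using pos by simp
  then have b2: "i * MM + E < 2 ^ bb" "i * MM < 2 ^ bb" using b1 by linarith+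
  have b3: "mm < 2 ^ bb" by (rule addr_less) (use mm_le_NN in simp)
  show "val c ((a1 \<otimes> var 14 \<oplus> a2) \<otimes> var 15 \<oplus> (var 15 \<ominus> cst 1)) ?\<kappa>"
    by (intro val_add val_mul val_sub a std_vals s val_num) (use b b1 b2 b3 pos sb in simp_all)
  fix c' x assume e: "c \<sqsubseteq> c'" and x: "val c' x ?\<kappa>"
  note s' = std_mono[OF s e] and m' = chains_mono[OF m e]
  have r: "val c2 (rd (var 21 \<oplus> y)) (chl ! p)" if c2: "std c2" "chains c2" "val c2 y p" "p < TM" for c2 y p
  proof -
    have "CB + p < 2 ^ bb" by (rule addr_less) (use c2(4) in \<open>simp add: EN_def\<close>)
    then have "val c2 (var 21 \<oplus> y) (CB + p)" by (intro val_add std_vals c2) (simp add: std_bits[OF c2(1)])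
    then show ?thesis by (rule val_rd) (use c2 in \<open>simp add: chains_def\<close>)
  qed
  have d: "val c' (m_desc (\<lambda>p. ite (p \<prec> var 23) (ite (x \<prec> rd (var 21 \<oplus> p)) (cst 0) (cst 1)) (cst 0))) (descend bb ?Q)"
  proof (rule val_desc[OF s'])
    fix c2 y p assume e2: "c' \<sqsubseteq> c2" and y: "val c2 y p"
    note s2 = std_mono[OF s' e2]
    show "val c2 (ite (y \<prec> var 23) (ite (x \<prec> rd (var 21 \<oplus> y)) (cst 0) (cst 1)) (cst 0)) (of_bool (?Q p))"
      by (rule val_guard[OF s2 y std_vals(20)[OF s2] val_mono[OF x e2]], rule r[OF s2 chains_mono[OF m' e2] y])
  qed
  have "descend bb ?Q = 0 \<or> ?Q (descend bb ?Q)"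
  proof (rule descend_correct(2))
    fix p p' assume "p' \<le> p" "?Q p"
    then show "?Q p'" using sorted_nth_mono[of chl p' p] by (auto simp: chl_def)
  qed
  then have "descend bb ?Q < TM" using pos by auto
  from r[OF s' m' d this]
  show "val c' (rd (var 21 \<oplus> m_desc (\<lambda>p. ite (p \<prec> var 23) (ite (x \<prec> rd (var 21 \<oplus> p)) (cst 0) (cst 1)) (cst 0))) \<odot> var 15)
      (chl ! descend bb ?Q mod mm)" by (rule val_mod[OF _ std_vals(12)[OF s']])
qed

definition ready :: "ctx \<Rightarrow> bool" where
  "ready c \<longleftrightarrow> std c \<and> pts c \<and> leads c \<and> seeds c \<and> chains c"

lemma readyD: "ready c \<Longrightarrow> std c" "ready c \<Longrightarrow> pts c" "ready c \<Longrightarrow> leads c" "ready c \<Longrightarrow> seeds c" "ready c \<Longrightarrow> chains c"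
  by (simp_all add: ready_def)

lemma ready_mono: "ready c \<Longrightarrow> c \<sqsubseteq> c' \<Longrightarrow> ready c'"
  unfolding ready_def using std_mono pts_mono leads_mono seeds_mono chains_mono by blast

lemma chain_less: "chain i E < MM"
proof -
  have "chain i E < mm" using pos by (simp add: chain_def)
  then show ?thesis using mm_le_MM by linarith
qed

lemma val_cand:
  assumes r: "ready c" and a: "val c a1 i" "val c a2 j" "val c a3 B" and i: "i < TT" "j < tt" and B: "B < MM"
  shows "val c (m_cand a1 a2 a3) (cand i j B)"
  unfolding m_cand_def cand_def
proof (rule val_let)
  note m = readyD[OF r]
  have "j + 1 < 2 ^ bb" by (rule fits_le[OF _ order.strict_trans2[of WW "2 * WW"]]) (use i(2) tt_le pos in auto)
  then have j1: "val c (a2 \<oplus> cst 1) (Suc j)"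
    using val_add[OF a(2) val_num[OF m(1), of 1]] std_bits[OF m(1)] by simp
  show "val c (m_from a1 (a2 \<oplus> cst 1) a3) (wfrom i (Suc j) B)"
    by (rule val_seg[OF m(1-4) a(1) j1 std_vals(7)[OF m(1)] a(3) i(1) B])
  fix c1 x1 assume e1: "c \<sqsubseteq> c1" and x1: "val c1 x1 (wfrom i (Suc j) B)"
  note m1 = readyD[OF ready_mono[OF r e1]] and a1 = a[THEN val_mono, OF e1]
  show "val c1 (hlet (m_chain a1 x1) (\<lambda>s. hlet (m_to a1 a2 s) (m_hash a1 a2)))
      (hsh i j (wto i j (chain i (wfrom i (Suc j) B))))"
  proof (rule val_let)
    show "val c1 (m_chain a1 x1) (chain i (wfrom i (Suc j) B))"
      by (rule val_chain[OF m1(1,5) a1(1) x1 i(1) seg_less[OF B]])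
    fix c2 x2 assume e2: "c1 \<sqsubseteq> c2" and x2: "val c2 x2 (chain i (wfrom i (Suc j) B))"
    note m2 = readyD[OF ready_mono[OF ready_mono[OF r e1] e2]] and a2 = a1[THEN val_mono, OF e2]
    show "val c2 (hlet (m_to a1 a2 x2) (m_hash a1 a2)) (hsh i j (wto i j (chain i (wfrom i (Suc j) B))))"
    proof (rule val_let)
      show "val c2 (m_to a1 a2 x2) (wto i j (chain i (wfrom i (Suc j) B)))"
        by (rule val_seg[OF m2(1-4) a2(1) val_num[OF m2(1)] a2(2) x2 i(1) chain_less]) simp
      fix c3 x3 assume e3: "c2 \<sqsubseteq> c3" and x3: "val c3 x3 (wto i j (chain i (wfrom i (Suc j) B)))"
      note m3 = readyD[OF ready_mono[OF ready_mono[OF ready_mono[OF r e1] e2] e3]]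
        and a3 = a2[THEN val_mono, OF e3]
      show "val c3 (m_hash a1 a2 x3) (hsh i j (wto i j (chain i (wfrom i (Suc j) B))))"
        by (rule val_hash[OF m3(1,4) a3(1,2) x3 i seg_less[OF chain_less]])
    qed
  qed
qed

lemma val_succ:
  assumes r: "ready c" and a: "val c a1 B" "val c a2 cur" and B: "B < MM"
  shows "val c (m_succ a1 a2) (succk B cur)"
  unfolding m_succ_def succk_def
proof (rule val_fold[where I = "\<lambda>_ _. True"])
  note m = readyD[OF r]
  show "lreg c 16 TT" by (rule std_lregs(13)[OF m(1)])
  have "B + 1 < 2 ^ bb" by (rule addr_less) (use B MM_le_NN in simp)
  then have "val c (a1 \<oplus> cst 1) (Suc B)"
    using val_add[OF a(1) val_num[OF m(1), of 1]] std_bits[OF m(1)] by simp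
  then show "val c (rd (var 19 \<oplus> (a1 \<oplus> cst 1))) (leadr (Suc B))"
    by (rule val_lead[OF m(1,3)]) (use B in simp)
  fix c1 x1 y i v assume e1: "c \<sqsubseteq> c1" and "i < TT" and x1: "val c1 x1 v" and y1: "val c1 y i"
  let ?F = "\<lambda>j acc. if cur < key (cand i j B) \<and> key (cand i j B) < acc then key (cand i j B) else acc"
  have "val c1 (hfold 10 x1 (\<lambda>acc j. hlet (m_cand y j a1) (\<lambda>e. hlet (m_key e)
      (\<lambda>\<kappa>. ite (a2 \<prec> \<kappa>) (ite (\<kappa> \<prec> acc) \<kappa> acc) acc)))) (iterate tt ?F v)"
  proof (rule val_fold[where I = "\<lambda>_ _. True"])
    note r1 = ready_mono[OF r e1]
    show "lreg c1 10 tt" by (rule std_lregs(7)[OF readyD(1)[OF r1]])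
    fix c2 x2 y2 j v assume e2: "c1 \<sqsubseteq> c2" and j: "j < tt" and x2: "val c2 x2 v" and y2: "val c2 y2 j"
    note r2 = ready_mono[OF r1 e2]
    have "val c2 (hlet (m_cand y y2 a1) (\<lambda>e. hlet (m_key e) (\<lambda>\<kappa>. ite (a2 \<prec> \<kappa>) (ite (\<kappa> \<prec> x2) \<kappa> x2) x2))) (?F j v)"
    proof (rule val_let)
      show "val c2 (m_cand y y2 a1) (cand i j B)"
        by (rule val_cand[OF r2 val_mono[OF y1 e2] y2 val_mono[OF val_mono[OF a(1) e1] e2] \<open>i < TT\<close> j B])
      fix c3 z assume e3: "c2 \<sqsubseteq> c3" and z: "val c3 z (cand i j B)"
      note r3 = readyD[OF ready_mono[OF r2 e3]]
      show "val c3 (hlet (m_key z) (\<lambda>\<kappa>. ite (a2 \<prec> \<kappa>) (ite (\<kappa> \<prec> x2) \<kappa> x2) x2)) (?F j v)"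
      proof (rule val_let[OF val_key[OF r3(1,2) z cand_less]])
        fix c4 k assume e4: "c3 \<sqsubseteq> c4" and k: "val c4 k (key (cand i j B))"
        have x4: "val c4 x2 v" and a4: "val c4 a2 cur"
          using val_mono[OF val_mono[OF x2 e3] e4]
            val_mono[OF val_mono[OF val_mono[OF val_mono[OF a(2) e1] e2] e3] e4] by auto
        show "val c4 (ite (a2 \<prec> k) (ite (k \<prec> x2) k x2) x2) (?F j v)"
        proof (rule val_ite[OF val_of_bool_less[OF a4 k]])
          assume "of_bool (cur < key (cand i j B)) \<noteq> (0::nat)"
          then have "cur < key (cand i j B)" by simp
          then show "val c4 (ite (k \<prec> x2) k x2) (?F j v)"
            using val_ite_less[OF k x4 k x4] by simp
        qed (use x4 in auto)
      qed
    qed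
    then show "val c2 (hlet (m_cand y y2 a1) (\<lambda>e. hlet (m_key e) (\<lambda>\<kappa>. ite (a2 \<prec> \<kappa>) (ite (\<kappa> \<prec> x2) \<kappa> x2) x2))) (?F j v) \<and> True" by blast
  qed (use x1 in auto)
  then show "val c1 (hfold 10 x1 (\<lambda>acc j. hlet (m_cand y j a1) (\<lambda>e. hlet (m_key e)
      (\<lambda>\<kappa>. ite (a2 \<prec> \<kappa>) (ite (\<kappa> \<prec> acc) \<kappa> acc) acc)))) (iterate tt ?F v) \<and> True" by blast
qed simp

end

definition m_par4 :: hexpr where "m_par4 = var 7 \<otimes> var 7 \<otimes> (var 7 \<otimes> var 7)"

text \<open>Each entry may use the registers filled by earlier ones; the two folds compute
  \<open>lt4\<close> and \<open>kk\<close>, bounded by the word length in register 8.\<close>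

definition m_params :: "nat \<Rightarrow> nat \<Rightarrow> hexpr list" where
  "m_params K C =
    [var 5 \<oplus> cst 1, cst K \<otimes> var 7,
     hfold 8 (cst 0) (\<lambda>l j. ite (var 6 \<prec> m_pow (cst 4 \<otimes> (l \<oplus> cst 1))) l (l \<oplus> cst 1)),
     m_pow (var 9), var 4 \<otimes> var 4 \<otimes> m_par4,
     hfold 8 (cst 0) (\<lambda>l j. ite (m_pow (l \<oplus> cst 1) \<prec> var 11) (l \<oplus> cst 1) l) \<oplus> cst 1,
     m_pow (var 12), m_pow (var 12 \<ominus> var 9), m_pow (var 12 \<ominus> cst 2 \<otimes> var 9 \<ominus> cst 1),
     cst C \<otimes> var 10 \<otimes> var 12, var 16 \<otimes> var 10, cst 16 \<otimes> m_par4,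
     cst 3 \<oplus> cst 2 \<otimes> var 4, var 19 \<oplus> var 14 \<oplus> cst 1, var 20 \<oplus> var 17, var 21 \<oplus> var 16 \<otimes> var 15,
     var 16 \<otimes> var 15, cst 2 \<otimes> var 4, var 22 \<oplus> var 13, cst 18 \<otimes> var 7, var 26 \<ominus> var 12,
     cst 8 \<otimes> var 7, cst 4 \<otimes> var 7, cst 2 \<otimes> var 7, cst 12 \<otimes> var 7]"

primrec lets_of :: "nat \<Rightarrow> hexpr list \<Rightarrow> expr list" where
  "lets_of d [] = []"
| "lets_of d (h # hs) = h d # lets_of (Suc d) hs"

lemma length_lets_of [simp]: "length (lets_of d hs) = length hs"
  by (induction hs arbitrary: d) auto

lemma lets_env_lets_of:
  assumes "length vs = length hs"
    "\<And>k. k < length hs \<Longrightarrow> val \<lparr>bits = b, lregs = min (d + k) G, cmem = m, depth = d + k,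
       env = store_list d (take k vs) \<rho>\<rparr> (hs ! k) (vs ! k)"
  shows "lets_env b G m (lets_of d hs) d \<rho> = store_list d vs \<rho>"
  using assms
proof (induction hs arbitrary: d vs \<rho>)
  case (Cons h hs)
  obtain v vs' where vs: "vs = v # vs'" "length vs' = length hs" using Cons.prems(1) by (cases vs) auto
  have "eval b (min d G) m (h d) d \<rho> = v"
    using val_eval[OF Cons.prems(2)[of 0]] by (simp add: vs)
  then have e: "lets_env b G m (lets_of d (h # hs)) d \<rho> = lets_env b G m (lets_of (Suc d) hs) (Suc d) (\<rho>(d := v))"
    by (simp del: fun_upd_apply)
  have "lets_env b G m (lets_of (Suc d) hs) (Suc d) (\<rho>(d := v)) = store_list (Suc d) vs' (\<rho>(d := v))"
  proof (rule Cons.IH[OF vs(2)])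
    fix k assume "k < length hs"
    then show "val \<lparr>bits = b, lregs = min (Suc d + k) G, cmem = m, depth = Suc d + k,
       env = store_list (Suc d) (take k vs') (\<rho>(d := v))\<rparr> (hs ! k) (vs' ! k)"
      using Cons.prems(2)[of "Suc k"] by (simp add: vs store_list_Cons del: fun_upd_apply)
  qed
  then show ?case unfolding e vs(1) store_list_Cons .
qed simp

context params
begin

definition partial :: "nat \<Rightarrow> ctx \<Rightarrow> bool" where
  "partial k c \<longleftrightarrow> bits c = bb \<and> lregs c = min (depth c) 32 \<and> 4 + k \<le> depth c \<and> (\<forall>i<k. env c (4 + i) = pv ! i)"

lemma partial_lreg: "partial k c \<Longrightarrow> i < k \<Longrightarrow> k \<le> 28 \<Longrightarrow> lreg c (4 + i) (pv ! i)"
  by (auto simp: partial_def lreg_def)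

lemma partial_val: "partial k c \<Longrightarrow> i < k \<Longrightarrow> val c (var (4 + i)) (pv ! i)"
  using val_var[of "4 + i" c] by (auto simp: partial_def)

lemma partial_all: "partial k c \<Longrightarrow> \<forall>i<23. i < k \<longrightarrow> val c (var (4 + i)) (pv ! i)"
  using partial_val by blast

lemma partial_vals:
  assumes "partial k c"
  shows "0 < k \<Longrightarrow> val c (var 4) n" "1 < k \<Longrightarrow> val c (var 5) w" "2 < k \<Longrightarrow> val c (var 6) q"
    "3 < k \<Longrightarrow> val c (var 7) WW" "4 < k \<Longrightarrow> val c (var 8) bb" "5 < k \<Longrightarrow> val c (var 9) lt4"
    "6 < k \<Longrightarrow> val c (var 10) tt" "7 < k \<Longrightarrow> val c (var 11) NW" "8 < k \<Longrightarrow> val c (var 12) kk"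
    "9 < k \<Longrightarrow> val c (var 13) NN" "10 < k \<Longrightarrow> val c (var 14) MM" "11 < k \<Longrightarrow> val c (var 15) mm"
    "12 < k \<Longrightarrow> val c (var 16) TT" "13 < k \<Longrightarrow> val c (var 17) RR" "14 < k \<Longrightarrow> val c (var 18) LV"
    "15 < k \<Longrightarrow> val c (var 19) LB" "16 < k \<Longrightarrow> val c (var 20) SB" "17 < k \<Longrightarrow> val c (var 21) CB"
    "18 < k \<Longrightarrow> val c (var 22) EN" "22 < k \<Longrightarrow> val c (var 26) uu"
  using partial_all[OF assms] by (simp_all add: pv_def All_less_Suc eval_nat_numeral)

lemma WW4_eq: "WW * WW * (WW * WW) = WW ^ 4" by (simp add: eval_nat_numeral)

lemma small_bits: "(x::nat) \<le> 2 ^ (20 * WW) \<Longrightarrow> x < 2 ^ bb" using fits_le[of x "20 * WW"] pos by simp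

lemma WW_le_pow: "WW \<le> 2 ^ WW" by (rule less_imp_le[OF less_exp])

lemma val_par4:
  assumes "bits c = bb" "val c (var 7) WW"
  shows "val c m_par4 (WW ^ 4)"
proof -
  have "WW ^ 4 \<le> 2 ^ (20 * WW)" using WW4 pow_le[of "4 * WW" "20 * WW"] by linarith
  from small_bits[OF this] have b: "WW * WW * (WW * WW) < 2 ^ bb" unfolding WW4_eq .
  have "WW * WW * 1 \<le> WW * WW * (WW * WW)" using pos by (intro mult_le_mono2) simp
  then have b2: "WW * WW < 2 ^ bb" using b by linarith
  show ?thesis unfolding m_par4_def WW4_eq[symmetric]
    by (intro val_mul assms(2)) (use b b2 assms(1) in simp_all)
qed

text \<open>Counting stops at \<open>L\<close>, so the invariant \<open>l \<le> L\<close> bounds the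
  exponents for which overflow has to be excluded.\<close>

lemma val_par_count:
  assumes l: "lreg c 8 bb" and b: "bits c = bb"
    and P: "\<not> P L" "\<And>c' x l. c \<sqsubseteq> c' \<Longrightarrow> val c' x l \<Longrightarrow> l \<le> L \<Longrightarrow> val c' (f x) (if P l then Suc l else l)"
    and L: "(LEAST l. \<not> P l) \<le> bb" "L = (LEAST l. \<not> P l)"
  shows "val c (hfold 8 (cst 0) (\<lambda>x y. f x)) L"
proof -
  have "val c (cst 0) 0" by (rule val_cst) (simp add: b)
  have "val c (hfold 8 (cst 0) (\<lambda>x y. f x)) (iterate bb (\<lambda>j l. if P l then Suc l else l) 0)"
  proof (rule val_fold[OF l \<open>val c (cst 0) 0\<close>, where I = "\<lambda>_ l. l \<le> L"])
    fix c' x y j a assume "c \<sqsubseteq> c'" "val c' x a" "a \<le> L"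
    moreover have "(if P a then Suc a else a) \<le> L"
      using P(1) \<open>a \<le> L\<close> by (cases "a = L") auto
    ultimately show "val c' (f x) (if P a then Suc a else a) \<and> (if P a then Suc a else a) \<le> L"
      using P(2) by blast
  qed simp
  then show ?thesis using iterate_count_up[of P L bb, OF P(1)] L by simp
qed

lemma bits_num: "bits c = bb \<Longrightarrow> k \<le> 20 \<Longrightarrow> val c (cst k) k"
  by (rule val_cst) (simp add: addr_less)

lemma bits_pow:
  assumes "bits c = bb" "val c a i" "i < C + 100 * WW"
  shows "val c (m_pow a) (2 ^ i)"
proof -
  have "(1::nat) * 2 ^ i < 2 ^ bits c" using fits_le[of "2 ^ i" i] assms by simp
  from val_shl[OF bits_num[OF assms(1)] assms(2) this] show ?thesis by (simp add: m_pow_def)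
qed

lemma val_lt4:
  assumes p: "partial 5 c"
  shows "val c (hfold 8 (cst 0) (\<lambda>l j. ite (var 6 \<prec> m_pow (cst 4 \<otimes> (l \<oplus> cst 1))) l (l \<oplus> cst 1))) lt4"
proof (rule val_par_count[where P = "\<lambda>l. 2 ^ (4 * Suc l) \<le> q"])
  show b: "bits c = bb" using p by (simp add: partial_def)
  show "lreg c 8 bb" using partial_lreg[OF p, of 4] by (simp add: pv_def)
  show e: "lt4 = (LEAST l. \<not> 2 ^ (4 * Suc l) \<le> q)" by (simp add: lt4_def)
  have "lt4 \<le> bb" using lt4_le bb_ge by (simp add: WW_def)
  then show "(LEAST l. \<not> 2 ^ (4 * Suc l) \<le> q) \<le> bb" by (simp only: e)
  have "(2::nat) ^ (4 * Suc lt4) = 16 * tt ^ 4" unfolding tt4_pow by (simp add: power_add)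
  then show "\<not> 2 ^ (4 * Suc lt4) \<le> q" using tt4(2) by simp
  fix c' x l assume ex: "c \<sqsubseteq> c'" and x: "val c' x l" and l: "l \<le> lt4"
  have b': "bits c' = bb" using b ext_bits[OF ex] by simp
  have ll: "4 * Suc l \<le> 8 * WW" using l lt4_le by (simp add: WW_def)
  then have "4 * Suc l \<le> bb" using bb_ge by simp
  from le_less_trans[OF this less_exp] have lb: "4 * (l + 1) < 2 ^ bb" by simp
  have l1: "val c' (x \<oplus> cst 1) (Suc l)"
    using val_add[OF x bits_num[OF b', of 1]] lb b' by simp
  have "val c' (cst 4 \<otimes> (x \<oplus> cst 1)) (4 * Suc l)"
    by (intro val_mul l1 bits_num b') (use lb b' in simp_all)
  then have pw: "val c' (m_pow (cst 4 \<otimes> (x \<oplus> cst 1))) (2 ^ (4 * Suc l))"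
    by (rule bits_pow[OF b']) (use ll pos in simp)
  have q: "val c' (var 6) q" by (rule val_mono[OF _ ex]) (use partial_vals(3)[OF p] in simp)
  \<comment> \<open>Only strict comparison is available, so the test is negated and the branches are
    exchanged.\<close>
  have swap: "(if a \<le> b then x else y) = (if b < a then y else x)" for a b x y :: nat by auto
  show "val c' (ite (var 6 \<prec> m_pow (cst 4 \<otimes> (x \<oplus> cst 1))) x (x \<oplus> cst 1)) (if 2 ^ (4 * Suc l) \<le> q then Suc l else l)"
    unfolding swap by (rule val_ite_less[OF q pw x l1])
qed

lemma val_kk:
  assumes p: "partial 8 c"
  shows "val c (hfold 8 (cst 0) (\<lambda>l j. ite (m_pow (l \<oplus> cst 1) \<prec> var 11) (l \<oplus> cst 1) l)) (kk - 1)"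
proof (rule val_par_count[where P = "\<lambda>l. 2 ^ Suc l < NW"])
  show b: "bits c = bb" using p by (simp add: partial_def)
  show "lreg c 8 bb" using partial_lreg[OF p, of 4] by (simp add: pv_def)
  show e: "kk - 1 = (LEAST l. \<not> 2 ^ Suc l < NW)" by (simp add: kk_def)
  have "kk \<le> bb" using kk_le bb_ge by linarith
  then have "kk - 1 \<le> bb" by linarith
  then show "(LEAST l. \<not> 2 ^ Suc l < NW) \<le> bb" by (simp only: e)
  have "Suc (kk - 1) = kk" using pos by simp
  then show "\<not> 2 ^ Suc (kk - 1) < NW" using NN_bounds(1) by (simp add: NN_def)
  fix c' x l assume ex: "c \<sqsubseteq> c'" and x: "val c' x l" and l: "l \<le> kk - 1"
  have b': "bits c' = bb" using b ext_bits[OF ex] by simp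
  have ll: "Suc l \<le> 8 * WW" using l kk_le pos by linarith
  then have "Suc l \<le> bb" using bb_ge by simp
  from le_less_trans[OF this less_exp] have lb: "l + 1 < 2 ^ bb" by simp
  have l1: "val c' (x \<oplus> cst 1) (Suc l)"
    using val_add[OF x bits_num[OF b', of 1]] lb b' by simp
  then have pw: "val c' (m_pow (x \<oplus> cst 1)) (2 ^ Suc l)"
    by (rule bits_pow[OF b']) (use ll pos in simp)
  have q: "val c' (var 11) NW" by (rule val_mono[OF _ ex]) (use partial_vals(8)[OF p] in simp)
  show "val c' (ite (m_pow (x \<oplus> cst 1) \<prec> var 11) (x \<oplus> cst 1) x) (if 2 ^ Suc l < NW then Suc l else l)"
    by (rule val_ite_less[OF pw q l1 x])
qed

lemma val_params:
  assumes "k < 25" "partial (3 + k) c"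
  shows "val c (m_params K C ! k) (pv ! (3 + k))"
proof -
  have b: "bits c = bb" using assms(2) by (simp add: partial_def)
  note v = partial_vals[OF assms(2)]
  note num = bits_num[OF b] and d = m_params_def pv_def
  have W: "WW \<le> 2 ^ (20 * WW)" using WW_le_pow pow_le[of WW "20 * WW"] by linarith
  have Wb: "x * WW < 2 ^ bb" if "x \<le> 20" for x
  proof (rule fits_le[of _ "40 * WW"])
    have "x * WW \<le> 2 ^ 20 * 2 ^ WW" using that WW_le_pow by (intro mult_le_mono) auto
    also have "\<dots> = 2 ^ (20 + WW)" by (simp only: power_add)
    also have "\<dots> \<le> 2 ^ (40 * WW)" by (rule pow_le) (simp add: WW_def)
    finally show "x * WW \<le> 2 ^ (40 * WW)" .
  qed (use pos in simp)
  have Kb: "K * WW < 2 ^ bb" using less_exp[of bb] by (simp add: bb_def)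
  have "K * 1 \<le> K * WW" using pos by (intro mult_le_mono2) simp
  then have K: "K < 2 ^ bb" using Kb by linarith
  have kb: "kk < 2 ^ bb" by (rule le_less_trans[OF kk_le Wb]) simp
  have lb: "2 * lt4 < 2 ^ bb" using Wb[of 1] lt4_le by (simp add: WW_def)
  have nb: "2 * n < 2 ^ bb" "3 + 2 * n < 2 ^ bb" by (rule addr_less, simp add: EN_def CB_def SB_def LB_def)+
  have NWb: "n * n * WW ^ 4 < 2 ^ bb" using NN_bounds(1) by (intro addr_less) (simp add: NW_def)
  have "n * n * 1 \<le> n * n * WW ^ 4" using pos by (intro mult_le_mono2) simp
  then have nn: "n * n < 2 ^ bb" using NWb by linarith
  have Cb: "C < 2 ^ bb"
  proof -
    have "C < 2 ^ C" by (rule less_exp)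
    then show ?thesis by (rule fits_less) simp
  qed
  have TTb: "C * tt * kk < 2 ^ bb" by (rule fits_le[OF TT_le[unfolded TT_def]]) (use pos in simp)
  have "C * tt * 1 \<le> C * tt * kk" using pos by (intro mult_le_mono2) simp
  then have Ct: "C * tt < 2 ^ bb" using TTb by linarith
  have "LV \<le> 2 ^ (5 * WW + 4 * WW)"
    unfolding LV_def power_add
  proof (intro mult_le_mono WW4)
    have "(16::nat) = 2 ^ 4" by simp
    also have "\<dots> \<le> 2 ^ (5 * WW)" by (rule pow_le) (simp add: WW_def)
    finally show "(16::nat) \<le> 2 ^ (5 * WW)" .
  qed
  then have LVb: "16 * WW ^ 4 < 2 ^ bb" unfolding LV_def by (rule fits_le) (use pos in simp)
  have ad: "LB + MM + 1 < 2 ^ bb" "SB + RR < 2 ^ bb" "CB + TM < 2 ^ bb" "RR < 2 ^ bb" "EN + NN < 2 ^ bb" "TM < 2 ^ bb"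
    by (rule addr_less, simp add: EN_def CB_def SB_def)+
  have le: "lt4 \<le> kk" "2 * lt4 \<le> kk" "1 \<le> kk - 2 * lt4" using lt4_kk by simp_all
  have kC: "kk < C + 100 * WW" "lt4 < C + 100 * WW" using kk_le le(1) pos by simp_all
  have ukk: "kk \<le> uu" using kk_le by (simp add: uu_def)
  have ub: "uu < 2 ^ bb" using Wb[of 18] by (simp add: uu_def)
  have p4: "3 < 3 + k \<Longrightarrow> val c m_par4 (WW ^ 4)" using val_par4[OF b] v(4) by simp
  consider "k < 5" | "5 \<le> k" "k < 10" | "10 \<le> k" "k < 15" | "15 \<le> k" "k < 20" | "20 \<le> k" "k < 25"
    using assms(1) by linarith
  then show ?thesis
  proof cases
    case 1
    then consider "k = 0" | "k = 1" | "k = 2" | "k = 3" | "k = 4" by linarith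
    then show ?thesis
    proof cases
      case 1
      have "val c (var 5 \<oplus> cst 1) (w + 1)"
        by (intro val_add v num) (use 1 Wb[of 1] b in \<open>simp_all add: WW_def\<close>)
      then show ?thesis using 1 by (simp add: d WW_def)
    next
      case 2
      have "val c (cst K \<otimes> var 7) (K * WW)" by (intro val_mul v val_cst) (use 2 K Kb b in simp_all)
      then show ?thesis using 2 by (simp add: d bb_def)
    next
      case 3
      then show ?thesis using val_lt4[of c] assms(2) by (simp add: d)
    next
      case 4
      have "val c (m_pow (var 9)) (2 ^ lt4)" by (intro bits_pow v b kC) (use 4 in simp)
      then show ?thesis using 4 by (simp add: d tt_def)
    next
      case 5
      have "val c (var 4 \<otimes> var 4 \<otimes> m_par4) (n * n * WW ^ 4)"
        by (intro val_mul v p4) (use 5 NWb nn b in simp_all)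
      then show ?thesis using 5 by (simp add: d NW_def)
    qed
  next
    case 2
    then consider "k = 5" | "k = 6" | "k = 7" | "k = 8" | "k = 9" by linarith
    then show ?thesis
    proof cases
      case 1
      have "val c (hfold 8 (cst 0) (\<lambda>l j. ite (m_pow (l \<oplus> cst 1) \<prec> var 11) (l \<oplus> cst 1) l) \<oplus> cst 1) (kk - 1 + 1)"
        by (intro val_add val_kk num) (use 1 assms(2) kb b pos in simp_all)
      then show ?thesis using 1 pos by (simp add: d)
    next
      case 2
      have "val c (m_pow (var 12)) (2 ^ kk)" by (intro bits_pow v b kC) (use 2 in simp)
      then show ?thesis using 2 by (simp add: d NN_def)
    next
      case 3
      have "val c (m_pow (var 12 \<ominus> var 9)) (2 ^ (kk - lt4))"
        by (intro bits_pow val_sub v b) (use 3 le kb kC b in simp_all)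
      then show ?thesis using 3 by (simp add: d MM_def)
    next
      case 4
      have "val c (m_pow (var 12 \<ominus> cst 2 \<otimes> var 9 \<ominus> cst 1)) (2 ^ (kk - 2 * lt4 - 1))"
        by (intro bits_pow val_sub val_mul v b num) (use 4 le kb lb kC b in simp_all)
      then show ?thesis using 4 by (simp add: d mm_def)
    next
      case 5
      have "val c (cst C \<otimes> var 10 \<otimes> var 12) (C * tt * kk)"
        by (intro val_mul v val_cst) (use 5 Cb Ct TTb b in simp_all)
      then show ?thesis using 5 by (simp add: d TT_def)
    qed
  next
    case 3
    then consider "k = 10" | "k = 11" | "k = 12" | "k = 13" | "k = 14" by linarith
    then show ?thesis
    proof cases
      case 1
      have "val c (var 16 \<otimes> var 10) (TT * tt)" by (intro val_mul v) (use 1 ad b in \<open>simp_all add: RR_def\<close>)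
      then show ?thesis using 1 by (simp add: d RR_def)
    next
      case 2
      have "val c (cst 16 \<otimes> m_par4) (16 * WW ^ 4)" by (intro val_mul num p4) (use 2 LVb b in simp_all)
      then show ?thesis using 2 by (simp add: d LV_def)
    next
      case 3
      have "val c (cst 3 \<oplus> cst 2 \<otimes> var 4) (3 + 2 * n)"
        by (intro val_add val_mul num v) (use 3 nb b in simp_all)
      then show ?thesis using 3 by (simp add: d LB_def)
    next
      case 4
      have "val c (var 19 \<oplus> var 14 \<oplus> cst 1) (LB + MM + 1)"
        by (intro val_add num v) (use 4 ad(1) b in simp_all)
      then show ?thesis using 4 by (simp add: d SB_def)
    next
      case 5
      have "val c (var 20 \<oplus> var 17) (SB + RR)"
        by (intro val_add num v) (use 5 ad(2) b in simp_all)
      then show ?thesis using 5 by (simp add: d CB_def)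
    qed
  next
    case 4
    then consider "k = 15" | "k = 16" | "k = 17" | "k = 18" | "k = 19" by linarith
    then show ?thesis
    proof cases
      case 1
      have "val c (var 21 \<oplus> var 16 \<otimes> var 15) (CB + TT * mm)"
        by (intro val_add val_mul v) (use 1 ad(3,6) b in \<open>simp_all add: TM_def\<close>)
      then show ?thesis using 1 by (simp add: d EN_def TM_def)
    next
      case 2
      have "val c (var 16 \<otimes> var 15) (TT * mm)"
        by (intro val_add val_mul v) (use 2 ad(3,6) b in \<open>simp_all add: TM_def\<close>)
      then show ?thesis using 2 by (simp add: d TM_def)
    next
      case 3
      have "val c (cst 2 \<otimes> var 4) (2 * n)" by (intro val_mul num v) (use 3 nb b in simp_all)
      then show ?thesis using 3 by (simp add: d)
    next
      case 4
      have "val c (var 22 \<oplus> var 13) (EN + NN)" by (intro val_add v) (use 4 ad(5) b in simp_all)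
      then show ?thesis using 4 by (simp add: d)
    next
      case 5
      have "val c (cst 18 \<otimes> var 7) (18 * WW)" by (intro val_mul num v) (use 5 Wb[of 18] b in simp_all)
      then show ?thesis using 5 by (simp add: d uu_def)
    qed
  next
    case 5
    then consider "k = 20" | "k = 21" | "k = 22" | "k = 23" | "k = 24" by linarith
    then show ?thesis
    proof cases
      case 1
      have "val c (var 26 \<ominus> var 12) (uu - kk)" by (intro val_sub v) (use 1 ukk ub b in simp_all)
      then show ?thesis using 1 by (simp add: d)
    next
      case 2
      have "val c (cst 8 \<otimes> var 7) (8 * WW)" by (intro val_mul num v) (use 2 Wb[of 8] b in simp_all)
      then show ?thesis using 2 by (simp add: d)
    next
      case 3
      have "val c (cst 4 \<otimes> var 7) (4 * WW)" by (intro val_mul num v) (use 3 Wb[of 4] b in simp_all)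
      then show ?thesis using 3 by (simp add: d)
    next
      case 4
      have "val c (cst 2 \<otimes> var 7) (2 * WW)" by (intro val_mul num v) (use 4 Wb[of 2] b in simp_all)
      then show ?thesis using 4 by (simp add: d)
    next
      case 5
      have "val c (cst 12 \<otimes> var 7) (12 * WW)" by (intro val_mul num v) (use 5 Wb[of 12] b in simp_all)
      then show ?thesis using 5 by (simp add: d)
    qed
  qed
qed

lemma val_piece:
  assumes s: "std c" and a: "val c a1 lo" "val c a2 hi" "val c a3 i" "val c a4 t"
    and b: "lo < 2 ^ w" "hi < 2 ^ w" "i < WW"
  shows "val c (m_piece a1 a2 a3 a4) (piece lo hi i t)"
proof -
  note sb = std_bits[OF s] and num = val_num[OF s]
  let ?l = "(lo + 2 ^ i - 1) div 2 ^ i" and ?r = "(hi + 1) div 2 ^ i"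
  have "(2::nat) ^ i \<le> 2 ^ w" "(1::nat) \<le> 2 ^ i" using b(3) by (simp_all add: WW_def)
  moreover have "(2::nat) ^ w * 2 = 2 ^ WW" by (simp add: WW_def)
  ultimately have l: "lo + 2 ^ i \<le> 2 ^ WW" "hi + 1 \<le> 2 ^ WW" using b by linarith+
  have one: "Suc 0 \<le> lo + 2 ^ i" using \<open>1 \<le> 2 ^ i\<close> by linarith
  have lb: "lo + 2 ^ i < 2 ^ bb" "hi + 1 < 2 ^ bb" by (rule fits_le[OF l(1)] fits_le[OF l(2)], use pos in simp)+
  have "?l \<le> lo + 2 ^ i - 1" by (rule div_le_dividend)
  moreover have "(0::nat) < 2 ^ i" by simp
  ultimately have lb2: "?l + 1 < 2 ^ bb" using lb(1) by linarith
  have pi: "val c (m_pow a3) (2 ^ i)" by (rule val_pow[OF s a(3)]) (use b(3) in simp)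
  have x: "val c (((a1 \<oplus> m_pow a3) \<ominus> cst 1) \<ggreater> a3) ?l" "val c ((a2 \<oplus> cst 1) \<ggreater> a3) ?r"
    by (intro val_shr val_sub val_add a pi num; use lb one sb in simp)+
  have x2: "val c (((a1 \<oplus> m_pow a3) \<ominus> cst 1) \<ggreater> a3 \<odot> cst 2) (?l mod 2)" "val c ((a2 \<oplus> cst 1) \<ggreater> a3 \<odot> cst 2) (?r mod 2)"
    by (intro val_mod x num; simp)+
  have x3: "val c (((a1 \<oplus> m_pow a3) \<ominus> cst 1) \<ggreater> a3 \<oplus> cst 1) (?l + 1)"
    by (intro val_add x num) (use lb2 sb in simp_all)
  have z: "val c (cst 0) 0" by (rule num) simp
  have v: "val c (m_piece a1 a2 a3 a4) (if ?l < ?r then (if t \<noteq> 0 then (if ?r mod 2 \<noteq> 0 then ?r else 0)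
      else (if ?l mod 2 \<noteq> 0 then ?l + 1 else 0)) else 0)"
    unfolding m_piece_def
    by (rule val_ite_less[OF x val_ite_nz[OF a(4) val_ite_nz[OF x2(2) x(2) z] val_ite_nz[OF x2(1) x3 z]] z])
  have "(if ?l < ?r then (if t \<noteq> 0 then (if ?r mod 2 \<noteq> 0 then ?r else 0)
      else (if ?l mod 2 \<noteq> 0 then ?l + 1 else 0)) else 0) = piece lo hi i t"
    unfolding piece_def Let_def odd_iff_mod_2_eq_one by (simp only: not_mod_2_eq_0_eq_1)
  then show ?thesis using v by (simp only:)
qed

end

section \<open>Values of selection, ranks and counts\<close>

context inst
begin

lemma val_select:
  assumes r: "ready c" and a: "val c a1 x" and x: "x \<le> NN"
  shows "val c (m_select a1) (select x)"
  unfolding m_select_def select_def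
proof (rule val_fold[where I = "\<lambda>_ _. True"])
  note m = readyD[OF r]
  show "lreg c 10 tt" by (rule std_lregs(7)[OF m(1)])
  have "x div tt \<le> MM" using div_le_mono[OF x, of tt] pos unfolding NN_MM by simp
  then show "val c (rd (var 19 \<oplus> a1 \<oslash> var 10)) (leadr (x div tt))"
    by (intro val_lead m val_div a std_vals(7))
  fix c1 z y u v assume e: "c \<sqsubseteq> c1" and z: "val c1 z v" and y: "val c1 y u"
  note r1 = ready_mono[OF r e]
  note t1 = std_vals(7)[OF readyD(1)[OF r1]] and a1 = val_mono[OF a e]
  have "val c1 (ite (y \<prec> a1 \<odot> var 10) (m_succ (a1 \<oslash> var 10) z) z) (if u < x mod tt then succk (x div tt) v else v)"
  proof (rule val_ite_less[OF y val_mod[OF a1 t1]])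
    assume "u < x mod tt"
    then have "x \<noteq> NN" unfolding NN_MM by auto
    then have "x < MM * tt" using x unfolding NN_MM by simp
    then have "x div tt < MM" by (rule less_mult_imp_div_less)
    then show "val c1 (m_succ (a1 \<oslash> var 10) z) (succk (x div tt) v)"
      by (rule val_succ[OF r1 val_div[OF a1 t1] z])
  qed (rule z)
  then show "val c1 (ite (y \<prec> a1 \<odot> var 10) (m_succ (a1 \<oslash> var 10) z) z)
      (if u < x mod tt then succk (x div tt) v else v) \<and> True" by blast
qed simp

lemma val_rank:
  assumes r: "ready c" and a: "val c a1 \<kappa>"
  shows "val c (m_rank a1) (rank \<kappa>)"
  unfolding m_rank_def rank_def
proof (rule val_desc[OF readyD(1)[OF r]])
  fix c' x p assume e: "c \<sqsubseteq> c'" and x: "val c' x p" and p: "0 < p" "p < 2 ^ bb"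
  note r1 = ready_mono[OF r e]
  note s = readyD(1)[OF r1]
  show "val c' (ite (var 13 \<prec> x) (cst 0) (m_select (x \<ominus> cst 1) \<prec> a1)) (of_bool (p \<le> NN \<and> select (p - 1) < \<kappa>))"
  proof (rule val_ite[OF val_of_bool_less[OF std_vals(10)[OF s] x]])
    assume "of_bool (NN < p) \<noteq> (0::nat)"
    then show "val c' (cst 0) (of_bool (p \<le> NN \<and> select (p - 1) < \<kappa>))" using val_num[OF s, of 0] by simp
  next
    assume "of_bool (NN < p) = (0::nat)"
    then have pN: "p \<le> NN" by simp
    have "val c' (x \<ominus> cst 1) (p - 1)" by (intro val_sub x val_num s) (use p std_bits[OF s] in simp_all)
    from val_select[OF r1 this] pN have "val c' (m_select (x \<ominus> cst 1)) (select (p - 1))" by simp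
    from val_of_bool_less[OF this val_mono[OF a e]] pN
    show "val c' (m_select (x \<ominus> cst 1) \<prec> a1) (of_bool (p \<le> NN \<and> select (p - 1) < \<kappa>))" by simp
  qed
qed

lemma rank_le: "good \<Longrightarrow> rank \<kappa> \<le> NN" by (simp add: rank_eq card_keys_le)

lemma rank_mono: "good \<Longrightarrow> \<kappa> \<le> \<kappa>' \<Longrightarrow> rank \<kappa> \<le> rank \<kappa>'"
  unfolding rank_eq by (intro card_mono) auto

lemma position_bound:
  assumes "v1 < 2 ^ WW" "v2 < 2 ^ WW" "v3 < 2 ^ WW" "v4 < 2 ^ WW" "i < WW ^ 4" "\<sigma> \<le> 2 ^ (4 * WW)"
  shows "(base i v1 v2 v3 v4 + \<sigma>) * 2 ^ (8 * WW) < 2 ^ bb"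
proof (rule fits_le[of _ "20 * WW"])
  have "(base i v1 v2 v3 v4 + \<sigma>) * 2 ^ (8 * WW) \<le> 2 ^ (12 * WW) * 2 ^ (8 * WW)"
    using base_less[OF assms(1-5)] assms(6) by (intro mult_le_mono1) linarith
  then show "(base i v1 v2 v3 v4 + \<sigma>) * 2 ^ (8 * WW) \<le> 2 ^ (20 * WW)" by (simp add: power_add[symmetric])
qed (use pos in simp)

lemma val_rank_at:
  assumes r: "ready c" and a: "val c a1 z" and z: "z * 2 ^ (8 * WW) < 2 ^ bb"
  shows "val c (hlet (a1 \<lless> var 28) m_rank) (rank (z * 2 ^ (8 * WW)))"
proof (rule val_let)
  note s = readyD(1)[OF r]
  show "val c (a1 \<lless> var 28) (z * 2 ^ (8 * WW))" by (intro val_shl a std_vals s) (use z std_bits[OF s] in simp)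
  fix c' x assume "c \<sqsubseteq> c'" "val c' x (z * 2 ^ (8 * WW))"
  then show "val c' (m_rank x) (rank (z * 2 ^ (8 * WW)))" using val_rank ready_mono[OF r] by blast
qed

text \<open>Word subtraction is exact only without underflow, hence the appeal to monotonicity of
  \<open>rank\<close> and through it to \<open>good\<close>.\<close>

lemma val_range:
  assumes r: "ready c" and g: good and a: "val c a1 (base i v1 v2 v3 v4)" "val c a2 \<sigma>"
    and v: "v1 < 2 ^ WW" "v2 < 2 ^ WW" "v3 < 2 ^ WW" "v4 < 2 ^ WW" "i < WW ^ 4" "\<sigma> \<le> 2 ^ (4 * WW)"
  shows "val c (m_range a1 a2) (rank ((base i v1 v2 v3 v4 + \<sigma>) * 2 ^ (8 * WW)) - rank (base i v1 v2 v3 v4 * 2 ^ (8 * WW)))"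
  unfolding m_range_def
proof (rule val_sub)
  note s = readyD(1)[OF r]
  note p = position_bound[OF v]
  have p0: "base i v1 v2 v3 v4 * 2 ^ (8 * WW) < 2 ^ bb" using position_bound[OF v(1-5), of 0] by simp
  have "base i v1 v2 v3 v4 + \<sigma> \<le> (base i v1 v2 v3 v4 + \<sigma>) * 2 ^ (8 * WW)" by simp
  then have "base i v1 v2 v3 v4 + \<sigma> < 2 ^ bb" using p by linarith
  then have "val c (a1 \<oplus> a2) (base i v1 v2 v3 v4 + \<sigma>)" by (intro val_add a) (simp add: std_bits[OF s])
  then show "val c (hlet ((a1 \<oplus> a2) \<lless> var 28) m_rank) (rank ((base i v1 v2 v3 v4 + \<sigma>) * 2 ^ (8 * WW)))"
    by (rule val_rank_at[OF r _ p])
  show "val c (hlet (a1 \<lless> var 28) m_rank) (rank (base i v1 v2 v3 v4 * 2 ^ (8 * WW)))"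
    by (rule val_rank_at[OF r a(1) p0])
  show "rank (base i v1 v2 v3 v4 * 2 ^ (8 * WW)) \<le> rank ((base i v1 v2 v3 v4 + \<sigma>) * 2 ^ (8 * WW))"
    by (rule rank_mono[OF g]) (intro mult_le_mono1, simp)
  have "NN < 2 ^ bb" by (rule addr_less) simp
  from le_less_trans[OF rank_le[OF g] this]
  show "rank ((base i v1 v2 v3 v4 + \<sigma>) * 2 ^ (8 * WW)) < 2 ^ bits c" using std_bits[OF s] by simp
qed

definition box :: "ctx \<Rightarrow> nat \<Rightarrow> nat \<Rightarrow> nat \<Rightarrow> nat \<Rightarrow> bool" where
  "box c x1 x2 y1 y2 \<longleftrightarrow> val c (var 0) x1 \<and> val c (var 1) x2 \<and> val c (var 2) y1 \<and> val c (var 3) y2 \<and>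
     x1 < 2 ^ w \<and> x2 < 2 ^ w \<and> y1 < 2 ^ w \<and> y2 < 2 ^ w"

lemma box_mono: "box c x1 x2 y1 y2 \<Longrightarrow> c \<sqsubseteq> c' \<Longrightarrow> box c' x1 x2 y1 y2"
  unfolding box_def using val_mono by blast

lemma pterm_le: "good \<Longrightarrow> pterm x1 x2 y1 y2 \<sigma> z \<le> NN"
proof -
  assume good
  have "(if a then if b then if c then if d then rank \<kappa> - x else 0 else 0 else 0 else 0) \<le> NN" for a b c d \<kappa> x
    using rank_le[OF \<open>good\<close>, of \<kappa>] by auto
  then show ?thesis unfolding pterm_def Let_def by blast
qed

lemma val_pterm:
  assumes r: "ready c" and g: good and bx: "box c x1 x2 y1 y2" and a: "val c a1 \<sigma>" "val c a2 z"
    and \<sigma>: "\<sigma> \<le> 2 ^ (4 * WW)" and z: "z < LV"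
  shows "val c (m_pterm a1 a2) (pterm x1 x2 y1 y2 \<sigma> z)"
proof -
  note s = readyD(1)[OF r] and sb = std_bits[OF readyD(1)[OF r]]
  define l where "l = z div 2 div 2 div 2 div 2"
  define c1 where "c1 = piece x1 x2 (lv1 l) (z mod 2)"
  define c2 where "c2 = piece y1 y2 (lv2 l) (z div 2 mod 2)"
  define c3 where "c3 = piece x1 x2 (lv3 l) (z div 2 div 2 mod 2)"
  define c4 where "c4 = piece y1 y2 (lv4 l) (z div 2 div 2 div 2 mod 2)"
  define z1 where "z1 = a2 \<oslash> cst 2"
  define z2 where "z2 = z1 \<oslash> cst 2"
  define z3 where "z3 = z2 \<oslash> cst 2"
  define m where "m = z3 \<oslash> cst 2"
  define m1 where "m1 = m_piece (var 0) (var 1) (m \<odot> var 7) (a2 \<odot> cst 2)"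
  define m2 where "m2 = m_piece (var 2) (var 3) (m \<oslash> var 7 \<odot> var 7) (z1 \<odot> cst 2)"
  define m3 where "m3 = m_piece (var 0) (var 1) (m \<oslash> var 7 \<oslash> var 7 \<odot> var 7) (z2 \<odot> cst 2)"
  define m4 where "m4 = m_piece (var 2) (var 3) (m \<oslash> var 7 \<oslash> var 7 \<oslash> var 7 \<odot> var 7) (z3 \<odot> cst 2)"
  have two: "val c (cst 2) 2" and zero: "val c (cst 0) 0" by (rule val_num[OF s], simp)+
  note W = std_vals(4)[OF s]
  have vz: "val c z1 (z div 2)" "val c z2 (z div 2 div 2)" "val c z3 (z div 2 div 2 div 2)" "val c m l"
    unfolding m_def z3_def z2_def z1_def l_def by (intro val_div a two)+
  have lw: "lv1 l < WW" "lv2 l < WW" "lv3 l < WW" "lv4 l < WW"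
    using pos by (simp_all add: lv1_def lv2_def lv3_def lv4_def)
  have vl: "val c (m \<odot> var 7) (lv1 l)" "val c (m \<oslash> var 7 \<odot> var 7) (lv2 l)"
    "val c (m \<oslash> var 7 \<oslash> var 7 \<odot> var 7) (lv3 l)" "val c (m \<oslash> var 7 \<oslash> var 7 \<oslash> var 7 \<odot> var 7) (lv4 l)"
    unfolding lv1_def lv2_def lv3_def lv4_def by (intro val_mod val_div vz W)+
  have vb: "val c (var 0) x1" "val c (var 1) x2" "val c (var 2) y1" "val c (var 3) y2"
    and xb: "x1 < 2 ^ w" "x2 < 2 ^ w" "y1 < 2 ^ w" "y2 < 2 ^ w" using bx by (simp_all add: box_def)
  have vc: "val c m1 c1" "val c m2 c2" "val c m3 c3" "val c m4 c4"
    unfolding m1_def m2_def m3_def m4_def c1_def c2_def c3_def c4_def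
    by (intro val_piece[OF s] vb xb vl lw val_mod vz two a)+
  have pw: "(2::nat) ^ w < 2 ^ WW" by (simp add: WW_def)
  have "c1 \<le> x2 + 1" "c2 \<le> y2 + 1" "c3 \<le> x2 + 1" "c4 \<le> y2 + 1"
    unfolding c1_def c2_def c3_def c4_def by (rule piece_le)+
  then have v: "c1 < 2 ^ WW" "c2 < 2 ^ WW" "c3 < 2 ^ WW" "c4 < 2 ^ WW"
    using xb pw by linarith+
  have vb: "x < 2 ^ bb" if "x < 2 ^ WW" for x :: nat by (rule fits_less[OF that]) simp
  have v1: "c1 - 1 < 2 ^ WW" "c2 - 1 < 2 ^ WW" "c3 - 1 < 2 ^ WW" "c4 - 1 < 2 ^ WW"
    using v by linarith+
  have "z div 16 < WW ^ 4" using z by (simp add: LV_def less_mult_imp_div_less mult.commute)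
  moreover have "l = z div 16" by (simp add: l_def div_mult2_eq[symmetric])
  ultimately have l: "l < WW ^ 4" by simp
  have p: "pterm x1 x2 y1 y2 \<sigma> z = (if c1 \<noteq> 0 then if c2 \<noteq> 0 then if c3 \<noteq> 0 then if c4 \<noteq> 0 then
       rank ((base l (c1 - 1) (c2 - 1) (c3 - 1) (c4 - 1) + \<sigma>) * 2 ^ (8 * WW)) -
       rank (base l (c1 - 1) (c2 - 1) (c3 - 1) (c4 - 1) * 2 ^ (8 * WW)) else 0 else 0 else 0 else 0)"
    unfolding pterm_def Let_def c1_def c2_def c3_def c4_def l_def ..
  have mp: "m_pterm a1 a2 = ite m1 (ite m2 (ite m3 (ite m4
       (m_range (m_base m (m1 \<ominus> cst 1) (m2 \<ominus> cst 1) (m3 \<ominus> cst 1) (m4 \<ominus> cst 1)) a1)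
       (cst 0)) (cst 0)) (cst 0)) (cst 0)"
    unfolding m_pterm_def Let_def m1_def m2_def m3_def m4_def m_def z3_def z2_def z1_def ..
  have sub: "val c (x \<ominus> cst 1) (k - 1)" if "val c x k" "k \<noteq> 0" "k < 2 ^ WW" for x k
    by (intro val_sub that(1) val_num s) (use that vb[OF that(3)] sb in simp_all)
  show ?thesis unfolding p mp
    by (rule val_ite_nz[OF vc(1) _ zero], rule val_ite_nz[OF vc(2) _ zero], rule val_ite_nz[OF vc(3) _ zero],
        rule val_ite_nz[OF vc(4) _ zero])
      (intro val_range[OF r g] val_base[OF s] vz sub vc v v1 l a \<sigma>; assumption)
qed

lemma val_cnt:
  assumes r: "ready c" and g: good and bx: "box c x1 x2 y1 y2" and a: "val c a1 \<sigma>" and \<sigma>: "\<sigma> \<le> 2 ^ (4 * WW)"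
  shows "val c (m_cnt a1) (cnt x1 x2 y1 y2 \<sigma>)"
  unfolding m_cnt_def cnt_def
proof (rule val_fold[where I = "\<lambda>j v. v \<le> j * NN"])
  note s = readyD(1)[OF r]
  show "lreg c 18 LV" by (rule std_lregs(15)[OF s])
  show "val c (cst 0) 0" by (rule val_num[OF s]) simp
  fix c1 x y j v assume e: "c \<sqsubseteq> c1" and j: "j < LV" and v: "v \<le> j * NN" and xy: "val c1 x v" "val c1 y j"
  note r1 = ready_mono[OF r e]
  note pt = pterm_le[OF g, of x1 x2 y1 y2 \<sigma> j]
  have le: "v + pterm x1 x2 y1 y2 \<sigma> j \<le> Suc j * NN" using v pt by simp
  also have "\<dots> \<le> LV * NN" using j by (intro mult_le_mono1) simp
  also have "\<dots> \<le> 2 ^ (4 + 4 * WW + 8 * WW)"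
    unfolding LV_def power_add using WW4 NN_le by (intro mult_le_mono) simp_all
  finally have "v + pterm x1 x2 y1 y2 \<sigma> j < 2 ^ bb" by (rule fits_le) (use pos in simp)
  then have "val c1 (x \<oplus> m_pterm a1 y) (v + pterm x1 x2 y1 y2 \<sigma> j)"
    by (intro val_add xy val_pterm[OF r1 g box_mono[OF bx e] val_mono[OF a e] xy(2) \<sigma> j])
      (simp add: std_bits[OF readyD(1)[OF r1]])
  then show "val c1 (x \<oplus> m_pterm a1 y) (v + pterm x1 x2 y1 y2 \<sigma> j) \<and> v + pterm x1 x2 y1 y2 \<sigma> j \<le> Suc j * NN"
    using le by blast
qed simp

lemma val_sigma:
  assumes r: "ready c" and g: good and bx: "box c x1 x2 y1 y2" and a: "val c a1 k"
  shows "val c (m_sigma a1) (sigma x1 x2 y1 y2 k)"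
  unfolding m_sigma_def sigma_def
proof (rule val_desc[OF readyD(1)[OF r]])
  fix c' x p assume e: "c \<sqsubseteq> c'" and x: "val c' x p" and p: "0 < p" "p < 2 ^ bb"
  note r1 = ready_mono[OF r e]
  note s = readyD(1)[OF r1]
  have pw: "val c' (m_pow (var 29)) (2 ^ (4 * WW))" by (rule val_pow[OF s std_vals(26)[OF s]]) (use pos in simp)
  note k = val_num[OF s, of 0] val_num[OF s, of 1]
  show "val c' (ite (m_pow (var 29) \<prec> x) (cst 0) (ite (a1 \<prec> m_cnt x) (cst 0) (cst 1)))
      (of_bool (p \<le> 2 ^ (4 * WW) \<and> cnt x1 x2 y1 y2 p \<le> k))"
  proof (rule val_ite[OF val_of_bool_less[OF pw x]])
    assume "of_bool (2 ^ (4 * WW) < p) = (0::nat)"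
    then have p4: "p \<le> 2 ^ (4 * WW)" by simp
    show "val c' (ite (a1 \<prec> m_cnt x) (cst 0) (cst 1)) (of_bool (p \<le> 2 ^ (4 * WW) \<and> cnt x1 x2 y1 y2 p \<le> k))"
      by (rule val_ite[OF val_of_bool_less[OF val_mono[OF a e] val_cnt[OF r1 g box_mono[OF bx e] x p4]]])
        (use k p4 in auto)
  qed (use k in auto)
qed

text \<open>A bit is set only if the new value satisfies the predicate, so the search never leaves
  this range, whatever the counts are.\<close>

lemma sigma_le: "sigma x1 x2 y1 y2 k \<le> 2 ^ (4 * WW)"
proof -
  define P where "P = (\<lambda>\<sigma>. \<sigma> \<le> 2 ^ (4 * WW) \<and> cnt x1 x2 y1 y2 \<sigma> \<le> k)"
  have "iterate j (\<lambda>j p. if P (p + 2 ^ (bb - 1 - j)) then p + 2 ^ (bb - 1 - j) else p) 0 \<le> 2 ^ (4 * WW)" for j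
    by (induction j) (auto simp: P_def)
  then show ?thesis by (simp add: sigma_def descend_def P_def)
qed

lemma val_find:
  assumes r: "ready c" and g: good and a: "val c a1 \<sigma>" and \<sigma>: "\<sigma> \<le> 2 ^ (4 * WW)"
  shows "val c (m_find a1) (find \<sigma>)"
proof -
  note s = readyD(1)[OF r] and sb = std_bits[OF readyD(1)[OF r]]
  have W4: "val c (var 7 \<otimes> var 7 \<otimes> (var 7 \<otimes> var 7)) (WW ^ 4)"
    using val_par4[OF sb std_vals(4)[OF s]] by (simp add: m_par4_def)
  have "WW ^ 4 < 2 ^ bb" by (rule fits_le[OF WW4]) (use pos in simp)
  then have W: "val c (var 7 \<otimes> var 7 \<otimes> (var 7 \<otimes> var 7) \<ominus> cst 1) (WW ^ 4 - 1)"
    by (intro val_sub W4 val_num s) (use pos sb in simp_all)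
  have z: "val c (cst 0) 0" by (rule val_num[OF s]) simp
  have l: "WW ^ 4 - 1 < WW ^ 4" using pos by simp
  have p: "(0::nat) < 2 ^ WW" by simp
  have t: "val c m_top ztop"
    unfolding m_top_def ztop_def by (rule val_base[OF s W z z z z p p p p l])
  note pb = position_bound[OF p p p p l \<sigma>, folded ztop_def]
  have "ztop + \<sigma> \<le> (ztop + \<sigma>) * 2 ^ (8 * WW)" by simp
  from le_less_trans[OF this pb]
  have "val c (m_top \<oplus> a1) (ztop + \<sigma>)" by (intro val_add t a) (simp add: sb)
  from val_rank_at[OF r this pb]
  have "val c (hlet ((m_top \<oplus> a1) \<lless> var 28) m_rank) (rank ((ztop + \<sigma>) * 2 ^ (8 * WW)))" .
  then have v: "val c (hlet (hlet ((m_top \<oplus> a1) \<lless> var 28) m_rank) m_select) (select (rank ((ztop + \<sigma>) * 2 ^ (8 * WW))))"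
    by (rule val_let) (rule val_select[OF ready_mono[OF r]], assumption+, rule rank_le[OF g])
  show ?thesis unfolding m_find_def find_def
    by (intro val_mod v val_pow std_vals s) (use pos in simp)
qed

end

definition m_anum :: "hexpr \<Rightarrow> hexpr" where "m_anum e = m_num (e \<odot> var 4) (e \<oslash> var 4 \<odot> var 4)"
definition m_aden :: "hexpr \<Rightarrow> hexpr" where "m_aden e = m_px (e \<oslash> var 4 \<odot> var 4) \<ominus> m_px (e \<odot> var 4)"

text \<open>Registers 32 to 39: number of pairs, two elements with the middle slopes, denominator of
  the median, sum of the shifted numerators, the shift to be subtracted, sign, absolute value of the
  difference. For an empty box all tests on register 32 fail, and denominator 0 reports that there
  is no estimator.\<close>

definition m_answer :: "hexpr list" where
  "m_answer =
    [m_cnt (m_pow (var 29)),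
     ite (var 32) (m_find (m_sigma ((var 32 \<ominus> cst 1) \<oslash> cst 2))) (cst 0),
     ite (var 32) (m_find (m_sigma (var 32 \<oslash> cst 2))) (cst 0),
     ite (var 32) ((m_aden (var 33) \<otimes> m_aden (var 34)) \<lless> cst 1) (cst 0),
     ite (var 32) (m_anum (var 33) \<otimes> m_aden (var 34) \<oplus> m_anum (var 34) \<otimes> m_aden (var 33)) (cst 0),
     ite (var 32) (m_aden (var 33) \<otimes> m_aden (var 34) \<otimes> m_pow (var 7 \<oplus> cst 1)) (cst 0),
     var 36 \<prec> var 37,
     ite (var 36 \<prec> var 37) (var 37 \<ominus> var 36) (var 36 \<ominus> var 37)]"

definition query_lets :: "nat \<Rightarrow> nat \<Rightarrow> hexpr list" where
  "query_lets K C = [rd (cst 0), rd (cst 1), rd (cst 2)] @ m_params K C @ m_answer"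

definition query_prog :: "nat \<Rightarrow> nat \<Rightarrow> program" where
  "query_prog K C = query_program 32 (lets_of 4 (query_lets K C)) [(0, 38), (1, 39), (2, 35)]"

text \<open>The list enumerates the points without repetition, so pairs of indices correspond to
  pairs of points and slopes keep their multiplicities.\<close>

lemma theil_sen_pairs:
  fixes ps :: "(nat \<times> nat) list" and x1 x2 y1 y2 :: nat
  assumes "distinct ps" "set ps = S" "length ps = n"
  defines "I \<equiv> {(i, j). i < n \<and> j < n \<and> fst (ps ! i) < fst (ps ! j) \<and>
     (x1 \<le> fst (ps ! i) \<and> fst (ps ! i) \<le> x2) \<and> (y1 \<le> snd (ps ! i) \<and> snd (ps ! i) \<le> y2) \<and>
     (x1 \<le> fst (ps ! j) \<and> fst (ps ! j) \<le> x2) \<and> (y1 \<le> snd (ps ! j) \<and> snd (ps ! j) \<le> y2)}"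
  defines "M \<equiv> image_mset (\<lambda>(i, j). (real (snd (ps ! j)) - real (snd (ps ! i))) /
    (real (fst (ps ! j)) - real (fst (ps ! i)))) (mset_set I)"
  shows "theil_sen (S \<inter> {x1..x2} \<times> {y1..y2}) = (if I = {} then None else Some (median M))"
proof -
  let ?P = "S \<inter> {x1..x2} \<times> {y1..y2}"
  let ?g = "\<lambda>(i, j). (ps ! i, ps ! j)"
  have fin: "finite I" by (rule finite_subset[of _ "{..<n} \<times> {..<n}"]) (auto simp: I_def)
  have inj: "inj_on ?g I"
  proof (rule inj_onI, clarify)
    fix i j i' j' assume h: "(i, j) \<in> I" "(i', j') \<in> I" "ps ! i = ps ! i'" "ps ! j = ps ! j'"
    then show "i = i' \<and> j = j'"
      using nth_eq_iff_index_eq[OF assms(1), of i i'] nth_eq_iff_index_eq[OF assms(1), of j j'] assms(3)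
      by (auto simp: I_def)
  qed
  have img: "{(p, q). p \<in> ?P \<and> q \<in> ?P \<and> fst p < fst q} = ?g ` I"
  proof (intro set_eqI iffI)
    fix pq assume h: "pq \<in> {(p, q). p \<in> ?P \<and> q \<in> ?P \<and> fst p < fst q}"
    obtain p q where pq: "pq = (p, q)" by (cases pq)
    have "p \<in> set ps" "q \<in> set ps" using h assms(2) by (auto simp: pq)
    then obtain i j where ij: "i < n" "ps ! i = p" "j < n" "ps ! j = q"
      using assms(3) by (auto simp: in_set_conv_nth)
    have "(i, j) \<in> I" using h ij by (auto simp: pq I_def)
    then show "pq \<in> ?g ` I" using ij by (auto simp: pq intro!: rev_image_eqI)
  next
    fix pq assume "pq \<in> ?g ` I"
    then obtain i j where ij: "(i, j) \<in> I" "pq = (ps ! i, ps ! j)" by auto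
    then have "ps ! i \<in> S" "ps ! j \<in> S" using assms(2,3) by (auto simp: I_def)
    then show "pq \<in> {(p, q). p \<in> ?P \<and> q \<in> ?P \<and> fst p < fst q}" using ij by (auto simp: I_def mem_Times_iff)
  qed
  have "slopes ?P = M"
    unfolding slopes_def img image_mset_mset_set[OF inj, symmetric] M_def multiset.map_comp
    by (intro arg_cong[of _ _ "\<lambda>f. image_mset f (mset_set I)"]) (auto simp: fun_eq_iff)
  moreover have "M = {#} \<longleftrightarrow> I = {}" using fin by (simp add: M_def mset_set_empty_iff)
  ultimately show ?thesis by (simp add: theil_sen_def)
qed

context inst
begin

definition answer_vals :: "nat \<Rightarrow> nat \<Rightarrow> nat \<Rightarrow> nat \<Rightarrow> nat list" where
  "answer_vals x1 x2 y1 y2 = (let tot = cnt x1 x2 y1 y2 (2 ^ (4 * WW));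
      e1 = (if tot \<noteq> 0 then find (sigma x1 x2 y1 y2 ((tot - 1) div 2)) else 0);
      e2 = (if tot \<noteq> 0 then find (sigma x1 x2 y1 y2 (tot div 2)) else 0);
      p = (if tot \<noteq> 0 then anum e1 * aden e2 + anum e2 * aden e1 else 0);
      d = (if tot \<noteq> 0 then aden e1 * aden e2 * 2 ^ (WW + 1) else 0) in
    [tot, e1, e2, if tot \<noteq> 0 then aden e1 * aden e2 * 2 ^ 1 else 0, p, d, of_bool (p < d), if p < d then d - p else p - d])"

lemma length_answer_vals: "length (answer_vals x1 x2 y1 y2) = 8"
  by (simp add: answer_vals_def Let_def)

lemma total_eq:
  assumes good "x2 < 2 ^ w" "y2 < 2 ^ w"
  shows "cnt x1 x2 y1 y2 (2 ^ (4 * WW)) = card (pairs x1 x2 y1 y2)"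
proof -
  have "{ij \<in> pairs x1 x2 y1 y2. (case ij of (i, j) \<Rightarrow> code i j) < 2 ^ (4 * WW)} = pairs x1 x2 y1 y2"
    using code_less by (auto simp: pairs_def)
  then show ?thesis using cnt_eq[OF assms, of "2 ^ (4 * WW)"] by simp
qed

lemma anum_le:
  assumes "px (e mod n) < px (e div n mod n)"
  shows "anum e \<le> 2 ^ (2 * WW)" "aden e \<le> 2 ^ WW"
proof -
  have ij: "e mod n < n" "e div n mod n < n" using n1 by simp_all
  show "anum e \<le> 2 ^ (2 * WW)"
    unfolding anum_def WW_def by (rule slope_code_bound(2)) (use px py ij assms in auto)
  show "aden e \<le> 2 ^ WW" using px_less(1)[OF ij(2)] by (simp add: aden_def)
qed

lemma val_anum:
  assumes s: "std c" and p: "pts c" and a: "val c a1 e" and lt: "px (e mod n) < px (e div n mod n)"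
  shows "val c (m_anum a1) (anum e)" "val c (m_aden a1) (aden e)"
proof -
  have ij: "e mod n < n" "e div n mod n < n" using n1 by simp_all
  have v: "val c (a1 \<odot> var 4) (e mod n)" "val c (a1 \<oslash> var 4 \<odot> var 4) (e div n mod n)"
    by (intro val_mod val_div a std_vals s)+
  show "val c (m_anum a1) (anum e)"
    unfolding m_anum_def anum_def by (rule val_slope_num(1)[OF s p v ij lt])
  show "val c (m_aden a1) (aden e)"
    unfolding m_aden_def aden_def
    by (intro val_sub val_px[OF s p] v ij) (use lt fits_less[OF px_less(1)[OF ij(2)]] std_bits[OF s] in simp_all)
qed

lemma val_answer:
  assumes r: "ready c" and g: good and bx: "box c x1 x2 y1 y2" and k: "k < 8"
    and v: "\<And>i. i < k \<Longrightarrow> val c (var (32 + i)) (answer_vals x1 x2 y1 y2 ! i)"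
  shows "val c (m_answer ! k) (answer_vals x1 x2 y1 y2 ! k)"
proof -
  note s = readyD(1)[OF r] and sb = std_bits[OF readyD(1)[OF r]]
  define tot where "tot = cnt x1 x2 y1 y2 (2 ^ (4 * WW))"
  define f1 where "f1 = find (sigma x1 x2 y1 y2 ((tot - 1) div 2))"
  define f2 where "f2 = find (sigma x1 x2 y1 y2 (tot div 2))"
  define e1 where "e1 = (if tot \<noteq> 0 then f1 else 0)"
  define e2 where "e2 = (if tot \<noteq> 0 then f2 else 0)"
  define p where "p = (if tot \<noteq> 0 then anum e1 * aden e2 + anum e2 * aden e1 else 0)"
  define d where "d = (if tot \<noteq> 0 then aden e1 * aden e2 * 2 ^ (WW + 1) else 0)"
  have a: "answer_vals x1 x2 y1 y2 = [tot, e1, e2, if tot \<noteq> 0 then aden e1 * aden e2 * 2 ^ 1 else 0, p, d,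
      of_bool (p < d), if p < d then d - p else p - d]"
    unfolding answer_vals_def Let_def tot_def e1_def e2_def p_def d_def f1_def f2_def ..
  have xb: "x2 < 2 ^ w" "y2 < 2 ^ w" using bx by (simp_all add: box_def)
  note tot = total_eq[OF g xb, of x1 y1, folded tot_def]
  have "pairs x1 x2 y1 y2 \<subseteq> {..<n} \<times> {..<n}" by (auto simp: pairs_def)
  then have "tot \<le> n * n" unfolding tot using card_mono[of "{..<n} \<times> {..<n}"] by simp
  moreover have "n * n * 1 \<le> NW" unfolding NW_def using pos by (intro mult_le_mono2) simp
  ultimately have totb: "tot < 2 ^ bb" using NN_bounds(1) by (intro addr_less) linarith
  have z: "val c (cst 0) 0" by (rule val_num[OF s]) simp
  have ne: "px (e1 mod n) < px (e1 div n mod n)" "px (e2 mod n) < px (e2 div n mod n)" if "tot \<noteq> 0"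
  proof -
    have "(tot - 1) div 2 < tot" "tot div 2 < tot" using that by linarith+
    then show "px (e1 mod n) < px (e1 div n mod n)" "px (e2 mod n) < px (e2 div n mod n)"
      using sigma_find(1)[OF g xb, of "(tot - 1) div 2" x1 y1] sigma_find(1)[OF g xb, of "tot div 2" x1 y1] that
      unfolding e1_def e2_def f1_def f2_def tot[symmetric] by simp_all
  qed
  have v0: "0 < k \<Longrightarrow> val c (var 32) tot" and v1: "1 < k \<Longrightarrow> val c (var 33) e1" and v2: "2 < k \<Longrightarrow> val c (var 34) e2"
    and v4: "4 < k \<Longrightarrow> val c (var 36) p" and v5: "5 < k \<Longrightarrow> val c (var 37) d"
    using v[of 0] v[of 1] v[of 2] v[of 4] v[of 5] by (simp_all add: a)
  have b: "anum e1 * aden e2 + anum e2 * aden e1 < 2 ^ bb" "anum e1 * aden e2 < 2 ^ bb" "anum e2 * aden e1 < 2 ^ bb"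
    "aden e1 * aden e2 * 2 ^ (WW + 1) < 2 ^ bb" "aden e1 * aden e2 * 2 ^ 1 < 2 ^ bb" "aden e1 * aden e2 < 2 ^ bb"
    "(2::nat) ^ (WW + 1) < 2 ^ bb" "WW + 1 < 2 ^ bb" if "tot \<noteq> 0"
  proof -
    note an = anum_le[OF ne(1)[OF that]] anum_le[OF ne(2)[OF that]]
    have W3: "(2::nat) ^ (2 * WW) * 2 ^ WW = 2 ^ (3 * WW)" "(2::nat) ^ WW * 2 ^ WW = 2 ^ (2 * WW)"
      by (simp_all add: power_add[symmetric])
    have c1: "anum e1 * aden e2 \<le> 2 ^ (3 * WW)" "anum e2 * aden e1 \<le> 2 ^ (3 * WW)" "aden e1 * aden e2 \<le> 2 ^ (2 * WW)"
      using mult_le_mono[OF an(1,4)] mult_le_mono[OF an(3,2)] mult_le_mono[OF an(2,4)] unfolding W3 by blast+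
    then have c2: "anum e1 * aden e2 + anum e2 * aden e1 \<le> 2 ^ (3 * WW + 1)" by simp
    have "aden e1 * aden e2 * 2 ^ (WW + 1) \<le> 2 ^ (2 * WW) * 2 ^ (WW + 1)" using c1(3) by (rule mult_le_mono1)
    also have "\<dots> = 2 ^ (2 * WW + (WW + 1))" by (simp only: power_add)
    finally have c3: "aden e1 * aden e2 * 2 ^ (WW + 1) \<le> 2 ^ (2 * WW + (WW + 1))" .
    have c4: "aden e1 * aden e2 * 2 ^ 1 \<le> 2 ^ (2 * WW + 1)" using c1(3) by simp
    have w: "WW + 1 \<le> 2 ^ (WW + 1)" by (rule less_imp_le[OF less_exp])
    show "anum e1 * aden e2 + anum e2 * aden e1 < 2 ^ bb" "anum e1 * aden e2 < 2 ^ bb" "anum e2 * aden e1 < 2 ^ bb"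
      "aden e1 * aden e2 * 2 ^ (WW + 1) < 2 ^ bb" "aden e1 * aden e2 * 2 ^ 1 < 2 ^ bb" "aden e1 * aden e2 < 2 ^ bb"
      "(2::nat) ^ (WW + 1) < 2 ^ bb" "WW + 1 < 2 ^ bb"
      by (rule fits_le[OF c2] fits_le[OF c1(1)] fits_le[OF c1(2)] fits_le[OF c3] fits_le[OF c4] fits_le[OF c1(3)]
        fits_le[OF order_refl] fits_le[OF w], use pos in linarith)+
  qed
  have pd: "p < 2 ^ bb" "d < 2 ^ bb" using b(1,4) by (simp_all add: p_def d_def)
  have an: "val c (m_anum (var 33)) (anum e1)" "val c (m_aden (var 33)) (aden e1)"
    "val c (m_anum (var 34)) (anum e2)" "val c (m_aden (var 34)) (aden e2)" if "tot \<noteq> 0" "2 < k"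
    using val_anum(1,2)[OF s readyD(2)[OF r] v1 ne(1)[OF that(1)]]
      val_anum(1,2)[OF s readyD(2)[OF r] v2 ne(2)[OF that(1)]] that(2) by simp_all
  consider "k = 0" | "k = 1" | "k = 2" | "k = 3" | "k = 4" | "k = 5" | "k = 6" | "k = 7" using k by linarith
  then show ?thesis
  proof cases
    case 1
    have "val c (m_pow (var 29)) (2 ^ (4 * WW))" by (rule val_pow[OF s std_vals(26)[OF s]]) (use pos in simp)
    from val_cnt[OF r g bx this order_refl] show ?thesis by (simp add: 1 m_answer_def a tot_def)
  next
    case 2
    have "val c (ite (var 32) (m_find (m_sigma ((var 32 \<ominus> cst 1) \<oslash> cst 2))) (cst 0)) e1"
      unfolding e1_def f1_def
      by (intro val_ite_nz[OF _ val_find[OF r g val_sigma[OF r g bx] sigma_le]] v0 z val_div val_sub val_num s)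
        (use 2 totb sb in simp_all)
    then show ?thesis by (simp add: 2 m_answer_def a)
  next
    case 3
    have "val c (ite (var 32) (m_find (m_sigma (var 32 \<oslash> cst 2))) (cst 0)) e2"
      unfolding e2_def f2_def
      by (intro val_ite_nz[OF _ val_find[OF r g val_sigma[OF r g bx] sigma_le]] v0 z val_div val_num s)
        (use 3 in simp_all)
    then show ?thesis by (simp add: 3 m_answer_def a)
  next
    case 4
    have "val c (ite (var 32) ((m_aden (var 33) \<otimes> m_aden (var 34)) \<lless> cst 1) (cst 0))
        (if tot \<noteq> 0 then aden e1 * aden e2 * 2 ^ 1 else 0)"
      by (intro val_ite_nz v0 z val_mul val_shl an val_num s) (use 4 b sb in simp_all)
    then show ?thesis by (simp add: 4 m_answer_def a)
  next
    case 5
    have "val c (ite (var 32) (m_anum (var 33) \<otimes> m_aden (var 34) \<oplus> m_anum (var 34) \<otimes> m_aden (var 33)) (cst 0)) p"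
      unfolding p_def by (intro val_ite_nz v0 z val_add val_mul an) (use 5 b sb in simp_all)
    then show ?thesis by (simp add: 5 m_answer_def a)
  next
    case 6
    have "val c (ite (var 32) (m_aden (var 33) \<otimes> m_aden (var 34) \<otimes> m_pow (var 7 \<oplus> cst 1)) (cst 0)) d"
      unfolding d_def
      by (intro val_ite_nz v0 z val_mul an val_pow[OF s] val_add std_vals s val_num) (use 6 b sb pos in simp_all)
    then show ?thesis by (simp add: 6 m_answer_def a)
  next
    case 7
    then show ?thesis using val_of_bool_less[OF v4 v5] by (simp add: m_answer_def a)
  next
    case 8
    have "val c (ite (var 36 \<prec> var 37) (var 37 \<ominus> var 36) (var 36 \<ominus> var 37)) (if p < d then d - p else p - d)"
      by (intro val_ite_less val_sub v4 v5) (use 8 pd sb in simp_all)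
    then show ?thesis by (simp add: 8 m_answer_def a)
  qed
qed

lemma params_length: "length (m_params K C) = 25" "length pv = 28" "length m_answer = 8"
  by (simp_all add: m_params_def pv_def m_answer_def)

lemma store_list_nth: "i < length xs \<Longrightarrow> store_list a xs m (a + i) = xs ! i"
  by (simp add: store_list_def)

lemma store_list_below: "i < a \<Longrightarrow> store_list a xs m i = m i"
  by (simp add: store_list_def)

lemma query_lets_env:
  fixes m \<rho> :: "nat \<Rightarrow> nat"
  assumes g: good and m: "m 0 = n" "m 1 = w" "m 2 = q"
    "\<And>i. i < n \<Longrightarrow> m (3 + (i + i)) = px i \<and> m (4 + (i + i)) = py i"
    "\<And>B. B \<le> MM \<Longrightarrow> m (LB + B) = leadr B" "\<And>j. j < RR \<Longrightarrow> m (SB + j) = rs ! j"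
    "\<And>j. j < TM \<Longrightarrow> m (CB + j) = chl ! j"
    and x: "\<rho> 0 < 2 ^ w" "\<rho> 1 < 2 ^ w" "\<rho> 2 < 2 ^ w" "\<rho> 3 < 2 ^ w"
  shows "lets_env bb 32 m (lets_of 4 (query_lets K C)) 4 \<rho> =
    store_list 4 (pv @ answer_vals (\<rho> 0) (\<rho> 1) (\<rho> 2) (\<rho> 3)) \<rho>"
proof (rule lets_env_lets_of)
  let ?vs = "pv @ answer_vals (\<rho> 0) (\<rho> 1) (\<rho> 2) (\<rho> 3)"
  show "length ?vs = length (query_lets K C)"
    by (simp add: query_lets_def params_length length_answer_vals)
  fix k assume "k < length (query_lets K C)"
  then have k: "k < 36" by (simp add: query_lets_def params_length)
  let ?c = "\<lparr>bits = bb, lregs = min (4 + k) 32, cmem = m, depth = 4 + k, env = store_list 4 (take k ?vs) \<rho>\<rparr>"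
  have env: "env ?c (4 + i) = ?vs ! i" if "i < k" for i
  proof -
    have "i < length (take k ?vs)" using that k by (simp add: params_length length_answer_vals)
    from store_list_nth[OF this, of 4 \<rho>] show ?thesis using nth_take[OF that, of ?vs] by (simp del: take_append)
  qed
  have num: "val ?c (cst i) i" if "i \<le> 20" for i by (rule bits_num) (use that in simp_all)
  consider "k < 3" | "3 \<le> k" "k < 28" | "28 \<le> k" by linarith
  then show "val ?c (query_lets K C ! k) (?vs ! k)"
  proof cases
    case 1
    then consider "k = 0" | "k = 1" | "k = 2" by linarith
    then show ?thesis
    proof cases
      case 1
      show ?thesis using val_rd[OF num[of 0]] m(1) 1 by (simp add: query_lets_def pv_def)
    next
      case 2
      show ?thesis using val_rd[OF num[of 1]] m(2) 2 by (simp add: query_lets_def pv_def)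
    next
      case 3
      show ?thesis using val_rd[OF num[of 2]] m(3) 3 by (simp add: query_lets_def pv_def)
    qed
  next
    case 2
    define j where "j = k - 3"
    have j: "j < 25" "k = 3 + j" using 2 by (simp_all add: j_def)
    have "?vs ! i = pv ! i" if "i < k" for i using that 2 by (simp add: nth_append params_length)
    then have "partial k ?c" using env by (simp add: partial_def)
    then have "val ?c (m_params K C ! j) (pv ! (3 + j))" using val_params[OF j(1)] j(2) by simp
    moreover have "query_lets K C ! k = m_params K C ! j"
      using j by (simp add: query_lets_def nth_append params_length)
    moreover have "?vs ! k = pv ! (3 + j)" using j by (simp add: nth_append params_length)
    ultimately show ?thesis by simp
  next
    case 3
    define j where "j = k - 28"
    have j: "j < 8" "k = 28 + j" using 3 k by (simp_all add: j_def)
    have "?vs ! i = pv ! i" if "i < 28" for i using that by (simp add: nth_append params_length)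
    then have "std ?c" using env 3 by (simp add: std_def)
    moreover have "pts ?c" "leads ?c" "seeds ?c" "chains ?c"
      using m(4-7) by (simp_all add: pts_def leads_def seeds_def chains_def)
    ultimately have r: "ready ?c" by (simp add: ready_def)
    have "val ?c (var i) (\<rho> i)" if "i < 4" for i
      using val_var[of i ?c] that by (simp add: store_list_below)
    then have bx: "box ?c (\<rho> 0) (\<rho> 1) (\<rho> 2) (\<rho> 3)" using x by (simp add: box_def)
    have "val ?c (var (32 + i)) (answer_vals (\<rho> 0) (\<rho> 1) (\<rho> 2) (\<rho> 3) ! i)" if "i < j" for i
    proof -
      have "env ?c (4 + (28 + i)) = ?vs ! (28 + i)" by (rule env) (use that j in simp)
      also have "\<dots> = answer_vals (\<rho> 0) (\<rho> 1) (\<rho> 2) (\<rho> 3) ! i" by (simp add: nth_append params_length)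
      finally have "env ?c (32 + i) = answer_vals (\<rho> 0) (\<rho> 1) (\<rho> 2) (\<rho> 3) ! i" by simp
      moreover have "32 + i < depth ?c" using that j by simp
      ultimately show ?thesis using val_var by metis
    qed
    from val_answer[OF r g bx j(1) this]
    have "val ?c (m_answer ! j) (answer_vals (\<rho> 0) (\<rho> 1) (\<rho> 2) (\<rho> 3) ! j)" .
    moreover have "query_lets K C ! k = m_answer ! j"
      using j by (simp add: query_lets_def nth_append params_length)
    moreover have "?vs ! k = answer_vals (\<rho> 0) (\<rho> 1) (\<rho> 2) (\<rho> 3) ! j"
      using j by (simp add: nth_append params_length)
    ultimately show ?thesis by simp
  qed
qed

lemma query_correct:
  assumes g: good and m: "m 0 = n" "m 1 = w" "m 2 = q"
    "\<And>i. i < n \<Longrightarrow> m (3 + (i + i)) = px i \<and> m (4 + (i + i)) = py i"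
    "\<And>B. B \<le> MM \<Longrightarrow> m (LB + B) = leadr B" "\<And>j. j < RR \<Longrightarrow> m (SB + j) = rs ! j"
    "\<And>j. j < TM \<Longrightarrow> m (CB + j) = chl ! j" and mb: "\<And>a. m a < 2 ^ bb"
    and x: "x1 < 2 ^ w" "x2 < 2 ^ w" "y1 < 2 ^ w" "y2 < 2 ^ w"
  defines "\<rho> \<equiv> zero_padded [x1, x2, y1, y2]"
  assumes T: "lets_cost bb 32 m (lets_of 4 (query_lets K C)) 4 \<rho> + 3 \<le> T"
  shows "\<exists>c. run bb (query_prog K C) T \<lparr>pc = 0, regs = \<rho>, mem = m\<rparr> = return_pmf c \<and>
    halted (query_prog K C) c \<and> query_answer c = (if pairs x1 x2 y1 y2 = {} then None
      else Some (median (image_mset (\<lambda>(i, j). slope i j) (mset_set (pairs x1 x2 y1 y2)))))"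
proof -
  let ?mv = "[(0, 38), (1, 39), (2, 35)] :: (nat \<times> nat) list"
  let ?es = "lets_of 4 (query_lets K C)"
  have r: "\<rho> 0 = x1" "\<rho> 1 = x2" "\<rho> 2 = y1" "\<rho> 3 = y2" by (simp_all add: \<rho>_def zero_padded_def)
  have xb: "x < 2 ^ bb" if "x < 2 ^ w" for x :: nat by (rule fits_less[OF that]) (simp add: WW_def)
  have \<rho>b: "\<rho> i < 2 ^ bb" for i
  proof (cases "i < 4")
    case True
    then have "i \<in> {0, 1, 2, 3}" by auto
    then show ?thesis using r x xb by auto
  qed (simp add: \<rho>_def zero_padded_def)
  have b1: "1 \<le> bb" using bb_ge pos by linarith
  have len: "length ?es = 36" by (simp add: query_lets_def params_length)
  have env: "lets_env bb 32 m ?es 4 \<rho> = store_list 4 (pv @ answer_vals x1 x2 y1 y2) \<rho>"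
    using query_lets_env[where m = m and \<rho> = \<rho>, OF g m] x unfolding r by blast
  have mv: "x < 4 \<and> 4 \<le> y \<and> y < 4 + length ?es" if "(x, y) \<in> set ?mv" for x y using that len by auto
  have "\<exists>c. run bb (query_prog K C) T \<lparr>pc = 0, regs = \<rho>, mem = m\<rparr> = return_pmf c \<and>
      halted (query_prog K C) c \<and> (\<forall>(x, y) \<in> set ?mv. regs c x = lets_env bb 32 m ?es 4 \<rho> y)"
    unfolding query_prog_def
    by (rule query_program_correct[OF \<rho>b mb b1 mv]) (use T in simp_all)
  then obtain c where c: "run bb (query_prog K C) T \<lparr>pc = 0, regs = \<rho>, mem = m\<rparr> = return_pmf c"
    "halted (query_prog K C) c" "\<forall>(x, y) \<in> set ?mv. regs c x = lets_env bb 32 m ?es 4 \<rho> y" by blast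
  let ?av = "answer_vals x1 x2 y1 y2"
  have e: "lets_env bb 32 m ?es 4 \<rho> (32 + i) = ?av ! i" if "i < 8" for i
    using that store_list_nth[of "28 + i" "pv @ ?av" 4 \<rho>] unfolding env
    by (simp add: params_length length_answer_vals nth_append)
  have regs: "regs c 0 = ?av ! 6" "regs c 1 = ?av ! 7" "regs c 2 = ?av ! 3"
    using c(3) e[of 6] e[of 7] e[of 3] by simp_all
  define M where "M = image_mset (\<lambda>(i, j). slope i j) (mset_set (pairs x1 x2 y1 y2))"
  have tot: "cnt x1 x2 y1 y2 (2 ^ (4 * WW)) = card (pairs x1 x2 y1 y2)" by (rule total_eq[OF g x(2,4)])
  have "query_answer c = (if pairs x1 x2 y1 y2 = {} then None else Some (median M))"
  proof (cases "pairs x1 x2 y1 y2 = {}")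
    case True
    then show ?thesis using regs tot by (simp add: query_answer_def answer_vals_def Let_def)
  next
    case False
    then have t0: "card (pairs x1 x2 y1 y2) \<noteq> 0" using finite_pairs by simp
    define t where "t = card (pairs x1 x2 y1 y2)"
    define e1 where "e1 = find (sigma x1 x2 y1 y2 ((t - 1) div 2))"
    define e2 where "e2 = find (sigma x1 x2 y1 y2 (t div 2))"
    define p where "p = anum e1 * aden e2 + anum e2 * aden e1"
    define d where "d = aden e1 * aden e2"
    note mq = median_query[OF g x(2,4) False, folded t_def, folded e1_def e2_def, folded p_def d_def, folded M_def]
    have rg: "regs c 0 = of_bool (p < d * 2 ^ (WW + 1))"
      "regs c 1 = (if p < d * 2 ^ (WW + 1) then d * 2 ^ (WW + 1) - p else p - d * 2 ^ (WW + 1))" "regs c 2 = d * 2 ^ 1"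
      using regs t0 unfolding answer_vals_def Let_def tot t_def[symmetric] e1_def[symmetric] e2_def[symmetric]
      by (simp_all add: e1_def[symmetric] e2_def[symmetric] p_def[symmetric] d_def[symmetric])
    have d0: "d \<noteq> 0" using mq(1,2) by (simp add: d_def)
    \<comment> \<open>The sign records which of the two natural subtractions was carried
      out.\<close>
    have "(if regs c 0 = 0 then 1 else - 1) * real (regs c 1) = real p - real (d * 2 ^ Suc WW)"
      unfolding rg(1,2) by (simp add: of_nat_diff)
    then have "query_answer c = Some (median M)"
      using d0 unfolding query_answer_def mq(3) rg(3) by (simp add: mult.commute)
    then show ?thesis using False by simp
  qed
  then show ?thesis using c(1,2) unfolding M_def by blast
qed

end

section \<open>The construction program\<close>

subsection \<open>Rules for commands\<close>

text \<open>Unlike \<open>\<sqsubseteq>\<close>, this allows the memory to change;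
  \<open>mval\<close> is the matching judgement for expressions whose value does not depend on
  memory.\<close>

definition extm :: "ctx \<Rightarrow> ctx \<Rightarrow> bool" (infix "\<unlhd>" 50) where
  "c \<unlhd> c' \<longleftrightarrow> bits c' = bits c \<and> lregs c' = lregs c \<and> depth c \<le> depth c' \<and> (\<forall>i<depth c. env c' i = env c i)"

definition mval :: "ctx \<Rightarrow> hexpr \<Rightarrow> nat \<Rightarrow> bool" where
  "mval c a v \<longleftrightarrow> (\<forall>m. val (c\<lparr>cmem := m\<rparr>) a v)"

lemma extm_refl [simp]: "c \<unlhd> c" by (auto simp: extm_def)

lemma extm_trans: "c \<unlhd> c' \<Longrightarrow> c' \<unlhd> c'' \<Longrightarrow> c \<unlhd> c''"
  unfolding extm_def by (metis order_less_le_trans order_trans)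

lemma extm_cmem: "c \<unlhd> c\<lparr>cmem := m\<rparr>" by (auto simp: extm_def)

lemma mval_val: "mval c a v \<Longrightarrow> val c a v"
proof -
  assume "mval c a v"
  then have "val (c\<lparr>cmem := cmem c\<rparr>) a v" unfolding mval_def by blast
  then show ?thesis by simp
qed

lemma mval_mono:
  assumes "mval c a v" "c \<unlhd> c'"
  shows "mval c' a v"
  unfolding mval_def
proof
  fix m
  have "c\<lparr>cmem := m\<rparr> \<sqsubseteq> c'\<lparr>cmem := m\<rparr>" using assms(2) by (auto simp: ext_def extm_def)
  then show "val (c'\<lparr>cmem := m\<rparr>) a v" using assms(1) val_mono unfolding mval_def by blast
qed

lemma mval_var: "i < depth c \<Longrightarrow> env c i = v \<Longrightarrow> mval c (var i) v"
  unfolding mval_def using val_var[of i "c\<lparr>cmem := m\<rparr>" for m] by simp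

lemma lreg_extm: "lreg c p k \<Longrightarrow> c \<unlhd> c' \<Longrightarrow> lreg c' p k"
  by (auto simp: lreg_def extm_def)

lemma hoare_seq:
  assumes "hoare c x R" "\<And>c'. c \<unlhd> c' \<Longrightarrow> R (cmem c') \<Longrightarrow> hoare c' y Q"
  shows "hoare c (x ;;; y) Q"
proof (rule hoare_sq[OF assms(1)])
  fix m assume "R m"
  then show "hoare (c\<lparr>cmem := m\<rparr>) y Q" using assms(2)[OF extm_cmem] by simp
qed

lemma hoare_loop:
  assumes "lreg c p k" "I 0 (cmem c)"
    "\<And>c' x j. c \<unlhd> c' \<Longrightarrow> j < k \<Longrightarrow> I j (cmem c') \<Longrightarrow> mval c' x j \<Longrightarrow> hoare c' (f x) (I (Suc j))"
  shows "hoare c (cfor p f) (I k)"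
  unfolding hoare_def
proof (intro allI impI)
  fix c' assume e: "c \<sqsubseteq> c'"
  have "lreg c' p k" using lreg_mono[OF assms(1) e] .
  then have lim: "limit (lregs c') (env c') p = k" by (auto simp: lreg_def limit_def)
  have "I l (iterate l (\<lambda>j m. sem (bits c') (lregs c') (f (var (depth c')) (Suc (depth c')))
        (Suc (depth c')) ((env c')(depth c' := j)) m) (cmem c'))" if "l \<le> k" for l
    using that
  proof (induction l)
    case 0
    then show ?case using assms(2) ext_cmem[OF e] by simp
  next
    case (Suc l)
    define m where "m = iterate l (\<lambda>j m. sem (bits c') (lregs c') (f (var (depth c')) (Suc (depth c')))
        (Suc (depth c')) ((env c')(depth c' := j)) m) (cmem c')"
    let ?c = "c'\<lparr>cmem := m, depth := Suc (depth c'), env := (env c')(depth c' := l)\<rparr>"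
    have ce: "c \<unlhd> ?c" using e by (auto simp: ext_def extm_def)
    have v: "mval ?c (var (depth c')) l" by (rule mval_var) simp_all
    have "hoare ?c (f (var (depth c'))) (I (Suc l))"
      by (rule assms(3)[OF ce _ _ v]) (use Suc m_def in \<open>simp_all del: fun_upd_apply\<close>)
    then have "I (Suc l) (exc ?c (f (var (depth c'))))"
      unfolding hoare_def using ext_refl by blast
    then show ?case by (simp add: m_def del: fun_upd_apply)
  qed
  then show "I k (exc c' (cfor p f))"
    using lim by (simp add: cfor_def del: fun_upd_apply)
qed

subsection \<open>Filling and sorting arrays\<close>

definition arr :: "(nat \<Rightarrow> nat) \<Rightarrow> nat \<Rightarrow> nat list \<Rightarrow> bool" where
  "arr m a xs \<longleftrightarrow> (\<forall>i<length xs. m (a + i) = xs ! i)"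

definition frame :: "nat set \<Rightarrow> (nat \<Rightarrow> nat) \<Rightarrow> (nat \<Rightarrow> nat) \<Rightarrow> bool" where
  "frame R m m' \<longleftrightarrow> (\<forall>x. x \<notin> R \<longrightarrow> m' x = m x)"

lemma frame_trans: "frame R m m' \<Longrightarrow> frame R m' m'' \<Longrightarrow> frame R m m''"
  by (simp add: frame_def)

lemma frame_mono: "frame R m m' \<Longrightarrow> R \<subseteq> R' \<Longrightarrow> frame R' m m'"
  by (auto simp: frame_def)

lemma frame_upd: "frame R m m' \<Longrightarrow> x \<in> R \<Longrightarrow> frame R m (m'(x := v))"
  by (auto simp: frame_def)

lemma arr_frame: "arr m a xs \<Longrightarrow> frame R m m' \<Longrightarrow> R \<inter> {a..<a + length xs} = {} \<Longrightarrow> arr m' a xs"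
  unfolding arr_def frame_def
proof (intro allI impI)
  fix i assume h: "\<forall>i<length xs. m (a + i) = xs ! i" "\<forall>x. x \<notin> R \<longrightarrow> m' x = m x"
    "R \<inter> {a..<a + length xs} = {}" "i < length xs"
  then have "a + i \<in> {a..<a + length xs}" by simp
  then have "a + i \<notin> R" using h(3) by blast
  then show "m' (a + i) = xs ! i" using h by simp
qed

lemma arr_snoc: "arr m a xs \<Longrightarrow> arr (m(a + length xs := x)) a (xs @ [x])"
  by (auto simp: arr_def nth_append less_Suc_eq)

definition m_fill :: "hexpr \<Rightarrow> nat \<Rightarrow> (hexpr \<Rightarrow> hexpr) \<Rightarrow> hcom" where
  "m_fill a p f = cfor p (\<lambda>i. cwr (a \<oplus> i) (f i))"

text \<open>The counter is kept one cell behind the end of the buffer proper: a rejected word may be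
  written directly behind a full buffer, and that cell has to be free.\<close>

definition m_cnt_cell :: "hexpr \<Rightarrow> nat \<Rightarrow> hexpr" where "m_cnt_cell buf p = buf \<oplus> var p \<oplus> cst 1"

definition m_pass :: "hexpr \<Rightarrow> nat \<Rightarrow> hexpr \<Rightarrow> (hexpr \<Rightarrow> hexpr) \<Rightarrow> hcom" where
  "m_pass a p buf cond = cfor p (\<lambda>i. cwr (buf \<oplus> rd (m_cnt_cell buf p)) (rd (a \<oplus> i)) ;;;
     cwr (m_cnt_cell buf p) (rd (m_cnt_cell buf p) \<oplus> cond (rd (a \<oplus> i))))"

text \<open>
  Least significant bit first. A pass writes every word behind the selected ones and counts only
  the selected ones, so that the next word overwrites a rejected one.
\<close>

definition m_sort :: "hexpr \<Rightarrow> nat \<Rightarrow> hexpr \<Rightarrow> hcom" where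
  "m_sort a p buf = cfor 8 (\<lambda>t. cwr (m_cnt_cell buf p) (cst 0) ;;;
     m_pass a p buf (\<lambda>x. ite (x \<ggreater> t \<odot> cst 2) (cst 0) (cst 1)) ;;;
     m_pass a p buf (\<lambda>x. x \<ggreater> t \<odot> cst 2) ;;;
     m_fill a p (\<lambda>i. rd (buf \<oplus> i)))"

text \<open>Bit \<open>t\<close> is the leading digit modulo \<open>2 ^ Suc t\<close>, and filtering
  is stable, so the order by the lower bits survives in both halves.\<close>

lemma radix_step:
  fixes xs :: "nat list"
  assumes "sorted (map (\<lambda>x. x mod 2 ^ t) xs)"
  defines "ys \<equiv> filter (\<lambda>x. even (x div 2 ^ t)) xs @ filter (\<lambda>x. odd (x div 2 ^ t)) xs"
  shows "mset ys = mset xs" "sorted (map (\<lambda>x. x mod 2 ^ Suc t) ys)"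
proof -
  show "mset ys = mset xs" unfolding ys_def by (induction xs) auto
  have m: "x mod 2 ^ Suc t = (x div 2 ^ t mod 2) * 2 ^ t + x mod 2 ^ t" for x :: nat
    using mod_mult2_eq[of x "2 ^ t" 2] by (simp add: mult.commute)
  have f: "sorted (map (\<lambda>x. x mod 2 ^ t) (filter P xs))" for P
    using assms(1) by (induction xs) auto
  have e: "map (\<lambda>x. x mod 2 ^ Suc t) (filter (\<lambda>x. even (x div 2 ^ t)) xs) =
      map (\<lambda>x. x mod 2 ^ t) (filter (\<lambda>x. even (x div 2 ^ t)) xs)"
    by (intro map_cong refl) (simp add: m even_iff_mod_2_eq_zero del: power_Suc)
  have o: "map (\<lambda>x. x mod 2 ^ Suc t) (filter (\<lambda>x. odd (x div 2 ^ t)) xs) =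
      map (\<lambda>v. 2 ^ t + v) (map (\<lambda>x. x mod 2 ^ t) (filter (\<lambda>x. odd (x div 2 ^ t)) xs))"
    unfolding map_map by (intro map_cong refl) (simp add: m odd_iff_mod_2_eq_one del: power_Suc)
  have "sorted (map (\<lambda>v. 2 ^ t + v) zs)" if "sorted zs" for zs :: "nat list"
    using that by (induction zs) auto
  then have so: "sorted (map (\<lambda>x. x mod 2 ^ Suc t) (filter (\<lambda>x. odd (x div 2 ^ t)) xs))"
    unfolding o using f by blast
  have se: "sorted (map (\<lambda>x. x mod 2 ^ Suc t) (filter (\<lambda>x. even (x div 2 ^ t)) xs))"
    unfolding e by (rule f)
  have sep: "u \<le> v" if uv: "u \<in> set (map (\<lambda>x. x mod 2 ^ Suc t) (filter (\<lambda>x. even (x div 2 ^ t)) xs))"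
    "v \<in> set (map (\<lambda>x. x mod 2 ^ Suc t) (filter (\<lambda>x. odd (x div 2 ^ t)) xs))" for u v
  proof -
    obtain x y where "u = x mod 2 ^ t" "v = 2 ^ t + y" using uv unfolding e o by auto
    moreover have "x mod 2 ^ t < 2 ^ t" by simp
    ultimately show ?thesis by linarith
  qed
  show "sorted (map (\<lambda>x. x mod 2 ^ Suc t) ys)"
    unfolding ys_def map_append sorted_append using se so sep by blast
qed

context params
begin

lemma std_extm: "std c \<Longrightarrow> c \<unlhd> c' \<Longrightarrow> std c'"
  by (auto simp: std_def extm_def)

lemma std_mvals:
  assumes "std c"
  shows "mval c (var 4) n" "mval c (var 5) w" "mval c (var 6) q" "mval c (var 7) WW" "mval c (var 10) tt"
    "mval c (var 14) MM" "mval c (var 15) mm" "mval c (var 19) LB" "mval c (var 20) SB" "mval c (var 21) CB"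
    "mval c (var 22) EN" "mval c (var 25) (EN + NN)"
  unfolding mval_def using std_vals[OF std_mem[OF assms]] by blast+

lemma std_mnum: "std c \<Longrightarrow> k \<le> 20 \<Longrightarrow> mval c (cst k) k"
  unfolding mval_def using val_num[OF std_mem] by blast

lemma hoare_fill:
  assumes s: "std c" and l: "lreg c p k" and a: "mval c a av" and b: "av + k < 2 ^ bb"
    and f: "\<And>c' x j. c \<unlhd> c' \<Longrightarrow> j < k \<Longrightarrow> mval c' x j \<Longrightarrow> frame {av..<av + j} (cmem c) (cmem c') \<Longrightarrow> val c' (f x) (F j)"
  shows "hoare c (m_fill a p f) (\<lambda>m. arr m av (map F [0..<k]) \<and> frame {av..<av + k} (cmem c) m)"
  unfolding m_fill_def
proof (rule hoare_loop[OF l, where I = "\<lambda>j m. arr m av (map F [0..<j]) \<and> frame {av..<av + j} (cmem c) m"])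
  fix c' x j assume e: "c \<unlhd> c'" and j: "j < k" and I: "arr (cmem c') av (map F [0..<j]) \<and> frame {av..<av + j} (cmem c) (cmem c')"
    and x: "mval c' x j"
  have "val c' (a \<oplus> x) (av + j)"
    by (intro val_add mval_val[OF mval_mono[OF a e]] mval_val[OF x])
      (use b j std_bits[OF std_extm[OF s e]] in simp)
  then show "hoare c' (cwr (a \<oplus> x) (f x)) (\<lambda>m. arr m av (map F [0..<Suc j]) \<and> frame {av..<av + Suc j} (cmem c) m)"
  proof (rule hoare_wr[OF _ f[OF e j x]])
    show "frame {av..<av + j} (cmem c) (cmem c')" using I by blast
    have "frame {av..<av + Suc j} (cmem c) (cmem c')" using I by (auto intro: frame_mono)
    then have "frame {av..<av + Suc j} (cmem c) ((cmem c')(av + j := F j))" by (rule frame_upd) simp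
    moreover have "arr ((cmem c')(av + j := F j)) av (map F [0..<Suc j])"
      using arr_snoc[OF conjunct1[OF I], of "F j"] by (simp del: fun_upd_apply)
    ultimately show "arr ((cmem c')(av + j := F j)) av (map F [0..<Suc j]) \<and>
      frame {av..<av + Suc j} (cmem c) ((cmem c')(av + j := F j))" by blast
  qed
qed (simp add: arr_def frame_def)

lemma val_cnt_cell:
  assumes "std c" "mval c buf bv" "lreg c p l" "bv + l + 1 < 2 ^ bb"
  shows "val c (m_cnt_cell buf p) (bv + l + 1)"
  unfolding m_cnt_cell_def
  by (intro val_add mval_val[OF assms(2)] val_lreg[OF assms(3)] val_num[OF assms(1)])
    (use assms(4) std_bits[OF assms(1)] in simp_all)

lemma hoare_pass:
  assumes s: "std c" and a: "mval c a av" and b: "mval c buf bv" and l: "lreg c p (length xs)"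
    and m: "arr (cmem c) av xs" "arr (cmem c) bv pre" "cmem c (bv + length xs + 1) = length pre"
    and disj: "av + length xs \<le> bv \<or> bv + length xs + 1 < av"
    and len: "length pre + length (filter P xs) \<le> length xs"
    and fit: "av + length xs < 2 ^ bb" "bv + length xs + 1 < 2 ^ bb"
    and cond: "\<And>c' x v. c \<unlhd> c' \<Longrightarrow> val c' x v \<Longrightarrow> val c' (cond x) (of_bool (P v))"
  shows "hoare c (m_pass a p buf cond) (\<lambda>m. arr m bv (pre @ filter P xs) \<and>
    m (bv + length xs + 1) = length (pre @ filter P xs) \<and> frame {bv..bv + length xs + 1} (cmem c) m)"
proof -
  let ?k = "bv + length xs + 1"
  let ?I = "\<lambda>j m. arr m bv (pre @ filter P (take j xs)) \<and>
    m ?k = length (pre @ filter P (take j xs)) \<and> frame {bv..?k} (cmem c) m"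
  have "hoare c (m_pass a p buf cond) (?I (length xs))"
    unfolding m_pass_def
  proof (rule hoare_loop[OF l, where I = ?I])
    show "?I 0 (cmem c)" using m by (simp add: frame_def)
    fix c' x j assume e: "c \<unlhd> c'" and j: "j < length xs" and I: "?I j (cmem c')" and x: "mval c' x j"
    let ?F = "pre @ filter P (take j xs)" and ?v = "xs ! j"
    let ?F' = "pre @ filter P (take (Suc j) xs)" and ?m = "(cmem c')(bv + length ?F := ?v)"
    have t: "take (Suc j) xs = take j xs @ [?v]" using j by (rule take_Suc_conv_app_nth)
    have le: "length (pre @ filter P (take i xs)) \<le> length xs" for i
    proof -
      have "length (filter P (take i xs)) + length (filter P (drop i xs)) = length (filter P xs)"
        by (metis append_take_drop_id filter_append length_append)
      then show ?thesis using len by simp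
    qed
    note lF = le[of j]
    have cell: "val c2 (m_cnt_cell buf p) ?k" if "c' \<unlhd> c2" for c2
      using extm_trans[OF e that] by (intro val_cnt_cell std_extm[OF s] mval_mono[OF b] lreg_extm[OF l] fit)
    have item: "val c2 (rd (a \<oplus> x)) ?v" if e2: "c' \<unlhd> c2" and f: "frame {bv..?k} (cmem c) (cmem c2)" for c2
    proof -
      have v: "val c2 (a \<oplus> x) (av + j)"
        by (intro val_add mval_val[OF mval_mono[OF a extm_trans[OF e e2]]] mval_val[OF mval_mono[OF x e2]])
          (use fit j std_bits[OF std_extm[OF s extm_trans[OF e e2]]] in simp)
      have "arr (cmem c2) av xs" by (rule arr_frame[OF m(1) f]) (use disj in auto)
      then have "cmem c2 (av + j) = ?v" using j by (simp add: arr_def)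
      then show ?thesis by (rule val_rd[OF v])
    qed
    have f: "frame {bv..?k} (cmem c) ?m" by (rule frame_upd) (use I lF in auto)
    have "val c' (rd (m_cnt_cell buf p)) (length ?F)" by (rule val_rd[OF cell]) (use I in simp_all)
    then have "val c' (buf \<oplus> rd (m_cnt_cell buf p)) (bv + length ?F)"
      by (intro val_add mval_val[OF mval_mono[OF b e]]) (use lF fit std_bits[OF std_extm[OF s e]] in simp_all)
    then have h1: "hoare c' (cwr (buf \<oplus> rd (m_cnt_cell buf p)) (rd (a \<oplus> x))) (\<lambda>m. m = ?m)"
      by (rule hoare_wr[OF _ item]) (use I in simp_all)
    show "hoare c' (cwr (buf \<oplus> rd (m_cnt_cell buf p)) (rd (a \<oplus> x)) ;;;
       cwr (m_cnt_cell buf p) (rd (m_cnt_cell buf p) \<oplus> cond (rd (a \<oplus> x)))) (?I (Suc j))"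
    proof (rule hoare_seq[OF h1])
      fix c2 assume e2: "c' \<unlhd> c2" and c2: "cmem c2 = ?m"
      have e3: "c \<unlhd> c2" by (rule extm_trans[OF e e2])
      have "val c2 (rd (m_cnt_cell buf p)) (length ?F)"
        by (rule val_rd[OF cell[OF e2]]) (use I lF in \<open>simp add: c2\<close>)
      then have "val c2 (rd (m_cnt_cell buf p) \<oplus> cond (rd (a \<oplus> x))) (length ?F + of_bool (P ?v))"
        by (rule val_add[OF _ cond[OF e3 item[OF e2 f[folded c2]]]])
          (use lF fit std_bits[OF std_extm[OF s e3]] in auto)
      then show "hoare c2 (cwr (m_cnt_cell buf p) (rd (m_cnt_cell buf p) \<oplus> cond (rd (a \<oplus> x)))) (?I (Suc j))"
      proof (rule hoare_wr[OF cell[OF e2]])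
        let ?m' = "(cmem c2)(?k := length ?F + of_bool (P ?v))"
        \<comment> \<open>A rejected word is written as well, but it lies behind the counted prefix,
          about which alone \<open>arr\<close> speaks.\<close>
        have "arr ?m bv (?F @ [?v])" by (rule arr_snoc) (use I in blast)
        then have "arr ?m bv ?F'" by (auto simp: t arr_def nth_append less_Suc_eq)
        then have "arr ?m' bv ?F'" unfolding c2
          by (rule arr_frame[where R = "{?k}"]) (use le[of "Suc j"] in \<open>auto simp: frame_def\<close>)
        moreover have "frame {bv..?k} (cmem c) ?m'" unfolding c2 by (rule frame_upd[OF f]) simp
        ultimately show "?I (Suc j) ?m'" by (simp add: t)
      qed
    qed
  qed
  then show ?thesis by simp
qed

text \<open>One round for each bit of a word gives linear time up to polylogarithmic factors with
  loops of fixed bounds only.\<close>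

lemma hoare_sort:
  assumes s: "std c" and a: "mval c a av" and b: "mval c buf bv" and l: "lreg c p (length xs)"
    and m: "arr (cmem c) av xs"
    and disj: "av + length xs \<le> bv \<or> bv + length xs + 1 < av"
    and fit: "av + length xs < 2 ^ bb" "bv + length xs + 1 < 2 ^ bb" and xs: "\<And>x. x \<in> set xs \<Longrightarrow> x < 2 ^ bb"
  shows "hoare c (m_sort a p buf) (\<lambda>m. arr m av (sort xs) \<and>
    frame ({av..<av + length xs} \<union> {bv..bv + length xs + 1}) (cmem c) m)"
proof -
  let ?k = "bv + length xs + 1"
  let ?R = "{av..<av + length xs} \<union> {bv..?k}"
  let ?I = "\<lambda>t m. \<exists>ys. mset ys = mset xs \<and> sorted (map (\<lambda>x. x mod 2 ^ t) ys) \<and> arr m av ys \<and> frame ?R (cmem c) m"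
  have "hoare c (m_sort a p buf) (?I bb)"
    unfolding m_sort_def
  proof (rule hoare_loop[OF std_lregs(5)[OF s], where I = ?I])
    have "arr (cmem c) av xs \<and> frame ?R (cmem c) (cmem c)" using m by (simp add: frame_def)
    then show "?I 0 (cmem c)" by (intro exI[of _ xs]) (simp add: map_replicate_const)
    fix c1 y t assume e1: "c \<unlhd> c1" and I: "?I t (cmem c1)" and y: "mval c1 y t"
    obtain ys where ys: "mset ys = mset xs" "sorted (map (\<lambda>x. x mod 2 ^ t) ys)" "arr (cmem c1) av ys"
      "frame ?R (cmem c) (cmem c1)" using I by blast
    have lys: "length ys = length xs" using ys(1) by (rule mset_eq_length)
    let ?P0 = "\<lambda>x. even (x div 2 ^ t)" and ?P1 = "\<lambda>x. odd (x div (2::nat) ^ t)"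
    let ?zs = "filter ?P0 ys @ filter ?P1 ys" and ?fill = "m_fill a p (\<lambda>i. rd (buf \<oplus> i))"
    let ?b0 = "\<lambda>x. ite (x \<ggreater> y \<odot> cst 2) (cst 0) (cst 1)" and ?b1 = "\<lambda>x. x \<ggreater> y \<odot> cst 2"
    let ?J = "\<lambda>zs m. arr m bv zs \<and> m ?k = length zs \<and> frame {bv..?k} (cmem c1) m"
    have lz: "length (filter ?P0 ys) + length (filter ?P1 ys) = length xs"
      unfolding lys[symmetric] by (rule sum_length_filter_compl)
    have s1: "std c'" "mval c' a av" "mval c' buf bv" "lreg c' p (length xs)" if "c1 \<unlhd> c'" for c'
      using extm_trans[OF e1 that] std_extm[OF s] mval_mono[OF a] mval_mono[OF b] lreg_extm[OF l] by blast+
    have b1: "val c' (?b1 x) (of_bool (?P1 v))" if "c1 \<unlhd> c'" "val c' x v" for c' x v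
    proof -
      have "val c' (?b1 x) (v div 2 ^ t mod 2)"
        by (intro val_mod val_shr that(2) mval_val[OF mval_mono[OF y that(1)]] val_num[OF s1(1)[OF that(1)]]) simp
      then show ?thesis by (simp add: mod_2_eq_odd)
    qed
    have b0: "val c' (?b0 x) (of_bool (?P0 v))" if "c1 \<unlhd> c'" "val c' x v" for c' x v
      by (rule val_ite[OF b1[OF that]]) (use val_num[OF s1(1)[OF that(1)]] in simp_all)
    have pass: "hoare c' (m_pass a p buf f) (?J (pre @ filter P ys))"
      if e: "c1 \<unlhd> c'" and pre: "?J pre (cmem c')" and le: "length pre + length (filter P ys) \<le> length xs"
        and f: "\<And>c' x v. c1 \<unlhd> c' \<Longrightarrow> val c' x v \<Longrightarrow> val c' (f x) (of_bool (P v))" for c' pre P f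
    proof (rule hoare_conseq[OF hoare_pass[where xs = ys and pre = pre and P = P, unfolded lys]])
      show "arr (cmem c') av ys" by (rule arr_frame[OF ys(3)]) (use pre disj lys in auto)
      show "val c'' (f x) (of_bool (P v))" if "c' \<unlhd> c''" "val c'' x v" for c'' x v
        by (rule f[OF extm_trans[OF e that(1)] that(2)])
    qed (use s1[OF e] pre le disj fit frame_trans in blast)+
    have h1: "hoare c1 (cwr (m_cnt_cell buf p) (cst 0)) (?J [])"
      by (rule hoare_wr[OF val_cnt_cell[OF s1(1,3,4)[OF extm_refl] fit(2)] val_num[OF s1(1)[OF extm_refl]]])
        (auto simp: arr_def frame_def)
    show "hoare c1 (cwr (m_cnt_cell buf p) (cst 0) ;;; m_pass a p buf ?b0 ;;; m_pass a p buf ?b1 ;;; ?fill) (?I (Suc t))"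
    proof (rule hoare_seq[OF h1])
      fix c2 assume e2: "c1 \<unlhd> c2" and m2: "?J [] (cmem c2)"
      have h2: "hoare c2 (m_pass a p buf ?b0) (?J ([] @ filter ?P0 ys))"
        by (rule pass[OF e2 m2 _ b0]) (use lz in simp_all)
      show "hoare c2 (m_pass a p buf ?b0 ;;; m_pass a p buf ?b1 ;;; ?fill) (?I (Suc t))"
      proof (rule hoare_seq[OF h2])
        fix c3 assume "c2 \<unlhd> c3" and m3: "?J ([] @ filter ?P0 ys) (cmem c3)"
        then have e3: "c1 \<unlhd> c3" using extm_trans[OF e2] by blast
        have h3: "hoare c3 (m_pass a p buf ?b1) (?J (([] @ filter ?P0 ys) @ filter ?P1 ys))"
          by (rule pass[OF e3 m3 _ b1]) (use lz in simp_all)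
        show "hoare c3 (m_pass a p buf ?b1 ;;; ?fill) (?I (Suc t))"
        proof (rule hoare_seq[OF h3])
          fix c4 assume "c3 \<unlhd> c4" and "?J (([] @ filter ?P0 ys) @ filter ?P1 ys) (cmem c4)"
          then have e4: "c1 \<unlhd> c4" and m4: "arr (cmem c4) bv ?zs" "frame {bv..?k} (cmem c1) (cmem c4)"
            using extm_trans[OF e3] by simp_all
          have f4: "frame ?R (cmem c) (cmem c4)"
            by (rule frame_trans[OF ys(4) frame_mono[OF m4(2)]]) simp
          have h4: "hoare c4 ?fill (\<lambda>m. arr m av (map ((!) ?zs) [0..<length xs]) \<and> frame {av..<av + length xs} (cmem c4) m)"
          proof (rule hoare_fill[OF s1(1,4,2)[OF e4] fit(1)])
            fix c' x j assume "c4 \<unlhd> c'" and j: "j < length xs" and x: "mval c' x j" and f: "frame {av..<av + j} (cmem c4) (cmem c')"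
            then have s': "std c'" "mval c' buf bv" using s1[OF extm_trans[OF e4]] by blast+
            have "val c' (buf \<oplus> x) (bv + j)"
              by (intro val_add mval_val[OF s'(2)] mval_val[OF x]) (use fit j std_bits[OF s'(1)] in simp)
            moreover have "arr (cmem c') bv ?zs" by (rule arr_frame[OF m4(1) f]) (use disj j lz in auto)
            then have "cmem c' (bv + j) = ?zs ! j" using j lz unfolding arr_def by simp
            ultimately show "val c' (rd (buf \<oplus> x)) (?zs ! j)" by (rule val_rd)
          qed
          have z: "map ((!) ?zs) [0..<length xs] = ?zs" using lz map_nth[of ?zs] by simp
          show "hoare c4 ?fill (?I (Suc t))"
          proof (rule hoare_conseq[OF h4[unfolded z]])
            fix m assume m: "arr m av ?zs \<and> frame {av..<av + length xs} (cmem c4) m"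
            have "frame ?R (cmem c) m" by (rule frame_trans[OF f4 frame_mono[OF conjunct2[OF m]]]) auto
            then show "?I (Suc t) m" using radix_step[OF ys(2)] ys(1) m by (intro exI[of _ ?zs]) simp
          qed
        qed
      qed
    qed
  qed
  then show ?thesis
  proof (rule hoare_conseq)
    fix m assume "?I bb m"
    then obtain ys where ys: "mset ys = mset xs" "sorted (map (\<lambda>x. x mod 2 ^ bb) ys)" "arr m av ys"
      "frame ?R (cmem c) m" by blast
    have "set ys = set xs" using ys(1) by (rule mset_eq_setD)
    \<comment> \<open>After \<open>bb\<close> rounds the residues modulo \<open>2 ^ bb\<close> are
      the words themselves.\<close>
    then have "map (\<lambda>x. x mod 2 ^ bb) ys = ys" using xs by (intro map_idI) auto
    then have "sort xs = ys" using ys(1,2) by (intro properties_for_sort) simp_all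
    then show "arr m av (sort xs) \<and> frame ?R (cmem c) m" using ys by simp
  qed
qed

end

subsection \<open>Building the data structure\<close>

text \<open>The points arrive from cell 0 on and have to move up by three cells for the header. As
  the ranges overlap, they are copied to the work space behind \<open>EN\<close> and back. The keys
  are sorted in the work space, and only every \<open>tt\<close>-th of them is retained; the last
  write is the sentinel leader.\<close>

definition m_build0 :: hcom where
  "m_build0 = (m_fill (var 22) 24 rd ;;; m_fill (cst 3) 24 (\<lambda>i. rd (var 22 \<oplus> i)) ;;;
     cwr (cst 0) (var 4) ;;; cwr (cst 1) (var 5) ;;; cwr (cst 2) (var 6) ;;;
     m_fill (var 22) 13 m_key ;;; m_sort (var 22) 13 (var 25) ;;;
     m_fill (var 19) 14 (\<lambda>i. rd (var 22 \<oplus> i \<otimes> var 10)) ;;;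
     cwr (var 19 \<oplus> var 14) (m_pow (var 31 \<oplus> var 28 \<oplus> var 7)))"

definition m_word :: "hexpr \<Rightarrow> hexpr" where
  "m_word y = ((y \<oslash> var 15) \<otimes> var 14 \<oplus> m_from (y \<oslash> var 15) (cst 0) (y \<odot> var 15)) \<otimes> var 15 \<oplus> y \<odot> var 15"

definition m_build1 :: hcom where
  "m_build1 = (m_fill (var 21) 23 m_word ;;; m_sort (var 21) 23 (var 22))"

text \<open>The first entry merely fills register 3, so that the parameters occupy the same
  registers as in the query program.\<close>

definition construct_lets :: "nat \<Rightarrow> nat \<Rightarrow> hexpr list" where
  "construct_lets K C = [cst 0, var 0, var 1, var 2] @ m_params K C"

text \<open>Registers 20, 17 and 22 hold \<open>SB\<close>, \<open>RR\<close> and \<open>EN\<close>: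
  address and number of the random words, and the size of the result.\<close>

definition construct_prog :: "nat \<Rightarrow> nat \<Rightarrow> program" where
  "construct_prog K C = construct_program 32 (lets_of 3 (construct_lets K C)) (m_build0 32) 20 17 (m_build1 32) 22"

context params
begin

lemma construct_lets_env:
  assumes "\<rho> 0 = n" "\<rho> 1 = w" "\<rho> 2 = q"
  shows "lets_env bb 32 m (lets_of 3 (construct_lets K C)) 3 \<rho> = store_list 3 (0 # pv) \<rho>"
proof (rule lets_env_lets_of)
  have l: "length (m_params K C) = 25" "length pv = 28" by (simp_all add: m_params_def pv_def)
  show "length (0 # pv) = length (construct_lets K C)" by (simp add: construct_lets_def l)
  fix k assume "k < length (construct_lets K C)"
  then have k: "k < 29" by (simp add: construct_lets_def l)
  let ?c = "\<lparr>bits = bb, lregs = min (3 + k) 32, cmem = m, depth = 3 + k, env = store_list 3 (take k (0 # pv)) \<rho>\<rparr>"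
  have old: "val ?c (var i) (\<rho> i)" if "i < 3" for i
    using val_var[of i ?c] that by (simp add: store_list_def)
  consider "k = 0" | "k = 1" | "k = 2" | "k = 3" | "4 \<le> k" by linarith
  then show "val ?c (construct_lets K C ! k) ((0 # pv) ! k)"
  proof cases
    case 1
    then show ?thesis using bits_num[of ?c 0] by (simp add: construct_lets_def)
  next
    case 2
    then show ?thesis using old[of 0] assms(1) by (simp add: construct_lets_def pv_def)
  next
    case 3
    then show ?thesis using old[of 1] assms(2) by (simp add: construct_lets_def pv_def)
  next
    case 4
    then show ?thesis using old[of 2] assms(3) by (simp add: construct_lets_def pv_def)
  next
    case 5
    define j where "j = k - 4"
    have j: "j < 25" "k = 4 + j" using 5 k by (simp_all add: j_def)
    have "env ?c (4 + i) = pv ! i" if "i < 3 + j" for i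
    proof -
      have "3 \<le> 4 + i" "4 + i < 3 + length (take k (0 # pv))" "4 + i - 3 = Suc i" "i < k - 1" using that j l by simp_all
      then show ?thesis using j by (simp add: store_list_def)
    qed
    then have "partial (3 + j) ?c" using j by (simp add: partial_def)
    from val_params[OF j(1) this] show ?thesis using j by (simp add: construct_lets_def nth_append)
  qed
qed

end

context inst
begin

section \<open>Contents of the memory during the construction\<close>

definition hdr :: "(nat \<Rightarrow> nat) \<Rightarrow> bool" where
  "hdr m \<longleftrightarrow> m 0 = n \<and> m 1 = w \<and> m 2 = q \<and> (\<forall>i<n. m (3 + (i + i)) = px i \<and> m (4 + (i + i)) = py i)"

definition ld :: "(nat \<Rightarrow> nat) \<Rightarrow> bool" where "ld m \<longleftrightarrow> (\<forall>B\<le>MM. m (LB + B) = leadr B)"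

lemma hdr_frame:
  assumes "hdr m" "frame R m m'" "\<And>x. x \<in> R \<Longrightarrow> LB \<le> x"
  shows "hdr m'"
proof -
  have "m' x = m x" if "x < LB" for x using assms(2,3) that unfolding frame_def by (meson not_less)
  then show ?thesis using assms(1) unfolding hdr_def LB_def by simp
qed

lemma ld_frame:
  assumes "ld m" "frame R m m'" "\<And>x. x \<in> R \<Longrightarrow> SB \<le> x"
  shows "ld m'"
proof -
  have "m' x = m x" if "x < SB" for x using assms(2,3) that unfolding frame_def by (meson not_less)
  then show ?thesis using assms(1) unfolding ld_def SB_def by simp
qed

lemma hdr_pts: "hdr (cmem c) \<Longrightarrow> pts c" by (simp add: hdr_def pts_def)
lemma ld_leads: "ld (cmem c) \<Longrightarrow> leads c" by (simp add: ld_def leads_def)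

lemma layout: "LB = 3 + 2 * n" "LB + MM < SB" "SB \<le> CB" "CB \<le> EN" "SB \<le> EN" "LB \<le> EN" "LB \<le> CB" "2 * n \<le> EN" "3 + 2 * n \<le> EN"
  by (simp_all add: EN_def CB_def SB_def LB_def)

lemma n_le_NN: "2 * n \<le> 2 * NN"
  using n_le_NW NN_bounds(1) by linarith

lemma build_header:
  assumes s: "std c" and init: "\<And>i. i < n \<Longrightarrow> cmem c (i + i) = px i \<and> cmem c (i + i + 1) = py i"
    and Q: "\<And>c'. c \<unlhd> c' \<Longrightarrow> hdr (cmem c') \<Longrightarrow> hoare c' z Q"
  shows "hoare c (m_fill (var 22) 24 rd ;;; m_fill (cst 3) 24 (\<lambda>i. rd (var 22 \<oplus> i)) ;;;
     cwr (cst 0) (var 4) ;;; cwr (cst 1) (var 5) ;;; cwr (cst 2) (var 6) ;;; z) Q"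
    (is "hoare c (?f1 ;;; ?f2 ;;; ?w0 ;;; ?w1 ;;; ?w2 ;;; z) Q")
proof -
  let ?is = "map (cmem c) [0..<2 * n]"
  have b1: "EN + 2 * n < 2 ^ bb" by (rule addr_less) (use n_le_NN in simp)
  have b2: "3 + 2 * n < 2 ^ bb" by (rule addr_less) (use layout in simp)
  have h1: "hoare c ?f1 (\<lambda>m. arr m EN ?is \<and> frame {EN..<EN + 2 * n} (cmem c) m)"
  proof (rule hoare_fill[OF s std_lregs(21)[OF s] std_mvals(11)[OF s] b1])
    fix c' x j assume "j < 2 * n" "mval c' x j" and f: "frame {EN..<EN + j} (cmem c) (cmem c')"
    have "j \<notin> {EN..<EN + j}" using \<open>j < 2 * n\<close> layout(8) by simp
    then have "cmem c' j = cmem c j" using f by (simp add: frame_def)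
    with mval_val[OF \<open>mval c' x j\<close>] show "val c' (rd x) (cmem c j)" by (rule val_rd)
  qed
  show ?thesis
  proof (rule hoare_seq[OF h1])
    fix c1 assume e1: "c \<unlhd> c1" and m1: "arr (cmem c1) EN ?is \<and> frame {EN..<EN + 2 * n} (cmem c) (cmem c1)"
    have s1: "std c1" by (rule std_extm[OF s e1])
    have h2: "hoare c1 ?f2 (\<lambda>m. arr m 3 ?is \<and> frame {3..<3 + 2 * n} (cmem c1) m)"
    proof (rule hoare_fill[OF s1 std_lregs(21)[OF s1] std_mnum[OF s1] b2])
      fix c' x j assume e: "c1 \<unlhd> c'" and j: "j < 2 * n" and x: "mval c' x j" and f: "frame {3..<3 + j} (cmem c1) (cmem c')"
      have s': "std c'" by (rule std_extm[OF s1 e])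
      have v: "val c' (var 22 \<oplus> x) (EN + j)"
        by (intro val_add std_vals s' mval_val[OF x]) (use b1 j std_bits[OF s'] in simp)
      have "EN + j \<notin> {3..<3 + j}" using layout(9) j by simp
      then have "cmem c' (EN + j) = cmem c1 (EN + j)" using f by (simp add: frame_def)
      also have "\<dots> = cmem c j" using m1 j by (simp add: arr_def)
      finally show "val c' (rd (var 22 \<oplus> x)) (cmem c j)" by (rule val_rd[OF v])
    qed simp
    show "hoare c1 (?f2 ;;; ?w0 ;;; ?w1 ;;; ?w2 ;;; z) Q"
    proof (rule hoare_seq[OF h2])
      fix c2 assume e2: "c1 \<unlhd> c2" and m2: "arr (cmem c2) 3 ?is \<and> frame {3..<3 + 2 * n} (cmem c1) (cmem c2)"
      have s2: "std c2" by (rule std_extm[OF s1 e2])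
      have h3: "hoare c2 ?w0 (\<lambda>m. m = (cmem c2)(0 := n))"
        by (rule hoare_wr[OF val_num[OF s2] std_vals(1)[OF s2]]) simp_all
      show "hoare c2 (?w0 ;;; ?w1 ;;; ?w2 ;;; z) Q"
      proof (rule hoare_seq[OF h3])
        fix c3 assume e3: "c2 \<unlhd> c3" and m3: "cmem c3 = (cmem c2)(0 := n)"
        have s3: "std c3" by (rule std_extm[OF s2 e3])
        have h4: "hoare c3 ?w1 (\<lambda>m. m = (cmem c3)(1 := w))"
          by (rule hoare_wr[OF val_num[OF s3] std_vals(2)[OF s3]]) simp_all
        show "hoare c3 (?w1 ;;; ?w2 ;;; z) Q"
        proof (rule hoare_seq[OF h4])
          fix c4 assume e4: "c3 \<unlhd> c4" and m4: "cmem c4 = (cmem c3)(1 := w)"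
          have s4: "std c4" by (rule std_extm[OF s3 e4])
          have h5: "hoare c4 ?w2 (\<lambda>m. m = (cmem c4)(2 := q))"
            by (rule hoare_wr[OF val_num[OF s4] std_vals(3)[OF s4]]) simp_all
          show "hoare c4 (?w2 ;;; z) Q"
          proof (rule hoare_seq[OF h5])
            fix c5 assume e5: "c4 \<unlhd> c5" and m5: "cmem c5 = (cmem c4)(2 := q)"
            have a: "cmem c2 (3 + j) = cmem c j" if "j < 2 * n" for j using m2 that by (simp add: arr_def)
            have "cmem c5 (3 + (i + i)) = px i \<and> cmem c5 (4 + (i + i)) = py i" if "i < n" for i
            proof -
              have "4 + (i + i) = 3 + (i + i + 1)" by simp
              then have "cmem c2 (4 + (i + i)) = cmem c (i + i + 1)" using a[of "i + i + 1"] that by (simp only:)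
              then show ?thesis using a[of "i + i"] init[OF that] that by (simp add: m5 m4 m3)
            qed
            then have "hdr (cmem c5)" by (simp add: hdr_def m5 m4 m3)
            then show "hoare c5 z Q"
              by (rule Q[OF extm_trans[OF extm_trans[OF extm_trans[OF extm_trans[OF e1 e2] e3] e4] e5]])
          qed
        qed
      qed
    qed
  qed
qed

lemma build0:
  assumes s: "std c" and init: "\<And>i. i < n \<Longrightarrow> cmem c (i + i) = px i \<and> cmem c (i + i + 1) = py i"
  shows "hoare c m_build0 (\<lambda>m. hdr m \<and> ld m)"
  unfolding m_build0_def
proof (rule build_header[OF s init])
  let ?fk = "m_fill (var 22) 13 m_key" and ?st = "m_sort (var 22) 13 (var 25)"
  let ?fl = "m_fill (var 19) 14 (\<lambda>i. rd (var 22 \<oplus> i \<otimes> var 10))"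
  let ?wl = "cwr (var 19 \<oplus> var 14) (m_pow (var 31 \<oplus> var 28 \<oplus> var 7))"
  fix c1 assume e1: "c \<unlhd> c1" and hd: "hdr (cmem c1)"
  have s1: "std c1" by (rule std_extm[OF s e1])
  have b1: "EN + NN < 2 ^ bb" by (rule addr_less) simp
  have b2: "EN + NN + NN + 1 < 2 ^ bb" by (rule addr_less) simp
  have h1: "hoare c1 ?fk (\<lambda>m. arr m EN (map key [0..<NN]) \<and> frame {EN..<EN + NN} (cmem c1) m)"
  proof (rule hoare_fill[OF s1 std_lregs(10)[OF s1] std_mvals(11)[OF s1] b1])
    fix c' x j assume e: "c1 \<unlhd> c'" and "j < NN" "mval c' x j" and f: "frame {EN..<EN + j} (cmem c1) (cmem c')"
    have "hdr (cmem c')" by (rule hdr_frame[OF hd f]) (use layout(6) in simp)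
    then show "val c' (m_key x) (key j)"
      by (intro val_key std_extm[OF s1 e] hdr_pts mval_val \<open>mval c' x j\<close> \<open>j < NN\<close>)
  qed
  show "hoare c1 (?fk ;;; ?st ;;; ?fl ;;; ?wl) (\<lambda>m. hdr m \<and> ld m)"
  proof (rule hoare_seq[OF h1])
    fix c2 assume e2: "c1 \<unlhd> c2" and m2: "arr (cmem c2) EN (map key [0..<NN]) \<and> frame {EN..<EN + NN} (cmem c1) (cmem c2)"
    have s2: "std c2" by (rule std_extm[OF s1 e2])
    have hd2: "hdr (cmem c2)" by (rule hdr_frame[OF hd conjunct2[OF m2]]) (use layout(6) in simp)
    let ?R = "{EN..<EN + NN} \<union> {EN + NN..EN + NN + NN + 1}"
    have h2: "hoare c2 ?st (\<lambda>m. arr m EN A \<and> frame ?R (cmem c2) m)"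
      by (rule hoare_sort[OF s2 std_mvals(11,12)[OF s2] _ conjunct1[OF m2], folded A_def, simplified length_map length_upt diff_zero])
        (use std_lregs(10)[OF s2] b1 b2 fits_less[OF key_bound] in auto)
    show "hoare c2 (?st ;;; ?fl ;;; ?wl) (\<lambda>m. hdr m \<and> ld m)"
    proof (rule hoare_seq[OF h2])
      fix c3 assume e3: "c2 \<unlhd> c3" and "arr (cmem c3) EN A \<and> frame ?R (cmem c2) (cmem c3)"
      then have m3: "arr (cmem c3) EN A" "frame ?R (cmem c2) (cmem c3)" by blast+
      have s3: "std c3" by (rule std_extm[OF s2 e3])
      have hd3: "hdr (cmem c3)" by (rule hdr_frame[OF hd2 m3(2)]) (use layout(6) in auto)
      have b3: "LB + MM < 2 ^ bb" by (rule addr_less) (use layout in linarith)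
      have h3: "hoare c3 ?fl
          (\<lambda>m. arr m LB (map leadr [0..<MM]) \<and> frame {LB..<LB + MM} (cmem c3) m)"
      proof (rule hoare_fill[OF s3 std_lregs(11)[OF s3] std_mvals(8)[OF s3] b3])
        fix c' x B assume e: "c3 \<unlhd> c'" and B: "B < MM" and x: "mval c' x B" and f: "frame {LB..<LB + B} (cmem c3) (cmem c')"
        have s': "std c'" by (rule std_extm[OF s3 e])
        note Bt = mul_tt_less[OF B]
        have v: "val c' (var 22 \<oplus> x \<otimes> var 10) (EN + B * tt)"
          by (intro val_add val_mul std_vals s' mval_val[OF x]) (use b1 Bt std_bits[OF s'] in simp_all)
        have "EN + B * tt \<notin> {LB..<LB + B}" using B layout by simp
        then have "cmem c' (EN + B * tt) = cmem c3 (EN + B * tt)" using f by (simp add: frame_def)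
        also have "\<dots> = leadr B" using m3(1) Bt B by (simp add: arr_def leadr_def)
        finally show "val c' (rd (var 22 \<oplus> x \<otimes> var 10)) (leadr B)" by (rule val_rd[OF v])
      qed
      show "hoare c3 (?fl ;;; ?wl) (\<lambda>m. hdr m \<and> ld m)"
      proof (rule hoare_seq[OF h3])
        fix c4 assume e4: "c3 \<unlhd> c4" and m4: "arr (cmem c4) LB (map leadr [0..<MM]) \<and> frame {LB..<LB + MM} (cmem c3) (cmem c4)"
        have s4: "std c4" by (rule std_extm[OF s3 e4])
        note sb = std_bits[OF s4]
        have hd4: "hdr (cmem c4)" by (rule hdr_frame[OF hd3 conjunct2[OF m4]]) simp
        have ad: "val c4 (var 19 \<oplus> var 14) (LB + MM)"
          by (intro val_add std_vals s4) (use b3 sb in simp)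
        have "12 * WW + 8 * WW + WW < 2 ^ bb"
        proof -
          have "12 * WW + 8 * WW + WW \<le> bb" using bb_ge by simp
          then show ?thesis using less_exp[of bb] by (rule le_less_trans)
        qed
        then have "val c4 (var 31 \<oplus> var 28 \<oplus> var 7) (12 * WW + 8 * WW + WW)"
          by (intro val_add std_vals s4) (use sb in simp_all)
        from val_pow[OF s4 this] have pw: "val c4 (m_pow (var 31 \<oplus> var 28 \<oplus> var 7)) (2 ^ (12 * WW + 8 * WW + WW))"
          using pos by simp
        show "hoare c4 ?wl (\<lambda>m. hdr m \<and> ld m)"
        proof (rule hoare_wr[OF ad pw])
          let ?m = "(cmem c4)(LB + MM := 2 ^ (12 * WW + 8 * WW + WW))"
          have "hdr ?m" by (rule hdr_frame[OF hd4, of "{LB + MM}"]) (simp_all add: frame_def)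
          moreover have "?m (LB + B) = leadr B" if "B \<le> MM" for B
          proof (cases "B = MM")
            case True
            have "12 * WW + 8 * WW + WW = 21 * WW" by simp
            then show ?thesis using True by (simp add: leadr_def)
          next
            case False
            then show ?thesis using that m4 by (simp add: arr_def)
          qed
          ultimately show "hdr ?m \<and> ld ?m" by (simp add: ld_def)
        qed
      qed
    qed
  qed
qed

lemma val_word:
  assumes s: "std c" and m: "pts c" "leads c" "seeds c" and a: "val c a1 y" and y: "y < TM"
  shows "val c (m_word a1) (cword y)"
proof -
  have i: "y div mm < TT" using y unfolding TM_def by (rule less_mult_imp_div_less)
  have j: "y mod mm < mm" using pos by simp
  then have jM: "y mod mm < MM" using mm_le_MM by linarith
  note sb = std_bits[OF s]
  note w = word_bound[OF i seg_less[OF jM] j, of "y div mm" 0 tt]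
  let ?E = "wfrom (y div mm) 0 (y mod mm)"
  define X where "X = (y div mm) * MM + ?E"
  have "X \<le> X * mm" using pos by simp
  moreover have "X * mm < 2 ^ bb" using w unfolding X_def by linarith
  ultimately have Xb: "X < 2 ^ bb" "X * mm < 2 ^ bb" by linarith+
  then have b: "(y div mm) * MM + ?E < 2 ^ bb" "(y div mm) * MM < 2 ^ bb" "((y div mm) * MM + ?E) * mm < 2 ^ bb"
    unfolding X_def by linarith+
  have vi: "val c (a1 \<oslash> var 15) (y div mm)" and vj: "val c (a1 \<odot> var 15) (y mod mm)"
    by (intro val_div val_mod a std_vals s)+
  have z: "val c (cst 0) 0" by (rule val_num[OF s]) simp
  show ?thesis unfolding m_word_def cword_def
    by (intro val_add val_mul vi vj val_seg[OF s m vi z std_vals(7)[OF s] vj i jM] std_vals s) (use w b sb in simp_all)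
qed

lemma cword_less: "y < TM \<Longrightarrow> cword y < 2 ^ bb"
proof -
  assume y: "y < TM"
  have i: "y div mm < TT" using y unfolding TM_def by (rule less_mult_imp_div_less)
  have j: "y mod mm < mm" using pos by simp
  then have jM: "y mod mm < MM" using mm_le_MM by linarith
  show ?thesis unfolding cword_def by (rule word_bound[OF i seg_less[OF jM] j])
qed

text \<open>Sorting uses the cells from \<open>EN\<close> on as its buffer and overwrites the keys
  there, of which only the leaders are still wanted.\<close>

lemma build1:
  assumes s: "std c" and hd: "hdr (cmem c)" "ld (cmem c)" and sd: "\<And>j. j < RR \<Longrightarrow> cmem c (SB + j) = rs ! j"
  shows "hoare c m_build1 (\<lambda>m. hdr m \<and> ld m \<and> (\<forall>j<RR. m (SB + j) = rs ! j) \<and> (\<forall>j<TM. m (CB + j) = chl ! j))"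
  unfolding m_build1_def
proof -
  have b1: "CB + TM < 2 ^ bb" by (rule addr_less) (simp add: EN_def)
  have b2: "EN + TM + 1 < 2 ^ bb" by (rule addr_less) simp
  have sd_frame: "\<forall>j<RR. m' (SB + j) = rs ! j"
    if "\<forall>j<RR. m (SB + j) = rs ! j" "frame R m m'" "\<And>x. x \<in> R \<Longrightarrow> CB \<le> x" for R m m'
  proof (intro allI impI)
    fix j assume j: "j < RR"
    then have "SB + j \<notin> R" using that(3)[of "SB + j"] by (auto simp: CB_def)
    then show "m' (SB + j) = rs ! j" using that(1,2) j by (simp add: frame_def)
  qed
  have h1: "hoare c (m_fill (var 21) 23 m_word) (\<lambda>m. arr m CB (map cword [0..<TM]) \<and> frame {CB..<CB + TM} (cmem c) m)"
  proof (rule hoare_fill[OF s std_lregs(20)[OF s] std_mvals(10)[OF s] b1])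
    fix c' x j assume e: "c \<unlhd> c'" and j: "j < TM" and x: "mval c' x j" and f: "frame {CB..<CB + j} (cmem c) (cmem c')"
    have "hdr (cmem c')" by (rule hdr_frame[OF hd(1) f]) (use layout in simp)
    moreover have "ld (cmem c')" by (rule ld_frame[OF hd(2) f]) (use layout in simp)
    moreover have "\<forall>j<RR. cmem c' (SB + j) = rs ! j" by (rule sd_frame[OF _ f]) (use sd in auto)
    ultimately show "val c' (m_word x) (cword j)"
      by (intro val_word std_extm[OF s e] hdr_pts ld_leads mval_val[OF x] j) (simp_all add: seeds_def)
  qed
  show "hoare c (m_fill (var 21) 23 m_word ;;; m_sort (var 21) 23 (var 22))
    (\<lambda>m. hdr m \<and> ld m \<and> (\<forall>j<RR. m (SB + j) = rs ! j) \<and> (\<forall>j<TM. m (CB + j) = chl ! j))"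
  proof (rule hoare_seq[OF h1])
    fix c2 assume e2: "c \<unlhd> c2" and m2: "arr (cmem c2) CB (map cword [0..<TM]) \<and> frame {CB..<CB + TM} (cmem c) (cmem c2)"
    have s2: "std c2" by (rule std_extm[OF s e2])
    let ?R = "{CB..<CB + TM} \<union> {EN..EN + TM + 1}"
    have R: "LB \<le> x" "SB \<le> x" "CB \<le> x" if "x \<in> ?R" for x using that layout by auto
    have h2: "hoare c2 (m_sort (var 21) 23 (var 22)) (\<lambda>m. arr m CB chl \<and> frame ?R (cmem c2) m)"
      by (rule hoare_sort[OF s2 std_mvals(10,11)[OF s2] _ conjunct1[OF m2], folded chl_def, simplified length_map length_upt diff_zero])
        (use std_lregs(20)[OF s2] b1 b2 cword_less in \<open>auto simp: EN_def\<close>)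
    show "hoare c2 (m_sort (var 21) 23 (var 22))
      (\<lambda>m. hdr m \<and> ld m \<and> (\<forall>j<RR. m (SB + j) = rs ! j) \<and> (\<forall>j<TM. m (CB + j) = chl ! j))"
    proof (rule hoare_conseq[OF h2])
      fix m assume "arr m CB chl \<and> frame ?R (cmem c2) m"
      then have m: "arr m CB chl" "frame ?R (cmem c2) m" by blast+
      have f: "frame ?R (cmem c) m"
        by (rule frame_trans[OF frame_mono[OF conjunct2[OF m2]] m(2)]) simp
      have "hdr m" by (rule hdr_frame[OF hd(1) f R(1)])
      moreover have "ld m" by (rule ld_frame[OF hd(2) f R(2)])
      moreover have "\<forall>j<RR. m (SB + j) = rs ! j" by (rule sd_frame[OF _ f R(3)]) (use sd in auto)
      moreover have "\<forall>j<TM. m (CB + j) = chl ! j" using m(1) by (simp add: arr_def)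
      ultimately show "hdr m \<and> ld m \<and> (\<forall>j<RR. m (SB + j) = rs ! j) \<and> (\<forall>j<TM. m (CB + j) = chl ! j)" by blast
    qed
  qed
qed

lemma std_start: "std \<lparr>bits = bb, lregs = 32, cmem = m, depth = 32, env = store_list 3 (0 # pv) \<rho>\<rparr>"
  by (simp add: std_def store_list_def pv_def)

lemma build_correct:
  fixes m \<rho> :: "nat \<Rightarrow> nat"
  assumes init: "\<And>i. i < n \<Longrightarrow> m (i + i) = px i \<and> m (i + i + 1) = py i" and len: "length rs = RR"
  defines "\<rho>' \<equiv> store_list 3 (0 # pv) \<rho>"
  defines "m' \<equiv> sem bb 32 (m_build1 32) 32 \<rho>' (store_list SB rs (sem bb 32 (m_build0 32) 32 \<rho>' m))"
  shows "hdr m' \<and> ld m' \<and> (\<forall>j<RR. m' (SB + j) = rs ! j) \<and> (\<forall>j<TM. m' (CB + j) = chl ! j)"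
proof -
  let ?c = "\<lambda>m. \<lparr>bits = bb, lregs = 32, cmem = m, depth = 32, env = \<rho>'\<rparr>"
  have s: "std (?c m)" for m unfolding \<rho>'_def by (rule std_start)
  have sem: "Q (sem bb 32 (a 32) 32 \<rho>' m)" if "hoare (?c m) a Q" for a Q m
    using that ext_refl[of "?c m"] unfolding hoare_def by fastforce
  define m0 where "m0 = sem bb 32 (m_build0 32) 32 \<rho>' m"
  have m0: "hdr m0 \<and> ld m0" unfolding m0_def by (rule sem[OF build0[OF s]]) (use init in simp)
  define m1 where "m1 = store_list SB rs m0"
  have f: "frame {SB..<SB + RR} m0 m1" by (auto simp: frame_def m1_def store_list_def len)
  have "hdr m1" by (rule hdr_frame[OF conjunct1[OF m0] f]) (use layout in simp)
  moreover have "ld m1" by (rule ld_frame[OF conjunct2[OF m0] f]) simp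
  moreover have "m1 (SB + j) = rs ! j" if "j < RR" for j using that len by (simp add: m1_def store_list_def)
  ultimately show ?thesis unfolding m'_def m0_def[symmetric] m1_def[symmetric]
    by (intro sem[OF build1[OF s]]) simp_all
qed

end

section \<open>Running times\<close>

lemma ecost_mono:
  assumes "\<And>p. limit G \<rho> p \<le> limit G' \<rho>' p"
  shows "ecost G \<rho> e \<le> ecost G' \<rho>' e"
proof (induction e)
  case (EFold p x y)
  have "limit G \<rho> p * (ecost G \<rho> y + 7) \<le> limit G' \<rho>' p * (ecost G' \<rho>' y + 7)"
    using assms[of p] EFold by (intro mult_le_mono) auto
  then show ?case using EFold by simp
qed auto

text \<open>Registers are set once and never changed, so each definition costs at most what it would
  cost in the final environment, where more loop bounds are available.\<close>

lemma lets_cost_le: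
  "lets_cost b G m es d \<rho> \<le> sum_list (map (ecost G (lets_env b G m es d \<rho>)) es)"
proof (induction es arbitrary: d \<rho>)
  case (Cons e es)
  let ?\<rho> = "lets_env b G m (e # es) d \<rho>"
  have "limit (min d G) \<rho> p \<le> limit G ?\<rho> p" for p
    using lets_env_below[of p d b G m "e # es" \<rho>] by (auto simp: limit_def)
  from ecost_mono[OF this, of e] Cons.IH[of "Suc d" "\<rho>(d := eval b (min d G) m e d \<rho>)"]
  show ?case by (simp del: fun_upd_apply)
qed simp

lemma soft_pow_sum_list:
  assumes "0 \<le> D" "\<And>e. e \<in> set es \<Longrightarrow> (\<lambda>n. real (F n e)) \<in> soft_pow D"
  shows "(\<lambda>n. real (sum_list (map (F n) es))) \<in> soft_pow D"
  using assms(2)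
proof (induction es)
  case (Cons e es)
  then show ?case using soft_pow_add[of "\<lambda>n. real (F n e)" D "\<lambda>n. real (sum_list (map (F n) es))"] by simp
qed (simp add: soft_pow_const assms(1))

lemma set_lets_of: "e \<in> set (lets_of d hs) \<Longrightarrow> \<exists>h\<in>set hs. \<exists>d. e = h d"
  by (induction hs arbitrary: d) auto

lemma lets_soft_pow:
  assumes "\<And>p. 4 \<le> p \<Longrightarrow> p < G \<Longrightarrow> (\<lambda>n. real (P n p)) \<in> soft_pow (g p)" "\<And>p. 0 \<le> g p"
    "\<And>h. h \<in> set hs \<Longrightarrow> deg_le g h D" "0 \<le> D"
  shows "(\<lambda>n. real (sum_list (map (ecost G (P n)) (lets_of d hs)))) \<in> soft_pow D"
proof (rule soft_pow_sum_list[OF assms(4)])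
  fix e assume "e \<in> set (lets_of d hs)"
  then obtain h d' where h: "h \<in> set hs" "e = h d'" using set_lets_of by blast
  then have "edeg g e \<le> D" using assms(3)[OF h(1)] by (simp add: deg_le_def)
  from soft_pow_mono[OF ecost_soft_pow[OF assms(1,2)] this]
  show "(\<lambda>n. real (ecost G (P n) e)) \<in> soft_pow D" by blast
qed

text \<open>Registers 8 and 18 hold \<open>bb\<close> and \<open>LV\<close>, which are
  polylogarithmic; registers 10 and 16 hold \<open>tt\<close> and \<open>TT\<close>, whose degree
  \<open>t\<close> will be \<open>\<alpha> / 4\<close>. These are all loop bounds that occur in a
  query.\<close>

locale degrees =
  fixes g :: "nat \<Rightarrow> real" and t :: real
  assumes g8: "g 8 = 0" and g18: "g 18 = 0" and g10: "g 10 = t" and g16: "g 16 = t" and t0: "0 \<le> t"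
begin

lemma deg_mono: "deg_le g a D \<Longrightarrow> D \<le> E \<Longrightarrow> deg_le g a E"
  unfolding deg_le_def by (meson order_trans)

lemma deg_fold8:
  "deg_le g a D \<Longrightarrow> (\<And>i j. deg_le g (h (var i) (var j)) D) \<Longrightarrow> deg_le g (hfold 8 a h) D"
  by (rule deg_le_intros(7)) (simp_all add: g8)

lemma deg_fold18:
  "deg_le g a D \<Longrightarrow> (\<And>i j. deg_le g (h (var i) (var j)) D) \<Longrightarrow> deg_le g (hfold 18 a h) D"
  by (rule deg_le_intros(7)) (simp_all add: g18)

lemma deg_fold10:
  "deg_le g a (E + t) \<Longrightarrow> (\<And>i j. deg_le g (h (var i) (var j)) E) \<Longrightarrow> deg_le g (hfold 10 a h) (E + t)"
  by (rule deg_le_intros(7)) (simp_all add: g10)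

lemma deg_fold16:
  "deg_le g a (E + t) \<Longrightarrow> (\<And>i j. deg_le g (h (var i) (var j)) E) \<Longrightarrow> deg_le g (hfold 16 a h) (E + t)"
  by (rule deg_le_intros(7)) (simp_all add: g16)

lemmas dl = deg_le_intros(1-6)

section \<open>Degrees of the parts of a query\<close>

lemma deg_pow: "0 \<le> D \<Longrightarrow> deg_le g a D \<Longrightarrow> deg_le g (m_pow a) D"
  unfolding m_pow_def by (intro dl)

lemma deg_desc: "0 \<le> D \<Longrightarrow> (\<And>i. deg_le g (P (var i)) D) \<Longrightarrow> deg_le g (m_desc P) D"
  unfolding m_desc_def by (intro deg_fold8 dl deg_pow)

abbreviation "cheap a \<equiv> deg_le g a 0"

lemma cheap_geometry:
  "cheap i \<Longrightarrow> cheap (m_px i)" "cheap i \<Longrightarrow> cheap (m_py i)"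
  "cheap i \<Longrightarrow> cheap j \<Longrightarrow> cheap (m_num i j)" "cheap i \<Longrightarrow> cheap j \<Longrightarrow> cheap (m_code i j)"
  "cheap i \<Longrightarrow> cheap a1 \<Longrightarrow> cheap a2 \<Longrightarrow> cheap a3 \<Longrightarrow> cheap a4 \<Longrightarrow> cheap (m_base i a1 a2 a3 a4)"
  unfolding m_code_def m_num_def m_px_def m_py_def m_base_def by (intro dl order_refl; assumption)+

lemma cheap_hi: "cheap i \<Longrightarrow> cheap j \<Longrightarrow> cheap l \<Longrightarrow> cheap (m_hi i j l)"
  unfolding m_hi_def by (intro dl cheap_geometry order_refl)

lemma cheap_key: "cheap e \<Longrightarrow> cheap (m_key e)"
  unfolding m_key_def by (intro dl cheap_geometry cheap_hi deg_pow order_refl)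

lemma cheap_bucket: "cheap e \<Longrightarrow> cheap (m_bucket e)"
  unfolding m_bucket_def by (intro deg_desc dl order_refl)

lemma cheap_gg: "cheap e \<Longrightarrow> cheap (m_gg e)"
  unfolding m_gg_def by (intro dl cheap_key cheap_bucket order_refl)

lemma cheap_hash: "cheap i \<Longrightarrow> cheap j \<Longrightarrow> cheap B \<Longrightarrow> cheap (m_hash i j B)"
  unfolding m_hash_def by (intro dl deg_pow order_refl)

lemma cheap_chain: "cheap i \<Longrightarrow> cheap E \<Longrightarrow> cheap (m_chain i E)"
  unfolding m_chain_def by (intro dl deg_desc order_refl)

lemma cheap_piece: "cheap lo \<Longrightarrow> cheap h \<Longrightarrow> cheap i \<Longrightarrow> cheap s \<Longrightarrow> cheap (m_piece lo h i s)"
  unfolding m_piece_def by (intro dl deg_pow order_refl)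

lemma cheap_anum: "cheap e \<Longrightarrow> cheap (m_anum e)" "cheap e \<Longrightarrow> cheap (m_aden e)"
  unfolding m_anum_def m_aden_def by (intro dl cheap_geometry order_refl; assumption)+

lemma cheap_top: "cheap m_top"
  unfolding m_top_def by (intro dl cheap_geometry order_refl)

lemma cheap_params: "h \<in> set (m_params K C) \<Longrightarrow> cheap h"
proof -
  have "list_all cheap (m_params K C)"
    unfolding m_params_def m_par4_def list.pred_inject(2)
    by (intro conjI dl deg_pow deg_fold8 order_refl list.pred_inject(1))
  then show "h \<in> set (m_params K C) \<Longrightarrow> cheap h" by (simp add: list_all_iff)
qed

lemma deg_seg:
  assumes "cheap i" "cheap l" "cheap h" "cheap B"
  shows "deg_le g (m_seg i l h B) t"
proof -
  have "deg_le g (m_seg i l h B) (0 + t)"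
    unfolding m_seg_def
    by (intro deg_fold10 dl cheap_gg cheap_hash order_refl deg_mono[OF assms(4)] assms) (use t0 in simp)
  then show ?thesis by simp
qed

lemma deg_cand:
  assumes "cheap i" "cheap j" "cheap B"
  shows "deg_le g (m_cand i j B) t"
  unfolding m_cand_def
  by (intro dl deg_seg deg_mono[OF cheap_chain t0] deg_mono[OF cheap_hash t0] assms order_refl)

text \<open>All \<open>TT\<close> tables and \<open>tt\<close> positions are tried, and each
  candidate takes walks of \<open>tt\<close> steps: three factors of degree
  \<open>t\<close>.\<close>

lemma deg_succ:
  assumes "cheap B" "cheap x"
  shows "deg_le g (m_succ B x) (t + t + t)"
proof -
  have tt: "0 \<le> t + t" "0 \<le> t + t + t" using t0 by simp_all
  have key: "deg_le g (m_key (var e)) t" for e by (rule deg_mono[OF cheap_key t0]) (rule dl(2)[OF order_refl])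
  have cand: "deg_le g (m_cand (var i) (var j) B) t" for i j by (intro deg_cand assms(1) dl(2) order_refl)
  have inner: "deg_le g (hlet (m_cand (var i) (var j) B) (\<lambda>e. hlet (m_key e)
      (\<lambda>\<kappa>. ite (x \<prec> \<kappa>) (ite (\<kappa> \<prec> var a) \<kappa> (var a)) (var a)))) t" for i j a
    by (intro dl(6,5,3,2) cand key deg_mono[OF assms(2) t0] t0)
  show ?thesis unfolding m_succ_def
  proof (rule deg_fold16)
    show "deg_le g (rd (var 19 \<oplus> (B \<oplus> cst 1))) (t + t + t)"
      by (intro dl(1-4) deg_mono[OF assms(1) tt(2)] tt)
    fix a i
    show "deg_le g (hfold 10 (var a) (\<lambda>acc j. hlet (m_cand (var i) j B) (\<lambda>e. hlet (m_key e)
      (\<lambda>\<kappa>. ite (x \<prec> \<kappa>) (ite (\<kappa> \<prec> acc) \<kappa> acc) acc)))) (t + t)"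
      by (rule deg_fold10, rule dl(2)[OF tt(1)], rule inner)
  qed
qed

text \<open>Up to \<open>tt\<close> successor steps within a block are the fourth factor; this is
  why \<open>tt\<close> has to be about the fourth root of \<open>q\<close>.\<close>

lemma deg_select:
  assumes "cheap x"
  shows "deg_le g (m_select x) (4 * t)"
proof -
  have e: "4 * t = (t + t + t) + t" by simp
  have tt: "0 \<le> t + t + t" "0 \<le> t + t + t + t" using t0 by simp_all
  show ?thesis unfolding m_select_def e
  proof (rule deg_fold10)
    show "deg_le g (rd (var 19 \<oplus> x \<oslash> var 10)) (t + t + t + t)"
      by (intro dl(2-4) deg_mono[OF assms tt(2)] tt)
    fix i j
    show "deg_le g (ite (var j \<prec> x \<odot> var 10) (m_succ (x \<oslash> var 10) (var i)) (var i)) (t + t + t)"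
      by (intro dl(5,3,2) deg_succ deg_mono[OF assms tt(1)] assms tt order_refl)
  qed
qed

lemma t4: "0 \<le> 4 * t" using t0 by simp

lemma deg_rank:
  assumes "cheap x" shows "deg_le g (m_rank x) (4 * t)"
  unfolding m_rank_def by (intro deg_desc dl deg_select t4 order_refl deg_mono[OF assms t4])

lemma deg_range: "cheap x \<Longrightarrow> cheap y \<Longrightarrow> deg_le g (m_range x y) (4 * t)"
  unfolding m_range_def by (intro dl deg_rank deg_mono[OF _ t4, of x] deg_mono[OF _ t4, of y] order_refl t4)

lemma deg_pterm: "cheap x \<Longrightarrow> cheap z \<Longrightarrow> deg_le g (m_pterm x z) (4 * t)"
  unfolding m_pterm_def Let_def
  by (intro dl(5) dl(1) t4 deg_range deg_mono[OF cheap_piece t4] cheap_geometry cheap_piece dl order_refl)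

lemma deg_cnt: "cheap x \<Longrightarrow> deg_le g (m_cnt x) (4 * t)"
  unfolding m_cnt_def by (intro deg_fold18 dl deg_pterm t4 order_refl)

lemma deg_sigma: "cheap x \<Longrightarrow> deg_le g (m_sigma x) (4 * t)"
  unfolding m_sigma_def by (intro deg_desc dl deg_cnt deg_pow deg_mono[OF _ t4, of x] t4 order_refl)

lemma deg_find: "deg_le g x (4 * t) \<Longrightarrow> deg_le g (m_find x) (4 * t)"
  unfolding m_find_def
  by (intro dl deg_rank deg_select deg_pow deg_mono[OF cheap_top t4] t4 order_refl)

lemma deg_query: "h \<in> set (query_lets K C) \<Longrightarrow> deg_le g h (4 * t)"
proof -
  have a: "list_all (\<lambda>h. deg_le g h (4 * t)) m_answer"
    unfolding m_answer_def list.pred_inject(2)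
    by (intro conjI dl deg_cnt deg_pow deg_find deg_sigma deg_mono[OF cheap_anum(1) t4]
      deg_mono[OF cheap_anum(2) t4] t4 order_refl list.pred_inject(1))
  have b: "list_all (\<lambda>h. deg_le g h (4 * t)) [rd (cst 0), rd (cst 1), rd (cst 2)]"
    unfolding list.pred_inject(2) by (intro conjI dl t4 list.pred_inject(1))
  assume "h \<in> set (query_lets K C)"
  then show ?thesis unfolding query_lets_def set_append using a[unfolded list_all_iff] b[unfolded list_all_iff] deg_mono[OF cheap_params t4] by blast
qed

lemma deg_construct_lets: "h \<in> set (construct_lets K C) \<Longrightarrow> deg_le g h 0"
proof -
  have b: "list_all cheap [cst 0, var 0, var 1, var 2]"
    unfolding list.pred_inject(2) by (intro conjI dl order_refl list.pred_inject(1))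
  assume "h \<in> set (construct_lets K C)"
  then show ?thesis unfolding construct_lets_def set_append using b[unfolded list_all_iff] cheap_params by blast
qed

section \<open>Degrees of the parts of the construction\<close>

lemma deg_fill:
  assumes "0 \<le> D" "deg_le g a 0" "\<And>i. deg_le g (f (var i)) (D - g p)" "g p \<le> D"
  shows "cdeg_le g (m_fill a p f) D"
  unfolding m_fill_def
  by (intro cdeg_le_intros(3,1) dl deg_mono[OF assms(2)] assms) (use assms in simp_all)

lemma deg_pass:
  assumes "0 \<le> D" "cheap a" "cheap b" "\<And>x. cheap x \<Longrightarrow> cheap (f x)" "g p \<le> D"
  shows "cdeg_le g (m_pass a p b f) D"
proof -
  have c: "deg_le g a (D - g p)" if "cheap a" for a using deg_mono[OF that] assms(5) by simp
  show ?thesis unfolding m_pass_def m_cnt_cell_def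
    by (intro cdeg_le_intros c dl assms order_refl)
qed

lemma deg_sort:
  assumes "0 \<le> g p" "cheap a" "cheap b" "g p \<le> D"
  shows "cdeg_le g (m_sort a p b) D"
proof -
  have D: "0 \<le> D - g 8" "g p \<le> D - g 8" using assms(1,4) g8 by simp_all
  have c: "deg_le g a (D - g 8)" if "cheap a" for a using deg_mono[OF that D(1)] .
  have c': "deg_le g a (D - g 8 - g p)" if "cheap a" for a using deg_mono[OF that] D by simp
  show ?thesis unfolding m_sort_def m_cnt_cell_def
    by (intro cdeg_le_intros(3,2,1) deg_pass deg_fill c c' dl assms(2,3) order_refl D; (assumption | use assms(1,4) in linarith))
qed

lemma deg_build:
  assumes "g 13 = 2" "g 14 = 2 - t" "g 23 = 2 - t" "g 24 = 2" "t \<le> 1"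
  shows "cdeg_le g m_build0 2" "cdeg_le g m_build1 2"
proof -
  have f: "cdeg_le g (m_fill a p f) 2" if "cheap a" "\<And>i. deg_le g (f (var i)) (2 - g p)" "g p \<le> 2" for a p f
    by (rule deg_fill) (use that in simp_all)
  have s: "cdeg_le g (m_sort a p b) 2" if "0 \<le> g p" "cheap a" "cheap b" "g p \<le> 2" for a p b
    by (rule deg_sort) (use that in simp_all)
  have t2: "t \<le> 2" using assms(5) by simp
  have 1: "cdeg_le g (m_fill (var 22) 24 rd) 2"
    by (rule f) (simp_all add: assms dl)
  have 2: "cdeg_le g (m_fill (cst 3) 24 (\<lambda>i. rd (var 22 \<oplus> i))) 2"
    by (rule f) (simp_all add: assms dl)
  have 3: "cdeg_le g (cwr (cst i) (var j)) 2" for i j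
    by (intro cdeg_le_intros(1) dl) simp_all
  have 4: "cdeg_le g (m_fill (var 22) 13 m_key) 2"
    by (rule f) (simp_all add: assms dl cheap_key)
  have 5: "cdeg_le g (m_sort (var 22) 13 (var 25)) 2"
    by (rule s) (simp_all add: assms dl)
  have 6: "cdeg_le g (m_fill (var 19) 14 (\<lambda>i. rd (var 22 \<oplus> i \<otimes> var 10))) 2"
    by (rule f) (use t0 in \<open>simp_all add: assms dl\<close>)
  have 7: "cdeg_le g (cwr (var 19 \<oplus> var 14) (m_pow (var 31 \<oplus> var 28 \<oplus> var 7))) 2"
    by (intro cdeg_le_intros(1) dl deg_pow) simp_all
  show "cdeg_le g m_build0 2"
    unfolding m_build0_def by (intro cdeg_le_intros(2) 1 2 3 4 5 6 7)
  \<comment> \<open>A chain word requires a whole walk of degree \<open>t\<close>, which the number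
    of chains, of degree \<open>2 - t\<close>, just compensates.\<close>
  have w: "deg_le g (m_word (var i)) t" for i
    unfolding m_word_def by (intro dl deg_seg order_refl t0)
  have 8: "cdeg_le g (m_fill (var 21) 23 m_word) 2"
    by (rule f) (use t0 w in \<open>simp_all add: assms dl\<close>)
  have 9: "cdeg_le g (m_sort (var 21) 23 (var 22)) 2"
    by (rule s) (use t2 t0 in \<open>simp_all add: assms dl\<close>)
  show "cdeg_le g m_build1 2"
    unfolding m_build1_def by (intro cdeg_le_intros(2) 8 9)
qed

end

section \<open>Putting everything together\<close>

context params
begin

definition pval :: "nat \<Rightarrow> nat" where "pval p = zero_padded pv (p - 4)"

lemma pval_eq: "4 \<le> p \<Longrightarrow> p < 32 \<Longrightarrow> pval p = pv ! (p - 4)"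
  by (simp add: pval_def zero_padded_def pv_def)

text \<open>Construction and query have the same loop bounds, independent of points and box, so both
  running times are functions of the parameters alone.\<close>

lemma pval_store:
  "4 \<le> p \<Longrightarrow> p < 32 \<Longrightarrow> store_list 3 (0 # pv) \<rho> p = pval p"
  "4 \<le> p \<Longrightarrow> p < 32 \<Longrightarrow> store_list 4 (pv @ xs) \<rho> p = pval p"
proof -
  assume p: "4 \<le> p" "p < 32"
  have l: "length pv = 28" by (simp add: pv_def)
  show "store_list 3 (0 # pv) \<rho> p = pval p" "store_list 4 (pv @ xs) \<rho> p = pval p"
    using p l by (auto simp: store_list_def pval_eq nth_append nth_Cons' numeral_eq_Suc)
qed

definition query_cost :: nat where
  "query_cost = sum_list (map (ecost 32 pval) (lets_of 4 (query_lets K C))) + 3"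

definition construct_cost :: nat where
  "construct_cost = sum_list (map (ecost 32 pval) (lets_of 3 (construct_lets K C))) +
     ccost 32 pval (m_build0 32) + 9 * RR + ccost 32 pval (m_build1 32) + 4"

end

context inst
begin

text \<open>The query program gets the first \<open>EN\<close> cells with zeros behind them, so it
  matters that header, leaders, seeds and chain words all lie below \<open>EN\<close>.\<close>

lemma outcome_correct:
  assumes g: good and m: "hdr (mem cfg)" "ld (mem cfg)" "\<forall>j<RR. mem cfg (SB + j) = rs ! j"
    "\<forall>j<TM. mem cfg (CB + j) = chl ! j" and mb: "\<And>a. mem cfg a < 2 ^ bb" and r0: "regs cfg 0 = EN"
    and ps: "distinct ps" "set ps = S" "length ps = n" "\<And>i. i < n \<Longrightarrow> px i = fst (ps ! i) \<and> py i = snd (ps ! i)"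
  shows "answers_theil_sen_queries bb w (query_prog K C) query_cost S (constructed cfg)"
  unfolding answers_theil_sen_queries_def
proof (intro allI impI ballI)
  fix x1 x2 y1 y2 c
  assume x: "x1 < 2 ^ w" "x2 < 2 ^ w" "y1 < 2 ^ w" "y2 < 2 ^ w"
    and c: "c \<in> set_pmf (run bb (query_prog K C) query_cost (init_config [x1, x2, y1, y2] (constructed cfg)))"
  define m where "m = zero_padded (constructed cfg)"
  let ?\<rho> = "zero_padded [x1, x2, y1, y2]"
  have eq: "m a = mem cfg a" if "a < EN" for a
    using that by (simp add: m_def zero_padded_def constructed_def r0)
  have mb': "m a < 2 ^ bb" for a
    using mb[of a] eq[of a] by (cases "a < EN") (simp_all add: m_def zero_padded_def constructed_def r0)
  have EN: "LB \<le> EN" "LB + MM < EN \<or> LB + MM < SB" "SB \<le> EN" using layout by simp_all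
  have h: "m 0 = n" "m 1 = w" "m 2 = q" using m(1) eq[of 0] eq[of 1] eq[of 2] layout(1,6) by (simp_all add: hdr_def)
  have p: "m (3 + (i + i)) = px i \<and> m (4 + (i + i)) = py i" if "i < n" for i
    using m(1) eq[of "3 + (i + i)"] eq[of "4 + (i + i)"] layout(1,6) that by (simp add: hdr_def)
  have l: "m (LB + B) = leadr B" if "B \<le> MM" for B
    using m(2) eq[of "LB + B"] layout(2,5) that by (simp add: ld_def)
  have s: "m (SB + j) = rs ! j" if "j < RR" for j
    using m(3) eq[of "SB + j"] layout(4) that by (simp add: CB_def)
  have ch: "m (CB + j) = chl ! j" if "j < TM" for j
    using m(4) eq[of "CB + j"] that by (simp add: EN_def)
  have le: "lets_env bb 32 m (lets_of 4 (query_lets K C)) 4 ?\<rho> = store_list 4 (pv @ answer_vals x1 x2 y1 y2) ?\<rho>"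
    using query_lets_env[where m = m and \<rho> = ?\<rho>, OF g h p l s ch] x by (simp add: zero_padded_def)
  have "lets_cost bb 32 m (lets_of 4 (query_lets K C)) 4 ?\<rho> \<le>
      sum_list (map (ecost 32 (store_list 4 (pv @ answer_vals x1 x2 y1 y2) ?\<rho>)) (lets_of 4 (query_lets K C)))"
    using lets_cost_le[of bb 32 m "lets_of 4 (query_lets K C)" 4 ?\<rho>] unfolding le .
  also have "ecost 32 (store_list 4 (pv @ answer_vals x1 x2 y1 y2) ?\<rho>) = ecost 32 pval"
    by (intro ext ecost_cong limit_cong pval_store(2))
  finally have cost: "lets_cost bb 32 m (lets_of 4 (query_lets K C)) 4 ?\<rho> + 3 \<le> query_cost"
    by (simp add: query_cost_def)
  obtain c0 where c0: "run bb (query_prog K C) query_cost \<lparr>pc = 0, regs = ?\<rho>, mem = m\<rparr> = return_pmf c0"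
    "halted (query_prog K C) c0" "query_answer c0 = (if pairs x1 x2 y1 y2 = {} then None
      else Some (median (image_mset (\<lambda>(i, j). slope i j) (mset_set (pairs x1 x2 y1 y2)))))"
    using query_correct[where m = m and T = query_cost, OF g h p l s ch mb' x cost] by blast
  have "c = c0" using c c0(1) by (simp add: init_config_def m_def)
  have pr: "pairs x1 x2 y1 y2 = {(i, j). i < n \<and> j < n \<and> fst (ps ! i) < fst (ps ! j) \<and>
     (x1 \<le> fst (ps ! i) \<and> fst (ps ! i) \<le> x2) \<and> (y1 \<le> snd (ps ! i) \<and> snd (ps ! i) \<le> y2) \<and>
     (x1 \<le> fst (ps ! j) \<and> fst (ps ! j) \<le> x2) \<and> (y1 \<le> snd (ps ! j) \<and> snd (ps ! j) \<le> y2)}"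
    using ps(4) by (auto simp: pairs_def)
  have "image_mset (\<lambda>(i, j). slope i j) (mset_set (pairs x1 x2 y1 y2)) =
      image_mset (\<lambda>(i, j). (real (snd (ps ! j)) - real (snd (ps ! i))) / (real (fst (ps ! j)) - real (fst (ps ! i))))
        (mset_set (pairs x1 x2 y1 y2))"
    using finite_pairs ps(4) by (intro image_mset_cong) (auto simp: slope_def pairs_def)
  then have "query_answer c0 = theil_sen (S \<inter> {x1..x2} \<times> {y1..y2})"
    using theil_sen_pairs[OF ps(1-3), of x1 x2 y1 y2] c0(3) unfolding pr[symmetric] by simp
  then show "halted (query_prog K C) c \<and> query_answer c = theil_sen (S \<inter> {x1..x2} \<times> {y1..y2})"
    using c0(2) \<open>c = c0\<close> by simp
qed

lemma prob_covered:
  "measure_pmf.prob (replicate_pmf RR (random_word bb)) {xs. \<forall>x<NN. \<exists>i<TT. R.covered mm (R.block i xs) x} \<ge>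
     1 - real NN * (1 - 1 / (8 * real tt)) ^ TT"
proof -
  let ?G = "{xs. \<forall>x<NN. \<exists>i<TT. R.covered mm (R.block i xs) x}"
  let ?p = "replicate_pmf RR (random_word bb)"
  have "measure_pmf.prob ?p (- ?G) = avg {..<2 ^ bb} RR (\<lambda>xs. of_bool (xs \<in> - ?G))"
    by (rule prob_replicate_pmf) (auto simp: lessThan_empty_iff)
  also have "\<dots> \<le> real NN * (1 - 1 / (8 * real tt)) ^ TT"
    using R.avg_not_good[OF MM_mm, of TT] by (simp add: RR_def)
  finally show ?thesis using measure_pmf.prob_compl[of ?G ?p] by (simp add: Compl_eq_Diff_UNIV)
qed

end

lemma concat_pairs_nth:
  "i < length ps \<Longrightarrow> zero_padded (concat (map (\<lambda>(x, y). [x, y]) ps)) (i + i) = fst (ps ! i) \<and>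
     zero_padded (concat (map (\<lambda>(x, y). [x, y]) ps)) (i + i + 1) = snd (ps ! i)"
proof (induction ps arbitrary: i)
  case (Cons p ps)
  show ?case
  proof (cases i)
    case 0
    then show ?thesis by (cases p) (simp add: zero_padded_def)
  next
    case (Suc k)
    then show ?thesis using Cons.IH[of k] Cons.prems by (cases p) (simp add: zero_padded_def split: if_splits)
  qed
qed simp

context params
begin

text \<open>The final configuration is a function \<open>gr\<close> of the seeds, and coverage of
  all elements by the seeds implies success. The failure bound for coverage thus carries
  over.\<close>

lemma structure_correct:
  assumes S: "S \<subseteq> grid w" "card S = n" and ps: "distinct ps" "set ps = S"
  shows "measure_pmf.prob (run bb (construct_prog K C) construct_cost (construction_input n w q ps))
      {cfg. halted (construct_prog K C) cfg \<and> length (constructed cfg) \<le> EN \<and>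
        answers_theil_sen_queries bb w (query_prog K C) query_cost S (constructed cfg)}
    \<ge> 1 - real NN * (1 - 1 / (8 * real tt)) ^ TT"
proof -
  let ?E = "{cfg. halted (construct_prog K C) cfg \<and> length (constructed cfg) \<le> EN \<and>
        answers_theil_sen_queries bb w (query_prog K C) query_cost S (constructed cfg)}"
  have len: "length ps = n" using distinct_card[OF ps(1)] S(2) ps(2) by simp
  define px where "px = (\<lambda>i. fst (ps ! i))"
  define py where "py = (\<lambda>i. snd (ps ! i))"
  have pts: "px i < 2 ^ w \<and> py i < 2 ^ w" if "i < n" for i
  proof -
    have "ps ! i \<in> S" using ps(2) len that nth_mem by metis
    then show ?thesis using S(1) by (auto simp: px_def py_def grid_def mem_Times_iff)
  qed
  \<comment> \<open>All lists of seeds are interpreted at once, since each outcome in the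
    distribution has its own list.\<close>
  interpret I: inst K C n w q px py rs for rs
    by unfold_locales (use pts in auto)
  define m where "m = zero_padded (concat (map (\<lambda>(x, y). [x, y]) ps))"
  define \<rho> where "\<rho> = zero_padded [n, w, q]"
  define \<rho>' where "\<rho>' = store_list 3 (0 # pv) \<rho>"
  have \<rho>: "\<rho> 0 = n" "\<rho> 1 = w" "\<rho> 2 = q" by (simp_all add: \<rho>_def zero_padded_def)
  have init: "m (i + i) = px i \<and> m (i + i + 1) = py i" if "i < n" for i
    unfolding m_def px_def py_def by (rule concat_pairs_nth) (use that len in simp)
  have env: "lets_env bb 32 m (lets_of 3 (construct_lets K C)) 3 \<rho> = \<rho>'"
    unfolding \<rho>'_def by (rule construct_lets_env[OF \<rho>])
  have wb: "x < 2 ^ bb" if "x < 2 ^ w" for x :: nat by (rule fits_less[OF that]) (simp add: WW_def)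
  have nb: "n < 2 ^ bb" "q < 2 ^ bb" by (rule addr_less, use qn in \<open>simp add: EN_def CB_def SB_def LB_def\<close>)+
  have \<rho>b: "\<rho> i < 2 ^ bb" for i
  proof (cases "i < 3")
    case True
    then have "i \<in> {0, 1, 2}" by auto
    then show ?thesis using \<rho> nb wb[OF less_exp] by auto
  qed (simp add: \<rho>_def zero_padded_def)
  have mb: "m a < 2 ^ bb" for a
  proof (cases "a < length (concat (map (\<lambda>(x, y). [x, y]) ps))")
    case True
    then have e: "m a = concat (map (\<lambda>(x, y). [x, y]) ps) ! a" by (simp add: m_def zero_padded_def)
    have "m a \<in> set (concat (map (\<lambda>(x, y). [x, y]) ps))" unfolding e by (rule nth_mem[OF True])
    then obtain p where "p \<in> S" "m a = fst p \<or> m a = snd p" using ps(2) by auto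
    then show ?thesis using S(1) wb by (auto simp: grid_def mem_Times_iff)
  qed (simp add: m_def zero_padded_def)
  have b1: "1 \<le> bb" using bb_ge pos by linarith
  have l32: "length (lets_of 3 (construct_lets K C)) = 29" by (simp add: construct_lets_def m_params_def)
  have rv: "\<rho>' 20 = SB" "\<rho>' 17 = RR" "\<rho>' 22 = EN"
    unfolding \<rho>'_def by (simp_all add: pval_store pval_eq) (simp_all add: pv_def)
  have SR: "SB + RR \<le> 2 ^ bb" by (rule less_imp_le, rule addr_less) (simp add: EN_def CB_def)
  have "lets_cost bb 32 m (lets_of 3 (construct_lets K C)) 3 \<rho> \<le>
      sum_list (map (ecost 32 \<rho>') (lets_of 3 (construct_lets K C)))"
    using lets_cost_le[of bb 32 m "lets_of 3 (construct_lets K C)" 3 \<rho>] unfolding env .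
  moreover have "ecost 32 \<rho>' = ecost 32 pval" "ccost 32 \<rho>' = ccost 32 pval"
    unfolding \<rho>'_def by (intro ext ecost_cong ccost_cong limit_cong pval_store(1); assumption)+
  ultimately have cost: "lets_cost bb 32 m (lets_of 3 (construct_lets K C)) 3 \<rho> + ccost 32 \<rho>' (m_build0 32) +
      9 * RR + ccost 32 \<rho>' (m_build1 32) + 4 \<le> construct_cost"
    by (simp add: construct_cost_def)
  let ?p = "replicate_pmf RR (random_word bb)"
  obtain gr where run: "run bb (construct_prog K C) construct_cost \<lparr>pc = 0, regs = \<rho>, mem = m\<rparr> = map_pmf gr ?p"
    and gr: "\<And>xs. length xs = RR \<Longrightarrow> \<forall>x\<in>set xs. x < 2 ^ bb \<Longrightarrow>
       halted (construct_prog K C) (gr xs) \<and> regs (gr xs) 0 = EN \<and>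
       mem (gr xs) = sem bb 32 (m_build1 32) 32 \<rho>' (store_list SB xs (sem bb 32 (m_build0 32) 32 \<rho>' m)) \<and>
       (\<forall>a. mem (gr xs) a < 2 ^ bb)"
    using construct_program_correct[of \<rho> bb m 32 "lets_of 3 (construct_lets K C)" 20 17 22 "m_build0 32" "m_build1 32"
        construct_cost, OF \<rho>b mb b1] cost SR unfolding construct_prog_def[symmetric] env l32 rv by auto
  have "1 - real NN * (1 - 1 / (8 * real tt)) ^ TT \<le>
      measure_pmf.prob ?p {xs. \<forall>x<NN. \<exists>i<TT. I.R.covered mm (I.R.block i xs) x}"
    by (rule I.prob_covered)
  also have "\<dots> \<le> measure_pmf.prob ?p (gr -` ?E)"
  proof (rule measure_pmf.finite_measure_mono_AE)
    show "AE xs in measure_pmf ?p. xs \<in> {xs. \<forall>x<NN. \<exists>i<TT. I.R.covered mm (I.R.block i xs) x} \<longrightarrow> xs \<in> gr -` ?E"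
      unfolding AE_measure_pmf_iff
    proof (intro ballI impI)
      fix xs assume xs: "xs \<in> set_pmf ?p" and cov: "xs \<in> {xs. \<forall>x<NN. \<exists>i<TT. I.R.covered mm (I.R.block i xs) x}"
      have lx: "length xs = RR" "\<forall>x\<in>set xs. x < 2 ^ bb"
        using xs by (auto simp: set_replicate_pmf lessThan_empty_iff)
      note h = gr[OF lx]
      have g: "I.good xs" using lx cov by (simp add: I.good_def)
      have "answers_theil_sen_queries bb w (query_prog K C) query_cost S (constructed (gr xs))"
      proof (rule I.outcome_correct[where rs = xs and ps = ps, OF g])
        have me: "mem (gr xs) = sem bb 32 (m_build1 32) 32 \<rho>' (store_list SB xs (sem bb 32 (m_build0 32) 32 \<rho>' m))"
          using h by blast
        note bc = I.build_correct[where m = m and \<rho> = \<rho> and rs = xs, OF init lx(1), folded \<rho>'_def, folded me]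
        show "I.hdr (mem (gr xs))" "I.ld (mem (gr xs))" "\<forall>j<RR. mem (gr xs) (SB + j) = xs ! j"
          "\<forall>j<TM. mem (gr xs) (CB + j) = I.chl xs ! j" using bc by blast+
        show "mem (gr xs) a < 2 ^ bb" for a using h by blast
        show "regs (gr xs) 0 = EN" using h by blast
        show "px i = fst (ps ! i) \<and> py i = snd (ps ! i)" for i by (simp add: px_def py_def)
      qed (rule ps len)+
      then show "xs \<in> gr -` ?E" using h by (simp add: constructed_def)
    qed
  qed simp
  also have "\<dots> = measure_pmf.prob (run bb (construct_prog K C) construct_cost (construction_input n w q ps)) ?E"
    unfolding construction_input_def init_config_def \<rho>_def[symmetric] m_def[symmetric] run by simp
  finally show ?thesis .
qed

end

context params
begin

text \<open>As \<open>TT\<close> is \<open>8 * (1 + c) * tt * kk\<close>, the power is at most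
  \<open>exp\<close> of \<open>- (1 + c) * kk\<close>. One factor \<open>exp kk\<close> pays for the
  union bound over \<open>2 ^ kk\<close> elements, and \<open>n \<le> exp kk\<close> turns the rest
  into a power of \<open>n\<close>.\<close>

lemma failure_bound:
  assumes "C = 8 * (1 + c)"
  shows "real NN * (1 - 1 / (8 * real tt)) ^ TT \<le> real n powr (- real c)"
proof -
  have t: "real tt > 0" "1 / (8 * real tt) \<le> 1" using pos(1) by (simp_all add: divide_le_eq)
  have e2: "(2::real) ^ k \<le> exp (real k)" for k
  proof -
    have "(2::real) \<le> exp 1" using exp_ge_add_one_self[of 1] by simp
    then have "(2::real) ^ k \<le> exp 1 ^ k" by (rule power_mono) simp
    then show ?thesis by (simp add: exp_of_nat_mult[symmetric])
  qed
  have "(1 - 1 / (8 * real tt)) ^ TT \<le> exp (- (1 / (8 * real tt))) ^ TT"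
    using exp_ge_add_one_self[of "- (1 / (8 * real tt))"] t by (intro power_mono) auto
  also have "\<dots> = exp (real TT * (- (1 / (8 * real tt))))" by (rule exp_of_nat_mult[symmetric])
  also have "real TT * (- (1 / (8 * real tt))) = - (real (1 + c) * real kk)"
  proof -
    have TT: "real TT = real C * real tt * real kk" by (simp add: TT_def)
    have "real C = 8 * real (1 + c)" using assms by simp
    then show ?thesis unfolding TT using t(1) by simp
  qed
  finally have p: "(1 - 1 / (8 * real tt)) ^ TT \<le> exp (- (real (1 + c) * real kk))" .
  have NNe: "real NN \<le> exp (real kk)" using e2[of kk] by (simp add: NN_def)
  have "real NN * (1 - 1 / (8 * real tt)) ^ TT \<le> exp (real kk) * exp (- (real (1 + c) * real kk))"
    using t by (intro mult_mono NNe p) simp_all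
  also have "\<dots> = exp (- (real c * real kk))"
    by (simp add: exp_add[symmetric] algebra_simps)
  also have "\<dots> \<le> real n powr (- real c)"
  proof -
    have "n \<le> NN" using n_le_NW NN_bounds(1) by linarith
    then have "real n \<le> exp (real kk)" using NNe by linarith
    moreover have n0: "real n > 0" using n1 by simp
    ultimately have "ln (real n) \<le> real kk" using ln_le_cancel_iff[of "real n" "exp (real kk)"] by simp
    then have "real c * ln (real n) \<le> real c * real kk" by (intro mult_left_mono) simp_all
    then show ?thesis using n0 by (simp add: powr_def)
  qed
  finally show ?thesis .
qed

text \<open>\<open>a\<close> will be \<open>n\<close> to the power \<open>\<alpha> / 4\<close>. The
  power of two \<open>tt\<close> follows it only up to a factor of 3, so all sizes are expressed
  through \<open>a\<close>, whose growth is known.\<close>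

lemma pval_bounds:
  fixes a :: real
  assumes a: "real tt \<le> a" "a \<le> 3 * real tt"
  defines "W \<equiv> real WW"
  defines "M \<equiv> 6 * (real n ^ 2 * W ^ 4 / a)"
  defines "E \<equiv> 4 + 2 * real n + M + 8 * real C * W * a ^ 2 + 8 * real C * W * M"
  shows "real (pval 8) \<le> real K * W" "real (pval 18) \<le> 16 * W ^ 4" "real (pval 10) \<le> a"
    "real (pval 16) \<le> 8 * real C * W * a" "real (pval 14) \<le> M" "real (pval 23) \<le> 8 * real C * W * M"
    "real (pval 17) \<le> 8 * real C * W * a ^ 2" "real (pval 22) \<le> E"
    "4 \<le> p \<Longrightarrow> p < 32 \<Longrightarrow> real (pval p) \<le> E + 3 * (real n ^ 2 * W ^ 4) + 16 * W ^ 4 + (real K + 20) * W"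
proof -
  have t0: "0 < real tt" using pos by simp
  have a0: "0 < a" using a(1) t0 by linarith
  have W0: "1 \<le> W" using WW_pow by (simp add: W_def)
  have pv8: "pval 8 = bb" "pval 18 = LV" "pval 10 = tt" "pval 16 = TT" "pval 14 = MM" "pval 23 = TM" "pval 17 = RR" "pval 22 = EN"
    by (simp_all add: pval_def zero_padded_def pv_def)
  have NW: "real NW = real n ^ 2 * W ^ 4" by (simp add: NW_def W_def power2_eq_square)
  have NN: "real NN \<le> 2 * (real n ^ 2 * W ^ 4)" unfolding NW[symmetric] using NN_bounds(2) by linarith
  have "real MM * a \<le> real MM * (3 * real tt)" using a(2) by (intro mult_left_mono) simp_all
  also have "\<dots> = 3 * real NN" by (simp add: NN_MM)
  also have "\<dots> \<le> 6 * (real n ^ 2 * W ^ 4)" using NN by linarith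
  finally have MM: "real MM \<le> M" using a0 by (simp add: M_def pos_le_divide_eq)
  have kk: "real kk \<le> 8 * W" using kk_le by (simp add: W_def)
  have TT: "real TT \<le> 8 * real C * W * a"
  proof -
    have "real TT = real C * (real tt * real kk)" by (simp add: TT_def)
    also have "\<dots> \<le> real C * (a * (8 * W))" using a(1) kk a0 by (intro mult_left_mono mult_mono) simp_all
    finally show ?thesis by (simp add: ac_simps)
  qed
  have RR: "real RR \<le> 8 * real C * W * a ^ 2"
  proof -
    have "real RR = real TT * real tt" by (simp add: RR_def)
    also have "\<dots> \<le> (8 * real C * W * a) * a" using a(1) TT a0 W0 by (intro mult_mono) simp_all
    finally show ?thesis by (simp add: power2_eq_square ac_simps)
  qed
  have TM: "real TM \<le> 8 * real C * W * M"
  proof -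
    have "mm * tt \<le> MM" using MM_mm by simp
    then have "real (mm * tt) \<le> M" using MM by linarith
    then have mt: "real mm * real tt \<le> M" by simp
    have "real TM = real C * (real kk * (real mm * real tt))" by (simp add: TM_def TT_def)
    also have "\<dots> \<le> real C * (8 * W * M)"
      using mt kk W0 by (intro mult_left_mono mult_mono) simp_all
    finally show ?thesis by (simp add: ac_simps)
  qed
  have "real EN = 4 + 2 * real n + real MM + real RR + real TM"
    by (simp add: EN_def CB_def SB_def LB_def)
  then have EN: "real EN \<le> E" using MM RR TM by (simp add: E_def)
  show "real (pval 8) \<le> real K * W" "real (pval 18) \<le> 16 * W ^ 4" "real (pval 10) \<le> a"
    "real (pval 16) \<le> 8 * real C * W * a" "real (pval 14) \<le> M" "real (pval 23) \<le> 8 * real C * W * M"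
    "real (pval 17) \<le> 8 * real C * W * a ^ 2" "real (pval 22) \<le> E"
    unfolding pv8 using MM RR TM TT EN a(1) by (simp_all add: bb_def LV_def W_def)
  assume p: "4 \<le> p" "p < 32"
  have "pval p \<in> set pv" unfolding pval_eq[OF p] by (rule nth_mem) (use p in \<open>simp add: pv_def\<close>)
  have "tt * 1 \<le> tt * TT" using pos by (intro mult_le_mono2) simp
  then have tR: "tt \<le> RR" by (simp add: RR_def mult.commute)
  have "TT * 1 \<le> TT * tt" using pos by (intro mult_le_mono2) simp
  then have TR: "TT \<le> RR" by (simp add: RR_def)
  have lw: "lt4 \<le> WW" "w \<le> WW" using lt4_le by (simp_all add: WW_def)
  have eq: "EN = 4 + 2 * n + MM + RR + TM" "LB = 3 + 2 * n" "SB = 4 + 2 * n + MM" "CB = 4 + 2 * n + MM + RR" "uu = 18 * WW"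
    by (simp_all add: EN_def CB_def SB_def LB_def uu_def)
  have "pval p \<le> EN + NN + NW + LV + bb + 20 * WW"
    using \<open>pval p \<in> set pv\<close> tR TR lw kk_le mm_le_NN qn eq(1)
    unfolding pv_def list.set insert_iff empty_iff eq(2-5) by (elim disjE FalseE) linarith+
  then have "real (pval p) \<le> real (EN + NN + NW + LV + bb + 20 * WW)" by (rule of_nat_mono)
  also have "\<dots> \<le> E + 3 * (real n ^ 2 * W ^ 4) + 16 * W ^ 4 + (real K + 20) * W"
    using EN NN NW by (simp add: LV_def bb_def W_def algebra_simps)
  finally show "real (pval p) \<le> E + 3 * (real n ^ 2 * W ^ 4) + 16 * W ^ 4 + (real K + 20) * W" .
qed

end

section \<open>Asymptotic bounds and final assembly\<close>

lemma polylog_soft_pow: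
  assumes "polylog w" shows "(\<lambda>n. real (w n)) \<in> soft_pow 0"
proof -
  obtain k where k: "(\<lambda>n. real (w n)) \<in> O(\<lambda>n. ln (real n) ^ k)" using assms by (auto simp: polylog_def)
  have "(\<lambda>n. ln (real n) ^ k) \<in> O(\<lambda>n. real n powr 0 * ln (real n) ^ k)"
    by (intro landau_o.big_mono eventually_mono[OF eventually_ge_at_top[of 1]]) simp
  from landau_o.big_trans[OF k this] show ?thesis by (rule soft_powI)
qed

lemma floor_powr_bounds:
  fixes \<alpha> :: real
  assumes "0 < \<alpha>" "\<alpha> < 1" "1 \<le> n"
  defines "q \<equiv> nat \<lfloor>real n powr \<alpha>\<rfloor>" and "a \<equiv> real n powr (\<alpha> / 4)"
  shows "1 \<le> q" "q \<le> n" "real q \<le> a ^ 4" "a ^ 4 < 2 * real q"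
proof -
  have n: "1 \<le> real n" using assms(3) by simp
  have "(real n powr (\<alpha> / 4)) ^ 4 = real n powr (\<alpha> / 4 * 4)"
    using n by (simp add: powr_power)
  then have a4: "a ^ 4 = real n powr \<alpha>" by (simp add: a_def)
  have ge: "1 \<le> real n powr \<alpha>" using n assms(1) by (simp add: ge_one_powr_ge_zero)
  then have f: "1 \<le> \<lfloor>real n powr \<alpha>\<rfloor>" by (simp add: le_floor_iff)
  then have rq: "real q = of_int \<lfloor>real n powr \<alpha>\<rfloor>" unfolding q_def by simp
  show "1 \<le> q" using f unfolding q_def by linarith
  then have q1: "1 \<le> real q" by simp
  show "real q \<le> a ^ 4" unfolding rq a4 by (rule of_int_floor_le)
  have "real n powr \<alpha> < real q + 1" unfolding rq by (rule floor_less_cancel) simp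
  then show "a ^ 4 < 2 * real q" unfolding a4 using q1 by linarith
  have "real n powr \<alpha> \<le> real n powr 1" using n assms(2) by (intro powr_mono) simp_all
  then have "real q \<le> real n" using \<open>real q \<le> a ^ 4\<close> n unfolding a4 by simp
  then show "q \<le> n" by simp
qed

theorem mainTheorem13:
  fixes \<alpha> c :: real and w :: "nat \<Rightarrow> nat"
  assumes "0 < \<alpha>" and "\<alpha> < 1" and "polylog w" and "0 < c"
  shows "\<exists>K0::nat. \<forall>K\<ge>K0.
    \<exists>(construct :: program) (query :: program)
     (construct_time :: nat \<Rightarrow> nat) (space :: nat \<Rightarrow> nat) (query_time :: nat \<Rightarrow> nat).
      (\<lambda>n. real (construct_time n)) \<in> soft_O (\<lambda>n. real n ^ 2) \<and>
      (\<lambda>n. real (space n)) \<in> soft_O (\<lambda>n. real n powr (2 - \<alpha> / 4)) \<and>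
      (\<lambda>n. real (query_time n)) \<in> soft_O (\<lambda>n. real n powr \<alpha>) \<and>
      (\<forall>n\<ge>1. \<forall>S ps. S \<subseteq> grid (w n) \<and> card S = n \<and> distinct ps \<and> set ps = S \<longrightarrow>
        (let b = K * (w n + 1) in
          measure_pmf.prob
            (run b construct (construct_time n)
              (construction_input n (w n) (nat \<lfloor>real n powr \<alpha>\<rfloor>) ps))
            {cfg. halted construct cfg \<and> length (constructed cfg) \<le> space n \<and>
              answers_theil_sen_queries b (w n) query (query_time n) S (constructed cfg)}
          \<ge> 1 - real n powr (- c)))"
proof -
  obtain c0 :: nat where c0: "c \<le> real c0" using real_arch_simple by blast
  \<comment> \<open>The exponent \<open>c\<close> enters the number of tables through
    \<open>C\<close>, and thereby the word length that is required of \<open>K\<close>.\<close>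
  define C where "C = 8 * (1 + c0)"
  show ?thesis
  proof (rule exI[of _ "100 + C"], intro allI impI, goal_cases)
    case (1 K)
    then have K: "100 + C \<le> K" .
    define q where "q = (\<lambda>n. nat \<lfloor>real n powr \<alpha>\<rfloor>)"
    define a where "a = (\<lambda>n::nat. real n powr (\<alpha> / 4))"
    define W where "W = (\<lambda>n. real (w n) + 1)"
    \<comment> \<open>If \<open>n\<close> exceeds the number of grid points, there is no set
      \<open>S\<close> to be handled; the bounds are then set to 0 and remain in their growth
      classes.\<close>
    define good where "good = (\<lambda>n. n \<le> 2 ^ (2 * w n))"
    have fl: "1 \<le> q n" "q n \<le> n" "real (q n) \<le> a n ^ 4" "a n ^ 4 < 2 * real (q n)" if "1 \<le> n" for n
      unfolding q_def a_def by (rule floor_powr_bounds[OF assms(1,2) that])+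
    have P: "params K C n (w n) (q n)" if "1 \<le> n" "good n" for n
      by unfold_locales (use that K fl(1,2)[OF that(1)] in \<open>simp_all add: good_def C_def\<close>)
    define pvl where "pvl = (\<lambda>n p. if good n then params.pval K C n (w n) (q n) p else 0)"
    define qt where "qt = (\<lambda>n. if good n then params.query_cost K C n (w n) (q n) else 0)"
    define ct where "ct = (\<lambda>n. if good n then params.construct_cost K C n (w n) (q n) else 0)"
    have pw: "x \<le> y" if "x ^ 4 \<le> y ^ 4" "0 \<le> y" for x y :: real
      using power_le_imp_le_base[of x 3 y] that by (simp add: eval_nat_numeral)
    have tt: "real (params.tt (q n)) \<le> a n" "a n \<le> 3 * real (params.tt (q n))" if n: "1 \<le> n" "good n" for n
    proof -
      interpret params K C n "w n" "q n" by (rule P[OF n])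
      have a0: "0 \<le> a n" by (simp add: a_def)
      have "real (tt ^ 4) \<le> real (q n)" using tt4(1) by (rule of_nat_mono)
      then have "real tt ^ 4 \<le> real (q n)" unfolding of_nat_power .
      from pw[OF order_trans[OF this fl(3)[OF n(1)]] a0] show "real tt \<le> a n" .
      have "real (q n) < real (16 * tt ^ 4)" using tt4(2) by (simp only: of_nat_less_iff)
      \<comment> \<open>\<open>a n ^ 4 < 2 * q n < 32 * tt ^ 4\<close>, and 32 is below the fourth
        power of 3.\<close>
      then have "a n ^ 4 \<le> (3 * real tt) ^ 4" using fl(4)[OF n(1)] by (simp add: power_mult_distrib)
      then show "a n \<le> 3 * real tt" by (rule pw) simp
    qed
    define M where "M = (\<lambda>n. 6 * (real n ^ 2 * W n ^ 4 / a n))"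
    define E where "E = (\<lambda>n. 4 + 2 * real n + M n + 8 * real C * W n * a n ^ 2 + 8 * real C * W n * M n)"
    define B where "B = (\<lambda>n. E n + 3 * (real n ^ 2 * W n ^ 4) + 16 * W n ^ 4 + (real K + 20) * W n)"
    have W0: "0 \<le> W n" and a0: "0 \<le> a n" and M0: "0 \<le> M n" for n by (simp_all add: W_def a_def M_def)
    have E0: "0 \<le> E n" for n unfolding E_def using W0[of n] a0[of n] M0[of n] by simp
    have B0: "0 \<le> B n" for n unfolding B_def using W0[of n] E0[of n] by simp
    have bnds: "real (pvl n 8) \<le> real K * W n \<and> real (pvl n 18) \<le> 16 * W n ^ 4 \<and> real (pvl n 10) \<le> a n \<and>
        real (pvl n 16) \<le> 8 * real C * W n * a n \<and> real (pvl n 14) \<le> M n \<and> real (pvl n 23) \<le> 8 * real C * W n * M n \<and>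
        real (pvl n 22) \<le> E n \<and> (\<forall>p. 4 \<le> p \<longrightarrow> p < 32 \<longrightarrow> real (pvl n p) \<le> B n)" if n: "1 \<le> n" for n
    proof (cases "good n")
      case True
      interpret params K C n "w n" "q n" by (rule P[OF n True])
      have WW: "real WW = W n" by (simp add: WW_def W_def)
      note b = pval_bounds[OF tt[OF n True], unfolded WW]
      show ?thesis unfolding pvl_def B_def E_def M_def if_P[OF True] by (intro conjI allI impI b)
    next
      case False
      then show ?thesis using W0[of n] a0[of n] M0[of n] E0[of n] B0[of n] by (simp add: pvl_def)
    qed
    have le: "f \<in> soft_pow D" if "h \<in> soft_pow D" "\<And>n. 1 \<le> n \<Longrightarrow> \<bar>f n\<bar> \<le> h n" for f h :: "nat \<Rightarrow> real" and D
    proof (rule soft_pow_le[OF that(1), where C = 1])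
      fix n :: nat assume "1 \<le> n"
      from that(2)[OF this] show "\<bar>f n\<bar> \<le> 1 * \<bar>h n\<bar>" by linarith
    qed
    have cm: "(\<lambda>n. k * f n) \<in> soft_pow D" if "f \<in> soft_pow D" for k and f :: "nat \<Rightarrow> real" and D
      using soft_pow_mult[OF soft_pow_const[of 0 k] that] by simp
    have Wp: "W \<in> soft_pow 0"
      unfolding W_def by (intro soft_pow_add polylog_soft_pow assms(3) soft_pow_const order_refl)
    have W4: "(\<lambda>n. W n ^ 4) \<in> soft_pow 0" by (rule soft_pow_power[OF Wp])
    have ap: "a \<in> soft_pow (\<alpha> / 4)" unfolding a_def by (rule soft_pow_powr)
    have sq: "(\<lambda>n. real n powr 2) = (\<lambda>n. real n ^ 2)" by (simp add: powr_numeral)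
    have n2: "(\<lambda>n. real n ^ 2) \<in> soft_pow 2" using soft_pow_powr[of 2] unfolding sq .
    have n1: "(\<lambda>n. real n) \<in> soft_pow 1" using soft_pow_powr[of 1] by simp
    have n2W: "(\<lambda>n. real n ^ 2 * W n ^ 4) \<in> soft_pow 2" using soft_pow_mult[OF n2 W4] by simp
    have ia: "(\<lambda>n. 1 / a n) \<in> soft_pow (- (\<alpha> / 4))"
      using soft_pow_powr[of "- (\<alpha> / 4)"] by (simp add: a_def powr_minus_divide)
    have Mp: "M \<in> soft_pow (2 - \<alpha> / 4)"
      using cm[OF soft_pow_mult[OF n2W ia], of 6] by (simp add: M_def)
    have WM: "(\<lambda>n. 8 * real C * W n * M n) \<in> soft_pow (2 - \<alpha> / 4)"
      using cm[OF soft_pow_mult[OF Wp Mp], of "8 * real C"] by (simp add: mult.assoc)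
    have Wa: "(\<lambda>n. 8 * real C * W n * a n) \<in> soft_pow (\<alpha> / 4)"
      using cm[OF soft_pow_mult[OF Wp ap], of "8 * real C"] by (simp add: mult.assoc)
    have Waa: "(\<lambda>n. 8 * real C * W n * a n ^ 2) \<in> soft_pow (\<alpha> / 4 + \<alpha> / 4)"
      using soft_pow_mult[OF Wa ap] by (simp add: power2_eq_square mult.assoc)
    have Ep: "E \<in> soft_pow (2 - \<alpha> / 4)"
      unfolding E_def
      by (intro soft_pow_add WM Mp soft_pow_mono[OF Waa] soft_pow_mono[OF cm[OF n1]] soft_pow_const)
        (use assms(1,2) in simp_all)
    have Bp: "B \<in> soft_pow 2"
      unfolding B_def
      by (intro soft_pow_add cm n2W soft_pow_mono[OF Ep] soft_pow_mono[OF cm[OF W4]] soft_pow_mono[OF cm[OF Wp]])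
        (use assms(1,2) in simp_all)
    \<comment> \<open>Degrees of the parameter registers. All those not singled out, including the
      loop bounds in registers 13 and 24, get the crude degree 2, which the construction can
      afford.\<close>
    define g where "g = (\<lambda>p::nat. if p = 8 \<or> p = 18 then 0 else if p = 10 \<or> p = 16 then \<alpha> / 4
      else if p = 14 \<or> p = 23 then 2 - \<alpha> / 4 else 2)"
    have g0: "0 \<le> g p" for p using assms(1,2) by (simp add: g_def)
    have pvp: "(\<lambda>n. real (pvl n p)) \<in> soft_pow (g p)" if p: "4 \<le> p" "p < 32" for p
    proof -
      consider "p = 8" | "p = 18" | "p = 10" | "p = 16" | "p = 14" | "p = 23" | "g p = 2"
        by (cases "p \<in> {8, 18, 10, 16, 14, 23}") (auto simp: g_def)
      then show ?thesis
      proof cases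
        case 1
        show ?thesis unfolding 1 by (rule le[where h = "\<lambda>n. real K * W n"]) (use bnds cm[OF Wp] in \<open>simp_all add: g_def\<close>)
      next
        case 2
        show ?thesis unfolding 2 by (rule le[where h = "\<lambda>n. 16 * W n ^ 4"]) (use bnds cm[OF W4] in \<open>simp_all add: g_def\<close>)
      next
        case 3
        show ?thesis unfolding 3 by (rule le[where h = a]) (use bnds ap in \<open>simp_all add: g_def\<close>)
      next
        case 4
        show ?thesis unfolding 4 by (rule le[where h = "\<lambda>n. 8 * real C * W n * a n"]) (use bnds Wa in \<open>simp_all add: g_def\<close>)
      next
        case 5
        show ?thesis unfolding 5 by (rule le[where h = M]) (use bnds Mp in \<open>simp_all add: g_def\<close>)
      next
        case 6
        show ?thesis unfolding 6 by (rule le[where h = "\<lambda>n. 8 * real C * W n * M n"]) (use bnds WM in \<open>simp_all add: g_def\<close>)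
      next
        case 7
        show ?thesis unfolding 7 by (rule le[OF Bp]) (use bnds p in simp)
      qed
    qed
    interpret deg: degrees g "\<alpha> / 4"
      by unfold_locales (use assms(1) in \<open>simp_all add: g_def\<close>)
    have q_cost: "(\<lambda>n. real (qt n)) \<in> soft_pow \<alpha>"
    proof (rule le)
      have "(\<lambda>n. real (sum_list (map (ecost 32 (pvl n)) (lets_of 4 (query_lets K C))))) \<in> soft_pow (4 * (\<alpha> / 4))"
        by (rule lets_soft_pow[OF pvp g0 deg.deg_query]) (use assms(1) in simp_all)
      then show "(\<lambda>n. real (sum_list (map (ecost 32 (pvl n)) (lets_of 4 (query_lets K C)))) + 3) \<in> soft_pow \<alpha>"
        using soft_pow_add[OF _ soft_pow_const[of \<alpha> 3]] assms(1) by simp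
      fix n :: nat assume n: "1 \<le> n"
      show "\<bar>real (qt n)\<bar> \<le> real (sum_list (map (ecost 32 (pvl n)) (lets_of 4 (query_lets K C)))) + 3"
      proof (cases "good n")
        case True
        interpret params K C n "w n" "q n" by (rule P[OF n True])
        have "pvl n = pval" using True by (simp add: pvl_def fun_eq_iff)
        then show ?thesis using True by (simp add: qt_def query_cost_def)
      qed (simp add: qt_def)
    qed
    have c_cost: "(\<lambda>n. real (ct n)) \<in> soft_pow 2"
    proof (rule le)
      let ?L = "\<lambda>n. real (sum_list (map (ecost 32 (pvl n)) (lets_of 3 (construct_lets K C))))"
      have "?L \<in> soft_pow 0"
        by (rule lets_soft_pow[OF pvp g0 deg.deg_construct_lets]) simp_all
      then have L: "?L \<in> soft_pow 2" by (rule soft_pow_mono) simp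
      have g: "cdeg_le g m_build0 2" "cdeg_le g m_build1 2"
        by (rule deg.deg_build; use assms(2) in \<open>simp add: g_def\<close>)+
      have b: "(\<lambda>n. real (ccost 32 (pvl n) (z 32))) \<in> soft_pow 2" if "cdeg_le g z 2" for z
        by (rule soft_pow_mono[OF ccost_soft_pow[OF pvp g0]]) (use that in \<open>simp_all add: cdeg_le_def\<close>)
      have R: "(\<lambda>n. 9 * real (pvl n 17)) \<in> soft_pow 2"
        using cm[OF pvp[of 17], of 9] by (simp add: g_def)
      show "(\<lambda>n. ?L n + real (ccost 32 (pvl n) (m_build0 32)) + 9 * real (pvl n 17) +
          real (ccost 32 (pvl n) (m_build1 32)) + 4) \<in> soft_pow 2"
        by (intro soft_pow_add L b g R soft_pow_const) simp
      fix n :: nat assume n: "1 \<le> n"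
      show "\<bar>real (ct n)\<bar> \<le> ?L n + real (ccost 32 (pvl n) (m_build0 32)) + 9 * real (pvl n 17) +
          real (ccost 32 (pvl n) (m_build1 32)) + 4"
      proof (cases "good n")
        case True
        interpret params K C n "w n" "q n" by (rule P[OF n True])
        have pv: "pvl n = pval" using True by (simp add: pvl_def fun_eq_iff)
        have "pval 17 = RR" by (simp add: pval_def zero_padded_def pv_def)
        then show ?thesis using True pv by (simp add: ct_def construct_cost_def)
      qed (simp add: ct_def)
    qed
    have s_cost: "(\<lambda>n. real (pvl n 22)) \<in> soft_pow (2 - \<alpha> / 4)"
      by (rule le[OF Ep]) (use bnds in simp)
    have correct: "measure_pmf.prob (run (K * (w n + 1)) (construct_prog K C) (ct n) (construction_input n (w n) (q n) ps))
        {cfg. halted (construct_prog K C) cfg \<and> length (constructed cfg) \<le> pvl n 22 \<and>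
          answers_theil_sen_queries (K * (w n + 1)) (w n) (query_prog K C) (qt n) S (constructed cfg)}
      \<ge> 1 - real n powr (- c)"
      if n: "1 \<le> n" and S: "S \<subseteq> grid (w n)" "card S = n" and ps: "distinct ps" "set ps = S" for n S ps
    proof -
      have "card S \<le> card (grid (w n))" by (rule card_mono[OF _ S(1)]) (simp add: grid_def)
      also have "card (grid (w n)) = 2 ^ (2 * w n)" by (simp add: grid_def mult_2 power_add)
      finally have gn: "good n" using S(2) by (simp add: good_def)
      interpret params K C n "w n" "q n" by (rule P[OF n gn])
      have v: "pvl n 22 = EN" "ct n = construct_cost" "qt n = query_cost" "K * (w n + 1) = bb"
        using gn by (simp_all add: pvl_def ct_def qt_def pval_def zero_padded_def pv_def bb_def WW_def)
      have "real NN * (1 - 1 / (8 * real tt)) ^ TT \<le> real n powr (- real c0)"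
        by (rule failure_bound) (simp add: C_def)
      also have "\<dots> \<le> real n powr (- c)" using n c0 by (intro powr_mono) simp_all
      finally show ?thesis unfolding v using structure_correct[OF S ps] by linarith
    qed
    show ?case
      using c_cost s_cost q_cost correct unfolding soft_pow_def sq Let_def q_def[symmetric]
      by (intro exI[of _ "construct_prog K C"] exI[of _ "query_prog K C"] exI[of _ ct] exI[of _ "\<lambda>n. pvl n 22"] exI[of _ qt])
        (auto simp: q_def)
  qed
qed

end
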